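(* Let $X\subseteq\mathbb{R}^d$ be a H\"older set or a simple fat closed subanalytic set. Let $f,g:X\to\mathbb{C}$ be such that, for some $m\in\mathbb{N}_{\ge1}$ and $C,\alpha>0$: (1) $g$, $fg$, $f^m\in\mathcal{C}^\infty(X,\mathbb{C})$, and (2) $|f(x)|\le C|g(x)|^\alpha$ for all $x\in X$. Then $f\in\mathcal{C}^\infty(X,\mathbb{C})$.
   Context: $\mathcal{C}^\infty(X,\mathbb{C})$ is the set of $f:X\to\mathbb{C}$ such that each $x\in X$ has an open neighborhood $V$ in $\mathbb{R}^d$ and a smooth $F:V\to\mathbb{C}$ with $F=f$ on $V\cap X$. A closed set $X$ is fat if $X=\overline{\mathrm{int}(X)}\neq\emptyset$; it is simple if each $x\in X$ has a basis of neighborhoods $\mathscr U$ with $U\cap\mathrm{int}(X)$ connected for all $U\in\mathscr U$. H\"older sets: for $0<\alpha\le1$, $r,h>0$ let $\Gamma^\alpha_d(r,h)=\{(x',x_d)\in\mathbb{R}^{d-1}\times\mathbb{R}: |x'|<r,\ h(|x'|/r)^\alpha<x_d<h\}$. An open $U$ has the uniform cusp property of index $\alpha$ if for every $x\in\partial U$ there are $\epsilon>0$, some $\Gamma=\Gamma^\alpha_d(r,h)$ and $A\in O(d)$ with $y+A\Gamma\subseteq U$ for all $y\in\overline U\cap B(x,\epsilon)$. A H\"older set is a fat closed set whose interior has the uniform cusp property of some index $\alpha\in(0,1]$. Subanalytic is meant in the sense of real analytic geometry. *)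

theory Defs imports "HOL-Analysis.Analysis" begin

definition fat :: "'a::topological_space set \<Rightarrow> bool" where
  "fat X \<longleftrightarrow> closed X \<and> X = closure (interior X) \<and> X \<noteq> {}"

definition simple_set :: "'a::topological_space set \<Rightarrow> bool" where
  "simple_set X \<longleftrightarrow> (\<forall>x\<in>X. \<forall>W. open W \<and> x \<in> W \<longrightarrow>
      (\<exists>U. x \<in> interior U \<and> U \<subseteq> W \<and> connected (U \<inter> interior X)))"

fun Ck :: "nat \<Rightarrow> ('a::real_normed_vector \<Rightarrow> 'b::real_normed_vector) \<Rightarrow> 'a set \<Rightarrow> bool" where
  "Ck 0 F V = continuous_on V F"
| "Ck (Suc k) F V = (\<exists>F'. (\<forall>x\<in>V. (F has_derivative F' x) (at x)) \<and> (\<forall>v. Ck k (\<lambda>x. F' x v) V))"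

definition smooth_on :: "'a::real_normed_vector set \<Rightarrow> ('a \<Rightarrow> 'b::real_normed_vector) \<Rightarrow> bool" where
  "smooth_on V F \<longleftrightarrow> (\<forall>k. Ck k F V)"

definition Cinf :: "(real^'d) set \<Rightarrow> (real^'d \<Rightarrow> complex) set" where
  "Cinf X = {f. \<forall>x\<in>X. \<exists>V F. open V \<and> x \<in> V \<and> smooth_on V F \<and> (\<forall>y\<in>V \<inter> X. F y = f y)}"

text \<open>The cusp Gamma^alpha_d(r,h), with the distinguished (last) coordinate k.\<close>
definition cusp :: "'d::finite \<Rightarrow> real \<Rightarrow> real \<Rightarrow> real \<Rightarrow> (real^'d) set" where
  "cusp k \<alpha> r h = {z. let n' = sqrt (\<Sum>j\<in>UNIV - {k}. (z$j)^2) in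
      n' < r \<and> h * (n' / r) powr \<alpha> < z$k \<and> z$k < h}"

definition uniform_cusp :: "(real^'d) set \<Rightarrow> real \<Rightarrow> bool" where
  "uniform_cusp U \<alpha> \<longleftrightarrow> (\<forall>x\<in>frontier U. \<exists>\<epsilon>>0. \<exists>r>0. \<exists>h>0. \<exists>A (k::'d).
      orthogonal_transformation A \<and>
      (\<forall>y\<in>closure U \<inter> ball x \<epsilon>. (\<lambda>z. y + A z) ` cusp k \<alpha> r h \<subseteq> U))"

definition holder_set :: "(real^'d) set \<Rightarrow> bool" where
  "holder_set X \<longleftrightarrow> fat X \<and> (\<exists>\<alpha>. 0 < \<alpha> \<and> \<alpha> \<le> 1 \<and> uniform_cusp (interior X) \<alpha>)"

text \<open>Coordinate spaces R^S for a finite index set S, realised as functions vanishing off S.\<close>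
definition cspace :: "'i set \<Rightarrow> ('i \<Rightarrow> real) set" where
  "cspace S = {p. \<forall>i. i \<notin> S \<longrightarrow> p i = 0}"

definition cdist :: "'i set \<Rightarrow> ('i \<Rightarrow> real) \<Rightarrow> ('i \<Rightarrow> real) \<Rightarrow> real" where
  "cdist S p q = sqrt (\<Sum>i\<in>S. (p i - q i)^2)"

definition cball :: "'i set \<Rightarrow> ('i \<Rightarrow> real) \<Rightarrow> real \<Rightarrow> ('i \<Rightarrow> real) set" where
  "cball S p r = {q \<in> cspace S. cdist S p q < r}"

definition copen :: "'i set \<Rightarrow> ('i \<Rightarrow> real) set \<Rightarrow> bool" where
  "copen S U \<longleftrightarrow> U \<subseteq> cspace S \<and> (\<forall>p\<in>U. \<exists>r>0. cball S p r \<subseteq> U)"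

definition mindex :: "'i set \<Rightarrow> ('i \<Rightarrow> nat) set" where
  "mindex S = {\<beta>. \<forall>i. i \<notin> S \<longrightarrow> \<beta> i = 0}"

definition c_analytic_on :: "'i set \<Rightarrow> ('i \<Rightarrow> real) set \<Rightarrow> (('i \<Rightarrow> real) \<Rightarrow> real) \<Rightarrow> bool" where
  "c_analytic_on S U F \<longleftrightarrow> (\<forall>p\<in>U. \<exists>r>0. \<exists>c::('i \<Rightarrow> nat) \<Rightarrow> real. cball S p r \<subseteq> U \<and>
      (\<forall>q\<in>cball S p r. ((\<lambda>\<beta>. c \<beta> * (\<Prod>i\<in>S. (q i - p i) ^ \<beta> i)) has_sum F q) (mindex S)))"

definition semianalytic :: "'i set \<Rightarrow> ('i \<Rightarrow> real) set \<Rightarrow> bool" where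
  "semianalytic S A \<longleftrightarrow> A \<subseteq> cspace S \<and>
     (\<forall>p\<in>cspace S. \<exists>U. copen S U \<and> p \<in> U \<and>
        (\<exists>(n::nat) (m::nat) (f::nat \<Rightarrow> nat \<Rightarrow> ('i \<Rightarrow> real) \<Rightarrow> real) g.
           (\<forall>i<n. \<forall>j<m. c_analytic_on S U (f i j) \<and> c_analytic_on S U (g i j)) \<and>
           A \<inter> U = (\<Union>i<n. {q\<in>U. \<forall>j<m. f i j q = 0 \<and> 0 < g i j q})))"

text \<open>X in R^d is subanalytic: locally the projection of a bounded (= relatively compact)
  semianalytic subset of R^d x R^e, coordinates indexed by Inl j (j in 'd) and Inr i (i < e).\<close>
definition subanalytic :: "(real^'d::finite) set \<Rightarrow> bool" where
  "subanalytic X \<longleftrightarrow> (\<forall>x. \<exists>U. open U \<and> x \<in> U \<and>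
     (\<exists>(e::nat) (A::('d + nat \<Rightarrow> real) set).
        semianalytic (range Inl \<union> Inr ` {..<e}) A \<and>
        (\<exists>R. \<forall>p\<in>A. \<forall>i. \<bar>p i\<bar> \<le> R) \<and>
        X \<inter> U = (\<lambda>p. \<chi> j. p (Inl j)) ` A))"

end

theory Submission imports Defs "HOL-Complex_Analysis.Complex_Analysis" begin

text \<open>
  A regularity condition on \<^term>\<open>X\<close> replaces all geometry: locally uniformly in \<^term>\<open>x\<close>, at every scale \<open>\<rho>\<close>
  there is a simplex with vertices in \<^term>\<open>X\<close> near \<^term>\<open>x\<close> whose volume is at least a fixed power of
  \<open>\<rho>\<close> (predicates \<open>dagger\<close>, \<open>reg\<close>). It lets one recover the derivatives of a smooth function from its
  values on \<^term>\<open>X\<close>. Cusps contain such simplices. For a subanalytic set they come from an effective curve selection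
  lemma (\<open>star_all\<close>): from any point one can move, inside the common sign stratum of finitely many analytic functions,
  to a point at distance at most \<open>\<rho>\<close> where all nonzero functions are at least \<open>c \<rho>\<^sup>L\<close>. It is proved by
  induction on the dimension, following the roots of a function that is regular in one variable; the generalized
  discriminants of these roots are analytic in the remaining variables. Baire's theorem shows that nondegenerate
  simplices shrink to a dense set of points.

  On the analytic side, \<open>f\<close> is smooth where \<open>g \<noteq> 0\<close>, and a binomial identity bounds its derivatives by
  arbitrarily small negative powers of \<open>|g|\<close>. Hence, at each scale \<open>\<rho>\<close>, \<open>f\<close> is approximated on balls of
  radius \<open>\<rho>\<close> to any order in \<open>\<rho>\<close> by Taylor polynomials, or by \<open>0\<close> where \<open>g\<close> is tiny. Regularity makes
  neighbouring approximations close with all derivatives, so a partition of unity on dyadic grids glues them to a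
  smooth extension.
\<close>

text \<open>A Taylor expansion of \<open>f\<close> cannot be followed across zeros of
  \<open>g\<close>, nor along segments that leave \<open>X\<close>. The remainder is therefore never
  estimated for \<open>f\<close> itself: with \<open>q\<close> the Taylor polynomial of
  \<open>f\<close> at a good centre \<open>w\<close>, the functions \<open>q ^ m - P\<close> and
  \<open>q * G - H\<close> are smooth on a full ball and have vanishing jets at \<open>w\<close>, so
  they are small; only then are they converted into a bound for \<open>f - q\<close> on
  \<open>X\<close>, and this is where the inequality between \<open>f\<close> and \<open>g\<close>
  enters. The simplices may be very thin. Since their volume is at least a power of the scale, they
  cost a fixed power of the scale, which approximations of arbitrary order can pay. To reach all
  orders of smoothness with one extension, the order of approximation grows slowly with the dyadic
  level. In the curve selection, the number of real roots is not detected by analytic functions of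
  the parameters, but the number of distinct complex roots is; conjugation symmetry then keeps real
  roots real. For subanalytic sets the lemma is applied to all vertices of a simplex at once, as one
  point of a product space, together with its size parameters: this turns a qualitative
  nondegeneracy into a bound by a power of the scale.\<close>

section \<open>Directional derivatives and the calculus of smooth functions\<close>

definition dd :: "'a::real_normed_vector => ('a => 'b::real_normed_vector) => 'a => 'b" where
  "dd v F x = frechet_derivative F (at x) v"

lemma dd_eq: "(F has_derivative F') (at x) ==> dd v F x = F' v"
  unfolding dd_def by (metis frechet_derivative_at)

lemma has_derivative_dd: "F differentiable (at x) ==> (F has_derivative (%v. dd v F x)) (at x)"
  unfolding dd_def using frechet_derivative_works by (metis eta_contract_eq)

lemma dd_cong:
  assumes "open V" "x \<in> V" "!!y. y \<in> V ==> F y = G y"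
  shows "dd v F x = dd v G x"
proof -
  have "(F has_derivative D) (at x) \<longleftrightarrow> (G has_derivative D) (at x)" for D
    using has_derivative_transform_within_open[OF _ assms(1,2), of F D UNIV G]
      has_derivative_transform_within_open[OF _ assms(1,2), of G D UNIV F] assms(3) by auto
  then show ?thesis unfolding dd_def frechet_derivative_def by simp
qed

lemma Ck_cong:
  assumes "open V" "!!y. y \<in> V ==> F y = G y" "Ck k F V"
  shows "Ck k G V"
  using assms(2,3)
proof (cases k)
  case 0 then show ?thesis using assms by (auto cong: continuous_on_cong)
next
  case (Suc n)
  then obtain F' where "!!x. x \<in> V ==> (F has_derivative F' x) (at x)" "!!v. Ck n (%x. F' x v) V" using assms(3) by auto
  moreover have "(G has_derivative F' x) (at x)" if "x \<in> V" for x
    using has_derivative_transform_within_open[OF calculation(1)[OF that] assms(1) that assms(2)] .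
  ultimately show ?thesis using Suc by auto
qed

text \<open>On an open set the derivative is unique, so the canonical \<open>dd\<close> can replace
  the existentially quantified derivative in \<open>Ck\<close>. Most later inductions on the order
  use this form, and the recursive equation of \<open>Ck\<close> then leaves the simp set.\<close>

lemma Ck_Suc_iff:
  assumes "open V"
  shows "Ck (Suc k) F V \<longleftrightarrow> (\<forall>x\<in>V. F differentiable (at x)) & (\<forall>v. Ck k (dd v F) V)"
proof
  assume "Ck (Suc k) F V"
  then obtain F' where F': "!!x. x \<in> V ==> (F has_derivative F' x) (at x)" "!!v. Ck k (%x. F' x v) V" by auto
  have "Ck k (dd v F) V" for v
    by (rule Ck_cong[OF assms _ F'(2)[of v]]) (use F'(1) dd_eq in metis)
  then show "(\<forall>x\<in>V. F differentiable (at x)) & (\<forall>v. Ck k (dd v F) V)"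
    using F' by (auto simp: differentiable_def)
next
  assume "(\<forall>x\<in>V. F differentiable (at x)) & (\<forall>v. Ck k (dd v F) V)"
  then show "Ck (Suc k) F V"
    by (auto intro!: exI[of _ "%x v. dd v F x"] has_derivative_dd)
qed

declare Ck.simps(2)[simp del]

lemma Ck_continuous: "open V ==> Ck k F V ==> continuous_on V F"
  by (cases k) (auto simp: Ck_Suc_iff continuous_on_eq_continuous_at differentiable_imp_continuous_within)

lemma Ck_pred: "open V ==> Ck (Suc k) F V ==> Ck k F V"
proof (induction k arbitrary: F)
  case 0 then show ?case using Ck_continuous by auto
next
  case (Suc k) then show ?case by (simp add: Ck_Suc_iff)
qed

lemma Ck_subset: "Ck k F V ==> U \<subseteq> V ==> Ck k F U"
proof (induction k arbitrary: F)
  case 0 then show ?case using continuous_on_subset by auto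
next
  case (Suc k)
  from Suc.prems(1) obtain F' where F': "!!x. x \<in> V ==> (F has_derivative F' x) (at x)" "!!v. Ck k (%x. F' x v) V"
    unfolding Ck.simps(2) by auto
  show ?case unfolding Ck.simps(2)
    by (intro exI[of _ F']) (use F' Suc.prems(2) Suc.IH in auto)
qed

lemma dd_const: "dd v (%x. c) x = 0" by (simp add: dd_def)

lemma dd_add:
  assumes "F differentiable (at x)" "G differentiable (at x)"
  shows "dd v (%x. F x + G x) x = dd v F x + dd v G x"
  using dd_eq[OF has_derivative_add[OF has_derivative_dd[OF assms(1)] has_derivative_dd[OF assms(2)]]] .

lemma dd_mult:
  fixes F G :: "'a::real_normed_vector => 'b::real_normed_algebra"
  assumes "F differentiable (at x)" "G differentiable (at x)"
  shows "dd v (%x. F x * G x) x = F x * dd v G x + dd v F x * G x"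
  using dd_eq[OF has_derivative_mult[OF has_derivative_dd[OF assms(1)] has_derivative_dd[OF assms(2)]]] .

lemma dd_bounded_linear:
  assumes "bounded_linear L" "F differentiable (at x)"
  shows "dd v (%x. L (F x)) x = L (dd v F x)"
  using dd_eq[OF bounded_linear.has_derivative[OF assms(1) has_derivative_dd[OF assms(2)]]] .

lemma dd_inverse:
  fixes F :: "'a::real_normed_vector => 'b::real_normed_field"
  assumes "F differentiable (at x)" "F x ~= 0"
  shows "dd v (%x. inverse (F x)) x = - (dd v F x * (inverse (F x) * inverse (F x)))"
  using dd_eq[OF Deriv.has_derivative_inverse[OF assms(2) has_derivative_dd[OF assms(1)]]] by (simp add: mult_ac)

lemma affine_has_derivative:
  assumes "bounded_linear L"
  shows "((%x. L x + c) has_derivative L) (at x)"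
  using has_derivative_add[OF bounded_linear_imp_has_derivative[OF assms] has_derivative_const[of c]] by simp

lemma dd_affine:
  assumes "bounded_linear L" "F differentiable (at (L x + c))"
  shows "dd v (%x. F (L x + c)) x = dd (L v) F (L x + c)"
    and "(%x. F (L x + c)) differentiable (at x)"
proof -
  have "((%x. F (L x + c)) has_derivative (%v. dd (L v) F (L x + c))) (at x)"
    using has_derivative_compose[OF affine_has_derivative[OF assms(1)] has_derivative_dd[OF assms(2)]] .
  from dd_eq[OF this] show "dd v (%x. F (L x + c)) x = dd (L v) F (L x + c)" .
  from \<open>((%x. F (L x + c)) has_derivative (%v. dd (L v) F (L x + c))) (at x)\<close>
  show "(%x. F (L x + c)) differentiable (at x)" unfolding differentiable_def by metis
qed

lemma Ck_const: "Ck k (%x. c) V"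
  by (induction k arbitrary: c) (auto simp: Ck.simps(2) intro!: exI[of _ "%x v. 0"])

lemma Ck_add:
  assumes "open V"
  shows "Ck k F V ==> Ck k G V ==> Ck k (%x. F x + G x) V"
proof (induction k arbitrary: F G)
  case 0 then show ?case by (auto intro: continuous_on_add)
next
  case (Suc k)
  note F = Suc.prems[unfolded Ck_Suc_iff[OF assms]]
  have "Ck k (dd v (%x. F x + G x)) V" for v
    by (rule Ck_cong[OF assms _ Suc.IH[of "dd v F" "dd v G"]]) (use F in \<open>auto simp: dd_add\<close>)
  then show ?case using F by (auto simp: Ck_Suc_iff[OF assms])
qed

lemma Ck_mult:
  fixes F G :: "'a::real_normed_vector => 'b::real_normed_algebra"
  assumes "open V"
  shows "Ck k F V ==> Ck k G V ==> Ck k (%x. F x * G x) V"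
proof (induction k arbitrary: F G)
  case 0 then show ?case by (auto intro: continuous_on_mult)
next
  case (Suc k)
  note F = Suc.prems[unfolded Ck_Suc_iff[OF assms]]
  have FG: "Ck k F V" "Ck k G V" using Suc.prems Ck_pred assms by auto
  have "Ck k (dd v (%x. F x * G x)) V" for v
    by (rule Ck_cong[OF assms _ Ck_add[OF assms Suc.IH[of "F" "dd v G"] Suc.IH[of "dd v F" "G"]]])
       (use F FG in \<open>auto simp: dd_mult\<close>)
  then show ?case using F by (auto simp: Ck_Suc_iff[OF assms])
qed

lemma Ck_bounded_linear:
  assumes "open V" "bounded_linear L"
  shows "Ck k F V ==> Ck k (%x. L (F x)) V"
proof (induction k arbitrary: F)
  case 0 then show ?case using assms by (auto intro: bounded_linear.continuous_on)
next
  case (Suc k)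
  note F = Suc.prems[unfolded Ck_Suc_iff[OF assms(1)]]
  have "Ck k (dd v (%x. L (F x))) V" for v
    by (rule Ck_cong[OF assms(1) _ Suc.IH[of "dd v F"]]) (use F assms in \<open>auto simp: dd_bounded_linear\<close>)
  moreover have "(%x. L (F x)) differentiable (at x)" if "x \<in> V" for x
    using F bounded_linear.has_derivative[OF assms(2) has_derivative_dd] that unfolding differentiable_def by metis
  ultimately show ?case by (auto simp: Ck_Suc_iff[OF assms(1)])
qed

lemma Ck_inverse:
  fixes F :: "'a::real_normed_vector => 'b::real_normed_field"
  assumes "open V" and nz: "!!x. x \<in> V ==> F x ~= 0"
  shows "Ck k F V ==> Ck k (%x. inverse (F x)) V"
proof (induction k)
  case 0 then show ?case using nz by (auto intro: continuous_on_inverse)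
next
  case (Suc k)
  note F = Suc.prems[unfolded Ck_Suc_iff[OF assms(1)]]
  have i: "Ck k (%x. inverse (F x)) V" using Suc Ck_pred[OF assms(1)] by auto
  have "Ck k (dd v (%x. inverse (F x))) V" for v
    by (rule Ck_cong[OF assms(1) _ Ck_bounded_linear[OF assms(1) bounded_linear_minus[OF bounded_linear_ident] Ck_mult[OF assms(1) _ Ck_mult[OF assms(1) i i], of "dd v F"]]])
       (use F nz in \<open>auto simp: dd_inverse\<close>)
  then show ?case using F nz by (auto simp: Ck_Suc_iff[OF assms(1)])
qed

lemma Ck_affine:
  assumes V: "open V" and U: "open U" and L: "bounded_linear L" and sub: "!!x. x \<in> U ==> L x + c \<in> V"
  shows "Ck k F V ==> Ck k (%x. F (L x + c)) U"
proof (induction k arbitrary: F)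
  case 0
  have "continuous_on U (%x. L x + c)" using L by (intro continuous_intros bounded_linear.continuous_on[OF L])
  then show ?case using 0 sub continuous_on_compose2[of V F U "%x. L x + c"] by auto
next
  case (Suc k)
  note F = Suc.prems[unfolded Ck_Suc_iff[OF V]]
  have "Ck k (dd v (%x. F (L x + c))) U" for v
    by (rule Ck_cong[OF U _ Suc.IH[of "dd (L v) F"]]) (use F sub in \<open>auto simp: dd_affine[OF L]\<close>)
  then show ?case using F sub by (auto simp: Ck_Suc_iff[OF U] dd_affine[OF L])
qed

lemma Ck_id: "Ck k (%x. x) V"
proof (cases k)
  case (Suc n) then show ?thesis
    by (auto simp: Ck.simps(2) Ck_const intro!: exI[of _ "%x v. v"])
qed auto

lemma smooth_onD: "smooth_on V F ==> Ck k F V" by (simp add: smooth_on_def)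

lemma smooth_on_iff:
  assumes "open V"
  shows "smooth_on V F \<longleftrightarrow> (\<forall>x\<in>V. F differentiable (at x)) & (\<forall>v. smooth_on V (dd v F))"
proof
  assume "smooth_on V F"
  then show "(\<forall>x\<in>V. F differentiable (at x)) & (\<forall>v. smooth_on V (dd v F))"
    unfolding smooth_on_def using Ck_Suc_iff[OF assms] by blast
next
  assume *: "(\<forall>x\<in>V. F differentiable (at x)) & (\<forall>v. smooth_on V (dd v F))"
  then have "Ck (Suc k) F V" for k unfolding smooth_on_def Ck_Suc_iff[OF assms] by blast
  then show "smooth_on V F" unfolding smooth_on_def using Ck_pred[OF assms] by blast
qed

lemma smooth_on_dd: "open V ==> smooth_on V F ==> smooth_on V (dd v F)"
  using smooth_on_iff by blast
lemma smooth_on_differentiable: "open V ==> smooth_on V F ==> x \<in> V ==> F differentiable (at x)"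
  using smooth_on_iff by blast
lemma smooth_on_has_derivative:
  "open V ==> smooth_on V F ==> x \<in> V ==> (F has_derivative (%v. dd v F x)) (at x)"
  using smooth_on_differentiable has_derivative_dd by blast
lemma smooth_on_continuous: "open V ==> smooth_on V F ==> continuous_on V F"
  using Ck_continuous smooth_on_def by blast
lemma smooth_on_cong: "open V ==> smooth_on V F ==> (!!y. y \<in> V ==> F y = G y) ==> smooth_on V G"
  unfolding smooth_on_def using Ck_cong by blast
lemma smooth_on_subset: "smooth_on V F ==> U \<subseteq> V ==> smooth_on U F"
  unfolding smooth_on_def using Ck_subset by blast
lemma smooth_on_const: "smooth_on V (%x. c)" unfolding smooth_on_def using Ck_const by blast
lemma smooth_on_id: "smooth_on V (%x. x)" unfolding smooth_on_def using Ck_id by blast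
lemma smooth_on_add: "open V ==> smooth_on V F ==> smooth_on V G ==> smooth_on V (%x. F x + G x)"
  unfolding smooth_on_def using Ck_add by blast
lemma smooth_on_bounded_linear: "open V ==> bounded_linear L ==> smooth_on V F ==> smooth_on V (%x. L (F x))"
  unfolding smooth_on_def using Ck_bounded_linear by blast
lemma smooth_on_minus: "open V ==> smooth_on V F ==> smooth_on V (%x. - F x)"
  using smooth_on_bounded_linear[OF _ bounded_linear_minus[OF bounded_linear_ident]] by blast
lemma smooth_on_diff: "open V ==> smooth_on V F ==> smooth_on V G ==> smooth_on V (%x. F x - G x)"
  using smooth_on_add[of V F "%x. - G x"] smooth_on_minus[of V G] by simp
lemma smooth_on_mult:
  fixes F G :: "'a::real_normed_vector => 'b::real_normed_algebra"
  shows "open V ==> smooth_on V F ==> smooth_on V G ==> smooth_on V (%x. F x * G x)"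
  unfolding smooth_on_def using Ck_mult by blast
lemma smooth_on_power:
  fixes F :: "'a::real_normed_vector => 'b::real_normed_algebra_1"
  shows "open V ==> smooth_on V F ==> smooth_on V (%x. F x ^ n)"
  by (induction n) (auto intro: smooth_on_const smooth_on_mult)
lemma smooth_on_inverse:
  fixes F :: "'a::real_normed_vector => 'b::real_normed_field"
  shows "open V ==> smooth_on V F ==> (!!x. x \<in> V ==> F x ~= 0) ==> smooth_on V (%x. inverse (F x))"
  unfolding smooth_on_def using Ck_inverse by blast
lemma smooth_on_sum:
  assumes "open V" shows "(!!i. i \<in> I ==> smooth_on V (F i)) ==> smooth_on V (%x. \<Sum>i\<in>I. F i x)"
  using assms by (induction I rule: infinite_finite_induct) (auto intro: smooth_on_const smooth_on_add)
lemma smooth_on_prod: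
  fixes F :: "'i => 'a::real_normed_vector => 'b::{real_normed_algebra,comm_ring_1}"
  assumes "open V" shows "(!!i. i \<in> I ==> smooth_on V (F i)) ==> smooth_on V (%x. \<Prod>i\<in>I. F i x)"
  using assms by (induction I rule: infinite_finite_induct) (auto intro: smooth_on_const smooth_on_mult)
lemma smooth_on_affine:
  "open V ==> open U ==> bounded_linear L ==> (!!x. x \<in> U ==> L x + c \<in> V) ==> smooth_on V F
   ==> smooth_on U (%x. F (L x + c))"
  unfolding smooth_on_def using Ck_affine by blast

section \<open>Uniform bounds on all derivatives up to a given order\<close>

text \<open>A C^k norm built from iterated derivatives along the basis vectors. Since
  \<open>dd\<close> is computed in the ambient space, \<open>W\<close> may be any set; for
  \<open>W = {w}\<close> this bounds the jet of \<open>F\<close> at \<open>w\<close>.\<close>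

fun bnd :: "nat => real => ('a::euclidean_space => 'b::real_normed_vector) => 'a set => bool" where
  "bnd 0 B F W = (\<forall>x\<in>W. norm (F x) \<le> B)"
| "bnd (Suc k) B F W = ((\<forall>x\<in>W. norm (F x) \<le> B) & (\<forall>b\<in>Basis. bnd k B (dd b F) W))"

lemma bnd_norm: "bnd k B F W ==> x \<in> W ==> norm (F x) \<le> B" by (cases k) auto
lemma bnd_pred: "bnd (Suc k) B F W ==> bnd k B F W"
  by (induction k arbitrary: F) auto
lemma bnd_le: "bnd n B F W ==> k \<le> n ==> bnd k B F W"
proof (induction n)
  case (Suc n) then show ?case using bnd_pred[of n B F W] by (cases "k = Suc n") auto
qed simp
lemma bnd_mono: "bnd k B F W ==> B \<le> B' ==> bnd k B' F W"
  by (induction k arbitrary: F) force+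
lemma bnd_subset: "bnd k B F W ==> W' \<subseteq> W ==> bnd k B F W'"
  by (induction k arbitrary: F) (auto)
lemma bnd_pointwise: "bnd k B F W \<longleftrightarrow> (\<forall>x\<in>W. bnd k B F {x})"
  by (induction k arbitrary: F) (auto)
lemma bnd_cong:
  assumes "open V" "W \<subseteq> V"
  shows "bnd k B F W ==> (!!y. y \<in> V ==> F y = G y) ==> bnd k B G W"
proof (induction k arbitrary: F G)
  case 0 then show ?case using assms by (metis bnd.simps(1) subsetD)
next
  case (Suc k)
  have "bnd k B (dd b G) W" if "b \<in> Basis" for b
    using Suc.IH[of "dd b F" "dd b G"] Suc.prems dd_cong[OF assms(1)] that by (metis bnd.simps(2))
  moreover have "\<forall>x\<in>W. norm (G x) \<le> B" using Suc.prems assms by (metis bnd.simps(2) subsetD)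
  ultimately show ?case by auto
qed

lemma bnd_add:
  assumes V: "open V" "W \<subseteq> V"
  shows "bnd k A F W ==> bnd k B G W ==> smooth_on V F ==> smooth_on V G ==> bnd k (A + B) (%x. F x + G x) W"
proof (induction k arbitrary: F G)
  case 0 then show ?case by (auto intro: norm_triangle_mono)
next
  case (Suc k)
  have "bnd k (A + B) (dd b (%x. F x + G x)) W" if "b \<in> Basis" for b
    by (rule bnd_cong[OF V Suc.IH[of "dd b F" "dd b G"]])
      (use Suc.prems that in \<open>auto simp: smooth_on_dd[OF V(1)] dd_add smooth_on_differentiable[OF V(1)]\<close>)
  then show ?case using Suc.prems by (auto intro: norm_triangle_mono)
qed

text \<open>Every application of the product rule doubles the number of terms, which is the origin
  of \<open>2^k\<close>.\<close>

lemma bnd_mult: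
  fixes F G :: "'a::euclidean_space => 'b::real_normed_algebra"
  assumes V: "open V" "W \<subseteq> V"
  shows "bnd k A F W ==> bnd k B G W ==> smooth_on V F ==> smooth_on V G ==> 0 \<le> A ==> 0 \<le> B ==> bnd k (2^k * (A * B)) (%x. F x * G x) W"
proof (induction k arbitrary: F G)
  case 0
  then show ?case by simp (meson norm_mult_ineq order_trans mult_mono norm_ge_zero)
next
  case (Suc k)
  have F: "bnd k A F W" "bnd k B G W" using Suc.prems bnd_pred by blast+
  have "bnd k (2^k * (A * B) + 2^k * (A * B)) (dd b (%x. F x * G x)) W" if "b \<in> Basis" for b
    by (rule bnd_cong[OF V bnd_add[OF V Suc.IH[of "F" "dd b G"] Suc.IH[of "dd b F" "G"]]])
      (use Suc.prems that F in \<open>auto simp: smooth_on_dd[OF V(1)] dd_mult smooth_on_differentiable[OF V(1)] intro!: smooth_on_mult[OF V(1)]\<close>)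
  moreover have "norm (F x * G x) \<le> 2 ^ Suc k * (A * B)" if "x \<in> W" for x
  proof -
    have "norm (F x * G x) \<le> A * B"
      by (meson that norm_mult_ineq order_trans mult_mono norm_ge_zero bnd_norm[OF F(1)] bnd_norm[OF F(2)] Suc.prems)
    also have "... \<le> 2 ^ Suc k * (A * B)" using Suc.prems one_le_power[of "2::real" "Suc k"] mult_right_mono[of 1 "2 ^ Suc k" "A * B"] by auto
    finally show ?thesis .
  qed
  moreover have "2^k * (A * B) + 2^k * (A * B) = 2 ^ Suc k * (A * B)" by simp
  ultimately show ?case unfolding bnd.simps(2) by metis
qed

lemma bnd_const: "norm c \<le> B ==> bnd k B (%x. c) W"
proof (induction k arbitrary: c)
  case (Suc k)
  have "bnd k B (dd b (%x. c)) W" for b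
    using Suc.IH[of 0] Suc.prems norm_ge_zero[of c] by (simp add: dd_const[abs_def] del: norm_ge_zero)
  then show ?case using Suc.prems by auto
qed auto
lemma bnd_bounded_linear:
  assumes V: "open V" "W \<subseteq> V" and L: "bounded_linear L" "!!y. norm (L y) \<le> norm y * K" "0 \<le> K"
  shows "bnd k B F W ==> smooth_on V F ==> bnd k (B * K) (%x. L (F x)) W"
proof (induction k arbitrary: F)
  case 0 then show ?case using L by (auto intro: order_trans[OF L(2)] mult_right_mono)
next
  case (Suc k)
  have "bnd k (B * K) (dd b (%x. L (F x))) W" if "b \<in> Basis" for b
    by (rule bnd_cong[OF V Suc.IH[of "dd b F"]])
      (use Suc.prems that in \<open>auto simp: smooth_on_dd[OF V(1)] dd_bounded_linear[OF L(1)] smooth_on_differentiable[OF V(1)]\<close>)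
  moreover have "norm (L (F x)) \<le> B * K" if "x \<in> W" for x
    using bnd_norm[OF Suc.prems(1) that] order_trans[OF L(2) mult_right_mono[OF _ L(3)]] by blast
  ultimately show ?case by auto
qed

lemma bnd_minus: "open V ==> W \<subseteq> V ==> bnd k B F W ==> smooth_on V F ==> bnd k B (%x. - F x) W"
  using bnd_bounded_linear[OF _ _ bounded_linear_minus[OF bounded_linear_ident], of V W 1 k B F] by simp
lemma bnd_diff:
  "open V ==> W \<subseteq> V ==> bnd k A F W ==> bnd k B G W ==> smooth_on V F ==> smooth_on V G ==> bnd k (A + B) (%x. F x - G x) W"
  using bnd_add[of V W k A F B "%x. - G x"] bnd_minus[of V W k B G] smooth_on_minus[of V G] by simp
lemma bnd_sum:
  assumes V: "open V" "W \<subseteq> V" and "finite I"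
  shows "(!!i. i \<in> I ==> bnd k (A i) (F i) W) ==> (!!i. i \<in> I ==> smooth_on V (F i)) ==> bnd k (\<Sum>i\<in>I. A i) (%x. \<Sum>i\<in>I. F i x) W"
  using assms(3)
proof (induction I rule: finite_induct)
  case empty then show ?case by (simp add: bnd_const)
next
  case (insert i I)
  then show ?case using bnd_add[OF V, of k "A i" "F i" "\<Sum>i\<in>I. A i" "%x. \<Sum>i\<in>I. F i x"] smooth_on_sum[OF V(1), of I F] by auto
qed

lemma bnd_compact:
  fixes F :: "'a::euclidean_space => 'b::real_normed_vector" and B \<eta> R :: real
  assumes "open V" "compact K" "K \<subseteq> V"
  shows "smooth_on V F ==> \<exists>B\<ge>0. bnd k B F K"
proof (induction k arbitrary: F)
  case 0
  have "bounded (F ` K)"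
    using assms(2) compact_continuous_image compact_imp_bounded continuous_on_subset[OF smooth_on_continuous[OF assms(1) 0] assms(3)] by blast
  then obtain B where "\<forall>x\<in>K. norm (F x) \<le> B" unfolding bounded_iff by auto
  then have "bnd 0 (max B 0) F K" by auto
  then show ?case by (meson max.cobounded2)
next
  case (Suc k)
  have "\<forall>b. \<exists>B\<ge>0. bnd k B (dd b F) K" using Suc smooth_on_dd[OF assms(1)] by blast
  then obtain B where B: "!!b. B b \<ge> 0" "!!b. bnd k (B b) (dd b F) K" by metis
  have "bounded (F ` K)"
    using assms(2) compact_continuous_image compact_imp_bounded continuous_on_subset[OF smooth_on_continuous[OF assms(1) Suc.prems] assms(3)] by blast
  then obtain C where C: "\<forall>x\<in>K. norm (F x) \<le> C" unfolding bounded_iff by auto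
  define M where "M = \<bar>C\<bar> + (\<Sum>b\<in>Basis. B b)"
  have "B b \<le> M" if "b \<in> Basis" for b
    using member_le_sum[of b Basis B] that B by (simp add: M_def add_increasing)
  then have "bnd (Suc k) M F K" using B C by (auto intro: bnd_mono simp: M_def add_increasing2 sum_nonneg)
  moreover have "M \<ge> 0" using B by (simp add: M_def sum_nonneg)
  ultimately show ?case by blast
qed

lemma dd_linear_basis:
  fixes F :: "'a::euclidean_space => 'b::real_normed_vector" and B \<eta> R :: real
  assumes "F differentiable (at x)"
  shows "dd v F x = (\<Sum>b\<in>Basis. (v \<bullet> b) *\<^sub>R dd b F x)"
proof -
  interpret bounded_linear "%v. dd v F x" using has_derivative_dd[OF assms] has_derivative_bounded_linear by blast
  show ?thesis by (subst euclidean_representation[of v, symmetric]) (simp only: sum scaleR)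
qed

lemma dd_norm_le:
  fixes F :: "'a::euclidean_space => 'b::real_normed_vector" and B \<eta> R :: real
  assumes "F differentiable (at x)" "!!b. b \<in> Basis ==> norm (dd b F x) \<le> B"
  shows "norm (dd v F x) \<le> real DIM('a) * B * norm v"
proof -
  have "norm (dd v F x) \<le> (\<Sum>b\<in>Basis. \<bar>v \<bullet> b\<bar> * norm (dd b F x))"
    unfolding dd_linear_basis[OF assms(1), of v] by (rule order_trans[OF norm_sum]) simp
  also have "... \<le> (\<Sum>b\<in>(Basis::'a set). norm v * B)"
    by (intro sum_mono mult_mono assms(2) Basis_le_norm) auto
  finally show ?thesis by (simp add: mult_ac)
qed

lemma bnd_lipschitz:
  fixes F :: "'a::euclidean_space => 'b::real_normed_vector" and B \<eta> R :: real
  assumes V: "open V" and W: "convex W" "W \<subseteq> V" and F: "smooth_on V F" "bnd (Suc k) B F W" and xy: "x \<in> W" "y \<in> W"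
  shows "norm (F x - F y) \<le> real DIM('a) * B * norm (x - y)"
proof (rule differentiable_bound[OF W(1) _ _ xy])
  fix z assume z: "z \<in> W"
  show "(F has_derivative (%v. dd v F z)) (at z within W)"
    using smooth_on_has_derivative[OF V F(1)] z W(2) has_derivative_at_withinI by blast
  have "F differentiable (at z)" using smooth_on_differentiable[OF V F(1)] z W(2) by blast
  moreover have "norm (dd b F z) \<le> B" if "b \<in> Basis" for b using F(2) that z bnd_norm[of k B "dd b F" W z] by auto
  ultimately show "onorm (%v. dd v F z) \<le> real DIM('a) * B"
    by (intro onorm_bound) (auto intro: dd_norm_le simp: order_trans[OF norm_ge_zero[of "F z"] bnd_norm[OF F(2) z]])
qed

text \<open>Mean value inequality for all derivatives up to order \<open>k\<close>: going from the
  centre to another point of the ball uses one further derivative and gains a factor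
  \<open>R\<close>.\<close>

lemma bnd_from_jets1:
  fixes F :: "'a::euclidean_space => 'b::real_normed_vector" and B \<eta> R :: real
  assumes V: "open V" "ball w R \<subseteq> V" "0 < R"
  shows "smooth_on V F ==> bnd (Suc k) B F (ball w R) ==> bnd k \<eta> F {w} ==> bnd k (\<eta> + real DIM('a) * B * R) F (ball w R)"
proof (induction k arbitrary: F)
  have step: "norm (F x) \<le> \<eta> + real DIM('a) * B * R" if "smooth_on V F" "bnd (Suc k) B F (ball w R)" "norm (F w) \<le> \<eta>" "x \<in> ball w R"
    for F :: "'a => 'b" and k x
  proof -
    have B: "0 \<le> B" using bnd_norm[OF that(2) that(4)] norm_ge_zero order_trans by blast
    have "norm (F x - F w) \<le> real DIM('a) * B * norm (x - w)"
      by (rule bnd_lipschitz[OF V(1) _ V(2) that(1,2,4)]) (use V in auto)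
    also have "... \<le> real DIM('a) * B * R" using that B by (intro mult_left_mono) (auto simp: dist_norm norm_minus_commute)
    finally show ?thesis using norm_triangle_ineq2[of "F x" "F w"] that(3) by linarith
  qed
  { case 0 then show ?case using step[OF 0(1,2)] by simp }
  { case (Suc k)
    have "norm (F w) \<le> \<eta>" using Suc.prems by simp
    then show ?case using step[OF Suc.prems(1,2)] Suc.IH[OF smooth_on_dd[OF V(1) Suc.prems(1)]] Suc.prems by auto }
qed

text \<open>Iterates \<open>bnd_from_jets1\<close>: each of the \<open>j\<close> surplus derivatives
  is traded for a factor \<open>DIM('a) * R\<close>. This replaces Taylor's formula when the jet at
  the centre is small but perhaps not zero.\<close>

lemma bnd_from_jets:
  fixes F :: "'a::euclidean_space => 'b::real_normed_vector" and B \<eta> R :: real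
  assumes V: "open V" "ball w R \<subseteq> V" "0 < R" and F: "smooth_on V F" and R: "real DIM('a) * R \<le> 1/2" and e: "0 \<le> \<eta>"
  shows "bnd (k + j) B F (ball w R) ==> bnd (k + j) \<eta> F {w} ==> bnd k (2 * \<eta> + B * (real DIM('a) * R)^j) F (ball w R)"
proof (induction j arbitrary: B)
  case 0 then show ?case using e by (auto intro: bnd_mono)
next
  case (Suc j)
  have "bnd (k + j) (\<eta> + real DIM('a) * B * R) F (ball w R)"
    using bnd_from_jets1[OF V F, of "k+j" B \<eta>] Suc.prems bnd_pred[of "k+j" \<eta> F "{w}"] by simp
  \<comment> \<open>Descent from order \<open>k + i\<close> to order \<open>k\<close>. A step turns
    the contribution of \<eta> into at most \<eta> + 2 \<eta> \<open>DIM('a) * R\<close>, and since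
    that factor is at most 1/2 the total never exceeds 2 \<eta>.\<close>
  have *: "bnd k (2 * \<eta> + B * (real DIM('a) * R)^(Suc j)) F (ball w R)" if "bnd (k+i) (2*\<eta> + B * (real DIM('a) * R)^(Suc j - i)) F (ball w R)" "i \<le> j" for i
    using that
  proof (induction i)
    case 0 then show ?case by simp
  next
    case (Suc i)
    have "bnd (k + i) \<eta> F {w}" using \<open>bnd (k + Suc j) \<eta> F {w}\<close> bnd_le Suc.prems by (metis add_left_mono le_SucI Suc_leD)
    then have "bnd (k + i) (\<eta> + real DIM('a) * (2*\<eta> + B * (real DIM('a) * R)^(Suc j - Suc i)) * R) F (ball w R)"
      using bnd_from_jets1[OF V F, of "k+i"] Suc.prems by auto
    moreover have "\<eta> + real DIM('a) * (2*\<eta> + B * (real DIM('a) * R)^(Suc j - Suc i)) * R \<le> 2*\<eta> + B * (real DIM('a) * R)^(Suc j - i)"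
    proof -
      have "Suc j - i = Suc (Suc j - Suc i)" using Suc.prems by auto
      then have "\<eta> + real DIM('a) * (2*\<eta> + B * (real DIM('a) * R)^(Suc j - Suc i)) * R = \<eta> + 2 * \<eta> * (real DIM('a) * R) + B * (real DIM('a) * R)^(Suc j - i)"
        by (simp add: algebra_simps)
      moreover have "2 * \<eta> * (real DIM('a) * R) \<le> 2 * \<eta> * (1/2)" using R e by (intro mult_left_mono) auto
      ultimately show ?thesis by simp
    qed
    ultimately show ?case using Suc.IH Suc.prems bnd_mono by (metis Suc_leD)
  qed
  have "bnd (k + j) (2*\<eta> + B * (real DIM('a) * R)^(Suc j - j)) F (ball w R)"
    using \<open>bnd (k + j) (\<eta> + real DIM('a) * B * R) F (ball w R)\<close> e by (auto intro: bnd_mono simp: algebra_simps)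
  then show ?case using *[of j] by simp
qed

text \<open>Weierstrass M-test, applied to the series and inductively to the series of its
  directional derivatives. Passing from basis directions to a direction \<open>v\<close> multiplies
  the majorant by the l1 norm of \<open>v\<close>.\<close>

lemma bnd_series_Ck:
  fixes T :: "nat => 'a::euclidean_space => 'b::banach"
  assumes V: "open V" "convex V" "V ~= {}" and b: "summable b" "!!n. 0 \<le> b n"
  shows "(!!n. smooth_on V (T n)) ==> (!!n. bnd (Suc k) (b n) (T n) V) ==> Ck k (%x. \<Sum>n. T n x) V"
  using b
proof (induction k arbitrary: T b)
  case 0
  have "uniform_limit V (%n x. \<Sum>i<n. T i x) (%x. \<Sum>i. T i x) sequentially"
    by (rule Weierstrass_m_test[OF _ 0(3)]) (use 0(2) bnd_norm in blast)
  then have "continuous_on V (%x. \<Sum>n. T n x)"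
    by (rule uniform_limit_theorem[rotated])
       (auto intro!: always_eventually continuous_on_sum smooth_on_continuous[OF V(1) 0(1)])
  then show ?case by simp
next
  case (Suc k)
  have dif: "!!n x. x \<in> V ==> T n differentiable (at x)" using Suc.prems(1) smooth_on_differentiable[OF V(1)] by blast
  have nb: "norm (dd v (T n) x) \<le> real DIM('a) * b n * norm v" if "x \<in> V" for n x v
    using dd_norm_le[OF dif[OF that]] Suc.prems(2)[of n] bnd_norm that by (metis bnd.simps(2))
  obtain x0 where x0: "x0 \<in> V" using V(3) by blast
  have ul: "uniform_limit V (%n x. \<Sum>i<n. dd v (T i) x) (%x. \<Sum>i. dd v (T i) x) sequentially" for v
    by (rule Weierstrass_m_test[of _ _ "%n. real DIM('a) * b n * norm v"]) (use nb Suc.prems in \<open>auto intro!: summable_mult2 summable_mult\<close>)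
  have "\<exists>g. \<forall>x\<in>V. (%n. T n x) sums g x & (g has_derivative (%v. \<Sum>n. dd v (T n) x)) (at x within V)"
  proof (rule has_derivative_series[OF V(2), of T "%n x v. dd v (T n) x"])
    show "(T n has_derivative (%v. dd v (T n) x)) (at x within V)" if "x \<in> V" for n x
      using has_derivative_dd[OF dif[OF that]] has_derivative_at_withinI by blast
    show "\<forall>\<^sub>F n in sequentially. \<forall>x\<in>V. \<forall>h. norm ((\<Sum>i<n. dd h (T i) x) - (\<Sum>n. dd h (T n) x)) \<le> e * norm h" if "e > 0" for e
    proof -
      have sb: "summable (%n. real DIM('a) * b n)" using Suc.prems summable_mult by blast
      from LIMSEQ_D[OF summable_LIMSEQ[OF sb] that] obtain N where N: "!!n. n \<ge> N ==> norm ((\<Sum>i<n. real DIM('a) * b i) - (\<Sum>n. real DIM('a) * b n)) < e" by blast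
      have "norm ((\<Sum>i<n. dd h (T i) x) - (\<Sum>n. dd h (T n) x)) \<le> e * norm h" if "n \<ge> N" "x \<in> V" for n x h
      proof -
        have s1: "summable (%i. norm (dd h (T i) x))"
          by (rule summable_comparison_test'[of "%n. real DIM('a) * b n * norm h" 0]) (use nb that sb in \<open>auto intro: summable_mult2\<close>)
        have s2: "summable (%i. norm (dd h (T (i + n)) x))" using summable_ignore_initial_segment[OF s1] .
        have s3: "summable (%i. real DIM('a) * b (i + n))" using summable_ignore_initial_segment[OF sb] .
        have "(\<Sum>n. dd h (T n) x) - (\<Sum>i<n. dd h (T i) x) = (\<Sum>i. dd h (T (i + n)) x)"
          using suminf_minus_initial_segment[OF summable_norm_cancel[OF s1], of n] by simp
        also have "norm ... \<le> (\<Sum>i. norm (dd h (T (i + n)) x))" by (rule summable_norm[OF s2])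
        also have "... \<le> (\<Sum>i. real DIM('a) * b (i + n) * norm h)"
          by (rule suminf_le[OF _ s2 summable_mult2[OF s3]]) (rule nb[OF that(2)])
        also have "... = (\<Sum>i. real DIM('a) * b (i + n)) * norm h"
          by (rule suminf_mult2[OF s3, symmetric])
        also have "(\<Sum>i. real DIM('a) * b (i + n)) \<le> e"
          using N[OF that(1)] suminf_minus_initial_segment[OF sb, of n] by simp
        finally show ?thesis by (simp add: norm_minus_commute mult_right_mono)
      qed
      then show ?thesis using eventually_sequentially by blast
    qed
    show "x0 \<in> V" by fact
    have "summable (%n. T n x0)"
      by (rule summable_comparison_test'[of b 0]) (use Suc.prems bnd_norm x0 in \<open>auto\<close>)
    then show "(%n. T n x0) sums (\<Sum>n. T n x0)" using summable_sums by blast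
  qed
  then obtain g where g: "!!x. x \<in> V ==> (%n. T n x) sums g x" "!!x. x \<in> V ==> (g has_derivative (%v. \<Sum>n. dd v (T n) x)) (at x within V)" by blast
  have "Ck (Suc k) g V"
    unfolding Ck.simps(2)
  proof (intro exI[of _ "%x v. \<Sum>n. dd v (T n) x"] conjI ballI allI)
    show "(g has_derivative (%v. \<Sum>n. dd v (T n) x)) (at x)" if "x \<in> V" for x
      using g(2)[OF that] at_within_open[OF that V(1)] by simp
    fix v :: 'a
    have "Ck k (%x. \<Sum>n. dd v (T n) x) V"
    proof (rule Suc.IH[where b="%n. b n * (\<Sum>c\<in>Basis. \<bar>v \<bullet> c\<bar>)"])
      show "smooth_on V (dd v (T n))" for n using smooth_on_dd[OF V(1) Suc.prems(1)] .
      show "summable (%n. b n * (\<Sum>c\<in>Basis. \<bar>v \<bullet> c\<bar>))" using Suc.prems summable_mult2 by blast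
      show "0 \<le> b n * (\<Sum>c\<in>Basis. \<bar>v \<bullet> c\<bar>)" for n using Suc.prems by (simp add: sum_nonneg)
      show "bnd (Suc k) (b n * (\<Sum>c\<in>Basis. \<bar>v \<bullet> c\<bar>)) (dd v (T n)) V" for n
      proof (rule bnd_cong[OF V(1) order_refl, of _ _ "%x. \<Sum>c\<in>Basis. (v \<bullet> c) *\<^sub>R dd c (T n) x"])
        have "bnd (Suc k) (\<Sum>c\<in>Basis. b n * \<bar>v \<bullet> c\<bar>) (%x. \<Sum>c\<in>Basis. (v \<bullet> c) *\<^sub>R dd c (T n) x) V"
          by (intro bnd_sum[OF V(1) order_refl] bnd_bounded_linear[OF V(1) order_refl bounded_linear_scaleR_right] smooth_on_bounded_linear[OF V(1) bounded_linear_scaleR_right] smooth_on_dd[OF V(1)] Suc.prems(1))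
             (use Suc.prems(2)[of n] in auto)
        then show "bnd (Suc k) (b n * (\<Sum>c\<in>Basis. \<bar>v \<bullet> c\<bar>)) (%x. \<Sum>c\<in>Basis. (v \<bullet> c) *\<^sub>R dd c (T n) x) V"
          by (simp add: sum_distrib_left)
        show "(\<Sum>c\<in>Basis. (v \<bullet> c) *\<^sub>R dd c (T n) y) = dd v (T n) y" if "y \<in> V" for y
          using dd_linear_basis[OF dif[OF that], of v] by simp
      qed
    qed
    then show "Ck k (%x. \<Sum>n. dd v (T n) x) V" .
  qed
  then show ?case by (rule Ck_cong[OF V(1), rotated]) (use g(1) sums_unique in blast)
qed

section \<open>Iterated derivatives along one direction and the binomial identity\<close>

lemma it_cong:
  assumes "open V" shows "(!!y. y \<in> V ==> F y = G y) ==> x \<in> V ==> (dd v ^^ k) F x = (dd v ^^ k) G x"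
proof (induction k arbitrary: x)
  case (Suc k)
  then show ?case using dd_cong[OF assms Suc.prems(2), of "(dd v ^^ k) F" "(dd v ^^ k) G" v] by simp
qed simp

lemma it_smooth: "open V ==> smooth_on V F ==> smooth_on V ((dd v ^^ k) F)"
  by (induction k) (auto intro: smooth_on_dd)

lemma it_add:
  assumes V: "open V" and F: "smooth_on V F" "smooth_on V G"
  shows "x \<in> V ==> (dd v ^^ k) (%x. F x + G x) x = (dd v ^^ k) F x + (dd v ^^ k) G x"
proof (induction k arbitrary: x)
  case (Suc k)
  have "dd v ((dd v ^^ k) (%x. F x + G x)) x = dd v (%x. (dd v ^^ k) F x + (dd v ^^ k) G x) x"
    by (rule dd_cong[OF V Suc.prems]) (use Suc.IH in auto)
  also have "... = dd v ((dd v ^^ k) F) x + dd v ((dd v ^^ k) G) x"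
    by (rule dd_add) (use F Suc.prems smooth_on_differentiable[OF V it_smooth[OF V]] in blast)+
  finally show ?case by simp
qed simp

lemma it_bounded_linear:
  assumes V: "open V" and F: "smooth_on V F" and L: "bounded_linear L"
  shows "x \<in> V ==> (dd v ^^ k) (%x. L (F x)) x = L ((dd v ^^ k) F x)"
proof (induction k arbitrary: x)
  case (Suc k)
  have "dd v ((dd v ^^ k) (%x. L (F x))) x = dd v (%x. L ((dd v ^^ k) F x)) x"
    by (rule dd_cong[OF V Suc.prems]) (use Suc.IH in auto)
  also have "... = L (dd v ((dd v ^^ k) F) x)"
    by (rule dd_bounded_linear[OF L]) (use F Suc.prems smooth_on_differentiable[OF V it_smooth[OF V]] in blast)+
  finally show ?case by simp
qed simp

lemma it_zero: "(dd v ^^ k) (%x. 0) = (%x. 0)"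
  by (induction k) (auto simp: dd_const)

lemma it_sum:
  assumes V: "open V" "x \<in> V" and "finite I"
  shows "(!!i. i \<in> I ==> smooth_on V (F i)) ==> (dd v ^^ k) (%x. \<Sum>i\<in>I. F i x) x = (\<Sum>i\<in>I. (dd v ^^ k) (F i) x)"
  using assms(3)
proof (induction I rule: finite_induct)
  case (insert i I)
  then show ?case using it_add[OF V(1) _ smooth_on_sum[OF V(1), of I F] V(2), where F="F i" and v=v and k=k] by auto
qed (simp add: it_zero)

lemma dd_power:
  fixes F :: "'a::real_normed_vector => complex"
  assumes "F differentiable (at x)"
  shows "dd v (%x. F x ^ n) x = of_nat n * F x ^ (n - 1) * dd v F x"
  using dd_eq[OF has_derivative_power[OF has_derivative_dd[OF assms], of n]] by (simp add: mult_ac)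

text \<open>By the binomial theorem the sum is the k-th derivative, at \<open>y = x\<close>, of
  (h(y) - h(x))^n \<phi>(y). This function vanishes to order \<open>n\<close> at \<open>x\<close>,
  so lower derivatives are zero and the n-th one only sees the first order part of
  \<open>h\<close>.\<close>

lemma binomial_derivative_identity:
  fixes h \<phi> :: "'a::real_normed_vector => complex"
  assumes D: "open D" and h: "smooth_on D h" and x: "x \<in> D"
  shows "smooth_on D \<phi> ==> k \<le> n ==> (\<Sum>i\<le>n. of_nat (n choose i) * (- h x) ^ (n - i) * (dd v ^^ k) (%y. h y ^ i * \<phi> y) x)
    = (if k = n then fact n * dd v h x ^ n * \<phi> x else 0)"
proof (induction k arbitrary: n \<phi>)
  case 0
  have "(\<Sum>i\<le>n. of_nat (n choose i) * (- h x) ^ (n - i) * (h x ^ i * \<phi> x)) = (h x + - h x) ^ n * \<phi> x"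
    unfolding binomial_ring sum_distrib_right by (intro sum.cong) (auto simp: mult_ac)
  then show ?case by auto
next
  case (Suc k)
  obtain p where n: "n = Suc p" using Suc.prems by (cases n) auto
  have sh: "smooth_on D (%y. h y ^ i * \<psi> y)" if "smooth_on D \<psi>" for i and \<psi> :: "'a => complex"
    using smooth_on_mult[OF D smooth_on_power[OF D h] that] .
  have s1: "smooth_on D (%y. dd v h y * \<phi> y)" using smooth_on_mult[OF D smooth_on_dd[OF D h]] Suc.prems by blast
  have s2: "smooth_on D (dd v \<phi>)" using smooth_on_dd[OF D] Suc.prems by blast
  \<comment> \<open>One derivative is carried out inside. It either hits \<open>h ^ i\<close>, which
    lowers \<open>n\<close> by one and replaces \<phi> by \<open>dd v h\<close> times \<phi>, or it
    hits \<phi>, which leaves \<open>n\<close> alone.\<close>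
  have e: "(dd v ^^ Suc k) (%y. h y ^ i * \<phi> y) x = of_nat i * (dd v ^^ k) (%y. h y ^ (i - 1) * (dd v h y * \<phi> y)) x + (dd v ^^ k) (%y. h y ^ i * dd v \<phi> y) x" for i
  proof -
    have "(dd v ^^ Suc k) (%y. h y ^ i * \<phi> y) x = (dd v ^^ k) (dd v (%y. h y ^ i * \<phi> y)) x" by (simp add: funpow_swap1)
    also have "... = (dd v ^^ k) (%y. of_nat i * (h y ^ (i - 1) * (dd v h y * \<phi> y)) + h y ^ i * dd v \<phi> y) x"
      using h Suc.prems(1)
      by (intro it_cong[OF D _ x]) (simp add: dd_mult dd_power smooth_on_differentiable[OF D] smooth_on_power[OF D])
    also have "... = (dd v ^^ k) (%y. of_nat i * (h y ^ (i - 1) * (dd v h y * \<phi> y))) x + (dd v ^^ k) (%y. h y ^ i * dd v \<phi> y) x"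
      by (intro it_add[OF D _ _ x] sh s2 smooth_on_mult[OF D smooth_on_const] s1)
    also have "(dd v ^^ k) (%y. of_nat i * (h y ^ (i - 1) * (dd v h y * \<phi> y))) x = of_nat i * (dd v ^^ k) (%y. h y ^ (i - 1) * (dd v h y * \<phi> y)) x"
      by (rule it_bounded_linear[OF D sh[OF s1] bounded_linear_mult_right x])
    finally show ?thesis .
  qed
  have "(\<Sum>i\<le>n. of_nat (n choose i) * (- h x) ^ (n - i) * (dd v ^^ Suc k) (%y. h y ^ i * \<phi> y) x)
     = (\<Sum>i\<le>n. of_nat (n choose i) * (- h x) ^ (n - i) * (of_nat i * (dd v ^^ k) (%y. h y ^ (i - 1) * (dd v h y * \<phi> y)) x))
     + (\<Sum>i\<le>n. of_nat (n choose i) * (- h x) ^ (n - i) * (dd v ^^ k) (%y. h y ^ i * dd v \<phi> y) x)"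
    unfolding e by (simp add: algebra_simps sum.distrib)
  \<comment> \<open>The part where \<phi> was differentiated has only \<open>k < n\<close>
    derivatives left, so it vanishes.\<close>
  also have "(\<Sum>i\<le>n. of_nat (n choose i) * (- h x) ^ (n - i) * (dd v ^^ k) (%y. h y ^ i * dd v \<phi> y) x) = 0"
    using Suc.IH[OF s2, of n] Suc.prems by simp
  also have "(\<Sum>i\<le>n. of_nat (n choose i) * (- h x) ^ (n - i) * (of_nat i * (dd v ^^ k) (%y. h y ^ (i - 1) * (dd v h y * \<phi> y)) x))
     = (\<Sum>i\<le>p. of_nat n * (of_nat (p choose i) * (- h x) ^ (p - i) * (dd v ^^ k) (%y. h y ^ i * (dd v h y * \<phi> y)) x))"
  proof -
    have c: "of_nat (Suc p choose Suc i) * (of_nat (Suc i) :: complex) = of_nat (Suc p) * of_nat (p choose i)" for i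
      using Suc_times_binomial[of i p] by (metis mult.commute of_nat_mult)
    have "of_nat (Suc p choose Suc i) * (- h x) ^ (p - i) * (of_nat (Suc i) * z)
      = of_nat (Suc p) * (of_nat (p choose i) * (- h x) ^ (p - i) * z)" for i and z :: complex
    proof -
      have "of_nat (Suc p choose Suc i) * (- h x) ^ (p - i) * (of_nat (Suc i) * z) = (of_nat (Suc p choose Suc i) * of_nat (Suc i)) * ((- h x) ^ (p - i) * z)"
        by (simp only: mult_ac)
      then show ?thesis unfolding c by (simp only: mult_ac)
    qed
    note cc = this
    show ?thesis unfolding n sum.atMost_Suc_shift diff_Suc_Suc diff_Suc_1 cc by simp
  qed
  also have "... = of_nat n * (if k = p then fact p * dd v h x ^ p * (dd v h x * \<phi> x) else 0)"
    unfolding sum_distrib_left[symmetric] using Suc.IH[OF s1, of p] Suc.prems n by simp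
  finally show ?case using n by (simp add: algebra_simps)
qed

section \<open>Derivatives of the root grow slower than any negative power of g\<close>

text \<open>The exponent \<open>a\<close> does not depend on \<open>n\<close>: every power of
  \<open>h\<close> is tamed by one and the same power of \<open>G\<close>. Taking n-th roots,
  \<open>h\<close> is bounded by a constant times the power -a/n of \<open>G\<close>, an exponent as
  close to 0 as desired.\<close>

definition mild :: "'a::euclidean_space set => ('a => complex) => nat => ('a => complex) => bool" where
  "mild D G a h \<longleftrightarrow> smooth_on D h & (\<forall>n k. \<exists>B\<ge>0. bnd k B (%x. h x ^ n * G x ^ a) D)"

lemma bnd_it: "bnd (k + n) B F W ==> b \<in> Basis ==> bnd k B ((dd b ^^ n) F) W"
proof (induction n arbitrary: F)
  case (Suc n) then show ?case using Suc.IH[of "dd b F"] by (simp add: funpow_swap1)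
qed simp

text \<open>Take \<open>k = n\<close> and \<phi> = \<open>G ^ a\<close> in
  \<open>binomial_derivative_identity\<close> and multiply by another \<open>G ^ a\<close>. Each
  summand becomes a product of \<open>h ^ (n - i) * G ^ a\<close> and an n-th derivative of
  \<open>h ^ i * G ^ a\<close>, both controlled by mildness of \<open>h\<close>, while the right
  side is n! times the n-th power of the derivative with weight \<open>G ^ (2 * a)\<close>.\<close>

lemma mild_dd:
  assumes D: "open D" and G: "smooth_on D G" and h: "mild D G a h" and b: "b \<in> Basis"
  shows "mild D G (2 * a) (dd b h)"
  unfolding mild_def
proof (intro conjI allI)
  have hs: "smooth_on D h" using h mild_def by blast
  then show "smooth_on D (dd b h)" using smooth_on_dd[OF D] by blast
  fix n k
  have "\<forall>i k. \<exists>B\<ge>0. bnd k B (%x. h x ^ i * G x ^ a) D" using h mild_def by blast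
  then obtain B where B: "!!i k. B i k \<ge> 0" "!!i k. bnd k (B i k) (%x. h x ^ i * G x ^ a) D" by metis
  have s: "smooth_on D (%x. h x ^ i * G x ^ a)" for i
    using smooth_on_mult[OF D smooth_on_power[OF D hs] smooth_on_power[OF D G]] .
  define c where "c i = (of_nat (n choose i) * (-1) ^ (n - i) / fact n :: complex)" for i
  define t where "t i = (%x. c i * ((h x ^ (n - i) * G x ^ a) * (dd b ^^ n) (%x. h x ^ i * G x ^ a) x))" for i
  have ts: "smooth_on D (%x. (h x ^ (n - i) * G x ^ a) * (dd b ^^ n) (%x. h x ^ i * G x ^ a) x)" for i
    by (intro smooth_on_mult[OF D s] it_smooth[OF D s])
  define A where "A i = (2 ^ k * (B (n - i) k * B i (k + n))) * norm (c i)" for i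
  have tb: "bnd k (A i) (t i) D" for i
  proof -
    have "bnd k (2 ^ k * (B (n - i) k * B i (k + n))) (%x. (h x ^ (n - i) * G x ^ a) * (dd b ^^ n) (%x. h x ^ i * G x ^ a) x) D"
      by (rule bnd_mult[OF D order_refl B(2) bnd_it[OF B(2) b] s it_smooth[OF D s] B(1) B(1)])
    from bnd_bounded_linear[OF D order_refl bounded_linear_mult_right[of "c i"] _ _ this ts] show ?thesis
      unfolding t_def A_def by (auto simp: norm_mult)
  qed
  have "bnd k (\<Sum>i\<le>n. A i) (%x. \<Sum>i\<le>n. t i x) D"
    by (intro bnd_sum[OF D order_refl] tb) (auto simp: t_def intro!: smooth_on_mult[OF D smooth_on_const] ts)
  moreover have "(\<Sum>i\<le>n. t i x) = dd b h x ^ n * G x ^ (2 * a)" if "x \<in> D" for x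
  proof -
    have "(\<Sum>i\<le>n. t i x) = (\<Sum>i\<le>n. of_nat (n choose i) * (- h x) ^ (n - i) * (dd b ^^ n) (%y. h y ^ i * G y ^ a) x) * (G x ^ a / fact n)"
      unfolding sum_distrib_right t_def c_def
    proof (intro sum.cong refl)
      fix i
      have "(- h x) ^ (n - i) = (-1) ^ (n - i) * h x ^ (n - i)" using power_mult_distrib[of "-1" "h x"] by simp
      then show "of_nat (n choose i) * (- 1) ^ (n - i) / fact n * (h x ^ (n - i) * G x ^ a * (dd b ^^ n) (%x. h x ^ i * G x ^ a) x) =
           of_nat (n choose i) * (- h x) ^ (n - i) * (dd b ^^ n) (%y. h y ^ i * G y ^ a) x * (G x ^ a / fact n)"
        by (simp add: field_simps)
    qed
    also have "... = dd b h x ^ n * G x ^ (2 * a)"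
      using binomial_derivative_identity[OF D hs that smooth_on_power[OF D G], of n n b a] by (simp add: mult_2 power_add)
    finally show ?thesis .
  qed
  moreover have "(\<Sum>i\<le>n. A i) \<ge> 0" unfolding A_def using B(1) by (intro sum_nonneg) auto
  ultimately have "bnd k (\<Sum>i\<le>n. A i) (%x. dd b h x ^ n * G x ^ (2 * a)) D"
    by (intro bnd_cong[OF D order_refl, of k "sum A {..n}" "%x. \<Sum>i\<le>n. t i x" "%x. dd b h x ^ n * G x ^ (2 * a)"])
  with \<open>(\<Sum>i\<le>n. A i) \<ge> 0\<close> show "\<exists>B\<ge>0. bnd k B (%x. dd b h x ^ n * G x ^ (2 * a)) D" by blast
qed

lemma mild_jet_bound:
  assumes D: "open D" and G: "smooth_on D G"
  shows "mild D G a h ==> \<exists>\<rho>0. 0 < \<rho>0 & \<rho>0 \<le> 1 & (\<forall>w\<in>D. \<forall>\<rho>. 0 < \<rho> --> \<rho> \<le> \<rho>0 --> \<rho> ^ M \<le> norm (G w) --> bnd N (1/\<rho>) h {w})"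
proof (induction N arbitrary: a h)
  have base: "\<exists>\<rho>0. 0 < \<rho>0 & \<rho>0 \<le> 1 & (\<forall>w\<in>D. \<forall>\<rho>. 0 < \<rho> --> \<rho> \<le> \<rho>0 --> \<rho> ^ M \<le> norm (G w) --> norm (h w) \<le> 1/\<rho>)"
    if "mild D G a h" for a h
  proof -
    \<comment> \<open>With this power the mild bound gives |h|^n \<rho>^(M a) \<le> B, hence (|h|
      \<rho>)^n \<le> B \<rho> \<le> 1 as soon as \<rho> is small.\<close>
    define n where "n = M * a + 1"
    obtain B where B: "B \<ge> 0" "bnd 0 B (%x. h x ^ n * G x ^ a) D" using \<open>mild D G a h\<close> mild_def by blast
    define r0 where "r0 = min 1 (1 / (B + 1))"
    have "norm (h w) \<le> 1/\<rho>" if w: "w \<in> D" "0 < \<rho>" "\<rho> \<le> r0" "\<rho> ^ M \<le> norm (G w)" for w \<rho>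
    proof (rule power_le_imp_le_base)
      have "norm (h w) ^ n * (\<rho> ^ M) ^ a \<le> norm (h w) ^ n * norm (G w) ^ a"
        using w by (intro mult_left_mono power_mono) auto
      also have "... \<le> B" using B(2) w by (auto simp: norm_mult norm_power)
      finally have 1: "norm (h w) ^ n * \<rho> ^ (M * a) \<le> B" by (simp add: power_mult)
      have "\<rho> \<le> 1 / (B + 1)" using w unfolding r0_def by auto
      then have "\<rho> * (B + 1) \<le> 1" using B(1) by (simp add: field_simps)
      then have 2: "B * \<rho> \<le> 1" using w by (simp add: algebra_simps)
      have "norm (h w) ^ n * \<rho> ^ n = (norm (h w) ^ n * \<rho> ^ (M * a)) * \<rho>" unfolding n_def by simp
      also have "... \<le> B * \<rho>" using 1 w by (intro mult_right_mono) auto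
      finally have "norm (h w) ^ n * \<rho> ^ n \<le> 1" using 2 by simp
      then show "norm (h w) ^ Suc (M * a) \<le> (1/\<rho>) ^ Suc (M * a)" using w by (simp add: n_def power_divide field_simps)
    qed (use w in auto)
    moreover have "0 < r0" "r0 \<le> 1" using B(1) by (auto simp: r0_def)
    ultimately show ?thesis by blast
  qed
  { case 0 then show ?case using base by simp }
  { case (Suc N)
    from base[OF Suc.prems] obtain r1 where r1: "0 < r1" "r1 \<le> 1" "!!w \<rho>. w\<in>D ==> 0 < \<rho> ==> \<rho> \<le> r1 ==> \<rho> ^ M \<le> norm (G w) ==> norm (h w) \<le> 1/\<rho>" by blast
    have "\<forall>b\<in>Basis. \<exists>\<rho>0. 0 < \<rho>0 & \<rho>0 \<le> 1 & (\<forall>w\<in>D. \<forall>\<rho>. 0 < \<rho> --> \<rho> \<le> \<rho>0 --> \<rho> ^ M \<le> norm (G w) --> bnd N (1/\<rho>) (dd b h) {w})"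
      using Suc.IH[OF mild_dd[OF D G Suc.prems]] by blast
    then obtain r2 where r2: "!!b. b \<in> Basis ==> 0 < r2 b" "!!b w \<rho>. b \<in> Basis ==> w\<in>D ==> 0 < \<rho> ==> \<rho> \<le> r2 b ==> \<rho> ^ M \<le> norm (G w) ==> bnd N (1/\<rho>) (dd b h) {w}"
      by metis
    define r0 where "r0 = Min (insert r1 (r2 ` Basis))"
    have "0 < r0" unfolding r0_def using r1 r2 by (subst Min_gr_iff) auto
    moreover have "r0 \<le> r1" "!!b. b \<in> Basis ==> r0 \<le> r2 b" unfolding r0_def by (intro Min_le; simp)+
    ultimately have "0 < r0 & r0 \<le> 1 & (\<forall>w\<in>D. \<forall>\<rho>. 0 < \<rho> --> \<rho> \<le> r0 --> \<rho> ^ M \<le> norm (G w) --> bnd (Suc N) (1/\<rho>) h {w})"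
      using r1 r2(2) order_trans[of _ r0] by (simp del: divide_le_eq_1 le_divide_eq_1) (meson order_trans)
    then show ?case by blast
  }
qed

section \<open>Taylor polynomials and their remainders\<close>

text \<open>The j-th derivative of \<open>F\<close> at \<open>w\<close> evaluated on (u, ..., u),
  see \<open>hp_eq_it\<close>. The expansion in coordinates makes it visibly a polynomial in
  \<open>u\<close> whose coefficients are entries of the jet at \<open>w\<close>, so smoothness and
  bounds in \<open>u\<close> need no regularity of \<open>F\<close> away from
  \<open>w\<close>.\<close>

fun hp :: "nat => ('a::euclidean_space => complex) => 'a => 'a => complex" where
  "hp 0 F w u = F w"
| "hp (Suc j) F w u = (\<Sum>b\<in>Basis. of_real (u \<bullet> b) * hp j (dd b F) w u)"

lemma hp_eq_it:
  assumes D: "open D" "w \<in> D"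
  shows "smooth_on D F ==> hp j F w u = (dd u ^^ j) F w"
proof (induction j arbitrary: F)
  case (Suc j)
  have s: "smooth_on D (dd b F)" for b using smooth_on_dd[OF D(1) Suc.prems] .
  have "(dd u ^^ Suc j) F w = (dd u ^^ j) (dd u F) w" by (simp add: funpow_swap1)
  also have "... = (dd u ^^ j) (%x. \<Sum>b\<in>Basis. of_real (u \<bullet> b) * dd b F x) w"
    using dd_linear_basis[OF smooth_on_differentiable[OF D(1) Suc.prems], of _ u]
    by (intro it_cong[OF D(1) _ D(2)]) (simp add: scaleR_conv_of_real)
  also have "... = (\<Sum>b\<in>Basis. (dd u ^^ j) (%x. of_real (u \<bullet> b) * dd b F x) w)"
    by (intro it_sum[OF D] smooth_on_mult[OF D(1) smooth_on_const s]) auto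
  also have "... = hp (Suc j) F w u"
    using it_bounded_linear[OF D(1) s bounded_linear_mult_right D(2)] Suc.IH[OF s] by simp
  finally show ?case by simp
qed simp

lemma bounded_linear_of_real_inner: "bounded_linear (%u::'a::euclidean_space. of_real (u \<bullet> b) :: complex)"
  using bounded_linear_compose[OF bounded_linear_of_real bounded_linear_inner_left] .

lemma smooth_linear: "bounded_linear L ==> smooth_on UNIV L"
  using smooth_on_bounded_linear[OF open_UNIV _ smooth_on_id, of L] by auto

lemma dd_linear: "bounded_linear L ==> dd v L x = L v"
  using dd_eq[OF bounded_linear_imp_has_derivative] .

lemma bnd_linear:
  assumes L: "bounded_linear L" and "!!x. x \<in> W ==> norm (L x) \<le> B" "!!b. b \<in> Basis ==> norm (L b) \<le> B"
  shows "bnd k B L W"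
proof (cases k)
  case (Suc j)
  have "bnd j B (dd b L) W" if "b \<in> Basis" for b
    using bnd_const[OF assms(3)[OF that], of j W] dd_linear[OF L, of b] by (metis ext)
  then show ?thesis using assms Suc by auto
qed (use assms in auto)

lemma hp_smooth: "smooth_on UNIV (hp j F w)"
proof (induction j arbitrary: F)
  case 0 show ?case by (rule smooth_on_cong[OF open_UNIV smooth_on_const[of UNIV "F w"]]) simp
next
  case (Suc j)
  have "smooth_on UNIV (%u. \<Sum>b\<in>Basis. of_real (u \<bullet> b) * hp j (dd b F) w u)"
    by (intro smooth_on_sum[OF open_UNIV] smooth_on_mult[OF open_UNIV smooth_linear[OF bounded_linear_of_real_inner] Suc.IH])
  then show ?case by (rule smooth_on_cong[OF open_UNIV]) simp
qed

lemma hp_bnd: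
  "\<exists>c\<ge>0. \<forall>(F::'a::euclidean_space => complex) w B. 0 \<le> B --> bnd j B F {w} --> bnd k (c * B) (hp j F w) (ball 0 2)"
proof (induction j)
  case 0
  show ?case
  proof (intro exI[of _ 1] conjI allI impI)
    fix F :: "'a => complex" and w B assume "bnd 0 B F {w}"
    then have "bnd k (1 * B) (%u. F w) (ball 0 2)" by (intro bnd_const) simp
    then show "bnd k (1 * B) (hp 0 F w) (ball 0 2)" by (rule bnd_cong[OF open_UNIV subset_UNIV]) simp
  qed simp
next
  case (Suc j)
  then obtain c where c: "c \<ge> 0" "!!(F::'a => complex) w B. 0 \<le> B ==> bnd j B F {w} ==> bnd k (c * B) (hp j F w) (ball 0 2)" by blast
  show ?case
  proof (intro exI[of _ "DIM('a) * (2 ^ k * (2 * c))"] conjI allI impI)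
    fix F :: "'a => complex" and w B assume B: "0 \<le> B" "bnd (Suc j) B F {w}"
    have l: "bnd k 2 (%u::'a. of_real (u \<bullet> b) :: complex) (ball 0 2)" if "b \<in> Basis" for b
    proof (rule bnd_linear[OF bounded_linear_of_real_inner])
      fix x :: 'a assume "x \<in> ball 0 2"
      then show "cmod (of_real (x \<bullet> b)) \<le> 2" using Basis_le_norm[OF that, of x] by simp
    next
      fix b' :: 'a assume "b' \<in> Basis"
      then show "cmod (of_real (b' \<bullet> b)) \<le> 2" using that by (simp add: inner_Basis)
    qed
    have "bnd k (\<Sum>b\<in>(Basis::'a set). 2 ^ k * (2 * (c * B))) (%u. \<Sum>b\<in>Basis. of_real (u \<bullet> b) * hp j (dd b F) w u) (ball 0 2)"
      by (intro bnd_sum[OF open_UNIV subset_UNIV] bnd_mult[OF open_UNIV subset_UNIV l c(2)]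
           smooth_on_mult[OF open_UNIV] smooth_linear[OF bounded_linear_of_real_inner] hp_smooth) (use B c in auto)
    then have "bnd k (real DIM('a) * (2 ^ k * (2 * c)) * B) (%u. \<Sum>b\<in>Basis. of_real (u \<bullet> b) * hp j (dd b F) w u) (ball 0 2)"
      by (simp add: mult_ac)
    then show "bnd k (real DIM('a) * (2 ^ k * (2 * c)) * B) (hp (Suc j) F w) (ball 0 2)"
      by (rule bnd_cong[OF open_UNIV subset_UNIV]) simp
  qed (use c in auto)
qed

lemma bnd_translate: "smooth_on UNIV F ==> bnd k B F W ==> bnd k B (%z. F (z + c)) {z. z + c \<in> W}"
proof (induction k arbitrary: F)
  case (Suc k)
  have "dd b (%z. F (z + c)) = (%z. dd b F (z + c))" for b
    using dd_affine(1)[OF bounded_linear_ident smooth_on_differentiable[OF open_UNIV Suc.prems(1)], where v=b and c=c] by auto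
  then show ?case using Suc.prems Suc.IH[OF smooth_on_dd[OF open_UNIV Suc.prems(1)]] by auto
qed auto

definition taylor_poly :: "nat => ('a::euclidean_space => complex) => 'a => 'a => complex" where
  "taylor_poly N F w z = (\<Sum>j\<le>N. of_real (1 / fact j) * hp j F w (z + - w))"

lemma taylor_poly_term_smooth: "smooth_on UNIV (%z. of_real (1 / fact j) * hp j F w (z + - w))"
  by (intro smooth_on_mult[OF open_UNIV smooth_on_const] smooth_on_affine[OF open_UNIV open_UNIV bounded_linear_ident _ hp_smooth]) auto

lemma taylor_poly_smooth: "smooth_on UNIV (taylor_poly N F w)"
  by (rule smooth_on_cong[OF open_UNIV smooth_on_sum[OF open_UNIV taylor_poly_term_smooth]]) (auto simp: taylor_poly_def)

lemma taylor_poly_bnd: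
  "\<exists>c\<ge>0. \<forall>(F::'a::euclidean_space => complex) w B. 0 \<le> B --> bnd N B F {w} --> bnd k (c * B) (taylor_poly N F w) (ball w 2)"
proof -
  have "\<forall>j. \<exists>c. c \<ge> 0 & (\<forall>(F::'a => complex) w B. 0 \<le> B --> bnd j B F {w} --> bnd k (c * B) (hp j F w) (ball 0 2))"
    by (intro allI hp_bnd)
  from choice[OF this] obtain c where c0: "\<forall>j. c j \<ge> 0 & (\<forall>(F::'a => complex) w B. 0 \<le> B --> bnd j B F {w} --> bnd k (c j * B) (hp j F w) (ball 0 2))" ..
  have c: "c j \<ge> 0" "0 \<le> B ==> bnd j B F {w} ==> bnd k (c j * B) (hp j F w) (ball 0 2)" for j and F :: "'a => complex" and w B
    using c0 by simp_all
  show ?thesis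
  proof (intro exI[of _ "\<Sum>j\<le>N. c j"] conjI allI impI)
    fix F :: "'a => complex" and w B assume B: "0 \<le> B" "bnd N B F {w}"
    have "bnd k (c j * B) (%z. of_real (1 / fact j) * hp j F w (z + - w)) (ball w 2)" if "j \<le> N" for j
    proof -
      have s: "smooth_on UNIV (%z. hp j F w (z + - w))"
        by (intro smooth_on_affine[OF open_UNIV open_UNIV bounded_linear_ident _ hp_smooth]) auto
      have "bnd k (c j * B) (hp j F w) (ball 0 2)" using c(2)[OF B(1) bnd_le[OF B(2) that]] .
      from bnd_translate[OF hp_smooth this, of "-w"]
      have "bnd k (c j * B) (%z. hp j F w (z + - w)) (ball w 2)"
        by (rule bnd_subset) (auto simp: dist_norm norm_minus_commute)
      from bnd_bounded_linear[OF open_UNIV subset_UNIV bounded_linear_mult_right[of "of_real (1 / fact j)"] _ _ this s, of 1]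
      show ?thesis by (simp add: norm_mult norm_divide divide_le_eq mult_le_cancel_left1)
    qed
    then have "bnd k (\<Sum>j\<le>N. c j * B) (%z. \<Sum>j\<le>N. of_real (1 / fact j) * hp j F w (z + - w)) (ball w 2)"
      by (intro bnd_sum[OF open_UNIV subset_UNIV] taylor_poly_term_smooth) auto
    then show "bnd k ((\<Sum>j\<le>N. c j) * B) (taylor_poly N F w) (ball w 2)"
      unfolding sum_distrib_right by (rule bnd_cong[OF open_UNIV subset_UNIV]) (simp add: taylor_poly_def)
  qed (simp add: c sum_nonneg)
qed

lemma open_line_preimage:
  fixes v w :: "'a::real_normed_vector"
  assumes "open S" shows "open {t::real. t *\<^sub>R v + w \<in> S}"
proof -
  have "open ((%t::real. t *\<^sub>R v + w) -` S)" by (rule open_vimage[OF assms]) (intro continuous_intros)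
  then show ?thesis by (simp add: vimage_def)
qed

lemma bnd_line:
  fixes F :: "'a::euclidean_space => complex" and B :: real
  assumes V: "open V" "W \<subseteq> V" and v: "norm v \<le> 1" and B: "0 \<le> B"
  shows "smooth_on V F ==> bnd k B F W ==> bnd k (real DIM('a) ^ k * B) (%t::real. F (t *\<^sub>R v + w)) {t. t *\<^sub>R v + w \<in> W}"
proof (induction k arbitrary: F)
  case 0 then show ?case by auto
next
  case (Suc k)
  let ?W = "{t::real. t *\<^sub>R v + w \<in> W}" and ?V = "{t::real. t *\<^sub>R v + w \<in> V}"
  have oV: "open ?V" using open_line_preimage[OF V(1)] .
  have bl: "bounded_linear (%t::real. t *\<^sub>R v)" by (rule bounded_linear_scaleR_left)
  have "bnd k (real DIM('a) ^ Suc k * B) (dd 1 (%t. F (t *\<^sub>R v + w))) ?W"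
  proof (rule bnd_cong[OF oV])
    have t1: "bnd k (real DIM('a) ^ k * B) (%t::real. of_real (v \<bullet> b) * dd b F (t *\<^sub>R v + w)) ?W"
      and t2: "smooth_on ?V (%t::real. of_real (v \<bullet> b) * dd b F (t *\<^sub>R v + w))" if "b \<in> Basis" for b
    proof -
      have s: "smooth_on ?V (%t::real. dd b F (t *\<^sub>R v + w))"
        by (rule smooth_on_affine[OF V(1) oV bl _ smooth_on_dd[OF V(1) Suc.prems(1)]]) auto
      then show "smooth_on ?V (%t::real. of_real (v \<bullet> b) * dd b F (t *\<^sub>R v + w))"
        by (rule smooth_on_mult[OF oV smooth_on_const])
      have 1: "\<bar>v \<bullet> b\<bar> \<le> 1" using Basis_le_norm[OF that, of v] v by linarith
      have "bnd k (real DIM('a) ^ k * B) (%t::real. dd b F (t *\<^sub>R v + w)) ?W"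
        using Suc.IH[OF smooth_on_dd[OF V(1) Suc.prems(1)]] Suc.prems(2) that by auto
      from bnd_bounded_linear[OF oV _ bounded_linear_mult_right _ _ this s, of "of_real (v \<bullet> b)" 1]
      show "bnd k (real DIM('a) ^ k * B) (%t::real. of_real (v \<bullet> b) * dd b F (t *\<^sub>R v + w)) ?W"
        using V(2) 1 by (auto simp: norm_mult mult_left_le_one_le)
    qed
    have "bnd k (\<Sum>b\<in>(Basis::'a set). real DIM('a) ^ k * B) (%t::real. \<Sum>b\<in>Basis. of_real (v \<bullet> b) * dd b F (t *\<^sub>R v + w)) ?W"
      by (rule bnd_sum[OF oV _ finite_Basis t1 t2]) (use V(2) in auto)
    then show "bnd k (real DIM('a) ^ Suc k * B) (%t::real. \<Sum>b\<in>Basis. of_real (v \<bullet> b) * dd b F (t *\<^sub>R v + w)) ?W"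
      by (simp add: mult_ac)
    show "(\<Sum>b\<in>Basis. of_real (v \<bullet> b) * dd b F (t *\<^sub>R v + w)) = dd 1 (%t. F (t *\<^sub>R v + w)) t" if "t \<in> ?V" for t
      using that dd_affine(1)[OF bl, of F t w 1] dd_linear_basis[of F "t *\<^sub>R v + w" v] smooth_on_differentiable[OF V(1) Suc.prems(1)]
      by (simp add: scaleR_conv_of_real)
  qed (use V in auto)
  moreover have "norm (F (t *\<^sub>R v + w)) \<le> real DIM('a) ^ Suc k * B" if "t \<in> ?W" for t
  proof -
    have "norm (F (t *\<^sub>R v + w)) \<le> B" using bnd_norm[OF Suc.prems(2)] that by auto
    also have "... \<le> real DIM('a) ^ Suc k * B"
      using B one_le_power[of "real DIM('a)" "Suc k"] mult_right_mono[of 1 "real DIM('a) ^ Suc k" B] by (auto simp: DIM_ge_Suc0 Suc_leI)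
    finally show ?thesis .
  qed
  ultimately show ?case by auto
qed

lemma it_line:
  fixes F :: "'a::real_normed_vector => complex"
  assumes V: "open V" and F: "smooth_on V F"
  shows "t *\<^sub>R v + w \<in> V ==> (dd 1 ^^ j) (%t::real. F (t *\<^sub>R v + w)) t = (dd v ^^ j) F (t *\<^sub>R v + w)"
proof (induction j arbitrary: t)
  case (Suc j)
  let ?V = "{t::real. t *\<^sub>R v + w \<in> V}"
  have oV: "open ?V" using open_line_preimage[OF V(1)] .
  have "(dd 1 ^^ Suc j) (%t::real. F (t *\<^sub>R v + w)) t = dd 1 (%t. (dd v ^^ j) F (t *\<^sub>R v + w)) t"
    using dd_cong[OF oV, of t "(dd 1 ^^ j) (%t::real. F (t *\<^sub>R v + w))" "%t. (dd v ^^ j) F (t *\<^sub>R v + w)" 1] Suc by auto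
  also have "... = dd v ((dd v ^^ j) F) (t *\<^sub>R v + w)"
    using dd_affine(1)[OF bounded_linear_scaleR_left[of v], of "(dd v ^^ j) F" t w 1]
       smooth_on_differentiable[OF V it_smooth[OF V F]] Suc.prems by auto
  finally show ?case by simp
qed simp

lemma bnd_jet_real:
  fixes u :: "real => complex"
  shows "(!!j. j \<le> N ==> (dd 1 ^^ j) u t = 0) ==> bnd N 0 u {t}"
proof (induction N arbitrary: u)
  case 0 then show ?case by (metis bnd.simps(1) funpow_0 le_refl norm_zero order_refl singletonD)
next
  case (Suc N)
  have "bnd N 0 (dd 1 u) {t}"
    by (rule Suc.IH) (use Suc.prems in \<open>metis Suc_le_mono comp_apply funpow_Suc_right\<close>)
  moreover have "u t = 0" using Suc.prems[of 0] by simp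
  ultimately show ?case by simp
qed

text \<open>The polynomial in one variable whose i-th derivative at 0 is \<open>c i\<close>.
  Restrictions of \<open>taylor_poly\<close> to lines through \<open>w\<close> have this
  form.\<close>

definition tp :: "nat => (nat => complex) => real => complex" where
  "tp N c t = (\<Sum>j\<le>N. of_real (t ^ j / fact j) * c j)"

lemma tp_has_derivative:
  "(tp N c has_derivative (%s. of_real s * (case N of 0 => 0 | Suc M => tp M (%j. c (Suc j)) t))) (at t)"
proof -
  have d: "((%t. of_real (t ^ j / fact j) * c j) has_derivative
        (%s. of_real s * (of_real (case j of 0 => 0 | Suc i => t ^ i / fact i) * c j))) (at t)" for j
  proof -
    have "((%t::real. t ^ j / fact j) has_derivative (%s. s * (case j of 0 => 0 | Suc i => t ^ i / fact i))) (at t)"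
    proof (cases j)
      case (Suc i)
      have "((%t::real. t ^ Suc i / fact (Suc i)) has_real_derivative (t ^ i / fact i)) (at t)"
        by (rule derivative_eq_intros refl)+ (simp_all add: divide_simps del: of_nat_Suc)
      then have "((%t::real. t ^ Suc i / fact (Suc i)) has_derivative (%s. s * (t ^ i / fact i))) (at t)"
        unfolding has_field_derivative_def by (metis (no_types, lifting) ext mult.commute)
      then show ?thesis unfolding Suc nat.case .
    qed simp
    from bounded_linear.has_derivative[OF bounded_linear_compose[OF bounded_linear_mult_left[of "c j"] bounded_linear_of_real] this]
    show ?thesis by (simp add: mult_ac)
  qed
  have "(tp N c has_derivative (%s. \<Sum>j\<le>N. of_real s * (of_real (case j of 0 => 0 | Suc i => t ^ i / fact i) * c j))) (at t)"
    unfolding tp_def[abs_def] by (intro has_derivative_sum d)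
  moreover have "(\<Sum>j\<le>N. of_real (case j of 0 => 0 | Suc i => t ^ i / fact i) * c j) = (case N of 0 => 0 | Suc M => tp M (%j. c (Suc j)) t)"
    by (cases N) (simp_all add: tp_def sum.atMost_Suc_shift del: sum.atMost_Suc)
  ultimately show ?thesis by (simp add: sum_distrib_left[symmetric])
qed

lemma it_tp: "i \<le> N ==> (dd 1 ^^ i) (tp N c) 0 = c i"
proof (induction i arbitrary: N c)
  case 0 then show ?case
    by (simp add: tp_def power_0_left if_distrib[of "%x. x / _"] if_distrib[of of_real] if_distrib[of "%x. x * _"] sum.delta cong: if_cong)
next
  case (Suc i)
  then obtain M where M: "N = Suc M" by (cases N) auto
  have "dd 1 (tp N c) = tp M (%j. c (Suc j))"
    using dd_eq[OF tp_has_derivative[of N c]] M by (auto simp: fun_eq_iff)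
  then show ?case using Suc M by (simp add: funpow_swap1)
qed

lemma hp_homogeneous: "hp j F w (t *\<^sub>R u) = of_real (t ^ j) * hp j F w u"
  by (induction j arbitrary: F) (auto simp: sum_distrib_left mult_ac)

lemma taylor_poly_line:
  assumes "open D" "w \<in> D" "smooth_on D F"
  shows "taylor_poly N F w (t *\<^sub>R v + w) = tp N (%j. (dd v ^^ j) F w) t"
  unfolding taylor_poly_def tp_def
  by (intro sum.cong) (auto simp: hp_homogeneous hp_eq_it[OF assms])

text \<open>Near \<open>w\<close> the smooth function \<open>U\<close> is a multiple of the Taylor
  error of \<open>F\<close>, so its N-jet at \<open>w\<close> vanishes along every line. Hence
  \<open>U\<close> is small on the whole ball, by the derivatives of \<open>U\<close> alone: beyond
  a neighbourhood of \<open>w\<close> nothing about \<open>F\<close> is used.\<close>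

lemma taylor_poly_algebraic_remainder:
  fixes F :: "'a::euclidean_space => complex" and \<Phi> :: "complex => 'a => complex"
  assumes D: "open D" "w \<in> D" "smooth_on D F" and V: "open V" "ball w R \<subseteq> V" and R: "0 < R" "R \<le> 1/2"
    and U: "smooth_on V U" "bnd N B U (ball w R)" and B: "0 \<le> B"
    and e: "!!z. z \<in> D \<inter> ball w R ==> U z = (taylor_poly N F w z - F z) * E z" and E: "smooth_on D E"
    and z: "z \<in> ball w R"
  shows "norm (U z) \<le> real DIM('a) ^ N * B * R ^ N"
proof (cases "z = w")
  case True
  have "taylor_poly N F w w = F w" using taylor_poly_line[OF D, of N 0 0] 
    it_tp[of 0 N "%j. (dd (0::'a) ^^ j) F w"] by simp
  then show ?thesis using e[of z] True D R B by simp
next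
  case False
  define t where "t = norm (z - w)"
  define v where "v = (1 / t) *\<^sub>R (z - w)"
  have t: "0 < t" "t < R" using False z by (auto simp: t_def dist_norm norm_minus_commute)
  have v: "norm v = 1" using t by (simp add: v_def t_def)
  have zt: "z = t *\<^sub>R v + w" using t by (simp add: v_def)
  let ?u = "%t::real. U (t *\<^sub>R v + w)"
  let ?V = "{t::real. t *\<^sub>R v + w \<in> V}"
  let ?J = "{t::real. t *\<^sub>R v + w \<in> D \<inter> ball w R}"
  have o: "open {t::real. t *\<^sub>R v + w \<in> S}" if "open S" for S
    using open_line_preimage[OF that] .
  have bl: "bounded_linear (%t::real. t *\<^sub>R v)" by (rule bounded_linear_scaleR_left)
  have us: "smooth_on ?V ?u" by (rule smooth_on_affine[OF V(1) o[OF V(1)] bl _ U(1)]) auto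
  have sub: "ball 0 R \<subseteq> {t::real. t *\<^sub>R v + w \<in> ball w R}" using v by (auto simp: dist_norm)
  have subV: "ball 0 R \<subseteq> ?V" using sub V(2) by blast
  have ub: "bnd N (real DIM('a) ^ N * B) ?u (ball 0 R)"
    using bnd_subset[OF bnd_line[OF V _ B U] sub] v by simp
  have oD: "open (D \<inter> ball w R)" using D by auto
  have oJ: "open ?J" using o[OF oD] .
  have J0: "0 \<in> ?J" using D R by simp
  let ?f = "%t::real. F (t *\<^sub>R v + w)" and ?q = "%t::real. taylor_poly N F w (t *\<^sub>R v + w)" and ?E = "%t::real. E (t *\<^sub>R v + w)"
  have s: "smooth_on ?J ?f" "smooth_on ?J ?E" "smooth_on ?J ?q"
    using smooth_on_affine[OF D(1) oJ bl _ D(3), of w] smooth_on_affine[OF D(1) oJ bl _ E, of w]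
      smooth_on_affine[OF open_UNIV oJ bl _ taylor_poly_smooth, of w N F w] by auto
  \<comment> \<open>Along the line the Taylor polynomial has the same first \<open>N\<close>
    derivatives at 0 as \<open>F\<close>. A function with zero N-jet keeps it after multiplication
    by \<open>E\<close>, and near 0 this product is \<open>U\<close>.\<close>
  have d0: "bnd N 0 (%t. ?q t - ?f t) {0}"
  proof (rule bnd_jet_real)
    fix j assume j: "j \<le> N"
    have "(dd 1 ^^ j) (%t. ?q t + - ?f t) 0 = (dd 1 ^^ j) ?q 0 + (dd 1 ^^ j) (%t. - ?f t) 0"
      by (rule it_add[OF oJ s(3) smooth_on_minus[OF oJ s(1)] J0])
    moreover have "(dd 1 ^^ j) (%t. - ?f t) 0 = - (dd 1 ^^ j) ?f 0"
      by (rule it_bounded_linear[OF oJ s(1) bounded_linear_minus[OF bounded_linear_ident] J0])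
    moreover have "(dd 1 ^^ j) ?f 0 = (dd v ^^ j) F w" using it_line[OF D(1,3), of 0 v w j] D by simp
    moreover have "(dd 1 ^^ j) ?q 0 = (dd v ^^ j) F w"
      using it_tp[OF j, of "%j. (dd v ^^ j) F w"] taylor_poly_line[OF D, of N _ v] by (simp add: tp_def[abs_def])
    ultimately show "(dd 1 ^^ j) (%t. ?q t - ?f t) 0 = 0" by simp
  qed
  obtain BE where BE: "BE \<ge> 0" "bnd N BE ?E {0}" using bnd_compact[OF oJ _ _ s(2), of "{0}" N] J0 by auto
  have "bnd N (2 ^ N * (0 * BE)) (%t. (?q t - ?f t) * ?E t) {0}"
    by (rule bnd_mult[OF oJ _ d0 BE(2) smooth_on_diff[OF oJ s(3,1)] s(2)]) (use J0 BE in auto)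
  then have "bnd N 0 (%t. (?q t - ?f t) * ?E t) {0}" by simp
  then have u0: "bnd N 0 ?u {0}" by (rule bnd_cong[OF oJ, rotated]) (use J0 e in auto)
  have "bnd 0 (2 * 0 + real DIM('a) ^ N * B * (real DIM(real) * R) ^ N) ?u (ball 0 R)"
    by (rule bnd_from_jets[OF o[OF V(1)] subV R(1) us]) (use R ub u0 in auto)
  then show ?thesis using t unfolding zt by (auto simp: dist_norm)
qed

section \<open>Approximation of the root f at every scale\<close>

lemma power_add_le:
  fixes x y :: real
  assumes "0 \<le> x" "0 \<le> y" "m \<ge> 1"
  shows "x ^ m + y ^ m \<le> (x + y) ^ m"
  using assms(3)
proof (induction m rule: dec_induct)
  case (step n)
  have "x ^ Suc n + y ^ Suc n \<le> (x ^ n + y ^ n) * (x + y)" using assms by (simp add: algebra_simps)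
  also have "... \<le> (x + y) ^ n * (x + y)" using step assms by (intro mult_right_mono) auto
  finally show ?case by (simp add: mult.commute)
qed simp

text \<open>If |G| \<le> \<eta>^(1/2), the growth condition makes \<open>f\<close> small, then
  \<open>f ^ m\<close>, and then \<open>q\<close>, because \<open>q ^ m\<close> is \<eta>-close to
  \<open>f ^ m\<close>. If |G| is larger, divide \<open>q * G - H = (q - f) * G\<close> by
  \<open>G\<close>. Without the growth condition the first case would determine \<open>f\<close>
  only up to an m-th root of unity.\<close>

lemma root_choice:
  fixes f q P G H :: complex
  assumes m: "m \<ge> 1" and eqs: "f ^ m = P" "f * G = H" and fG: "norm f \<le> C * norm G powr \<alpha>" and C: "C > 0" and \<alpha>: "\<alpha> > 0"
    and e: "0 < \<eta>" "\<eta> \<le> 1" and q: "norm (q ^ m - P) \<le> \<eta>" "norm (q * G - H) \<le> \<eta>"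
  shows "norm (f - q) \<le> (2 * C + 2) * \<eta> powr (min (\<alpha>/2) (1 / (2 * real m)))"
proof -
  define \<gamma> where "\<gamma> = min (\<alpha>/2) (1 / (2 * real m))"
  have mono: "\<eta> powr b \<le> \<eta> powr \<gamma>" if "\<gamma> \<le> b" for b using powr_mono'[OF that] e by simp
  show ?thesis
  proof (cases "norm G \<le> \<eta> powr (1/2)")
    case True
    have "norm f \<le> C * (\<eta> powr (1/2)) powr \<alpha>" using fG C \<alpha> True
      by (meson mult_left_mono powr_mono2 norm_ge_zero less_imp_le order_trans)
    then have f: "norm f \<le> C * \<eta> powr (\<alpha>/2)" by (simp add: powr_powr)
    have "norm q ^ m \<le> norm f ^ m + \<eta>"
      using norm_triangle_ineq2[of "q ^ m" "f ^ m"] q(1) unfolding eqs(1)[symmetric] by (simp add: norm_power)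
    also have "... = norm f ^ m + (\<eta> powr (1 / m)) ^ m" using e m by (simp add: powr_realpow[symmetric] powr_powr)
    also have "... \<le> (norm f + \<eta> powr (1/m)) ^ m"
      using m by (intro power_add_le) auto
    finally have "norm q \<le> norm f + \<eta> powr (1/m)" using m by (metis add_nonneg_nonneg le_numeral_extra(3) norm_ge_zero not_one_le_zero power_mono_iff powr_ge_zero zero_less_iff_neq_zero)
    then have "norm (f - q) \<le> 2 * norm f + \<eta> powr (1/m)" using norm_triangle_ineq4[of f q] by linarith
    also have "... \<le> 2 * (C * \<eta> powr \<gamma>) + \<eta> powr \<gamma>"
      using f mono[of "\<alpha>/2"] mono[of "1/m"] C m by (intro add_mono mult_left_mono order_trans[OF f]) (auto simp: \<gamma>_def min_def field_simps)
    also have "... \<le> (2 * C + 2) * \<eta> powr \<gamma>" by (simp add: algebra_simps)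
    finally show ?thesis unfolding \<gamma>_def .
  next
    case False
    then have G: "\<eta> powr (1/2) < norm G" by simp
    have "norm (f - q) * norm G = norm (q * G - H)" unfolding eqs(2)[symmetric]
      by (metis norm_minus_commute norm_mult left_diff_distrib)
    then have "norm (f - q) * \<eta> powr (1/2) \<le> \<eta>" using q(2) G by (smt (verit) mult_left_mono norm_ge_zero)
    also have "\<eta> = \<eta> powr (1/2) * \<eta> powr (1/2)" using e by (simp add: powr_add[symmetric])
    finally have "norm (f - q) \<le> \<eta> powr (1/2)" using e by simp
    also have "... \<le> \<eta> powr \<gamma>"
    proof (rule mono)
      have "1 / (2 * real m) \<le> 1/2" using m by (simp add: field_simps)
      then show "\<gamma> \<le> 1/2" unfolding \<gamma>_def by linarith
    qed
    also have "... \<le> (2 * C + 2) * \<eta> powr \<gamma>" using C by (simp add: algebra_simps)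
    finally show ?thesis unfolding \<gamma>_def .
  qed
qed


lemma bnd_power:
  fixes F :: "'a::euclidean_space => 'b::real_normed_algebra_1"
  assumes V: "open V" "W \<subseteq> V" and F: "bnd k A F W" "smooth_on V F" "0 \<le> A"
  shows "bnd k (2 ^ (k * m) * A ^ m) (%x. F x ^ m) W"
proof (induction m)
  case 0 show ?case using bnd_const[of "1::'b" 1 k W] by simp
next
  case (Suc m)
  have "bnd k (2 ^ k * (A * (2 ^ (k * m) * A ^ m))) (%x. F x * F x ^ m) W"
    by (rule bnd_mult[OF V F(1) Suc F(2) smooth_on_power[OF V(1) F(2)] F(3)]) (use F in auto)
  then show ?case by (simp add: power_add mult_ac)
qed

text \<open>\<open>G\<close>, \<open>H\<close> and \<open>P\<close> are local smooth extensions of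
  \<open>g\<close>, \<open>f g\<close> and \<open>f ^ m\<close>. The doubled radius makes their
  derivatives bounded on \<open>ball x0 r\<close> by compactness.\<close>

locale root_data =
  fixes X V :: "'a::euclidean_space set" and x0 :: 'a and r :: real and f G H P :: "'a => complex"
    and m :: nat and C \<alpha> :: real
  assumes r: "0 < r" and V: "open V" "ball x0 (2 * r) \<subseteq> V"
    and sm: "smooth_on V G" "smooth_on V H" "smooth_on V P"
    and fG: "!!x. x \<in> X \<inter> V ==> f x * G x = H x" and fm: "!!x. x \<in> X \<inter> V ==> f x ^ m = P x"
    and fle: "!!x. x \<in> X \<inter> V ==> norm (f x) \<le> C * norm (G x) powr \<alpha>"
    and m: "m \<ge> 1" and C: "C > 0" and \<alpha>: "\<alpha> > 0" and X: "X = closure (interior X)"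
begin

definition D where "D = {w \<in> interior X \<inter> ball x0 r. G w ~= 0}"

lemma ball_V: "ball x0 r \<subseteq> V"
  using order_trans[OF subset_ball V(2)] r by simp

lemma D_subset: "D \<subseteq> X \<inter> V" "D \<subseteq> ball x0 r" using interior_subset ball_V by (auto simp: D_def)

lemma open_D: "open D"
proof -
  have "continuous_on (interior X \<inter> ball x0 r) G"
    using smooth_on_continuous[OF V(1) sm(1)] ball_V continuous_on_subset by blast
  then have "open ((interior X \<inter> ball x0 r) \<inter> G -` (- {0}))"
    by (intro continuous_open_preimage) auto
  moreover have "D = (interior X \<inter> ball x0 r) \<inter> G -` (- {0})" unfolding D_def by auto
  ultimately show ?thesis by simp
qed

lemma G_D: "smooth_on D G" using smooth_on_subset[OF sm(1)] D_subset by blast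

lemma f_D: "smooth_on D f"
proof (rule smooth_on_cong[OF open_D, of "%x. H x * inverse (G x)"])
  show "smooth_on D (%x. H x * inverse (G x))"
    using D_subset by (intro smooth_on_mult[OF open_D] smooth_on_inverse[OF open_D G_D] smooth_on_subset[OF sm(2)]) (auto simp: D_def)
  show "H y * inverse (G y) = f y" if "y \<in> D" for y
  proof -
    have "y \<in> X \<inter> V" using that D_subset by blast
    from fG[OF this] have "f y * G y = H y" "G y ~= 0" using that by (auto simp: D_def)
    then show ?thesis by (auto simp: field_simps)
  qed
qed

lemma bounds: assumes "smooth_on V F" shows "\<exists>B\<ge>0. bnd k B F (ball x0 r)"
proof -
  have "Elementary_Metric_Spaces.cball x0 r \<subseteq> ball x0 (2 * r)" using r by auto
  then have "Elementary_Metric_Spaces.cball x0 r \<subseteq> V" using V(2) by (rule order_trans)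
  from bnd_compact[OF V(1) compact_cball this assms, of k]
  obtain B where "B \<ge> 0" "bnd k B F (Elementary_Metric_Spaces.cball x0 r)" by auto
  then show ?thesis using bnd_subset[OF _ ball_subset_cball] by (intro exI[of _ B]) auto
qed

text \<open>Divide \<open>n\<close> by \<open>m\<close>: the quotient turns powers of
  \<open>f\<close> into powers of \<open>P\<close>, and the remainder, at most \<open>m - 1\<close>,
  is paid by factors \<open>G\<close>, each changing an \<open>f\<close> into an \<open>H\<close>.
  So \<open>f ^ n * G ^ (m - 1)\<close> is the restriction of a function smooth on all of
  \<open>V\<close>.\<close>

lemma f_mild: "mild D G (m - 1) f"
  unfolding mild_def
proof (intro conjI allI f_D)
  fix n k
  let ?F = "%x. P x ^ (n div m) * (H x ^ (n mod m) * G x ^ (m - 1 - n mod m))"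
  have "smooth_on V ?F" by (intro smooth_on_mult[OF V(1)] smooth_on_power[OF V(1)] sm)
  from bounds[OF this, of k] obtain B where B: "B \<ge> 0" "bnd k B ?F (ball x0 r)" by auto
  have BD: "bnd k B ?F D" by (rule bnd_subset[OF B(2) D_subset(2)])
  have "?F x = f x ^ n * G x ^ (m - 1)" if "x \<in> D" for x
  proof -
    have x: "x \<in> X \<inter> V" using that D_subset by blast
    have "n mod m \<le> m - 1" using m by (metis Suc_pred' less_Suc_eq_le mod_less_divisor less_le_trans zero_less_one)
    then have "G x ^ (m - 1) = G x ^ (n mod m) * G x ^ (m - 1 - n mod m)" by (metis le_add_diff_inverse power_add)
    moreover have "f x ^ n = (f x ^ m) ^ (n div m) * f x ^ (n mod m)"
      by (metis power_add power_mult mult_div_mod_eq)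
    ultimately show ?thesis unfolding fm[OF x, symmetric] fG[OF x, symmetric] by (simp add: power_mult_distrib mult_ac)
  qed
  then have "bnd k B (%x. f x ^ n * G x ^ (m - 1)) D" by (rule bnd_cong[OF open_D order_refl BD])
  then show "\<exists>B\<ge>0. bnd k B (%x. f x ^ n * G x ^ (m - 1)) D" using B by blast
qed

text \<open>Either some interior point \<open>w\<close> of the \<rho>-ball has |G| at least
  \<rho>^M, and then the Taylor polynomial of \<open>f\<close> at \<open>w\<close> serves, or |G| is
  below \<rho>^M throughout and 0 serves. The approximant is a smooth function on the whole space,
  as it will be multiplied by cut-off functions.\<close>

lemma approx:
  "\<exists>\<rho>0>0. \<forall>x\<in>X \<inter> ball x0 (r/2). \<forall>\<rho>. 0 < \<rho> --> \<rho> < \<rho>0 -->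
     (\<exists>q. smooth_on UNIV q & (\<forall>y\<in>X \<inter> ball x \<rho>. norm (f y - q y) \<le> \<rho> ^ k) & bnd K (1 / \<rho>\<^sup>2) q (ball x \<rho>))"
proof -
  define \<gamma> where "\<gamma> = min (\<alpha>/2) (1 / (2 * real m))"
  have \<gamma>: "\<gamma> > 0" using \<alpha> m by (auto simp: \<gamma>_def)
  \<comment> \<open>\<open>N'\<close> and \<open>M\<close> yield the power \<open>k + 1\<close> of
    \<rho> in the two cases, one more than claimed; the spare factor \<rho> absorbs the
    constants.\<close>
  obtain N' :: nat where "(k + 1) / \<gamma> < N'" using reals_Archimedean2 by blast
  then have N': "real k + 1 \<le> real N' * \<gamma>" using \<gamma> by (simp add: field_simps)
  obtain M :: nat where "(k + 1) / \<alpha> < M" using reals_Archimedean2 by blast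
  then have M: "real k + 1 \<le> real M * \<alpha>" using \<alpha> by (simp add: field_simps)
  \<comment> \<open>The order of the Taylor polynomial: \<open>m\<close> compensates the growth
    \<open>1 / \<rho> ^ m\<close> of the derivatives of \<open>q ^ m - P\<close>, the 1 absorbs
    constants, and \<open>K\<close> lets the jet bound control \<open>K\<close> derivatives of
    \<open>q\<close>.\<close>
  define N where "N = N' + m + 1 + K"
  obtain cT where cT: "cT \<ge> 0" "!!(F::'a => complex) w B. 0 \<le> B ==> bnd N B F {w} ==> bnd N (cT * B) (taylor_poly N F w) (ball w 2)"
    using taylor_poly_bnd[of N N, where 'a='a] by auto
  obtain BG BH BP where B: "BG \<ge> 0" "bnd N BG G (ball x0 r)" "BH \<ge> 0" "bnd N BH H (ball x0 r)" "BP \<ge> 0" "bnd N BP P (ball x0 r)"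
    using bounds[OF sm(1), of N] bounds[OF sm(2), of N] bounds[OF sm(3), of N] by auto
  define c where "c = 2 ^ (N * m) * cT ^ m + BP + 2 ^ N * (cT * BG) + BH"
  have c: "c \<ge> 0" using B cT by (simp add: c_def)
  from mild_jet_bound[OF open_D G_D f_mild, of M N] obtain \<rho>1 where \<rho>1: "0 < \<rho>1" "\<rho>1 \<le> 1"
    "!!w \<rho>. w \<in> D ==> 0 < \<rho> ==> \<rho> \<le> \<rho>1 ==> \<rho> ^ M \<le> norm (G w) ==> bnd N (1/\<rho>) f {w}" by blast
  define Q where "Q = 4 + 2 * C + real DIM('a) ^ N * c * 2 ^ N + cT"
  have Q: "Q \<ge> 4" "2 * C + 2 \<le> Q" "real DIM('a) ^ N * c * 2 ^ N \<le> Q" "cT \<le> Q" "C \<le> Q" using C c cT by (auto simp: Q_def)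
  define \<rho>0 where "\<rho>0 = min \<rho>1 (min (r/8) (1/Q))"
  have "0 < \<rho>0" using \<rho>1 r Q by (auto simp: \<rho>0_def)
  moreover have "\<exists>q. smooth_on UNIV q & (\<forall>y\<in>X \<inter> ball x \<rho>. norm (f y - q y) \<le> \<rho> ^ k) & bnd K (1 / \<rho>\<^sup>2) q (ball x \<rho>)"
    if x: "x \<in> X \<inter> ball x0 (r/2)" and \<rho>: "0 < \<rho>" "\<rho> < \<rho>0" for x \<rho>
  proof -
    have \<rho>s: "\<rho> \<le> \<rho>1" "\<rho> < r/8" "Q * \<rho> \<le> 1" using \<rho> Q by (auto simp: \<rho>0_def field_simps)
    have \<rho>4: "\<rho> \<le> 1/4" using \<rho>s(3) Q(1) \<rho>(1) mult_right_mono[of 4 Q \<rho>] by linarith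
    have Qr: "a * \<rho> \<le> 1" if "a \<le> Q" for a using that \<rho>s(3) \<rho>(1) mult_right_mono[of a Q \<rho>] by linarith
    have sub: "ball x \<rho> \<subseteq> ball x0 r"
    proof
      fix y assume "y \<in> ball x \<rho>"
      then show "y \<in> ball x0 r" using x \<rho>s r dist_triangle[of x0 y x] by auto
    qed
    have sp: "a * b powr (s) \<le> \<rho> ^ k" if "0 \<le> a" "a \<le> Q" "b = \<rho> ^ n" "real k + 1 \<le> real n * s" for a b s n
    proof -
      have "b powr s = \<rho> powr (real n * s)" using \<rho> that by (simp add: powr_realpow[symmetric] powr_powr)
      also have "... \<le> \<rho> powr (real k + 1)" using that \<rho>4 \<rho> by (intro powr_mono') auto
      also have "... = \<rho> ^ k * \<rho>" using \<rho> by (simp add: powr_add powr_realpow)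
      finally have "a * b powr s \<le> a * (\<rho> ^ k * \<rho>)" using that by (intro mult_left_mono) auto
      also have "... = \<rho> ^ k * (a * \<rho>)" by simp
      also have "... \<le> \<rho> ^ k * 1" using Qr[OF that(2)] \<rho> by (intro mult_left_mono) auto
      finally show ?thesis by simp
    qed
    show ?thesis
    proof (cases "\<exists>w\<in>D \<inter> ball x \<rho>. \<rho> ^ M \<le> norm (G w)")
      case False
      \<comment> \<open>Points with large |G| form an open set, and the interior is dense in
        \<open>X\<close>, so a violation at a point of \<open>X\<close> would produce one in
        \<open>D\<close>.\<close>
      have G: "norm (G y) \<le> \<rho> ^ M" if y: "y \<in> X \<inter> ball x \<rho>" for y
      proof (rule ccontr)
        assume "\<not> ?thesis"
        then have gy: "\<rho> ^ M < norm (G y)" by simp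
        have "continuous_on (ball x \<rho>) (%y. norm (G y))"
          using smooth_on_continuous[OF V(1) sm(1)] sub ball_V by (intro continuous_on_norm) (meson continuous_on_subset order_trans)
        then have "open (ball x \<rho> \<inter> (%y. norm (G y)) -` {\<rho> ^ M<..})" by (intro continuous_open_preimage) auto
        moreover have "y \<in> ball x \<rho> \<inter> (%y. norm (G y)) -` {\<rho> ^ M<..}" "y \<in> closure (interior X)" using y gy X by auto
        ultimately obtain w where w: "w \<in> interior X" "w \<in> ball x \<rho>" "\<rho> ^ M < norm (G w)"
          using open_Int_closure_eq_empty[of "ball x \<rho> \<inter> (%y. norm (G y)) -` {\<rho> ^ M<..}" "interior X"] by auto
        then have "w \<in> D" using sub \<rho> unfolding D_def by (auto simp: not_less[symmetric])
        then show False using False w less_imp_le by blast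
      qed
      have "norm (f y - 0) \<le> \<rho> ^ k" if y: "y \<in> X \<inter> ball x \<rho>" for y
      proof -
        have "norm (f y) \<le> C * norm (G y) powr \<alpha>" using fle y sub ball_V by blast
        also have "... \<le> C * (\<rho> ^ M) powr \<alpha>" using G[OF y] C \<alpha> by (intro mult_left_mono powr_mono2) auto
        also have "... \<le> \<rho> ^ k" using sp[of C "\<rho> ^ M" M \<alpha>] C Q M by auto
        finally show ?thesis by simp
      qed
      then show ?thesis using \<rho> by (intro exI[of _ "%y. 0"]) (auto intro: smooth_on_const bnd_const)
    next
      case True
      then obtain w where w: "w \<in> D" "w \<in> ball x \<rho>" "\<rho> ^ M \<le> norm (G w)" by blast
      let ?q = "taylor_poly N f w"
      have q: "bnd N (cT * (1/\<rho>)) ?q (ball w 2)" using cT(2)[OF _ \<rho>1(3)[OF w(1) \<rho>(1) \<rho>s(1) w(3)]] \<rho> by simp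
      have A: "0 \<le> cT * (1/\<rho>)" using cT \<rho> by simp
      have sub2: "ball w (2 * \<rho>) \<subseteq> ball x0 r" "ball w (2 * \<rho>) \<subseteq> ball w 2" "ball x \<rho> \<subseteq> ball w (2 * \<rho>)"
      proof -
        show "ball w (2 * \<rho>) \<subseteq> ball x0 r"
        proof
          fix y assume "y \<in> ball w (2 * \<rho>)"
          then show "y \<in> ball x0 r" using x w \<rho>s r dist_triangle[of x0 y x] dist_triangle[of x y w] by auto
        qed
        show "ball w (2 * \<rho>) \<subseteq> ball w 2" using \<rho>4 by auto
        show "ball x \<rho> \<subseteq> ball w (2 * \<rho>)"
        proof
          fix y assume "y \<in> ball x \<rho>"
          then show "y \<in> ball w (2 * \<rho>)" using w dist_triangle[of w y x] by (auto simp: dist_commute)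
        qed
      qed
      have qV: "smooth_on S ?q" for S using smooth_on_subset[OF taylor_poly_smooth] by blast
      have bV: "ball w (2 * \<rho>) \<subseteq> V" using sub2 ball_V by blast
      have rm: "1 \<le> 1 / \<rho> ^ m" "1 / \<rho> \<le> 1 / \<rho> ^ m"
      proof -
        show "1 \<le> 1 / \<rho> ^ m" using \<rho> \<rho>4 by (simp add: power_le_one)
        have "\<rho> ^ m \<le> \<rho> ^ 1" using m \<rho> \<rho>4 by (intro power_decreasing) auto
        then show "1 / \<rho> \<le> 1 / \<rho> ^ m" using \<rho> by (intro divide_left_mono) auto
      qed
      \<comment> \<open>The common remainder estimate for U = q^m - P, with cofactor the sum of
        mixed powers of \<open>f\<close> and \<open>q\<close>, and for U = q G - H, with cofactor
        \<open>G\<close>.\<close>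
      have rem: "norm (U y) \<le> \<rho> ^ N'" if "smooth_on V U" "bnd N (c / \<rho> ^ m) U (ball w (2 * \<rho>))"
          "!!z. z \<in> D \<inter> ball w (2 * \<rho>) ==> U z = (?q z - f z) * E z" "smooth_on D E" "y \<in> ball x \<rho>" for U E y
      proof -
        have "norm (U y) \<le> real DIM('a) ^ N * (c / \<rho> ^ m) * (2 * \<rho>) ^ N"
          by (rule taylor_poly_algebraic_remainder[OF open_D w(1) f_D V(1) bV _ _ that(1,2) _ that(3,4)]) (use \<rho> \<rho>4 c that sub2 in auto)
        also have "... = (real DIM('a) ^ N * c * 2 ^ N) * (\<rho> ^ N / \<rho> ^ m)" by (simp add: power_mult_distrib)
        also have "\<rho> ^ N / \<rho> ^ m = \<rho> ^ N' * \<rho> * \<rho> ^ K" using \<rho> by (simp add: N_def power_add)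
        also have "(real DIM('a) ^ N * c * 2 ^ N) * (\<rho> ^ N' * \<rho> * \<rho> ^ K) = \<rho> ^ N' * ((real DIM('a) ^ N * c * 2 ^ N) * \<rho>) * \<rho> ^ K" by (simp only: mult_ac)
        also have "... \<le> \<rho> ^ N' * 1 * 1"
          using Qr[OF Q(3)] \<rho> \<rho>4 c by (intro mult_mono power_le_one) auto
        finally show ?thesis by simp
      qed
      have u1: "norm (?q y ^ m - P y) \<le> \<rho> ^ N'" if "y \<in> ball x \<rho>" for y
      proof (rule rem[OF _ _ _ _ that])
        show "smooth_on V (%y. ?q y ^ m - P y)" by (intro smooth_on_diff[OF V(1)] smooth_on_power[OF V(1)] qV sm)
        have "bnd N (2 ^ (N * m) * (cT * (1/\<rho>)) ^ m + BP) (%y. ?q y ^ m - P y) (ball w (2 * \<rho>))"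
          by (rule bnd_diff[OF V(1) bV bnd_power[OF V(1) bV bnd_subset[OF q sub2(2)] qV A] bnd_subset[OF B(6) sub2(1)] smooth_on_power[OF V(1) qV] sm(3)])
        moreover have "2 ^ (N * m) * (cT * (1/\<rho>)) ^ m + BP \<le> c / \<rho> ^ m"
        proof -
          have "BP \<le> BP * (1 / \<rho> ^ m)" using rm B by (metis mult_left_mono mult.right_neutral)
          moreover have "0 \<le> (2 ^ N * (cT * BG) + BH) * (1 / \<rho> ^ m)" using B cT \<rho> by (intro mult_nonneg_nonneg) auto
          moreover have "c / \<rho> ^ m = 2 ^ (N * m) * (cT * (1/\<rho>)) ^ m + BP * (1 / \<rho> ^ m) + (2 ^ N * (cT * BG) + BH) * (1 / \<rho> ^ m)"
            by (simp add: c_def power_divide add_divide_distrib)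
          ultimately show ?thesis by linarith
        qed
        ultimately show "bnd N (c / \<rho> ^ m) (%y. ?q y ^ m - P y) (ball w (2 * \<rho>))" by (rule bnd_mono)
        show "smooth_on D (%z. \<Sum>i<m. f z ^ (m - Suc i) * ?q z ^ i)"
          by (intro smooth_on_sum[OF open_D] smooth_on_mult[OF open_D] smooth_on_power[OF open_D] f_D qV)
        show "?q z ^ m - P z = (?q z - f z) * (\<Sum>i<m. f z ^ (m - Suc i) * ?q z ^ i)" if "z \<in> D \<inter> ball w (2 * \<rho>)" for z
        proof -
          have "z \<in> X \<inter> V" using that D_subset by blast
          from fm[OF this] show ?thesis using power_diff_sumr2[of "?q z" m "f z"] by simp
        qed
      qed
      have u2: "norm (?q y * G y - H y) \<le> \<rho> ^ N'" if "y \<in> ball x \<rho>" for y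
      proof (rule rem[OF _ _ _ G_D that])
        show "smooth_on V (%y. ?q y * G y - H y)" by (intro smooth_on_diff[OF V(1)] smooth_on_mult[OF V(1)] qV sm)
        have "bnd N (2 ^ N * ((cT * (1/\<rho>)) * BG) + BH) (%y. ?q y * G y - H y) (ball w (2 * \<rho>))"
          by (rule bnd_diff[OF V(1) bV bnd_mult[OF V(1) bV bnd_subset[OF q sub2(2)] bnd_subset[OF B(2) sub2(1)] qV sm(1) A B(1)] bnd_subset[OF B(4) sub2(1)] smooth_on_mult[OF V(1) qV sm(1)] sm(2)])
        moreover have "2 ^ N * ((cT * (1/\<rho>)) * BG) + BH \<le> c / \<rho> ^ m"
        proof -
          have "BH \<le> BH * (1 / \<rho> ^ m)" using rm B by (metis mult_left_mono mult.right_neutral)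
          moreover have "(2 ^ N * (cT * BG)) * (1/\<rho>) \<le> (2 ^ N * (cT * BG)) * (1/\<rho> ^ m)" using rm B cT by (intro mult_left_mono) auto
          moreover have "0 \<le> (2 ^ (N * m) * cT ^ m + BP) * (1 / \<rho> ^ m)" using B cT \<rho> by (intro mult_nonneg_nonneg) auto
          moreover have "c / \<rho> ^ m = (2 ^ (N * m) * cT ^ m + BP) * (1 / \<rho> ^ m) + (2 ^ N * (cT * BG)) * (1/\<rho> ^ m) + BH * (1 / \<rho> ^ m)"
            by (simp add: c_def add_divide_distrib)
          moreover have "2 ^ N * ((cT * (1/\<rho>)) * BG) = (2 ^ N * (cT * BG)) * (1/\<rho>)" by simp
          ultimately show ?thesis by linarith
        qed
        ultimately show "bnd N (c / \<rho> ^ m) (%y. ?q y * G y - H y) (ball w (2 * \<rho>))" by (rule bnd_mono)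
        show "?q z * G z - H z = (?q z - f z) * G z" if "z \<in> D \<inter> ball w (2 * \<rho>)" for z
        proof -
          have "z \<in> X \<inter> V" using that D_subset by blast
          from fG[OF this, symmetric] show ?thesis by (simp add: algebra_simps)
        qed
      qed
      have "norm (f y - ?q y) \<le> \<rho> ^ k" if y: "y \<in> X \<inter> ball x \<rho>" for y
      proof -
        have yV: "y \<in> X \<inter> V" using y sub ball_V by blast
        have "norm (f y - ?q y) \<le> (2 * C + 2) * (\<rho> ^ N') powr \<gamma>"
          unfolding \<gamma>_def
          by (rule root_choice[OF m fm[OF yV] fG[OF yV] fle[OF yV] C \<alpha>]) (use \<rho> \<rho>4 u1 u2 y in \<open>auto intro: power_le_one\<close>)
        also have "... \<le> \<rho> ^ k" using sp[of "2 * C + 2" "\<rho> ^ N'" N' \<gamma>] C Q N' by auto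
        finally show ?thesis .
      qed
      moreover have "bnd K (1 / \<rho>\<^sup>2) ?q (ball x \<rho>)"
      proof (rule bnd_mono)
        show "bnd K (cT * (1/\<rho>)) ?q (ball x \<rho>)" using bnd_le[OF bnd_subset[OF q]] sub2 by (auto simp: N_def)
        show "cT * (1/\<rho>) \<le> 1 / \<rho>\<^sup>2" using Qr[OF Q(4)] \<rho> by (simp add: field_simps power2_eq_square)
      qed
      ultimately show ?thesis using taylor_poly_smooth by blast
    qed
  qed
  ultimately show ?thesis by (intro exI[of _ \<rho>0]) simp
qed

end

section \<open>Recovering derivatives from values on X\<close>

text \<open>Inverting the edge matrix of the simplex costs \<sigma>^(d-1) / |det| by Cramer's rule.
  The second order error \<sigma>^2 thus becomes \<sigma>^(d+1) / |det|, which the condition on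
  \<sigma> bounds by n \<rho>, and errors in the values are amplified by at most \<rho>^(-n). A
  single \<open>n\<close> plays the role of all constants, which makes monotonicity in
  \<open>n\<close> available.\<close>

definition dagger :: "(real^'d) set => real^'d => nat => bool" where
  "dagger X x n \<longleftrightarrow> (\<forall>\<rho>. 0 < \<rho> --> real n * \<rho> \<le> 1 -->
    (\<exists>b0 (b :: 'd => real^'d) \<sigma>. b0 \<in> X & (\<forall>j. b j \<in> X) & norm (b0 - x) \<le> real n * \<rho> & (\<forall>j. norm (b j - x) \<le> real n * \<rho>)
      & 0 < \<sigma> & \<sigma> \<le> 1 & (\<forall>j. norm (b j - b0) \<le> \<sigma>)
      & \<sigma> ^ (CARD('d) + 1) \<le> real n * \<rho> * \<bar>det (\<chi> j. b j - b0)\<bar> & \<rho> ^ n \<le> \<bar>det (\<chi> j. b j - b0)\<bar>))"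

lemma det_column_bound:
  fixes M :: "real^'d^'d"
  assumes "!!i j. j ~= k ==> \<bar>M $ i $ j\<bar> \<le> s" "!!i. \<bar>M $ i $ k\<bar> \<le> 1" "0 \<le> s"
  shows "\<bar>det M\<bar> \<le> fact CARD('d) * s ^ (CARD('d) - 1)"
proof -
  have "\<bar>det M\<bar> \<le> (\<Sum>p | p permutes (UNIV::'d set). \<bar>of_int (sign p) * (\<Prod>i\<in>UNIV. M $ i $ p i)\<bar>)"
    unfolding det_def by (rule sum_abs)
  also have "... \<le> (\<Sum>p | p permutes (UNIV::'d set). s ^ (CARD('d) - 1))"
  proof (rule sum_mono)
    fix p assume "p \<in> {p. p permutes (UNIV::'d set)}"
    then have p: "p permutes (UNIV::'d set)" by simp
    define i0 where "i0 = Hilbert_Choice.inv p k"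
    have i0: "p i0 = k" "!!i. i ~= i0 ==> p i ~= k"
      using p unfolding i0_def by (auto simp: permutes_inverses permutes_inv_eq)
    have "\<bar>of_int (sign p) * (\<Prod>i\<in>UNIV. M $ i $ p i)\<bar> = (\<Prod>i\<in>UNIV. \<bar>M $ i $ p i\<bar>)"
      by (simp add: abs_mult abs_prod sign_def)
    also have "... = \<bar>M $ i0 $ p i0\<bar> * (\<Prod>i\<in>UNIV - {i0}. \<bar>M $ i $ p i\<bar>)"
      by (rule prod.remove) auto
    also have "... \<le> 1 * (\<Prod>i\<in>UNIV - {i0}. s)"
      using assms i0 by (intro mult_mono prod_mono) (auto intro: prod_nonneg)
    also have "... = s ^ (CARD('d) - 1)" by simp
    finally show "\<bar>of_int (sign p) * (\<Prod>i\<in>UNIV. M $ i $ p i)\<bar> \<le> s ^ (CARD('d) - 1)" .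
  qed
  also have "... = fact CARD('d) * s ^ (CARD('d) - 1)" by (simp add: card_permutations)
  finally show ?thesis .
qed

lemma simplex_coordinates:
  fixes u :: "'d => real^'d" and e :: "real^'d"
  assumes d: "det (\<chi> j. u j) ~= 0" and u: "!!j. norm (u j) \<le> s" and e: "norm e \<le> 1"
  shows "\<exists>c. e = (\<Sum>j\<in>UNIV. c j *\<^sub>R u j) & (\<forall>j. \<bar>c j\<bar> \<le> fact CARD('d) * s ^ (CARD('d) - 1) / \<bar>det (\<chi> j. u j)\<bar>)"
proof -
  let ?A = "transpose (\<chi> j. u j) :: real^'d^'d"
  have dA: "det ?A ~= 0" "det ?A = det (\<chi> j. u j)" using d by (simp_all add: det_transpose)
  define c where "c = (\<chi> k. det (\<chi> i j. if j = k then e $ i else ?A $ i $ j) / det ?A)"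
  have "?A *v c = e" using cramer[OF dA(1), of c e] unfolding c_def by simp
  then have "e $ i = (\<Sum>j\<in>UNIV. c $ j *\<^sub>R u j) $ i" for i
    by (auto simp: matrix_vector_mult_def transpose_def sum_component mult.commute)
  then have "e = (\<Sum>j\<in>UNIV. c $ j *\<^sub>R u j)" by (simp add: vec_eq_iff)
  moreover have "\<bar>c $ k\<bar> \<le> fact CARD('d) * s ^ (CARD('d) - 1) / \<bar>det (\<chi> j. u j)\<bar>" for k
  proof -
    have s: "0 \<le> s" using u[of k] norm_ge_zero order_trans by blast
    have "\<bar>det (\<chi> i j. if j = k then e $ i else ?A $ i $ j)\<bar> \<le> fact CARD('d) * s ^ (CARD('d) - 1)"
    proof (rule det_column_bound[of k])
      show "\<bar>(\<chi> i j. if j = k then e $ i else ?A $ i $ j) $ i $ j\<bar> \<le> s" if "j ~= k" for i j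
        using that component_le_norm_cart[of "u j" i] u[of j] by (auto simp: transpose_def)
      show "\<bar>(\<chi> i j. if j = k then e $ i else ?A $ i $ j) $ i $ k\<bar> \<le> 1" for i
        using component_le_norm_cart[of e i] e by auto
    qed (rule s)
    then show ?thesis unfolding c_def using dA by (simp add: abs_divide divide_right_mono)
  qed
  ultimately show ?thesis by (intro exI[of _ "%j. c $ j"]) auto
qed

lemma second_order_remainder:
  fixes F :: "'a::euclidean_space => complex" and B :: real
  assumes V: "open V" and W: "convex W" "W \<subseteq> V" and F: "smooth_on V F" "bnd 2 B F W" and xy: "x \<in> W" "y \<in> W"
    and s: "norm (y - x) \<le> s"
  shows "norm (F y - F x - dd (y - x) F x) \<le> real DIM('a) * (real DIM('a) * B * s) * s"
proof -
  have B: "0 \<le> B" using bnd_norm[OF F(2) xy(1)] norm_ge_zero order_trans by blast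
  have s0: "0 \<le> s" using s norm_ge_zero order_trans by blast
  have F2: "bnd (Suc (Suc 0)) B F W" using F(2) by (simp add: numeral_2_eq_2)
  define S where "S = closed_segment x y"
  have S: "S \<subseteq> W" "convex S" "x \<in> S" "y \<in> S" using xy W by (auto simp: S_def closed_segment_subset)
  interpret bounded_linear "%v. dd v F x"
    using smooth_on_has_derivative[OF V F(1)] xy W has_derivative_bounded_linear by blast
  let ?g = "%z. F z - dd z F x"
  have "norm (?g y - ?g x) \<le> real DIM('a) * (real DIM('a) * B * s) * norm (y - x)"
  proof (rule differentiable_bound[OF S(2) _ _ S(4) S(3)])
    fix z assume z: "z \<in> S"
    then have zW: "z \<in> W" using S by auto
    show "(?g has_derivative (%v. dd v F z - dd v F x)) (at z within S)"
      by (intro has_derivative_diff has_derivative_at_withinI[OF smooth_on_has_derivative[OF V F(1)]] bounded_linear_imp_has_derivative bounded_linear_axioms)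
         (use zW W in auto)
    have nz: "norm (z - x) \<le> s" using z s unfolding S_def by (metis closed_segment_commute dist_commute dist_norm order_trans segment_bound(1) norm_minus_commute)
    show "onorm (%v. dd v F z - dd v F x) \<le> real DIM('a) * (real DIM('a) * B * s)"
    proof (rule onorm_bound)
      fix v
      have dz: "F differentiable (at z)" "F differentiable (at x)" using smooth_on_differentiable[OF V F(1)] zW xy W by blast+
      have "dd v F z - dd v F x = (\<Sum>b\<in>Basis. (v \<bullet> b) *\<^sub>R (dd b F z - dd b F x))"
        unfolding dd_linear_basis[OF dz(1), of v] dd_linear_basis[OF dz(2), of v] by (simp add: scaleR_diff_right sum_subtractf)
      also have "norm ... \<le> (\<Sum>b\<in>(Basis::'a set). norm v * (real DIM('a) * B * s))"
      proof (rule sum_norm_le)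
        fix b :: 'a assume b: "b \<in> Basis"
        have "norm (dd b F z - dd b F x) \<le> real DIM('a) * B * norm (z - x)"
          by (rule bnd_lipschitz[OF V W smooth_on_dd[OF V F(1)] _ zW xy(1), of 0]) (use F2 b in auto)
        also have "... \<le> real DIM('a) * B * s" using nz B by (intro mult_left_mono) auto
        finally show "norm ((v \<bullet> b) *\<^sub>R (dd b F z - dd b F x)) \<le> norm v * (real DIM('a) * B * s)"
          using Basis_le_norm[OF b, of v] by (auto intro!: mult_mono)
      qed
      finally show "norm (dd v F z - dd v F x) \<le> real DIM('a) * (real DIM('a) * B * s) * norm v" by (simp add: mult_ac)
    qed (use B s0 in auto)
  qed
  also have "... \<le> real DIM('a) * (real DIM('a) * B * s) * s" using s B s0 by (intro mult_left_mono) auto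
  finally show ?thesis by (simp add: diff algebra_simps)
qed

text \<open>Write \<open>e\<close> as a combination of the edges \<open>b j - b0\<close>. The
  derivative along an edge is a difference of two values, each at most \<epsilon>, up to a second
  order remainder; finally the derivative is carried from \<open>b0\<close> to \<open>x\<close> at
  the cost of B times their distance.\<close>

lemma gradient_bound:
  fixes F :: "real^'d => complex" and B :: real
  assumes dag: "dagger X x n" and F: "smooth_on V F" "open V" "ball x R \<subseteq> V" "bnd 2 B F (ball x R)"
    and small: "!!y. y \<in> X \<inter> ball x R ==> norm (F y) \<le> \<epsilon>" and e: "e \<in> Basis"
    and \<rho>: "0 < \<rho>" "real n * \<rho> \<le> 1" "real n * \<rho> < R" and \<epsilon>: "0 \<le> \<epsilon>"
  shows "norm (dd e F x) \<le> (2 * real CARD('d) * fact CARD('d)) * (\<epsilon> / \<rho> ^ n) + (real CARD('d)^3 * fact CARD('d) + real CARD('d)) * (B * (real n * \<rho>))"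
proof -
  let ?d = "real CARD('d)" and ?f = "fact CARD('d) :: real"
  obtain b0 b \<sigma> where b: "b0 \<in> X" "!!j. b j \<in> X" "norm (b0 - x) \<le> real n * \<rho>" "!!j. norm (b j - x) \<le> real n * \<rho>"
      "0 < \<sigma>" "\<sigma> \<le> 1" "!!j. norm (b j - b0) \<le> \<sigma>"
      "\<sigma> ^ (CARD('d) + 1) \<le> real n * \<rho> * \<bar>det (\<chi> j. b j - b0)\<bar>" "\<rho> ^ n \<le> \<bar>det (\<chi> j. b j - b0)\<bar>"
    using dag \<rho>(1,2) unfolding dagger_def by metis
  define \<Delta> where "\<Delta> = \<bar>det (\<chi> j. b j - b0)\<bar>"
  have \<Delta>: "0 < \<Delta>" using b(9) \<rho>(1) unfolding \<Delta>_def by (smt (verit) zero_less_power)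
  have mem: "b0 \<in> ball x R" "b j \<in> ball x R" "x \<in> ball x R" for j
    using b(3) b(4)[of j] \<rho> norm_ge_zero[of "b0 - x"] by (auto simp: dist_norm norm_minus_commute simp del: norm_ge_zero)
  have cv: "convex (ball x R)" by simp
  have B: "0 \<le> B" using bnd_norm[OF F(4) mem(3)] norm_ge_zero order_trans by blast
  have F2: "bnd (Suc (Suc 0)) B F (ball x R)" using F(4) by (simp add: numeral_2_eq_2)
  obtain c where c: "e = (\<Sum>j\<in>UNIV. c j *\<^sub>R (b j - b0))" "!!j. \<bar>c j\<bar> \<le> ?f * \<sigma> ^ (CARD('d) - 1) / \<Delta>"
    using simplex_coordinates[of "%j. b j - b0" \<sigma> e] \<Delta> b(7) e unfolding \<Delta>_def by auto
  interpret bounded_linear "%v. dd v F b0"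
    using smooth_on_has_derivative[OF F(2,1)] mem F(3) has_derivative_bounded_linear by blast
  have "dd e F b0 = (\<Sum>j\<in>UNIV. c j *\<^sub>R dd (b j - b0) F b0)" by (subst c(1)) (simp add: sum scaleR)
  also have "norm ... \<le> (\<Sum>j\<in>(UNIV::'d set). (?f * \<sigma> ^ (CARD('d) - 1) / \<Delta>) * (2 * \<epsilon> + ?d * (?d * B * \<sigma>) * \<sigma>))"
  proof (rule sum_norm_le)
    fix j
    have "norm (F (b j) - F b0 - dd (b j - b0) F b0) \<le> ?d * (?d * B * \<sigma>) * \<sigma>"
      using second_order_remainder[OF F(2) cv F(3) F(1) F(4) mem(1) mem(2) b(7)] by simp
    moreover have "norm (F (b j)) \<le> \<epsilon>" "norm (F b0) \<le> \<epsilon>" using small b mem by auto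
    ultimately have "norm (dd (b j - b0) F b0) \<le> 2 * \<epsilon> + ?d * (?d * B * \<sigma>) * \<sigma>"
      using norm_triangle_ineq4[of "F (b j) - F b0" "F (b j) - F b0 - dd (b j - b0) F b0"] norm_triangle_ineq4[of "F (b j)" "F b0"] by simp
    then show "norm (c j *\<^sub>R dd (b j - b0) F b0) \<le> (?f * \<sigma> ^ (CARD('d) - 1) / \<Delta>) * (2 * \<epsilon> + ?d * (?d * B * \<sigma>) * \<sigma>)"
      unfolding norm_scaleR by (rule mult_mono[OF c(2)]) (use order_trans[OF abs_ge_zero c(2)] in auto)
  qed
  also have "... = (2 * ?d * ?f) * (\<epsilon> * (\<sigma> ^ (CARD('d) - 1) / \<Delta>)) + ?d ^ 3 * ?f * (B * (\<sigma> ^ (CARD('d) - 1) * \<sigma> * \<sigma> / \<Delta>))"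
    by (simp add: algebra_simps power3_eq_cube)
  \<comment> \<open>The two estimates on the determinant in \<open>dagger\<close> are used here, one
    for each summand.\<close>
  also have "... \<le> (2 * ?d * ?f) * (\<epsilon> * (1 / \<rho> ^ n)) + ?d ^ 3 * ?f * (B * (real n * \<rho>))"
  proof (intro add_mono mult_left_mono)
    show "\<sigma> ^ (CARD('d) - 1) / \<Delta> \<le> 1 / \<rho> ^ n"
      using b \<rho> \<Delta> unfolding \<Delta>_def by (intro frac_le power_le_one) auto
    have "\<sigma> ^ (CARD('d) - 1) * \<sigma> * \<sigma> = \<sigma> ^ (CARD('d) + 1)"
      by (metis One_nat_def Suc_pred add.commute mult.commute plus_1_eq_Suc power_Suc zero_less_card_finite)
    with b(8) have "\<sigma> ^ (CARD('d) - 1) * \<sigma> * \<sigma> \<le> real n * \<rho> * \<Delta>" unfolding \<Delta>_def by metis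
    then show "\<sigma> ^ (CARD('d) - 1) * \<sigma> * \<sigma> / \<Delta> \<le> real n * \<rho>" using \<Delta> by (simp only: pos_divide_le_eq)
  qed (use \<epsilon> B in auto)
  finally have 1: "norm (dd e F b0) \<le> (2 * ?d * ?f) * (\<epsilon> / \<rho> ^ n) + ?d ^ 3 * ?f * (B * (real n * \<rho>))" by simp
  have "norm (dd e F x - dd e F b0) \<le> real DIM(real^'d) * B * norm (x - b0)"
    by (rule bnd_lipschitz[OF F(2) cv F(3) smooth_on_dd[OF F(2,1)] _ mem(3) mem(1), of 0]) (use F2 e in auto)
  also have "... \<le> ?d * (B * (real n * \<rho>))" using b(3) B by (simp add: norm_minus_commute mult_left_mono mult.assoc)
  finally have 2: "norm (dd e F x - dd e F b0) \<le> ?d * (B * (real n * \<rho>))" .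
  have "norm (dd e F x) \<le> norm (dd e F b0) + norm (dd e F x - dd e F b0)" by (metis add.commute diff_add_cancel norm_triangle_ineq)
  with 1 2 show ?thesis by (simp add: algebra_simps)
qed

text \<open>The power of \<tau> by which a function must be small on \<open>X\<close> so that its
  derivatives of order \<open>j\<close> are still \<tau>^a there; one step is the exponent loss of
  \<open>cmp_step_ex\<close>.\<close>

fun Eexp :: "nat => nat => nat => nat" where
  "Eexp n 0 a = a" | "Eexp n (Suc j) a = (n + 1) * (Eexp n j a + 4)"

lemma Eexp_ge: "a \<le> Eexp n j a" by (induction j) (auto intro: order_trans)

lemma cmp_step_ex:
  "\<exists>\<tau>0>0. \<tau>0 \<le> 1 & (\<forall>(X::(real^'d) set) x R V F B \<tau> a (e::real^'d). 0 < \<tau> --> \<tau> \<le> \<tau>0 --> (\<forall>y\<in>X \<inter> ball x R. dagger X y n) --> \<tau>\<^sup>2 \<le> R -->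
     open V --> smooth_on V F --> ball x R \<subseteq> V --> bnd 2 B F (ball x R) --> B \<le> 1/\<tau>^3 --> e \<in> Basis -->
     (\<forall>y\<in>X \<inter> ball x R. norm (F y :: complex) \<le> \<tau> ^ ((n + 1) * (a + 4))) --> (\<forall>y\<in>X \<inter> ball x (R/2). norm (dd e F y) \<le> \<tau> ^ a))"
proof -
  define K :: real where "K = (2 * real CARD('d) * fact CARD('d)) + (real CARD('d)^3 * fact CARD('d) + real CARD('d)) * real n"
  have K: "0 < K" unfolding K_def by (intro add_pos_nonneg mult_pos_pos) auto
  define \<tau>0 where "\<tau>0 = 1 / (2 * real n + K + 2)"
  have t0: "0 < \<tau>0" "\<tau>0 \<le> 1" using K by (auto simp: \<tau>0_def)
  show ?thesis
  proof (intro exI[of _ \<tau>0] conjI t0 allI impI ballI)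
    fix X :: "(real^'d) set" and x R V and F :: "real^'d => complex" and B \<tau> :: real and a :: nat and e y :: "real^'d"
    assume \<tau>: "0 < \<tau>" "\<tau> \<le> \<tau>0" and dag: "\<forall>y\<in>X \<inter> ball x R. dagger X y n" and R: "\<tau>\<^sup>2 \<le> R" and V: "open V" and F: "smooth_on V F" "ball x R \<subseteq> V" "bnd 2 B F (ball x R)" "B \<le> 1/\<tau>^3"
      and e: "e \<in> Basis" and small: "\<forall>y\<in>X \<inter> ball x R. norm (F y) \<le> \<tau> ^ ((n + 1) * (a + 4))" and y: "y \<in> X \<inter> ball x (R/2)"
    \<comment> \<open>With this scale \<tau>^((n+1)(a+4)) / \<rho>^n equals \<rho>, and B \<rho> is
      at most \<rho> / \<tau>^3 = \<tau>^(a+1); the remaining factor \<tau> absorbs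
      \<open>K\<close>.\<close>
    define \<rho> where "\<rho> = \<tau> ^ (a + 4)"
    have t: "(2 * real n + K + 2) * \<tau> \<le> 1" using \<tau> K by (simp add: \<tau>0_def field_simps)
    have "\<tau> \<le> 1" using \<tau> t0 by linarith
    have nt: "2 * real n * \<tau> < 1" "K * \<tau> \<le> 1"
    proof -
      have "0 \<le> 2 * real n * \<tau>" "0 \<le> K * \<tau>" using \<tau>(1) K by auto
      then show "2 * real n * \<tau> < 1" "K * \<tau> \<le> 1" using t \<tau>(1) by (simp_all only: distrib_right)
    qed
    have \<rho>0: "0 < \<rho>" using \<tau> by (simp add: \<rho>_def)
    have \<rho>3: "\<rho> \<le> \<tau> ^ 3" unfolding \<rho>_def using \<tau> \<open>\<tau> \<le> 1\<close> by (intro power_decreasing) auto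
    have n\<rho>: "2 * (real n * \<rho>) < \<tau>\<^sup>2"
    proof -
      have "2 * (real n * \<rho>) \<le> 2 * (real n * \<tau> ^ 3)" using \<rho>3 by (intro mult_left_mono) auto
      also have "... = (2 * real n * \<tau>) * \<tau>\<^sup>2" by (simp add: power2_eq_square power3_eq_cube)
      also have "... < 1 * \<tau>\<^sup>2" using nt \<tau> by (intro mult_strict_right_mono) auto
      finally show ?thesis by simp
    qed
    have t21: "\<tau>\<^sup>2 \<le> 1" using \<tau> \<open>\<tau> \<le> 1\<close> by (simp add: power_le_one)
    have sub: "ball y (R/2) \<subseteq> ball x R"
    proof
      fix z assume "z \<in> ball y (R/2)" then show "z \<in> ball x R" using y dist_triangle[of x z y] by auto
    qed
    have "0 \<le> dist x y" by simp
    then have yR: "y \<in> X \<inter> ball x R" using y by (simp del: zero_le_dist)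
    have B0: "0 \<le> B" using bnd_norm[OF F(3)] yR norm_ge_zero order_trans by blast
    have "norm (dd e F y) \<le> (2 * real CARD('d) * fact CARD('d)) * (\<tau> ^ ((n + 1) * (a + 4)) / \<rho> ^ n) + (real CARD('d)^3 * fact CARD('d) + real CARD('d)) * (B * (real n * \<rho>))"
      by (rule gradient_bound[OF _ F(1) V _ bnd_subset[OF F(3) sub] _ e \<rho>0]) (use dag yR sub F(2) small n\<rho> t21 R \<tau> in auto)
    also have "\<tau> ^ ((n + 1) * (a + 4)) / \<rho> ^ n = \<rho>"
      using \<tau> by (simp add: \<rho>_def power_mult[symmetric] power_add[symmetric] power_diff[symmetric] mult.commute add.commute divide_eq_eq)
    also have "(2 * real CARD('d) * fact CARD('d)) * \<rho> + (real CARD('d)^3 * fact CARD('d) + real CARD('d)) * (B * (real n * \<rho>)) \<le> (2 * real CARD('d) * fact CARD('d)) * (\<rho>/\<tau>^3) + (real CARD('d)^3 * fact CARD('d) + real CARD('d)) * (real n * (\<rho>/\<tau>^3))"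
    proof (intro add_mono mult_left_mono)
      have "\<tau>^3 \<le> 1" using \<tau> \<open>\<tau> \<le> 1\<close> by (simp add: power_le_one)
      then show "\<rho> \<le> \<rho>/\<tau>^3" using \<rho>0 \<tau> by (simp add: field_simps)
      have "B * (real n * \<rho>) \<le> (1/\<tau>^3) * (real n * \<rho>)" using F(4) \<rho>0 by (intro mult_right_mono) auto
      then show "B * (real n * \<rho>) \<le> real n * (\<rho>/\<tau>^3)" by simp
    qed auto
    also have "... = K * (\<rho>/\<tau>^3)" unfolding K_def by (simp add: algebra_simps)
    also have "\<rho>/\<tau>^3 = \<tau> ^ a * \<tau>" using \<tau> unfolding \<rho>_def by (simp add: power_add eval_nat_numeral)
    also have "K * (\<tau> ^ a * \<tau>) = \<tau> ^ a * (K * \<tau>)" by simp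
    also have "... \<le> \<tau> ^ a * 1" using nt \<tau> by (intro mult_left_mono) auto
    finally show "norm (dd e F y) \<le> \<tau> ^ a" by simp
  qed
qed

text \<open>Repeated gradient estimates on \<open>X\<close>, each on a ball of half the radius, make
  the jet at \<open>x\<close> small; then \<open>bnd_from_jets\<close> transports this smallness
  from the point to the full ball, which \<open>X\<close> need not fill.\<close>

lemma cmp_ex:
  "\<exists>E J \<tau>0. 0 < \<tau>0 & (\<forall>(X::(real^'d) set) x \<tau> F. 0 < \<tau> --> \<tau> \<le> \<tau>0 --> x \<in> X --> (\<forall>y\<in>X \<inter> ball x \<tau>. dagger X y n) -->
     smooth_on UNIV F --> bnd J (1/\<tau>^3) F (ball x \<tau>) --> (\<forall>y\<in>X \<inter> ball x \<tau>. norm (F y :: complex) \<le> \<tau> ^ E) --> bnd k (\<tau> ^ a) F (ball x \<tau>))"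
proof -
  from cmp_step_ex[where 'd='d and n=n] obtain \<tau>1 where \<tau>1: "0 < \<tau>1" "\<tau>1 \<le> 1" and
    st: "\<forall>(X::(real^'d) set) x R V F B \<tau> a (e::real^'d). 0 < \<tau> --> \<tau> \<le> \<tau>1 --> (\<forall>y\<in>X \<inter> ball x R. dagger X y n) --> \<tau>\<^sup>2 \<le> R -->
     open V --> smooth_on V F --> ball x R \<subseteq> V --> bnd 2 B F (ball x R) --> B \<le> 1/\<tau>^3 --> e \<in> Basis -->
     (\<forall>y\<in>X \<inter> ball x R. norm (F y :: complex) \<le> \<tau> ^ ((n + 1) * (a + 4))) --> (\<forall>y\<in>X \<inter> ball x (R/2). norm (dd e F y) \<le> \<tau> ^ a)" by (elim exE conjE)
  have step: "norm (dd e F y) \<le> \<tau> ^ a" if "0 < \<tau>" "\<tau> \<le> \<tau>1" "\<forall>y\<in>X \<inter> ball x R. dagger X y n" "\<tau>\<^sup>2 \<le> R"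
     "open V" "smooth_on V F" "ball x R \<subseteq> V" "bnd 2 B F (ball x R)" "B \<le> 1/\<tau>^3" "e \<in> Basis"
     "\<forall>y\<in>X \<inter> ball x R. norm (F y :: complex) \<le> \<tau> ^ ((n + 1) * (a + 4))" "y\<in>X \<inter> ball x (R/2)"
    for X :: "(real^'d) set" and x R V F B \<tau> a and e y :: "real^'d"
    using st[rule_format, of \<tau> X x R V F B e a y] that by blast
  \<comment> \<open>The radius is halved \<open>j\<close> times, and the condition
    \<open>2 ^ j * \<tau>\<^sup>2 \<le> R\<close> guarantees that it never falls below the square of
    \<tau> demanded by the gradient step.\<close>
  have jets: "bnd j (\<tau> ^ a) F {x}" if \<tau>: "0 < \<tau>" "\<tau> \<le> \<tau>1" and "\<forall>y\<in>X \<inter> ball x R. dagger X y n" "2 ^ j * \<tau>\<^sup>2 \<le> R" "x \<in> X"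
     "smooth_on UNIV F" "bnd (j + 1) B F (ball x R)" "B \<le> 1/\<tau>^3" "\<forall>y\<in>X \<inter> ball x R. norm (F y :: complex) \<le> \<tau> ^ (Eexp n j a)"
    for X :: "(real^'d) set" and x \<tau> F R B j a
    using that(3-)
  proof (induction j arbitrary: F R)
    case 0
    have "0 < \<tau>\<^sup>2" using \<tau> by simp
    moreover have "\<tau>\<^sup>2 \<le> R" using 0(2) by simp
    ultimately have "0 < R" by linarith
    then show ?case using 0 by auto
  next
    case (Suc j)
    have R: "\<tau>\<^sup>2 \<le> R" "2 ^ j * \<tau>\<^sup>2 \<le> R / 2"
    proof -
      show "2 ^ j * \<tau>\<^sup>2 \<le> R / 2" using Suc.prems(2) by simp
      have "1 * \<tau>\<^sup>2 \<le> 2 ^ Suc j * \<tau>\<^sup>2" by (intro mult_right_mono one_le_power) auto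
      then show "\<tau>\<^sup>2 \<le> R" using Suc.prems(2) by linarith
    qed
    have "0 < \<tau>\<^sup>2" using \<tau> by simp
    then have R0: "0 < R" using R(1) by linarith
    have "bnd j (\<tau> ^ a) (dd e F) {x}" if e: "e \<in> Basis" for e
    proof (rule Suc.IH[of "R/2"])
      show "\<forall>y\<in>X \<inter> ball x (R / 2). dagger X y n" using Suc.prems(1) R0 by auto
      show "smooth_on UNIV (dd e F)" using smooth_on_dd[OF open_UNIV Suc.prems(4)] .
      have "bnd (j + 1) B (dd e F) (ball x R)" using Suc.prems(5) e by auto
      then show "bnd (j + 1) B (dd e F) (ball x (R / 2))" by (rule bnd_subset) (use R0 in auto)
      show "\<forall>y\<in>X \<inter> ball x (R / 2). cmod (dd e F y) \<le> \<tau> ^ Eexp n j a"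
        using step[OF \<tau> Suc.prems(1) R(1) open_UNIV Suc.prems(4) subset_UNIV _ Suc.prems(6) e, of "Eexp n j a"] Suc.prems(7)
          bnd_le[OF Suc.prems(5), of 2] by auto
    qed (use Suc.prems R in auto)
    moreover have "norm (F x) \<le> \<tau> ^ a"
    proof -
      have "norm (F x) \<le> \<tau> ^ Eexp n (Suc j) a" using Suc.prems R0 by auto
      also have "... \<le> \<tau> ^ a" using \<tau> \<tau>1 Eexp_ge[of a n "Suc j"] by (intro power_decreasing) (auto intro: less_imp_le simp del: Eexp.simps)
      finally show ?thesis .
    qed
    ultimately show ?case by auto
  qed
  \<comment> \<open>Of these a + 5 factors \<tau>, three pay for the derivative bound 1/\<tau>^3 and
    two remain to absorb constants.\<close>
  define i where "i = a + 5"
  define j where "j = k + i"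
  let ?d = "real CARD('d)"
  define \<tau>0 where "\<tau>0 = min \<tau>1 (min (1 / 2 ^ j) (min (1 / (2 * ?d)) (1 / (2 + ?d ^ i))))"
  have "0 < \<tau>0" using \<tau>1 by (auto simp: \<tau>0_def intro!: divide_pos_pos add_pos_pos)
  moreover have "bnd k (\<tau> ^ a) F (ball x \<tau>)"
    if \<tau>: "0 < \<tau>" "\<tau> \<le> \<tau>0" and x: "x \<in> X" "\<forall>y\<in>X \<inter> ball x \<tau>. dagger X y n" and F: "smooth_on UNIV F" "bnd (j + 1) (1/\<tau>^3) F (ball x \<tau>)"
      "\<forall>y\<in>X \<inter> ball x \<tau>. norm (F y :: complex) \<le> \<tau> ^ (Eexp n j (a + 1))" for X :: "(real^'d) set" and x \<tau> F
  proof -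
    have \<tau>s: "\<tau> \<le> \<tau>1" "2 ^ j * \<tau> \<le> 1" "?d * \<tau> \<le> 1/2" "(2 + ?d ^ i) * \<tau> \<le> 1"
    proof -
      show "\<tau> \<le> \<tau>1" using \<tau> by (simp add: \<tau>0_def)
      show "2 ^ j * \<tau> \<le> 1" using \<tau> by (simp add: \<tau>0_def field_simps)
      show "?d * \<tau> \<le> 1/2" using \<tau> by (simp add: \<tau>0_def field_simps)
      have "\<tau> \<le> 1 / (2 + ?d ^ i)" using \<tau> by (simp add: \<tau>0_def)
      moreover have "0 < 2 + ?d ^ i" by (intro add_pos_pos) auto
      ultimately show "(2 + ?d ^ i) * \<tau> \<le> 1" by (simp add: pos_le_divide_eq mult.commute)
    qed
    have R: "2 ^ j * \<tau>\<^sup>2 \<le> \<tau>" using \<tau>s(2) \<tau>(1) mult_right_mono[of "2 ^ j * \<tau>" 1 \<tau>] by (simp add: power2_eq_square mult.assoc)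
    have b1: "bnd j (\<tau> ^ (a+1)) F {x}" by (rule jets[OF \<tau>(1) \<tau>s(1) x(2) R x(1) F(1,2) order_refl F(3)])
    have "bnd k (2 * \<tau> ^ (a+1) + (1/\<tau>^3) * (real DIM(real^'d) * \<tau>)^i) F (ball x \<tau>)"
      by (rule bnd_from_jets[OF open_UNIV subset_UNIV \<tau>(1) F(1)]) (use \<tau> \<tau>s b1 bnd_le[OF F(2), of j] in \<open>auto simp: j_def\<close>)
    moreover have "2 * \<tau> ^ (a+1) + (1/\<tau>^3) * (real DIM(real^'d) * \<tau>)^i \<le> \<tau> ^ a"
    proof -
      have "(1/\<tau>^3) * (real DIM(real^'d) * \<tau>)^i = ?d ^ i * \<tau> ^ a * \<tau> * \<tau>"
        using \<tau> by (simp add: i_def power_mult_distrib power_add eval_nat_numeral)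
      also have "... \<le> ?d ^ i * \<tau> ^ a * \<tau> * 1" using \<tau> \<tau>s \<tau>1 by (intro mult_left_mono) auto
      finally have "2 * \<tau> ^ (a+1) + (1/\<tau>^3) * (real DIM(real^'d) * \<tau>)^i \<le> \<tau> ^ a * ((2 + ?d ^ i) * \<tau>)" by (simp add: algebra_simps)
      also have "... \<le> \<tau> ^ a * 1" using \<tau>s \<tau> by (intro mult_left_mono) auto
      finally show ?thesis by simp
    qed
    ultimately show ?thesis by (rule bnd_mono)
  qed
  ultimately have "0 < \<tau>0 & (\<forall>(X::(real^'d) set) x \<tau> F. 0 < \<tau> --> \<tau> \<le> \<tau>0 --> x \<in> X --> (\<forall>y\<in>X \<inter> ball x \<tau>. dagger X y n) -->
     smooth_on UNIV F --> bnd (j + 1) (1/\<tau>^3) F (ball x \<tau>) --> (\<forall>y\<in>X \<inter> ball x \<tau>. norm (F y :: complex) \<le> \<tau> ^ (Eexp n j (a + 1))) --> bnd k (\<tau> ^ a) F (ball x \<tau>))"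
    by simp
  then show ?thesis by (intro exI)
qed

section \<open>Smooth cut-off functions and dyadic partitions of unity\<close>

text \<open>The polynomial parameter makes the family closed under differentiation: the derivative
  of \<open>flat p\<close> is \<open>flat (flat_deriv p)\<close>, also at 0, where the exponential
  wins over every polynomial in 1/t.\<close>

definition flat :: "real poly => real => real" where
  "flat p t = (if t \<le> 0 then 0 else poly p (inverse t) * exp (- inverse t))"

lemma poly_exp_tendsto_0: "((%x. x ^ k * poly p x * exp (- x)) \<longlongrightarrow> 0) (at_top :: real filter)"
proof (induction p arbitrary: k)
  case 0 then show ?case by simp
next
  case (pCons a p)
  have "((%x::real. a * (x ^ k / exp x) + x ^ Suc k * poly p x * exp (- x)) \<longlongrightarrow> a * 0 + 0) at_top"
    by (intro tendsto_intros tendsto_power_div_exp_0 pCons.IH)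
  then show ?case by (simp add: algebra_simps exp_minus divide_inverse)
qed

definition flat_deriv :: "real poly => real poly" where
  "flat_deriv p = [:0, 0, 1:] * (p - pderiv p)"

lemma flat_has_derivative: "(flat p has_real_derivative flat (flat_deriv p) t) (at t)"
proof (cases t "0::real" rule: linorder_cases)
  case less
  have "((%t::real. 0::real) has_real_derivative 0) (at t)" by simp
  moreover have "\<forall>\<^sub>F x in nhds t. flat p x = 0"
    using less by (intro eventually_nhds_in_open[THEN eventually_mono, of "{..<0}"]) (auto simp: flat_def)
  ultimately show ?thesis using less by (subst DERIV_cong_ev[OF refl _ refl]) (auto simp: flat_def)
next
  case greater
  have "((%t. poly p (inverse t) * exp (- inverse t)) has_real_derivative flat (flat_deriv p) t) (at t)"
    using greater
    by (auto intro!: derivative_eq_intros DERIV_chain2[OF poly_DERIV] simp: flat_def flat_deriv_def algebra_simps power2_eq_square)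
  moreover have "\<forall>\<^sub>F x in nhds t. flat p x = poly p (inverse x) * exp (- inverse x)"
    using greater by (intro eventually_nhds_in_open[THEN eventually_mono, of "{0<..}"]) (auto simp: flat_def)
  ultimately show ?thesis by (subst DERIV_cong_ev[OF refl _ refl]) auto
next
  case equal
  have "((%h. flat p h / h) \<longlongrightarrow> 0) (at_right 0)"
  proof -
    have "((%h. (inverse h) ^ 1 * poly p (inverse h) * exp (- inverse h)) \<longlongrightarrow> 0) (at_right (0::real))"
      by (rule filterlim_compose[OF poly_exp_tendsto_0 filterlim_inverse_at_top_right])
    moreover have "\<forall>\<^sub>F h in at_right (0::real). (inverse h) ^ 1 * poly p (inverse h) * exp (- inverse h) = flat p h / h"
      by (auto simp: eventually_at_right_field flat_def divide_inverse intro!: exI[of _ 1])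
    ultimately show ?thesis by (rule Lim_transform_eventually)
  qed
  moreover have "((%h. flat p h / h) \<longlongrightarrow> 0) (at_left 0)"
  proof (rule Lim_transform_eventually[OF tendsto_const])
    show "\<forall>\<^sub>F h in at_left (0::real). 0 = flat p h / h"
      by (auto simp: eventually_at_left_field flat_def intro!: exI[of _ "-1"])
  qed
  ultimately have "((%h. flat p h / h) \<longlongrightarrow> 0) (at 0)" by (simp add: filterlim_at_split)
  then show ?thesis unfolding DERIV_def using equal by (simp add: flat_def)
qed

lemma flat_smooth: "smooth_on UNIV (flat p)"
  unfolding smooth_on_def
proof
  fix k show "Ck k (flat p) UNIV"
  proof (induction k arbitrary: p)
    case 0
    have "isCont (flat p) t" for t using flat_has_derivative[of p t] DERIV_isCont by blast
    then show ?case by (simp add: continuous_on_eq_continuous_at)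
  next
    case (Suc k)
    show ?case unfolding Ck.simps(2)
    proof (intro exI[of _ "%x v. flat (flat_deriv p) x * v"] conjI ballI allI)
      show "(flat p has_derivative (%v. flat (flat_deriv p) x * v)) (at x)" for x
        using flat_has_derivative[of p x] unfolding has_field_derivative_def by (simp add: mult_commute_abs)
      show "Ck k (%x. flat (flat_deriv p) x * v) UNIV" for v
        using Ck_mult[OF open_UNIV Suc.IH Ck_const] .
    qed
  qed
qed

definition step :: "real => real" where
  "step t = flat 1 t * inverse (flat 1 t + flat 1 (1 - t))"

lemma flat1_pos: "0 < t ==> 0 < flat 1 t" and flat1_nonneg: "0 \<le> flat 1 t" and flat1_zero: "t \<le> 0 ==> flat 1 t = 0"
  by (auto simp: flat_def)

lemma step_denominator: "0 < flat 1 t + flat 1 (1 - t)"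
proof (cases "0 < t")
  case True then show ?thesis using flat1_pos[of t] flat1_nonneg[of "1 - t"] by linarith
next
  case False then show ?thesis using flat1_pos[of "1 - t"] flat1_nonneg[of t] by linarith
qed

lemma step_smooth: "smooth_on UNIV step"
proof -
  have "smooth_on UNIV (%t. flat 1 (- t + 1))"
    by (rule smooth_on_affine[OF open_UNIV open_UNIV bounded_linear_minus[OF bounded_linear_ident] _ flat_smooth]) auto
  then have "smooth_on UNIV (%t. flat 1 (1 - t))" by simp
  then have "smooth_on UNIV (%t. flat 1 t * inverse (flat 1 t + flat 1 (1 - t)))"
    using step_denominator
    by (intro smooth_on_mult[OF open_UNIV flat_smooth] smooth_on_inverse[OF open_UNIV] smooth_on_add[OF open_UNIV flat_smooth])
       (auto simp: less_imp_neq[THEN not_sym])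
  then show ?thesis by (rule smooth_on_cong[OF open_UNIV]) (simp add: step_def)
qed

lemma step_zero: "t \<le> 0 ==> step t = 0" by (simp add: step_def flat1_zero)
lemma step_one: "1 \<le> t ==> step t = 1"
  using flat1_pos[of t] by (simp add: step_def flat1_zero)

text \<open>A difference of two shifted steps, so that the sum over integer translates telescopes to
  1.\<close>

definition bump :: "real => complex" where "bump t = of_real (step (t + 1) - step t)"

lemma bump_smooth: "smooth_on UNIV bump"
proof -
  have "smooth_on UNIV (%t. step (t + 1))"
    by (rule smooth_on_affine[OF open_UNIV open_UNIV bounded_linear_ident _ step_smooth]) auto
  then have "smooth_on UNIV (%t. of_real (step (t + 1) - step t) :: complex)"
    by (intro smooth_on_bounded_linear[OF open_UNIV bounded_linear_of_real] smooth_on_diff[OF open_UNIV] step_smooth)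
  then show ?thesis by (rule smooth_on_cong[OF open_UNIV]) (simp add: bump_def)
qed

lemma bump_support: "1 \<le> \<bar>t\<bar> ==> bump t = 0"
  by (cases "t \<ge> 0") (auto simp: bump_def step_zero step_one)

lemma bump_sum:
  fixes N :: int
  assumes "\<bar>t\<bar> \<le> of_int N"
  shows "(\<Sum>k\<in>{-N..N}. bump (t - of_int k)) = 1"
proof -
  have "(\<Sum>k\<in>{-N..-N + int n}. bump (t - of_int k)) = of_real (step (t + of_int N + 1) - step (t + of_int N - int n))" for n
  proof (induction n)
    case 0 then show ?case by (simp add: bump_def algebra_simps)
  next
    case (Suc n)
    have "{-N..-N + int (Suc n)} = insert (-N + int (Suc n)) {-N..-N + int n}" by auto
    then have "(\<Sum>k\<in>{-N..-N + int (Suc n)}. bump (t - of_int k)) = bump (t - of_int (-N + int (Suc n))) + (\<Sum>k\<in>{-N..-N + int n}. bump (t - of_int k))" by simp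
    then show ?case unfolding Suc by (simp add: bump_def algebra_simps)
  qed
  from this[of "nat (2 * N)"] assms show ?thesis by (simp add: step_zero step_one)
qed

lemma dd_zero_off:
  assumes "closed K" "!!x. x \<notin> K ==> F x = 0" "x \<notin> K" shows "dd v F x = 0"
  using dd_cong[of "- K" x F "%x. 0" v] assms by (auto simp: dd_const)

text \<open>Off the closed set \<open>K\<close> the function vanishes near each point, so all its
  derivatives vanish there and only \<open>K\<close> matters.\<close>

lemma bnd_off_support:
  assumes K: "closed K" and B: "0 \<le> B"
  shows "(!!x. x \<notin> K ==> F x = 0) ==> bnd k B F (W \<inter> K) ==> bnd k B F W"
proof (induction k arbitrary: F)
  case 0 then show ?case using B by (metis IntI bnd.simps(1) norm_zero)
next
  case (Suc k)
  have "bnd k B (dd b F) W" if "b \<in> Basis" for b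
    using Suc.IH[of "dd b F"] dd_zero_off[OF K Suc.prems(1)] Suc.prems(2) that by auto
  moreover have "\<forall>x\<in>W. norm (F x) \<le> B" using Suc.prems B by (metis IntI bnd.simps(2) norm_zero)
  ultimately show ?case by auto
qed

lemma bump_bnd: "\<exists>A\<ge>1. bnd k A bump UNIV"
proof -
  obtain A where A: "A \<ge> 0" "bnd k A bump {-1..1}" using bnd_compact[OF open_UNIV compact_Icc subset_UNIV bump_smooth, of k] by auto
  have "bnd k (A + 1) bump UNIV"
    by (rule bnd_off_support[of "{-1..1}"]) (use A bump_support in \<open>auto intro: bnd_mono simp: abs_le_iff not_le less_eq_real_def\<close>)
  then show ?thesis using A by (intro exI[of _ "A + 1"]) auto
qed

lemma bnd_functional:
  fixes F :: "real => complex" and L :: "'a::euclidean_space => real"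
  assumes L: "bounded_linear L" and l: "!!b. b \<in> Basis ==> \<bar>L b\<bar> \<le> l" "1 \<le> l" and A: "0 \<le> A"
  shows "smooth_on UNIV F ==> bnd k A F UNIV ==> bnd k (l ^ k * A) (%z. F (L z + c)) UNIV"
proof (induction k arbitrary: F)
  case 0 then show ?case by auto
next
  case (Suc k)
  have "bnd k (l ^ Suc k * A) (dd b (%z. F (L z + c))) UNIV" if b: "b \<in> Basis" for b
  proof (rule bnd_cong[OF open_UNIV subset_UNIV])
    have s: "smooth_on UNIV (%z. dd 1 F (L z + c))"
      by (rule smooth_on_affine[OF open_UNIV open_UNIV L _ smooth_on_dd[OF open_UNIV Suc.prems(1)]]) auto
    have "bnd k (l ^ k * A) (%z. dd 1 F (L z + c)) UNIV"
      using Suc.IH[OF smooth_on_dd[OF open_UNIV Suc.prems(1)], of 1] Suc.prems(2) by auto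
    have ln: "norm (L b *\<^sub>R y) \<le> norm y * l" for y :: complex
      using mult_right_mono[OF l(1)[OF b] norm_ge_zero[of y]] by (simp add: mult.commute)
    from bnd_bounded_linear[OF open_UNIV subset_UNIV bounded_linear_scaleR_right ln _ \<open>bnd k (l ^ k * A) (%z. dd 1 F (L z + c)) UNIV\<close> s]
    show "bnd k (l ^ Suc k * A) (%z. L b *\<^sub>R dd 1 F (L z + c)) UNIV"
      using l by (simp add: mult_ac)
    show "L b *\<^sub>R dd 1 F (L z + c) = dd b (%z. F (L z + c)) z" for z
    proof -
      have d: "F differentiable (at (L z + c))" using smooth_on_differentiable[OF open_UNIV Suc.prems(1)] by simp
      have "dd b (%z. F (L z + c)) z = dd (L b) F (L z + c)" by (rule dd_affine(1)[OF L d])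
      also have "... = L b *\<^sub>R dd 1 F (L z + c)" using dd_linear_basis[OF d, of "L b"] by simp
      finally show ?thesis by simp
    qed
  qed
  moreover have "norm (F (L z + c)) \<le> l ^ Suc k * A" for z
  proof -
    have "norm (F (L z + c)) \<le> A" using bnd_norm[OF Suc.prems(2)] by simp
    also have "A \<le> l ^ Suc k * A" using A l mult_right_mono[of 1 "l ^ Suc k" A] one_le_power[of l "Suc k"] by simp
    finally show ?thesis .
  qed
  ultimately show ?case by auto
qed

lemma bnd_prod:
  fixes F :: "'i => 'a::euclidean_space => complex"
  assumes V: "open V" "W \<subseteq> V" and "finite I" and A: "1 \<le> A"
  shows "(!!i. i \<in> I ==> bnd k A (F i) W) ==> (!!i. i \<in> I ==> smooth_on V (F i)) ==> bnd k ((2 ^ k * A) ^ card I) (%x. \<Prod>i\<in>I. F i x) W"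
  using assms(3)
proof (induction I rule: finite_induct)
  case empty then show ?case by (simp add: bnd_const)
next
  case (insert i I)
  have "bnd k (2 ^ k * (A * (2 ^ k * A) ^ card I)) (%x. F i x * (\<Prod>i\<in>I. F i x)) W"
    by (rule bnd_mult[OF V _ _ _ smooth_on_prod[OF V(1)]]) (use insert A in auto)
  then show ?case using insert by (simp add: mult_ac)
qed

definition pu :: "nat => ('d => int) => real^'d => complex" where
  "pu n \<kappa> z = (\<Prod>i\<in>UNIV. bump (2 ^ n * (z $ i) + - of_int (\<kappa> i)))"

definition cube :: "nat => ('d => int) => (real^'d) set" where
  "cube n \<kappa> = {z. \<forall>i. \<bar>2 ^ n * (z $ i) - of_int (\<kappa> i)\<bar> \<le> 1}"

lemma coordinate_bl: "bounded_linear (%z::real^'d. c * (z $ i))"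
  using bounded_linear_const_mult[OF bounded_linear_vec_nth] .

lemma pu_smooth: "smooth_on UNIV (pu n \<kappa>)"
proof -
  have "smooth_on UNIV (%z. \<Prod>i\<in>UNIV. bump (2 ^ n * (z $ i) + - of_int (\<kappa> i)))"
    by (intro smooth_on_prod[OF open_UNIV] smooth_on_affine[OF open_UNIV open_UNIV coordinate_bl _ bump_smooth]) auto
  then show ?thesis by (rule smooth_on_cong[OF open_UNIV]) (simp add: pu_def)
qed

lemma pu_support: "z \<notin> cube n \<kappa> ==> pu n \<kappa> z = 0"
proof -
  assume "z \<notin> cube n \<kappa>"
  then obtain i where "1 < \<bar>2 ^ n * (z $ i) - of_int (\<kappa> i)\<bar>" unfolding cube_def by (auto simp: not_le)
  then have "bump (2 ^ n * (z $ i) + - of_int (\<kappa> i)) = 0" by (intro bump_support) auto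
  then show ?thesis unfolding pu_def by (intro prod_zero) auto
qed

lemma closed_cube: "closed (cube n \<kappa>)"
  unfolding cube_def by (intro closed_Collect_all closed_Collect_le continuous_intros)

lemma pu_bnd: "\<exists>A\<ge>1. \<forall>n. \<forall>\<kappa>::'d::finite => int. bnd k (A * (2 ^ n) ^ (k * CARD('d))) (pu n \<kappa>) UNIV"
proof -
  obtain A where A: "A \<ge> 1" "bnd k A bump UNIV" using bump_bnd by blast
  have "bnd k ((2 ^ k * A) ^ CARD('d) * (2 ^ n) ^ (k * CARD('d))) (pu n \<kappa>) UNIV" for n and \<kappa> :: "'d => int"
  proof -
    have 1: "bnd k ((2 ^ n) ^ k * A) (%z::real^'d. bump (2 ^ n * (z $ i) + - of_int (\<kappa> i))) UNIV" for i
      by (rule bnd_functional[OF coordinate_bl _ _ _ bump_smooth A(2)])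
         (use A in \<open>auto simp: Basis_vec_def axis_def\<close>)
    have "bnd k ((2 ^ k * ((2 ^ n) ^ k * A)) ^ card (UNIV::'d set)) (%z::real^'d. \<Prod>i\<in>UNIV. bump (2 ^ n * (z $ i) + - of_int (\<kappa> i))) UNIV"
      using A one_le_power[of "2::real"]
      by (intro bnd_prod[OF open_UNIV subset_UNIV _ _ 1] smooth_on_affine[OF open_UNIV open_UNIV coordinate_bl _ bump_smooth])
         (auto intro!: mult_ge1_I)
    then have "bnd k ((2 ^ k * A) ^ CARD('d) * (2 ^ n) ^ (k * CARD('d))) (%z::real^'d. \<Prod>i\<in>UNIV. bump (2 ^ n * (z $ i) + - of_int (\<kappa> i))) UNIV"
      by (simp add: power_mult_distrib power_mult mult_ac)
    then show ?thesis by (rule bnd_cong[OF open_UNIV subset_UNIV]) (simp add: pu_def)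
  qed
  moreover have "(2 ^ k * A) ^ CARD('d) \<ge> 1" using A by (intro one_le_power mult_ge1_I) auto
  ultimately show ?thesis by blast
qed

text \<open>The indices of the level n cubes that are needed for points of norm at most
  \<open>Z\<close>. Their number is of the order (2^n)^d, which enters every sum over cubes.\<close>

definition grid :: "int => nat => ('d::finite => int) set" where
  "grid Z n = (UNIV \<rightarrow>\<^sub>E {- (2 ^ n * Z)..2 ^ n * Z})"

lemma finite_grid: "finite (grid Z n :: ('d::finite => int) set)"
  unfolding grid_def by (intro finite_PiE) auto

lemma card_grid: "0 \<le> Z ==> real (card (grid Z n :: ('d::finite => int) set)) = (2 * (2 ^ n * real_of_int Z) + 1) ^ CARD('d)"
  unfolding grid_def by (simp add: card_PiE mult.commute)

lemma pu_sum:
  fixes z :: "real^'d"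
  assumes "norm z \<le> of_int Z"
  shows "(\<Sum>\<kappa>\<in>grid Z n. pu n \<kappa> z) = 1"
proof -
  have "(\<Sum>\<kappa>\<in>grid Z n. pu n \<kappa> z) = (\<Prod>i\<in>UNIV. \<Sum>k\<in>{- (2 ^ n * Z)..2 ^ n * Z}. bump (2 ^ n * (z $ i) + - of_int k))"
    unfolding grid_def pu_def by (rule prod_sum_PiE[symmetric]) auto
  also have "... = (\<Prod>i\<in>(UNIV::'d set). 1)"
  proof (rule prod.cong[OF refl])
    fix i
    have "\<bar>2 ^ n * z $ i\<bar> \<le> of_int (2 ^ n * Z)"
      using component_le_norm_cart[of z i] assms by (auto simp: abs_mult intro!: mult_left_mono)
    from bump_sum[OF this] show "(\<Sum>k\<in>{- (2 ^ n * Z)..2 ^ n * Z}. bump (2 ^ n * (z $ i) + - of_int k)) = 1" by simp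
  qed
  finally show ?thesis by simp
qed

lemma cube_dist: "z \<in> cube n \<kappa> ==> z' \<in> cube n \<kappa> ==> norm (z - z') \<le> 2 * real CARD('d) / 2 ^ n"
  for z z' :: "real^'d"
proof -
  assume z: "z \<in> cube n \<kappa>" "z' \<in> cube n \<kappa>"
  have "norm (z - z') \<le> (\<Sum>i\<in>(UNIV::'d set). \<bar>(z - z') $ i\<bar>)" by (rule norm_le_l1_cart)
  also have "... \<le> (\<Sum>i\<in>(UNIV::'d set). 2 / 2 ^ n)"
  proof (rule sum_mono)
    fix i
    have "\<bar>2 ^ n * (z $ i) - of_int (\<kappa> i)\<bar> \<le> 1" "\<bar>2 ^ n * (z' $ i) - of_int (\<kappa> i)\<bar> \<le> 1" using z by (auto simp: cube_def)
    then have "\<bar>2 ^ n * (z $ i) - 2 ^ n * (z' $ i)\<bar> \<le> 2" by linarith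
    then have "2 ^ n * \<bar>z $ i - z' $ i\<bar> \<le> 2" by (simp add: abs_mult right_diff_distrib[symmetric])
    then show "\<bar>(z - z') $ i\<bar> \<le> 2 / 2 ^ n" by (simp add: field_simps)
  qed
  also have "... = 2 * real CARD('d) / 2 ^ n" by simp
  finally show ?thesis .
qed

section \<open>Gluing the local approximations\<close>

text \<open>Diagonal choice: if \<open>Q J\<close> holds eventually for each fixed \<open>J\<close>,
  then \<open>j n\<close> can tend to infinity so slowly that \<open>Q (j n) n\<close> holds for all
  large \<open>n\<close>.\<close>

lemma slow_sequence:
  fixes Q :: "nat => nat => bool"
  assumes "!!J. \<exists>N. \<forall>n\<ge>N. Q J n"
  obtains j n0 where "mono_on {n0..} j" "!!k. \<exists>N\<ge>n0. \<forall>n\<ge>N. k \<le> j n" "!!n. n \<ge> n0 ==> Q (j n) n"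
proof -
  obtain N where N: "!!J n. n \<ge> N J ==> Q J n" using assms by metis
  define M where "M J = (\<Sum>i\<le>J. N i) + J" for J
  have MN: "N J \<le> M J" "J \<le> M J" for J unfolding M_def using member_le_sum[of J "{..J}" N] by auto
  have Mmono: "M i \<le> M J" if "i \<le> J" for i J using that unfolding M_def by (intro add_mono sum_mono2) auto
  define j where "j n = Max {J. M J \<le> n}" for n
  have fin: "finite {J. M J \<le> n}" for n
  proof (rule finite_subset)
    show "{J. M J \<le> n} \<subseteq> {..n}" using le_trans[OF MN(2)] by auto
  qed simp
  have ne: "{J. M J \<le> n} ~= {}" if "n \<ge> M 0" for n using that by auto
  have jM: "M (j n) \<le> n" if "n \<ge> M 0" for n using Max_in[OF fin ne[OF that]] unfolding j_def by simp
  show thesis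
  proof (rule that[of "M 0" j])
    show "mono_on {M 0..} j"
    proof (rule mono_onI)
      fix a b assume "a \<in> {M 0..}" "b \<in> {M 0..}" "a \<le> b"
      then show "j a \<le> j b" unfolding j_def using fin ne by (intro Max_mono) auto
    qed
    show "\<exists>N\<ge>M 0. \<forall>n\<ge>N. k \<le> j n" for k
      by (rule exI[of _ "M k"]) (auto simp: j_def intro!: Max_ge fin Mmono)
    show "Q (j n) n" if "n \<ge> M 0" for n using N MN(1) jM[OF that] order_trans by blast
  qed
qed

lemma pow2_eventually_small:
  fixes c :: real
  shows "\<exists>N. \<forall>n\<ge>N. c \<le> 2 ^ n"
proof -
  obtain N :: nat where "c < 2 ^ N" using real_arch_pow[of 2 c] by auto
  then show ?thesis by (intro exI[of _ N]) (metis less_imp_le order_trans power_increasing one_le_numeral)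
qed

text \<open>The level n approximation \<open>EE n\<close> is a partition of unity sum of local
  approximants, and the extension is the first level plus the series of the corrections
  \<open>T n\<close>. Two approximants over overlapping cubes are both close to \<open>f\<close> on
  \<open>X\<close>, so B makes all derivatives of their difference small. On \<open>X\<close> the
  corrections telescope; off \<open>X\<close> they are deliberately not
  \<open>EE (Suc n) - EE n\<close>, because approximants far from \<open>X\<close> cannot be
  compared.\<close>

theorem extension_theorem:
  fixes X :: "(real^'d) set" and f :: "real^'d => complex"
  assumes R: "0 < R"
    and A: "!!k K. \<exists>\<rho>0>0. \<forall>x\<in>X \<inter> ball x0 R. \<forall>\<rho>. 0 < \<rho> --> \<rho> < \<rho>0 -->
     (\<exists>q. smooth_on UNIV q & (\<forall>y\<in>X \<inter> ball x \<rho>. norm (f y - q y) \<le> \<rho> ^ k) & bnd K (1 / \<rho>\<^sup>2) q (ball x \<rho>))"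
    and B: "!!k a. \<exists>E J \<tau>0. 0 < \<tau>0 & (\<forall>x\<in>X \<inter> ball x0 R. \<forall>\<tau> F. 0 < \<tau> --> \<tau> \<le> \<tau>0 --> 
     smooth_on UNIV F --> bnd J (1/\<tau>^3) F (ball x \<tau>) --> (\<forall>y\<in>X \<inter> ball x \<tau>. norm (F y :: complex) \<le> \<tau> ^ E) --> bnd k (\<tau> ^ a) F (ball x \<tau>))"
  shows "\<exists>F. smooth_on (ball x0 R) F & (\<forall>y\<in>X \<inter> ball x0 R. F y = f y)"
proof -
  let ?d = "real CARD('d)"
  have d1: "1 \<le> ?d" by (simp add: Suc_leI)
  \<comment> \<open>The power of 2^(-n) required of a difference of approximants: 2 J d for the
    derivatives of two partition functions, 2 d for the number of pairs of cubes, and 2 more, one to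
    absorb \<open>Cst J\<close> and one for convergence.\<close>
  define ex where "ex J = 2 * (J * CARD('d)) + 2 * CARD('d) + 2" for J :: nat
  obtain E0 J0 \<tau>0 where B0: "!!k. 0 < \<tau>0 k" "!!k x \<tau> F. x\<in>X \<inter> ball x0 R ==> 0 < \<tau> ==> \<tau> \<le> \<tau>0 k ==> smooth_on UNIV F ==> bnd (J0 k) (1/\<tau>^3) F (ball x \<tau>) ==>
     (!!y. y\<in>X \<inter> ball x \<tau> ==> norm (F y :: complex) \<le> \<tau> ^ E0 k) ==> bnd k (\<tau> ^ ex k) F (ball x \<tau>)"
  proof -
    have "\<forall>k. \<exists>E J \<tau>0. 0 < \<tau>0 & (\<forall>x\<in>X \<inter> ball x0 R. \<forall>\<tau> F. 0 < \<tau> --> \<tau> \<le> \<tau>0 --> 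
       smooth_on UNIV F --> bnd J (1/\<tau>^3) F (ball x \<tau>) --> (\<forall>y\<in>X \<inter> ball x \<tau>. norm (F y :: complex) \<le> \<tau> ^ E) --> bnd k (\<tau> ^ ex k) F (ball x \<tau>))"
      using B by (intro allI)
    from this[unfolded choice_iff] obtain E0 J0 \<tau>0 where "\<forall>k. 0 < \<tau>0 k & (\<forall>x\<in>X \<inter> ball x0 R. \<forall>\<tau> F. 0 < \<tau> --> \<tau> \<le> \<tau>0 k --> 
       smooth_on UNIV F --> bnd (J0 k) (1/\<tau>^3) F (ball x \<tau>) --> (\<forall>y\<in>X \<inter> ball x \<tau>. norm (F y :: complex) \<le> \<tau> ^ (E0 k)) --> bnd k (\<tau> ^ ex k) F (ball x \<tau>))"
      by (elim exE)
    then show thesis by (intro that[of \<tau>0 J0 E0]) auto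
  qed
  \<comment> \<open>Partial sums rather than the bare requirements: this makes the orders monotone
    in \<open>J\<close>, so a better approximant is also good for smaller \<open>J\<close>, and
    forces \<open>kk J\<close> above \<open>J\<close>.\<close>
  define kk where "kk J = (\<Sum>i\<le>J. E0 i + 1)" for J
  define KK where "KK J = (\<Sum>i\<le>J. J0 i)" for J
  have kk: "E0 J + 1 \<le> kk J" "J0 J \<le> KK J" for J
    unfolding kk_def KK_def using member_le_sum[of J "{..J}" "%i. E0 i + 1"] member_le_sum[of J "{..J}" J0] by auto
  have kkm: "kk i \<le> kk J" "KK i \<le> KK J" if "i \<le> J" for i J
    using that unfolding kk_def KK_def by (intro sum_mono2; auto)+
  \<comment> \<open>With \<tau> = 4 d / 2^n the radii are 4 \<tau> at level n and 2 \<tau> at the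
    next level. Centres belonging to overlapping cubes differ by at most 6 d / 2^n, below 2 \<tau>,
    so both approximants are valid on the ball of radius \<tau> around the finer centre.\<close>
  define rr where "rr n = 16 * ?d / 2 ^ n" for n :: nat
  have rr0: "0 < rr n" "rr (Suc n) = rr n / 2" for n using d1 by (auto simp: rr_def)
  define Good where "Good J n q x \<longleftrightarrow> smooth_on UNIV q & (\<forall>y\<in>X \<inter> ball x (rr n). norm (f y - q y) \<le> rr n ^ kk J) & bnd (KK J) (1 / (rr n)\<^sup>2) q (ball x (rr n))"
    for J n and q :: "real^'d => complex" and x :: "real^'d"
  have rr_small: "\<exists>N. \<forall>n\<ge>N. rr n < c" if "0 < c" for c
  proof -
    obtain N where "\<forall>n\<ge>N. 16 * ?d / c + 1 \<le> 2 ^ n" using pow2_eventually_small by blast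
    then show ?thesis using that unfolding rr_def by (intro exI[of _ N]) (auto simp: field_simps; smt (verit) mult_pos_pos)
  qed
  have rr_mono: "rr n \<le> rr n'" if "n' \<le> n" for n n' unfolding rr_def using that d1 by (intro divide_left_mono power_increasing) auto
  obtain Ap where Ap: "!!k. Ap k \<ge> 1" "!!k n (\<kappa>::'d => int). bnd k (Ap k * (2 ^ n) ^ (k * CARD('d))) (pu n \<kappa>) UNIV"
    using pu_bnd[where 'd='d] by metis
  obtain Z0 :: nat where Z0: "norm x0 + R < Z0" using reals_Archimedean2 by blast
  define Z where "Z = int Z0"
  have nz: "norm z \<le> of_int Z" if "z \<in> ball x0 R" for z
    using that Z0 norm_triangle_sub[of z x0] by (auto simp: Z_def dist_norm norm_minus_commute)
  have Z1: "0 \<le> Z" by (simp add: Z_def)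
  define cZ where "cZ = (4 * real_of_int Z + 1) ^ CARD('d)"
  have cZ1: "1 \<le> cZ" using Z1 by (auto simp: cZ_def intro!: one_le_power)
  have cardg: "real (card (grid Z n :: ('d => int) set)) \<le> cZ * (2 ^ n) ^ CARD('d)" "real (card (grid Z (Suc n) :: ('d => int) set)) \<le> cZ * (2 ^ n) ^ CARD('d)" for n
  proof -
    have 1: "(1::real) \<le> 2 ^ n" by simp
    have "2 * (2 ^ n * real_of_int Z) + 1 \<le> (4 * real_of_int Z + 1) * 2 ^ n" "2 * (2 ^ Suc n * real_of_int Z) + 1 \<le> (4 * real_of_int Z + 1) * 2 ^ n"
    proof -
      have "0 \<le> real_of_int Z * 2 ^ n" using Z1 by simp
      moreover have "2 * (2 ^ n * real_of_int Z) + 1 = 2 * (real_of_int Z * 2 ^ n) + 1" "2 * (2 ^ Suc n * real_of_int Z) + 1 = 4 * (real_of_int Z * 2 ^ n) + 1"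
        "(4 * real_of_int Z + 1) * 2 ^ n = 4 * (real_of_int Z * 2 ^ n) + 2 ^ n" by (simp_all add: algebra_simps)
      ultimately show "2 * (2 ^ n * real_of_int Z) + 1 \<le> (4 * real_of_int Z + 1) * 2 ^ n" "2 * (2 ^ Suc n * real_of_int Z) + 1 \<le> (4 * real_of_int Z + 1) * 2 ^ n"
        using 1 by linarith+
    qed
    then show "real (card (grid Z n :: ('d => int) set)) \<le> cZ * (2 ^ n) ^ CARD('d)" "real (card (grid Z (Suc n) :: ('d => int) set)) \<le> cZ * (2 ^ n) ^ CARD('d)"
      unfolding card_grid[OF Z1] cZ_def power_mult_distrib[symmetric] using Z1 by (intro power_mono; auto)+
  qed
  \<comment> \<open>All factors in the bound for \<open>T n\<close> that depend on \<open>J\<close>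
    but not on \<open>n\<close>; the predicate \<open>Q\<close> below asks that 2^n exceeds
    them.\<close>
  define Cst where "Cst J = cZ * cZ * (2 ^ J * (2 ^ J * (Ap J * 2 ^ (J * CARD('d)) * Ap J))) * (4 * ?d) ^ ex J" for J
  define Q where "Q J n \<longleftrightarrow> (\<forall>x\<in>X \<inter> ball x0 R. \<exists>q. Good J n q x) & rr n \<le> 1 &
     (\<forall>x x' q q'. x \<in> X \<inter> ball x0 R --> Good J (Suc n) q x --> Good J n q' x' --> norm (x - x') \<le> 6 * ?d / 2 ^ n -->
        bnd J ((4 * ?d / 2 ^ n) ^ ex J) (%z. q z - q' z) (ball x (4 * ?d / 2 ^ n))) & Cst J \<le> 2 ^ n" for J n
  have "\<exists>N. \<forall>n\<ge>N. Q J n" for J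
  proof -
    obtain \<rho>0 where \<rho>0: "0 < \<rho>0" "!!x \<rho>. x\<in>X \<inter> ball x0 R ==> 0 < \<rho> ==> \<rho> < \<rho>0 ==>
       (\<exists>q. smooth_on UNIV q & (\<forall>y\<in>X \<inter> ball x \<rho>. norm (f y - q y) \<le> \<rho> ^ kk J) & bnd (KK J) (1 / \<rho>\<^sup>2) q (ball x \<rho>))"
      using A[of "kk J" "KK J"] by blast
    obtain N1 where N1: "!!n. n \<ge> N1 ==> rr n < \<rho>0" using rr_small[OF \<rho>0(1)] by blast
    obtain N2 where N2: "!!n. n \<ge> N2 ==> rr n < min 1 (min (\<tau>0 J) (min (2 * (1 / 4 ^ kk J)) (1/8)))" using rr_small[of "min 1 (min (\<tau>0 J) (min (2 * (1 / 4 ^ kk J)) (1/8)))"] B0(1)[of J] by auto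
    obtain N3 where N3: "!!n. n \<ge> N3 ==> Cst J \<le> 2 ^ n" using pow2_eventually_small by blast
    have "Q J n" if "n \<ge> N1 + N2 + N3" for n
      unfolding Q_def
    proof (intro conjI allI impI ballI)
      show "\<exists>q. Good J n q x" if "x \<in> X \<inter> ball x0 R" for x
        using \<rho>0(2)[OF that rr0(1)] N1 \<open>n \<ge> N1 + N2 + N3\<close> unfolding Good_def by auto
      have small: "rr n \<le> 1" "rr n \<le> \<tau>0 J" "rr n \<le> 2 * (1 / 4 ^ kk J)" "rr n \<le> 1/8" using N2[of n] that by auto
      show "rr n \<le> 1" by fact
      show "Cst J \<le> 2 ^ n" using N3 that by auto
      fix x x' q q' assume x: "x \<in> X \<inter> ball x0 R" and g: "Good J (Suc n) q x" "Good J n q' x'" and xx: "norm (x - x') \<le> 6 * ?d / 2 ^ n"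
      define \<tau> where "\<tau> = 4 * ?d / 2 ^ n"
      have \<tau>: "0 < \<tau>" "rr n = 4 * \<tau>" "rr (Suc n) = 2 * \<tau>" using d1 by (auto simp: \<tau>_def rr_def)
      have sub: "ball x \<tau> \<subseteq> ball x (rr (Suc n))" "ball x \<tau> \<subseteq> ball x' (rr n)"
      proof -
        show "ball x \<tau> \<subseteq> ball x (rr (Suc n))" using \<tau> by auto
        show "ball x \<tau> \<subseteq> ball x' (rr n)"
        proof
          fix z assume "z \<in> ball x \<tau>"
          moreover have "dist x' x \<le> 2 * \<tau>"
            using xx divide_right_mono[of "6 * ?d" "8 * ?d" "2 ^ n"] by (simp add: \<tau>_def dist_norm norm_minus_commute)
          ultimately show "z \<in> ball x' (rr n)" using dist_triangle[of x' z x] \<tau> by simp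
        qed
      qed
      have s: "smooth_on UNIV q" "smooth_on UNIV q'" using g by (auto simp: Good_def)
      have "bnd J (\<tau> ^ ex J) (%z. q z - q' z) (ball x \<tau>)"
      proof (rule B0(2)[OF x \<tau>(1)])
        show "\<tau> \<le> \<tau>0 J" using small \<tau> by simp
        show "smooth_on UNIV (%z. q z - q' z)" using smooth_on_diff[OF open_UNIV s] .
        have "bnd (J0 J) (1 / (rr (Suc n))\<^sup>2 + 1 / (rr n)\<^sup>2) (%z. q z - q' z) (ball x \<tau>)"
          using g kk(2)[of J] sub unfolding Good_def
          by (intro bnd_diff[OF open_UNIV subset_UNIV]) (auto intro: bnd_le bnd_subset)
        moreover have "1 / (rr (Suc n))\<^sup>2 + 1 / (rr n)\<^sup>2 \<le> 1 / \<tau> ^ 3"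
        proof -
          have "1 / (rr (Suc n))\<^sup>2 + 1 / (rr n)\<^sup>2 = (5/16) * (1 / \<tau>\<^sup>2)" using \<tau> by (simp add: power_mult_distrib field_simps)
          also have "... \<le> (1 / \<tau>) * (1 / \<tau>\<^sup>2)" using \<tau> small(1) by (intro mult_right_mono) (auto simp: field_simps)
          also have "... = 1 / \<tau> ^ 3" by (simp add: power3_eq_cube power2_eq_square)
          finally show ?thesis .
        qed
        ultimately show "bnd (J0 J) (1 / \<tau> ^ 3) (%z. q z - q' z) (ball x \<tau>)" by (rule bnd_mono)
        fix y assume y: "y \<in> X \<inter> ball x \<tau>"
        have "norm (q y - q' y) \<le> norm (f y - q y) + norm (f y - q' y)" by (metis norm_minus_commute norm_triangle_sub add.commute diff_add_cancel norm_triangle_ineq dist_norm dist_triangle2 dist_commute)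
        also have "... \<le> rr (Suc n) ^ kk J + rr n ^ kk J" using g y sub unfolding Good_def by (intro add_mono) auto
        also have "... \<le> 2 * (rr n ^ kk J)" using rr0[of n] by (auto intro!: power_mono)
        also have "... = 2 * 4 ^ kk J * \<tau> ^ kk J" using \<tau> by (simp add: power_mult_distrib)
        also have "... \<le> 2 * 4 ^ kk J * (\<tau> ^ E0 J * \<tau>)"
        proof -
          have "\<tau> ^ kk J \<le> \<tau> ^ (E0 J + 1)" using kk(1)[of J] \<tau> small(1) by (intro power_decreasing) auto
          then show ?thesis by (intro mult_left_mono) (auto simp: mult.commute)
        qed
        also have "... = \<tau> ^ E0 J * (2 * 4 ^ kk J * \<tau>)" by simp
        also have "... \<le> \<tau> ^ E0 J * 1" using \<tau> small(3) by (intro mult_left_mono) (auto simp: field_simps)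
        finally show "norm (q y - q' y) \<le> \<tau> ^ E0 J" by simp
      qed
      then show "bnd J ((4 * ?d / 2 ^ n) ^ ex J) (%z. q z - q' z) (ball x (4 * ?d / 2 ^ n))" by (simp add: \<tau>_def)
    qed
    then show ?thesis by blast
  qed
  note evQ = this
  obtain j n0 where j: "mono_on {n0..} j" "!!k. \<exists>N\<ge>n0. \<forall>n\<ge>N. k \<le> j n" "!!n. n \<ge> n0 ==> Q (j n) n"
    by (rule slow_sequence[of Q, OF evQ]) (rule that)
  \<comment> \<open>The tolerance is stable under coarsening: a point within 2 d / 2^(n+1) of a
    level n+1 cube is within 2 d / 2^n of every level n cube that meets it. So the centre of a fine
    approximant also witnesses that a coarse one exists.\<close>
  define near where "near n \<mu> x \<longleftrightarrow> x \<in> X \<inter> ball x0 R & (\<exists>z\<in>cube n \<mu>. norm (x - z) \<le> 2 * ?d / 2 ^ n)" for n and \<mu> :: "'d => int" and x :: "real^'d"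
  \<comment> \<open>The default 0 over cubes away from \<open>X\<close> is never compared with
    anything.\<close>
  define p where "p n \<mu> = (if \<exists>x. near n \<mu> x then (SOME q. \<exists>x. near n \<mu> x & Good (j n) n q x) else (%z. 0))" for n and \<mu> :: "'d => int"
  have pgood: "\<exists>x. near n \<mu> x & Good (j n) n (p n \<mu>) x" if "near n \<mu> x" "n \<ge> n0" for n \<mu> x
  proof -
    have "\<exists>q x. near n \<mu> x & Good (j n) n q x" using j(3)[OF that(2)] that(1) unfolding Q_def near_def by blast
    from someI_ex[OF this] show ?thesis unfolding p_def using that by auto
  qed
  have psm: "smooth_on UNIV (p n \<mu>)" if "n \<ge> n0" for n \<mu>
  proof (cases "\<exists>x. near n \<mu> x")
    case True then show ?thesis using pgood that unfolding Good_def by blast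
  next
    case False
    then have "p n \<mu> = (%z. 0)" unfolding p_def by (rule if_not_P)
    then show ?thesis by (simp add: smooth_on_const)
  qed
  define active where "active n = {\<kappa> \<in> grid Z n. \<exists>x\<in>X \<inter> ball x0 R. x \<in> cube n \<kappa>}" for n
  have act_near: "near n \<kappa> x" if "x \<in> X \<inter> ball x0 R" "x \<in> cube n \<kappa>" for n \<kappa> x using that unfolding near_def by (auto intro!: bexI[of _ x])
  define tm where "tm n \<kappa> \<mu> = (%z. pu (Suc n) \<kappa> z * (pu n \<mu> z * (p (Suc n) \<kappa> z - p n \<mu> z)))" for n \<kappa> \<mu>
  \<comment> \<open>Inserting both partitions of unity writes \<open>EE (Suc n) - EE n\<close> as a
    sum over pairs of cubes. The fine cubes are restricted to those that meet \<open>X\<close>; at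
    points of \<open>X\<close> the others contribute nothing.\<close>
  define T where "T n = (%z. \<Sum>\<kappa>\<in>active (Suc n). \<Sum>\<mu>\<in>grid Z n. tm n \<kappa> \<mu> z)" for n
  define EE where "EE n = (%z. \<Sum>\<mu>\<in>grid Z n. pu n \<mu> z * p n \<mu> z)" for n
  have finact: "finite (active n)" for n unfolding active_def by (rule finite_subset[OF _ finite_grid[of Z n]]) auto
  have tsm: "smooth_on UNIV (tm n \<kappa> \<mu>)" if "n \<ge> n0" for n \<kappa> \<mu>
    unfolding tm_def using that by (intro smooth_on_mult[OF open_UNIV] smooth_on_diff[OF open_UNIV] pu_smooth psm) auto
  have Tsm: "smooth_on UNIV (T n)" if "n \<ge> n0" for n
    unfolding T_def by (intro smooth_on_sum[OF open_UNIV] tsm that)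
  have Esm: "smooth_on UNIV (EE n)" if "n \<ge> n0" for n
    unfolding EE_def using that by (intro smooth_on_sum[OF open_UNIV] smooth_on_mult[OF open_UNIV] pu_smooth psm)
  have tb: "bnd J ((2 ^ J * (2 ^ J * (Ap J * 2 ^ (J * CARD('d)) * Ap J))) * ((2 ^ n) ^ (2 * (J * CARD('d)))) * (4 * ?d / 2 ^ n) ^ ex J) (tm n \<kappa> \<mu>) UNIV"
    if n: "n \<ge> n0" and J: "J = j n" and \<kappa>: "\<kappa> \<in> active (Suc n)" for n \<kappa> \<mu> J
  proof -
    let ?K = "cube (Suc n) \<kappa> \<inter> cube n \<mu>"
    let ?\<tau> = "4 * ?d / 2 ^ n"
    have cl: "closed ?K" using closed_cube by blast
    have B1: "0 \<le> Ap J * (2 ^ Suc n) ^ (J * CARD('d))" "0 \<le> Ap J * (2 ^ n) ^ (J * CARD('d))" "0 \<le> ?\<tau> ^ ex J" using Ap(1)[of J] by auto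
    have eq: "(2 ^ J * (2 ^ J * (Ap J * 2 ^ (J * CARD('d)) * Ap J))) * ((2 ^ n) ^ (2 * (J * CARD('d)))) * ?\<tau> ^ ex J
       = 2 ^ J * ((Ap J * (2 ^ Suc n) ^ (J * CARD('d))) * (2 ^ J * ((Ap J * (2 ^ n) ^ (J * CARD('d))) * ?\<tau> ^ ex J)))"
    proof -
      have "((2::real) ^ n) ^ (2 * (J * CARD('d))) = (2 ^ n) ^ (J * CARD('d)) * (2 ^ n) ^ (J * CARD('d))" by (simp add: mult_2 power_add)
      moreover have "((2::real) ^ Suc n) ^ (J * CARD('d)) = 2 ^ (J * CARD('d)) * (2 ^ n) ^ (J * CARD('d))" by (simp add: power_mult_distrib)
      ultimately show ?thesis by (simp only: mult_ac)
    qed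
    show ?thesis unfolding eq
    proof (rule bnd_off_support[OF cl])
      show "tm n \<kappa> \<mu> z = 0" if "z \<notin> ?K" for z using that pu_support[of z "Suc n" \<kappa>] pu_support[of z n \<mu>] unfolding tm_def by auto
      show "bnd J (2 ^ J * ((Ap J * (2 ^ Suc n) ^ (J * CARD('d))) * (2 ^ J * ((Ap J * (2 ^ n) ^ (J * CARD('d))) * ?\<tau> ^ ex J)))) (tm n \<kappa> \<mu>) (UNIV \<inter> ?K)"
      proof (cases "?K = {}")
        case True
        have "bnd J c F {}" for c and F :: "real^'d => complex" by (subst bnd_pointwise) simp
        then show ?thesis using True by simp
      next
        case False
        then obtain z where z: "z \<in> cube (Suc n) \<kappa>" "z \<in> cube n \<mu>" by blast
        obtain xa where xa: "xa \<in> X \<inter> ball x0 R" "xa \<in> cube (Suc n) \<kappa>" using \<kappa> unfolding active_def by blast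
        obtain x where x: "near (Suc n) \<kappa> x" "Good (j (Suc n)) (Suc n) (p (Suc n) \<kappa>) x" using pgood[OF act_near[OF xa]] n by auto
        have d2: "2 * ?d / 2 ^ Suc n = ?d / 2 ^ n" by simp
        obtain y where y: "y \<in> cube (Suc n) \<kappa>" "norm (x - y) \<le> ?d / 2 ^ n" using x(1) unfolding near_def d2 by blast
        have c1: "norm (w - w') \<le> ?d / 2 ^ n" if "w \<in> cube (Suc n) \<kappa>" "w' \<in> cube (Suc n) \<kappa>" for w w' using cube_dist[OF that] d2 by simp
        have xz: "norm (x - z) \<le> 2 * ?d / 2 ^ n" using y c1[OF y(1) z(1)] norm_triangle_ineq[of "x - y" "y - z"] by simp
        have "near n \<mu> x" unfolding near_def using x(1) z xz unfolding near_def by blast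
        from pgood[OF this n] obtain x' where x': "near n \<mu> x'" "Good (j n) n (p n \<mu>) x'" by blast
        obtain z' where z': "z' \<in> cube n \<mu>" "norm (x' - z') \<le> 2 * ?d / 2 ^ n" using x'(1) unfolding near_def by blast
        have zz: "norm (z - z') \<le> 2 * ?d / 2 ^ n" by (rule cube_dist[OF z(2) z'(1)])
        have "norm (x - x') \<le> norm (x - z) + norm (z - z') + norm (x' - z')"
          by (smt (verit) norm_minus_commute norm_triangle_ineq diff_add_cancel add_diff_eq norm_triangle_ineq4 dist_norm dist_triangle)
        also have "... \<le> 2 * ?d / 2 ^ n + 2 * ?d / 2 ^ n + 2 * ?d / 2 ^ n" using xz zz z' by (intro add_mono) auto
        finally have xx': "norm (x - x') \<le> 6 * ?d / 2 ^ n" by simp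
        have Qn: "Q (j n) n" "Q (j (Suc n)) (Suc n)" using j(3) n by auto
        \<comment> \<open>Since \<open>j\<close> increases, an approximant of level
          \<open>Suc n\<close>, good to order \<open>j (Suc n)\<close>, is also good to order
          \<open>j n\<close> and can be compared with one of level \<open>n\<close>.\<close>
        have jm: "j n \<le> j (Suc n)" using j(1) n by (auto intro: mono_onD)
        have g: "Good (j n) (Suc n) (p (Suc n) \<kappa>) x"
        proof -
          have "rr (Suc n) ^ kk (j (Suc n)) \<le> rr (Suc n) ^ kk (j n)"
            using Qn(2) rr0(1)[of "Suc n"] kkm(1)[OF jm] unfolding Q_def by (intro power_decreasing) auto
          then show ?thesis using x(2) kkm(2)[OF jm] unfolding Good_def by (meson bnd_le order_trans)
        qed
        have xR: "x \<in> X \<inter> ball x0 R" using x(1) unfolding near_def by blast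
        have sb: "bnd J (?\<tau> ^ ex J) (%w. p (Suc n) \<kappa> w - p n \<mu> w) (ball x ?\<tau>)"
          using Qn(1) xR g x'(2) xx' unfolding Q_def J by blast
        have Ksub: "?K \<subseteq> ball x ?\<tau>"
        proof
          fix w assume "w \<in> ?K"
          then have "norm (x - w) \<le> 2 * ?d / 2 ^ n" using y c1[OF y(1), of w] norm_triangle_ineq[of "x - y" "y - w"] by simp
          also have "... < ?\<tau>" using d1 by (intro divide_strict_right_mono) auto
          finally show "w \<in> ball x ?\<tau>" by (simp add: dist_norm)
        qed
        have ps: "smooth_on UNIV (%w. p (Suc n) \<kappa> w - p n \<mu> w)" using psm n by (intro smooth_on_diff[OF open_UNIV]) auto
        have m1: "bnd J (2 ^ J * ((Ap J * (2 ^ n) ^ (J * CARD('d))) * ?\<tau> ^ ex J)) (%w. pu n \<mu> w * (p (Suc n) \<kappa> w - p n \<mu> w)) ?K"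
          by (rule bnd_mult[OF open_UNIV subset_UNIV bnd_subset[OF Ap(2) subset_UNIV] bnd_subset[OF sb Ksub] pu_smooth ps B1(2,3)])
        show ?thesis unfolding tm_def Int_UNIV_left
          by (rule bnd_mult[OF open_UNIV subset_UNIV bnd_subset[OF Ap(2) subset_UNIV] m1 pu_smooth smooth_on_mult[OF open_UNIV pu_smooth ps] B1(1)])
             (use B1 in auto)
      qed
    qed (use B1 Ap(1)[of J] in auto)
  qed
  have Tb: "bnd (j n) (1 / 2 ^ n) (T n) UNIV" if n: "n \<ge> n0" for n
  proof -
    define J where "J = j n"
    define c where "c = (2 ^ J * (2 ^ J * (Ap J * 2 ^ (J * CARD('d)) * Ap J))) * ((2 ^ n) ^ (2 * (J * CARD('d)))) * (4 * ?d / 2 ^ n) ^ ex J"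
    have c0: "0 \<le> c" unfolding c_def using Ap(1)[of J] by auto
    have "bnd J (\<Sum>\<kappa>\<in>active (Suc n). \<Sum>\<mu>\<in>(grid Z n :: ('d => int) set). c) (T n) UNIV"
      unfolding T_def
      by (intro bnd_sum[OF open_UNIV subset_UNIV] finact finite_grid smooth_on_sum[OF open_UNIV] tsm n)
         (use tb[OF n J_def] in \<open>simp add: c_def\<close>)
    moreover have "(\<Sum>\<kappa>\<in>active (Suc n). \<Sum>\<mu>\<in>(grid Z n :: ('d => int) set). c) \<le> 1 / 2 ^ n"
    proof -
      have ca: "real (card (active (Suc n))) \<le> cZ * (2 ^ n) ^ CARD('d)"
        using cardg(2)[of n] card_mono[OF finite_grid[of Z "Suc n"], of "active (Suc n)"] unfolding active_def by auto
      have "(\<Sum>\<kappa>\<in>active (Suc n). \<Sum>\<mu>\<in>(grid Z n :: ('d => int) set). c) = real (card (active (Suc n))) * (real (card (grid Z n :: ('d => int) set)) * c)" by simp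
      also have "... \<le> (cZ * (2 ^ n) ^ CARD('d)) * ((cZ * (2 ^ n) ^ CARD('d)) * c)"
        using ca cardg(1)[of n] c0 cZ1 by (intro mult_mono) auto
      also have "... = Cst J / (2 ^ n)\<^sup>2"
      proof -
        have "((2::real) ^ n) ^ ex J = (2 ^ n) ^ (2 * (J * CARD('d))) * ((2 ^ n) ^ CARD('d) * (2 ^ n) ^ CARD('d)) * (2 ^ n)\<^sup>2"
          unfolding ex_def by (simp add: power_add mult_2 power2_eq_square)
        then show ?thesis unfolding c_def Cst_def by (simp add: power_divide field_simps)
      qed
      also have "... \<le> 2 ^ n / (2 ^ n)\<^sup>2" using j(3)[OF n] unfolding Q_def J_def by (intro divide_right_mono) auto
      also have "... = 1 / 2 ^ n" by (simp add: power2_eq_square)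
      finally show ?thesis .
    qed
    ultimately show ?thesis unfolding J_def by (rule bnd_mono)
  qed
  have sumT: "summable (%i. T (n0 + i) z)" for z
  proof (rule summable_comparison_test')
    show "summable (%i. (1/2 :: real) ^ i)" by (rule summable_geometric) simp
    show "norm (T (n0 + i) z) \<le> (1/2) ^ i" for i
    proof -
      have "norm (T (n0 + i) z) \<le> 1 / 2 ^ (n0 + i)" using bnd_norm[OF Tb] by simp
      also have "... \<le> 1 / 2 ^ i" by (intro divide_left_mono power_increasing) auto
      finally show ?thesis by (simp add: power_divide)
    qed
  qed
  define F where "F z = EE n0 z + (\<Sum>i. T (n0 + i) z)" for z
  have "smooth_on (ball x0 R) F"
    unfolding smooth_on_def
  proof
    fix k
    obtain N where N: "N \<ge> n0" "!!n. n \<ge> N ==> Suc k \<le> j n" using j(2) by blast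
    have "Ck k (%z. \<Sum>i. T (N + i) z) (ball x0 R)"
    proof (rule bnd_series_Ck[where b="%i. (1/2) ^ i"])
      show "smooth_on (ball x0 R) (T (N + n))" for n using smooth_on_subset[OF Tsm] N by auto
      show "bnd (Suc k) ((1/2) ^ n) (T (N + n)) (ball x0 R)" for n
      proof (rule bnd_mono[OF bnd_le[OF bnd_subset[OF Tb subset_UNIV] N(2)]])
        show "1 / 2 ^ (N + n) \<le> (1/2 :: real) ^ n" unfolding power_divide by (auto intro!: divide_left_mono power_increasing)
      qed (use N in auto)
    qed (use R in \<open>auto intro: summable_geometric\<close>)
    moreover have "smooth_on UNIV (%z. EE n0 z + (\<Sum>i<N - n0. T (n0 + i) z))"
      by (intro smooth_on_add[OF open_UNIV] smooth_on_sum[OF open_UNIV] Esm Tsm) auto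
    from Ck_subset[OF smooth_onD[OF this] subset_UNIV]
    have "Ck k (%z. EE n0 z + (\<Sum>i<N - n0. T (n0 + i) z)) (ball x0 R)" .
    ultimately have "Ck k (%z. EE n0 z + (\<Sum>i<N - n0. T (n0 + i) z) + (\<Sum>i. T (N + i) z)) (ball x0 R)"
      by (rule_tac Ck_add[OF open_ball])
    then show "Ck k F (ball x0 R)"
    proof (rule Ck_cong[OF open_ball, rotated])
      fix z
      have "(\<Sum>i. T (n0 + i) z) = (\<Sum>i. T (n0 + (i + (N - n0))) z) + (\<Sum>i<N - n0. T (n0 + i) z)"
        using suminf_split_initial_segment[OF sumT] .
      moreover have "n0 + (i + (N - n0)) = N + i" for i using N(1) by simp
      ultimately show "EE n0 z + (\<Sum>i<N - n0. T (n0 + i) z) + (\<Sum>i. T (N + i) z) = F z" unfolding F_def by simp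
    qed
  qed
  moreover have "F y = f y" if y: "y \<in> X \<inter> ball x0 R" for y
  proof -
    have pus: "(\<Sum>\<mu>\<in>grid Z n. pu n \<mu> y) = 1" for n using pu_sum[OF nz] y by blast
    have pua: "(\<Sum>\<mu>\<in>active n. pu n \<mu> y * h \<mu>) = (\<Sum>\<mu>\<in>grid Z n. pu n \<mu> y * h \<mu>)" for n h
      using y pu_support[of y n] by (intro sum.mono_neutral_left finite_grid) (auto simp: active_def)
    have tel: "T n y = EE (Suc n) y - EE n y" for n
    proof -
      have "T n y = (\<Sum>\<kappa>\<in>active (Suc n). pu (Suc n) \<kappa> y * (\<Sum>\<mu>\<in>grid Z n. pu n \<mu> y * (p (Suc n) \<kappa> y - p n \<mu> y)))"
        unfolding T_def tm_def by (simp add: sum_distrib_left)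
      also have "... = (\<Sum>\<kappa>\<in>grid Z (Suc n). pu (Suc n) \<kappa> y * (\<Sum>\<mu>\<in>grid Z n. pu n \<mu> y * (p (Suc n) \<kappa> y - p n \<mu> y)))"
        by (rule pua)
      also have "... = (\<Sum>\<kappa>\<in>grid Z (Suc n). pu (Suc n) \<kappa> y * (p (Suc n) \<kappa> y - EE n y))"
      proof (intro sum.cong refl)
        fix \<kappa>
        have "(\<Sum>\<mu>\<in>grid Z n. pu n \<mu> y * (p (Suc n) \<kappa> y - p n \<mu> y)) = (\<Sum>\<mu>\<in>grid Z n. pu n \<mu> y) * p (Suc n) \<kappa> y - EE n y"
          unfolding EE_def by (simp add: right_diff_distrib sum_subtractf sum_distrib_right)
        then show "pu (Suc n) \<kappa> y * (\<Sum>\<mu>\<in>grid Z n. pu n \<mu> y * (p (Suc n) \<kappa> y - p n \<mu> y)) = pu (Suc n) \<kappa> y * (p (Suc n) \<kappa> y - EE n y)"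
          unfolding pus by simp
      qed
      also have "... = EE (Suc n) y - (\<Sum>\<kappa>\<in>grid Z (Suc n). pu (Suc n) \<kappa> y) * EE n y"
        unfolding EE_def[of "Suc n"] by (simp add: right_diff_distrib sum_subtractf sum_distrib_right)
      finally show ?thesis unfolding pus by simp
    qed
    obtain N where N: "N \<ge> n0" "!!n. n \<ge> N ==> CARD('d) \<le> j n" using j(2) by blast
    define c where "c = cZ * (Ap 0 * (16 * ?d) ^ (CARD('d) + 1))"
    \<comment> \<open>There are of the order 2^(n d) cubes and each approximant errs by at most
      \<open>rr n ^ (d + 1)\<close> at \<open>y\<close>, which leaves a multiple of 2^(-n).\<close>
    have Ef: "norm (EE n y - f y) \<le> c / 2 ^ n" if n: "n \<ge> N" for n
    proof -
      have n0: "n \<ge> n0" using n N by simp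
      have "EE n y - f y = (\<Sum>\<mu>\<in>grid Z n. pu n \<mu> y * (p n \<mu> y - f y))"
        unfolding EE_def right_diff_distrib sum_subtractf sum_distrib_right[symmetric] pus by simp
      also have "norm ... \<le> (\<Sum>\<mu>\<in>(grid Z n :: ('d => int) set). Ap 0 * rr n ^ (CARD('d) + 1))"
      proof (rule sum_norm_le)
        fix \<mu> :: "'d => int"
        show "norm (pu n \<mu> y * (p n \<mu> y - f y)) \<le> Ap 0 * rr n ^ (CARD('d) + 1)"
        proof (cases "y \<in> cube n \<mu>")
          case False
          then have "pu n \<mu> y = 0" by (rule pu_support)
          then show ?thesis using Ap(1)[of 0] rr0(1)[of n] by simp
        next
          case True
          obtain x where x: "near n \<mu> x" "Good (j n) n (p n \<mu>) x" using pgood[OF act_near[OF y True] n0] by blast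
          obtain z where z: "z \<in> cube n \<mu>" "norm (x - z) \<le> 2 * ?d / 2 ^ n" using x(1) unfolding near_def by blast
          have "norm (x - y) \<le> norm (x - z) + norm (z - y)" using norm_triangle_ineq[of "x - z" "z - y"] by simp
          also have "... \<le> 2 * ?d / 2 ^ n + 2 * ?d / 2 ^ n" using z cube_dist[OF z(1) True] by (intro add_mono) auto
          also have "... = (4 * ?d) / 2 ^ n" by simp
          also have "... < rr n" unfolding rr_def using d1 by (intro divide_strict_right_mono) auto
          finally have "y \<in> X \<inter> ball x (rr n)" using y by (simp add: dist_norm)
          then have "norm (f y - p n \<mu> y) \<le> rr n ^ kk (j n)" using x(2) unfolding Good_def by blast
          also have "... \<le> rr n ^ (CARD('d) + 1)"
          proof (rule power_decreasing)
            have "(\<Sum>i\<le>j n. 1) \<le> kk (j n)" unfolding kk_def by (intro sum_mono) simp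
            then show "CARD('d) + 1 \<le> kk (j n)" using N(2)[OF n] by simp
            show "rr n \<le> 1" using j(3)[OF n0] unfolding Q_def by blast
          qed (use rr0(1)[of n] in simp)
          finally have "norm (p n \<mu> y - f y) \<le> rr n ^ (CARD('d) + 1)" by (simp add: norm_minus_commute)
          moreover have "norm (pu n \<mu> y) \<le> Ap 0" using bnd_norm[OF Ap(2)[of 0 n \<mu>]] by simp
          ultimately show ?thesis unfolding norm_mult using Ap(1)[of 0] by (intro mult_mono) auto
        qed
      qed
      also have "... = real (card (grid Z n :: ('d => int) set)) * (Ap 0 * rr n ^ (CARD('d) + 1))" by simp
      also have "... \<le> (cZ * (2 ^ n) ^ CARD('d)) * (Ap 0 * rr n ^ (CARD('d) + 1))"
        using cardg(1)[of n] Ap(1)[of 0] rr0(1)[of n] by (intro mult_right_mono) auto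
      also have "... = c / 2 ^ n" unfolding c_def rr_def power_divide by (simp add: field_simps)
      finally show ?thesis .
    qed
    have "(%n. EE n y) \<longlonglongrightarrow> f y"
    proof (rule LIMSEQ_I)
      fix e :: real assume e: "0 < e"
      obtain M where M: "!!n. n \<ge> M ==> \<bar>c\<bar> / e + 1 \<le> 2 ^ n" using pow2_eventually_small by blast
      have "norm (EE n y - f y) < e" if "n \<ge> max N M" for n
      proof -
        have "norm (EE n y - f y) \<le> c / 2 ^ n" using Ef that by simp
        moreover have "c / 2 ^ n < e"
        proof -
          have "\<bar>c\<bar> / e < 2 ^ n" using M[of n] that by simp
          then have "\<bar>c\<bar> < 2 ^ n * e" using e by (simp add: divide_less_eq)
          then show ?thesis by (simp add: divide_less_eq mult.commute)
        qed
        ultimately show ?thesis by linarith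
      qed
      then show "\<exists>no. \<forall>n\<ge>no. norm (EE n y - f y) < e" by blast
    qed
    then have "(%m. EE (m + n0) y - EE n0 y) \<longlonglongrightarrow> f y - EE n0 y"
      by (intro tendsto_diff tendsto_const LIMSEQ_ignore_initial_segment)
    moreover have "(\<Sum>i<m. T (n0 + i) y) = EE (m + n0) y - EE n0 y" for m
      by (induction m) (auto simp: tel add.commute)
    ultimately have "(%i. T (n0 + i) y) sums (f y - EE n0 y)" unfolding sums_def by simp
    from sums_unique[OF this, symmetric] show ?thesis unfolding F_def by (simp only: add_diff_eq add_diff_cancel_left')
  qed
  ultimately show ?thesis by blast
qed

section \<open>Regular sets satisfy the theorem\<close>

definition reg :: "(real^'d) set => bool" where
  "reg X \<longleftrightarrow> (\<forall>x0\<in>X. \<exists>n. \<exists>\<delta>>0. \<forall>x\<in>X \<inter> ball x0 \<delta>. dagger X x n)"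

text \<open>\<open>approx\<close> supplies hypothesis A of \<open>extension_theorem\<close> and
  \<open>cmp_ex\<close> supplies B; the radius is shrunk so that the extensions exist, and
  \<open>dagger\<close> holds with one \<open>n\<close>, at all points involved.\<close>

theorem root_in_Cinf:
  fixes X :: "(real^'d) set" and f g :: "real^'d => complex"
  assumes reg: "reg X" and X: "X = closure (interior X)" and m: "m \<ge> 1" and C: "C > 0" and \<alpha>: "\<alpha> > 0"
    and ext: "g \<in> Cinf X" "(%x. f x * g x) \<in> Cinf X" "(%x. f x ^ m) \<in> Cinf X"
    and le: "\<forall>x\<in>X. cmod (f x) \<le> C * cmod (g x) powr \<alpha>"
  shows "f \<in> Cinf X"
  unfolding Cinf_def
proof (intro CollectI ballI)
  fix x0 assume x0: "x0 \<in> X"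
  obtain V1 G where G: "open V1" "x0 \<in> V1" "smooth_on V1 G" "\<forall>y\<in>V1 \<inter> X. G y = g y" using ext(1) x0 unfolding Cinf_def by blast
  obtain V2 H where H: "open V2" "x0 \<in> V2" "smooth_on V2 H" "\<forall>y\<in>V2 \<inter> X. H y = f y * g y" using ext(2) x0 unfolding Cinf_def by blast
  obtain V3 P where P: "open V3" "x0 \<in> V3" "smooth_on V3 P" "\<forall>y\<in>V3 \<inter> X. P y = f y ^ m" using ext(3) x0 unfolding Cinf_def by blast
  define V where "V = V1 \<inter> V2 \<inter> V3"
  have V: "open V" "x0 \<in> V" using G H P by (auto simp: V_def)
  obtain e where e: "e > 0" "ball x0 e \<subseteq> V" using V open_contains_ball by blast
  define r where "r = e / 2"
  interpret root_data X V x0 r f G H P m C \<alpha>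
  proof
    show "0 < r" using e by (simp add: r_def)
    show "ball x0 (2 * r) \<subseteq> V" using e by (simp add: r_def)
    show "smooth_on V G" "smooth_on V H" "smooth_on V P" unfolding V_def by (rule smooth_on_subset[OF G(3)] smooth_on_subset[OF H(3)] smooth_on_subset[OF P(3)]; blast)+
    show "f x * G x = H x" if "x \<in> X \<inter> V" for x using that G(4) H(4) by (auto simp: V_def)
    show "f x ^ m = P x" if "x \<in> X \<inter> V" for x using that P(4) by (auto simp: V_def)
    show "norm (f x) \<le> C * norm (G x) powr \<alpha>" if "x \<in> X \<inter> V" for x using that le G(4) by (auto simp: V_def)
  qed (use V m C \<alpha> X in auto)
  obtain n \<delta> where n: "\<delta> > 0" "!!x. x\<in>X \<inter> ball x0 \<delta> ==> dagger X x n" using reg x0 unfolding reg_def by blast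
  define R where "R = min (r/2) (\<delta>/2)"
  have R: "0 < R" "R \<le> r/2" "R \<le> \<delta>/2" using r n by (auto simp: R_def)
  have "\<exists>F. smooth_on (ball x0 R) F & (\<forall>y\<in>X \<inter> ball x0 R. F y = f y)"
  proof (rule extension_theorem[OF R(1)])
    fix k K
    obtain \<rho>0 where \<rho>0: "\<rho>0 > 0" "\<forall>x\<in>X \<inter> ball x0 (r/2). \<forall>\<rho>. 0 < \<rho> --> \<rho> < \<rho>0 -->
     (\<exists>q. smooth_on UNIV q & (\<forall>y\<in>X \<inter> ball x \<rho>. norm (f y - q y) \<le> \<rho> ^ k) & bnd K (1 / \<rho>\<^sup>2) q (ball x \<rho>))"
      using approx[of k K] by (elim exE conjE)
    have "X \<inter> ball x0 R \<subseteq> X \<inter> ball x0 (r/2)" using R by auto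
    with \<rho>0 show "\<exists>\<rho>0>0. \<forall>x\<in>X \<inter> ball x0 R. \<forall>\<rho>. 0 < \<rho> --> \<rho> < \<rho>0 -->
     (\<exists>q. smooth_on UNIV q & (\<forall>y\<in>X \<inter> ball x \<rho>. norm (f y - q y) \<le> \<rho> ^ k) & bnd K (1 / \<rho>\<^sup>2) q (ball x \<rho>))"
      by (intro exI[of _ \<rho>0] conjI ballI) (auto dest: subsetD)
  next
    fix k a
    obtain E J \<tau>0 where B: "0 < \<tau>0" "\<forall>(X::(real^'d) set) x \<tau> F. 0 < \<tau> --> \<tau> \<le> \<tau>0 --> x \<in> X --> (\<forall>y\<in>X \<inter> ball x \<tau>. dagger X y n) -->
     smooth_on UNIV F --> bnd J (1/\<tau>^3) F (ball x \<tau>) --> (\<forall>y\<in>X \<inter> ball x \<tau>. norm (F y :: complex) \<le> \<tau> ^ E) --> bnd k (\<tau> ^ a) F (ball x \<tau>)"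
      using cmp_ex[where 'd='d and n=n and k=k and a=a] by (elim exE conjE)
    have "bnd k (\<tau> ^ a) F (ball x \<tau>)" if "x \<in> X \<inter> ball x0 R" "0 < \<tau>" "\<tau> \<le> min \<tau>0 (\<delta>/2)" "smooth_on UNIV F" "bnd J (1/\<tau>^3) F (ball x \<tau>)"
        "\<forall>y\<in>X \<inter> ball x \<tau>. norm (F y :: complex) \<le> \<tau> ^ E" for x \<tau> F
    proof -
      have "dagger X y n" if y: "y \<in> X \<inter> ball x \<tau>" for y
      proof (rule n(2))
        show "y \<in> X \<inter> ball x0 \<delta>"
          using y \<open>x \<in> X \<inter> ball x0 R\<close> \<open>\<tau> \<le> min \<tau>0 (\<delta>/2)\<close> R(3) dist_triangle[of x0 y x] by auto
      qed
      then show ?thesis using B(2)[rule_format, of \<tau> x X F] that by auto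
    qed
    then have "0 < min \<tau>0 (\<delta>/2) & (\<forall>x\<in>X \<inter> ball x0 R. \<forall>\<tau> F. 0 < \<tau> --> \<tau> \<le> min \<tau>0 (\<delta>/2) --> 
     smooth_on UNIV F --> bnd J (1/\<tau>^3) F (ball x \<tau>) --> (\<forall>y\<in>X \<inter> ball x \<tau>. norm (F y :: complex) \<le> \<tau> ^ E) --> bnd k (\<tau> ^ a) F (ball x \<tau>))"
      using B(1) n(1) by simp
    then show "\<exists>E J \<tau>0. 0 < \<tau>0 & (\<forall>x\<in>X \<inter> ball x0 R. \<forall>\<tau> F. 0 < \<tau> --> \<tau> \<le> \<tau>0 --> 
     smooth_on UNIV F --> bnd J (1/\<tau>^3) F (ball x \<tau>) --> (\<forall>y\<in>X \<inter> ball x \<tau>. norm (F y :: complex) \<le> \<tau> ^ E) --> bnd k (\<tau> ^ a) F (ball x \<tau>))"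
      by (intro exI)
  qed
  then obtain F where "smooth_on (ball x0 R) F" "\<forall>y\<in>X \<inter> ball x0 R. F y = f y" by blast
  then show "\<exists>V F. open V & x0 \<in> V & smooth_on V F & (\<forall>y\<in>V \<inter> X. F y = f y)"
    using R(1) by (intro exI[of _ "ball x0 R"] exI[of _ F]) auto
qed

section \<open>Hoelder sets are regular\<close>

lemma det_scaled_isometry:
  fixes A :: "real^'d => real^'d"
  assumes "orthogonal_transformation A"
  shows "\<bar>det (\<chi> j. A (s *\<^sub>R axis j 1))\<bar> = \<bar>s\<bar> ^ CARD('d)"
proof -
  have lin: "linear A" using assms orthogonal_transformation_linear by blast
  have "(\<chi> j. A (s *\<^sub>R axis j 1)) = (\<chi> j. s *s (transpose (matrix A)) $ j)"
    using linear_scale[OF lin] by (simp add: vec_eq_iff transpose_def matrix_def)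
  then have "det (\<chi> j. A (s *\<^sub>R axis j 1)) = s ^ CARD('d) * det (transpose (matrix A))"
    using det_rows_mul[of "%_. s" "%j. transpose (matrix A) $ j"] by simp
  moreover have "orthogonal_matrix (matrix A)" using assms orthogonal_transformation_matrix by blast
  then have "\<bar>det (transpose (matrix A))\<bar> = 1" using det_orthogonal_matrix[of "matrix A"] by (auto simp: det_transpose)
  ultimately show ?thesis by (simp add: abs_mult power_abs)
qed

text \<open>A rotated corner with d orthogonal edges of length \<open>s\<close> has determinant s^d
  in absolute value. With \<sigma> = s the shape condition reduces to s \<le> n \<rho>.\<close>

lemma dagger_from_frame:
  fixes X :: "(real^'d) set" and A :: "real^'d => real^'d"
  assumes A: "orthogonal_transformation A" and n: "1 \<le> n"
    and "!!\<rho>. 0 < \<rho> ==> real n * \<rho> \<le> 1 ==> \<exists>u s. 0 < s & s \<le> \<rho> * real n & norm u + s \<le> real n * \<rho> & \<rho> ^ n \<le> s ^ CARD('d) &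
       x + A u \<in> X & (\<forall>j::'d. x + A (u + s *\<^sub>R axis j 1) \<in> X)"
  shows "dagger X x n"
  unfolding dagger_def
proof (intro allI impI)
  fix \<rho> :: real assume \<rho>: "0 < \<rho>" "real n * \<rho> \<le> 1"
  obtain u s where us: "0 < s" "s \<le> \<rho> * real n" "norm u + s \<le> real n * \<rho>" "\<rho> ^ n \<le> s ^ CARD('d)" "x + A u \<in> X" "!!j::'d. x + A (u + s *\<^sub>R axis j 1) \<in> X"
    using assms(3)[OF \<rho>] by blast
  have lin: "linear A" using A orthogonal_transformation_linear by blast
  have nA: "norm (A v) = norm v" for v using A orthogonal_transformation_norm by blast
  have d: "x + A (u + s *\<^sub>R axis j 1) - (x + A u) = A (s *\<^sub>R axis j 1)" for j :: 'd using linear_add[OF lin] by simp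
  have det: "\<bar>det (\<chi> j. x + A (u + s *\<^sub>R axis j 1) - (x + A u))\<bar> = s ^ CARD('d)"
    unfolding d using det_scaled_isometry[OF A, of s] us by simp
  show "\<exists>b0 (b :: 'd => real^'d) \<sigma>. b0 \<in> X & (\<forall>j. b j \<in> X) & norm (b0 - x) \<le> real n * \<rho> & (\<forall>j. norm (b j - x) \<le> real n * \<rho>)
      & 0 < \<sigma> & \<sigma> \<le> 1 & (\<forall>j. norm (b j - b0) \<le> \<sigma>)
      & \<sigma> ^ (CARD('d) + 1) \<le> real n * \<rho> * \<bar>det (\<chi> j. b j - b0)\<bar> & \<rho> ^ n \<le> \<bar>det (\<chi> j. b j - b0)\<bar>"
  proof (intro exI[of _ "x + A u"] exI[of _ "%j. x + A (u + s *\<^sub>R axis j 1)"] exI[of _ s] conjI allI)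
    show "norm (x + A u - x) \<le> real n * \<rho>" using us nA[of u] by simp
    show "norm (x + A (u + s *\<^sub>R axis j 1) - x) \<le> real n * \<rho>" for j
    proof -
      have "norm (u + s *\<^sub>R axis j 1) \<le> norm u + s" using norm_triangle_ineq[of u "s *\<^sub>R axis j 1"] us(1) by (simp add: norm_axis_1)
      then show ?thesis using us nA[of "u + s *\<^sub>R axis j 1"] by simp
    qed
    show "s \<le> 1" using us \<rho> by (simp add: mult.commute)
    show "norm (x + A (u + s *\<^sub>R axis j 1) - (x + A u)) \<le> s" for j unfolding d nA using us(1) by (simp add: norm_axis_1)
    show "s ^ (CARD('d) + 1) \<le> real n * \<rho> * \<bar>det (\<chi> j. x + A (u + s *\<^sub>R axis j 1) - (x + A u))\<bar>"
      unfolding det using us by (auto simp: mult.commute intro!: mult_right_mono)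
    show "\<rho> ^ n \<le> \<bar>det (\<chi> j. x + A (u + s *\<^sub>R axis j 1) - (x + A u))\<bar>" unfolding det by fact
  qed (use us in auto)
qed

lemma axis_in_cusp:
  fixes k :: "'d::finite"
  assumes t: "0 < t" "t + s < h" and s: "0 < s" "s < r" "h * (s / r) powr \<alpha> < t" and h: "0 < h"
  shows "t *\<^sub>R axis k 1 \<in> cusp k \<alpha> r h" "t *\<^sub>R axis k 1 + s *\<^sub>R axis j 1 \<in> cusp k \<alpha> r h"
proof -
  have z: "(\<Sum>i\<in>UNIV - {k}. ((t *\<^sub>R axis k 1 :: real^'d) $ i)^2) = 0" by (intro sum.neutral) (auto simp: axis_def)
  show "t *\<^sub>R axis k 1 \<in> cusp k \<alpha> r h" unfolding cusp_def Let_def using t s by (simp add: z axis_def)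
  show "t *\<^sub>R axis k 1 + s *\<^sub>R axis j 1 \<in> cusp k \<alpha> r h"
  proof (cases "j = k")
    case True
    have "(\<Sum>i\<in>UNIV - {k}. ((t *\<^sub>R axis k 1 + s *\<^sub>R axis j 1 :: real^'d) $ i)^2) = 0" using True by (intro sum.neutral) (auto simp: axis_def)
    then show ?thesis unfolding cusp_def Let_def using t s True by (simp add: axis_def)
  next
    case False
    have "(\<Sum>i\<in>UNIV - {k}. ((t *\<^sub>R axis k 1 + s *\<^sub>R axis j 1 :: real^'d) $ i)^2) = (\<Sum>i\<in>UNIV - {k}. if i = j then s^2 else 0)"
      by (intro sum.cong) (auto simp: axis_def)
    also have "... = s^2" using False by (simp add: sum.delta)
    finally show ?thesis unfolding cusp_def Let_def using t s False by (simp add: axis_def)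
  qed
qed

lemma holder_reg:
  fixes X :: "(real^'d) set"
  assumes "holder_set X"
  shows "reg X"
  unfolding reg_def
proof
  fix x0 assume x0: "x0 \<in> X"
  obtain \<alpha> where \<alpha>: "0 < \<alpha>" "\<alpha> \<le> 1" "uniform_cusp (interior X) \<alpha>" and X: "X = closure (interior X)"
    using assms unfolding holder_set_def fat_def by blast
  show "\<exists>n. \<exists>\<delta>>0. \<forall>x\<in>X \<inter> ball x0 \<delta>. dagger X x n"
  proof (cases "x0 \<in> interior X")
    case True
    then obtain \<delta> where \<delta>: "\<delta> > 0" "ball x0 \<delta> \<subseteq> X" using open_contains_ball[of "interior X"] interior_subset by (metis open_interior order_trans)
    obtain n0 :: nat where n0: "2 / \<delta> < n0" using reals_Archimedean2 by blast
    define n where "n = n0 + CARD('d) + 1"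
    have "dagger X x n" if x: "x \<in> X \<inter> ball x0 (\<delta>/2)" for x
    proof (rule dagger_from_frame[OF orthogonal_transformation_id])
      fix \<rho> :: real assume \<rho>: "0 < \<rho>" "real n * \<rho> \<le> 1"
      have r1: "\<rho> \<le> real n * \<rho>" using \<rho>(1) by (simp add: n_def)
      have "(2 / \<delta>) * \<rho> < real n * \<rho>" using n0 \<rho>(1) by (intro mult_strict_right_mono) (auto simp: n_def)
      then have "(2 / \<delta>) * \<rho> < 1" using \<rho>(2) by linarith
      then have "\<rho> < \<delta>/2" using \<delta>(1) by (simp add: field_simps)
      then have mem: "x + \<rho> *\<^sub>R axis j 1 \<in> X" for j
        using x \<rho>(1) dist_triangle[of x0 "x + \<rho> *\<^sub>R axis j 1" x] by (intro subsetD[OF \<delta>(2)]) (auto simp: dist_norm norm_axis_1)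
      have "\<rho> \<le> 1" using r1 \<rho> by linarith
      then have "\<rho> ^ n \<le> \<rho> ^ CARD('d)" using \<rho>(1) by (intro power_decreasing) (auto simp: n_def)
      then show "\<exists>u s. 0 < s & s \<le> \<rho> * real n & norm u + s \<le> real n * \<rho> & \<rho> ^ n \<le> s ^ CARD('d) &
       x + u \<in> X & (\<forall>j. x + (u + s *\<^sub>R axis j 1) \<in> X)"
        using \<rho> r1 x mem by (intro exI[of _ 0] exI[of _ \<rho>]) (auto simp: mult.commute)
    qed (simp add: n_def)
    then show ?thesis using \<delta>(1) by (intro exI[of _ n] exI[of _ "\<delta>/2"]) auto
  next
    case False
    then have "x0 \<in> frontier (interior X)" using x0 X by (auto simp: frontier_def)
    obtain \<epsilon> r h and A :: "real^'d => real^'d" and k :: 'd where U: "\<epsilon> > 0" "r > 0" "h > 0" "orthogonal_transformation A"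
       "\<forall>y\<in>closure (interior X) \<inter> ball x0 \<epsilon>. (%z. y + A z) ` cusp k \<alpha> r h \<subseteq> interior X"
      using \<alpha>(3)[unfolded uniform_cusp_def, rule_format, OF \<open>x0 \<in> frontier (interior X)\<close>] by (elim exE conjE) (rule that)
    define c where "c = r * (1 / (2 * h)) powr (1/\<alpha>)"
    have c: "0 < c" using U by (simp add: c_def)
    \<comment> \<open>\<open>n1\<close> bounds s / \<rho>, \<open>n2\<close> keeps the corner below
      the top of the cusp, \<open>n3\<close> absorbs the constant c^d, and \<open>n4\<close> covers
      the exponent d / \<alpha> in the volume s^d.\<close>
    obtain n1 :: nat where n1: "r / (2 * h) < n1" using reals_Archimedean2 by blast
    obtain n2 :: nat where n2: "(1 + r / (2 * h)) / h < n2" using reals_Archimedean2 by blast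
    obtain n3 :: nat where n3: "1 / c ^ CARD('d) < n3" using reals_Archimedean2 by blast
    obtain n4 :: nat where n4: "real CARD('d) / \<alpha> < n4" using reals_Archimedean2 by blast
    define n where "n = n1 + n2 + n3 + n4 + 1"
    have "dagger X x n" if x: "x \<in> X \<inter> ball x0 \<epsilon>" for x
    proof (rule dagger_from_frame[OF U(4)])
      fix \<rho> :: real assume \<rho>: "0 < \<rho>" "real n * \<rho> \<le> 1"
      have le: "a * \<rho> < 1" "a * \<rho> \<le> real n * \<rho>" if "a < real m" "m \<le> n" for a m
      proof -
        have "a * \<rho> < real m * \<rho>" using that \<rho> by simp
        moreover have "real m * \<rho> \<le> real n * \<rho>" using that \<rho> by (intro mult_right_mono) auto
        ultimately show "a * \<rho> < 1" "a * \<rho> \<le> real n * \<rho>" using \<rho> by linarith+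
      qed
      have "1 \<le> real n" by (simp add: n_def)
      then have r1: "\<rho> \<le> 1" using \<rho> mult_right_mono[of 1 "real n" \<rho>] by linarith
      have l2: "(1 + r / (2 * h)) * \<rho> < h" using le(1)[OF n2] U(3) by (simp add: n_def field_simps)
      have "0 \<le> r / (2 * h) * \<rho>" using U(2,3) \<rho>(1) by simp
      then have h2: "\<rho> < h" using l2 by (simp only: distrib_right)
      \<comment> \<open>The half-width at which the cusp wall has height \<rho>/2. A corner based on
        the axis at height \<rho> with arms of this length therefore stays inside the cusp.\<close>
      define s where "s = r * (\<rho> / (2 * h)) powr (1/\<alpha>)"
      have q: "0 < \<rho> / (2 * h)" "\<rho> / (2 * h) < 1" using \<rho> U h2 by auto
      have "(\<rho> / (2 * h)) powr (1/\<alpha>) > 0" using q(1) by (subst powr_gt_zero) linarith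
      then have s0: "0 < s" using U(2) unfolding s_def by (rule mult_pos_pos[rotated])
      have "(\<rho> / (2 * h)) powr (1/\<alpha>) \<le> (\<rho> / (2 * h)) powr 1" using q \<alpha> by (intro powr_mono') auto
      then have pw: "(\<rho> / (2 * h)) powr (1/\<alpha>) \<le> \<rho> / (2 * h)" using q by simp
      have sle: "s \<le> r / (2 * h) * \<rho>" unfolding s_def using mult_left_mono[OF pw, of r] U by simp
      have "(\<rho> / (2 * h)) powr (1/\<alpha>) < 1" using pw q(2) by linarith
      then have sr: "s < r" unfolding s_def using mult_strict_left_mono[OF _ U(2)] by fastforce
      have ss: "s \<le> real n * \<rho>" using sle le(2)[OF n1] by (simp add: n_def)
      have hs: "h * (s / r) powr \<alpha> < \<rho>"
      proof -
        have "s / r = (\<rho> / (2 * h)) powr (1/\<alpha>)" using U by (simp add: s_def)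
        then have "(s / r) powr \<alpha> = \<rho> / (2 * h)" using \<alpha> q(1) U(3) \<rho>(1) by (simp add: powr_powr)
        then show ?thesis using U \<rho> by simp
      qed
      have ts: "\<rho> + s < h" using sle l2 by (simp add: distrib_right)
      have mem: "x + A z \<in> X" if "z \<in> cusp k \<alpha> r h" for z
        using U(5)[rule_format, of x] x X that interior_subset[of X] by auto
      have m1: "x + A (\<rho> *\<^sub>R axis k 1) \<in> X" "x + A (\<rho> *\<^sub>R axis k 1 + s *\<^sub>R axis j 1) \<in> X" for j
        using mem axis_in_cusp[OF \<rho>(1) ts s0 sr hs U(3)] by blast+
      have nn: "norm (\<rho> *\<^sub>R axis k (1::real)) + s \<le> real n * \<rho>"
      proof -
        have "\<rho> + s \<le> (1 + real n1) * \<rho>" using sle mult_right_mono[of "r/(2*h)" n1 \<rho>] n1 \<rho> by (simp add: distrib_right)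
        also have "... \<le> real n * \<rho>" using \<rho> by (intro mult_right_mono) (auto simp: n_def)
        finally show ?thesis using \<rho> by (simp add: norm_axis_1)
      qed
      have dt: "\<rho> ^ n \<le> s ^ CARD('d)"
      proof -
        have "s = c * \<rho> powr (1/\<alpha>)" using q U \<rho> by (simp add: s_def c_def powr_divide powr_mult)
        then have sd: "s ^ CARD('d) = c ^ CARD('d) * \<rho> powr (real CARD('d) / \<alpha>)"
          using \<rho> by (simp add: power_mult_distrib powr_realpow[symmetric] powr_powr)
        have "\<rho> ^ n \<le> \<rho> ^ (n4 + 1)" using \<rho> r1 by (intro power_decreasing) (auto simp: n_def)
        also have "... = \<rho> powr real n4 * \<rho>" using \<rho> by (simp add: powr_realpow)
        also have "... \<le> \<rho> powr (real CARD('d) / \<alpha>) * \<rho>" using \<rho> r1 n4 by (intro mult_right_mono powr_mono') auto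
        also have "... \<le> \<rho> powr (real CARD('d) / \<alpha>) * c ^ CARD('d)"
        proof (rule mult_left_mono)
          have "1 / c ^ CARD('d) * \<rho> < 1" using le(1)[OF n3] by (simp add: n_def)
          then show "\<rho> \<le> c ^ CARD('d)" using c by (simp add: field_simps)
        qed simp
        finally show ?thesis unfolding sd by (simp add: mult.commute)
      qed
      show "\<exists>u s. 0 < s & s \<le> \<rho> * real n & norm u + s \<le> real n * \<rho> & \<rho> ^ n \<le> s ^ CARD('d) &
       x + A u \<in> X & (\<forall>j. x + A (u + s *\<^sub>R axis j 1) \<in> X)"
        using s0 ss nn dt m1 by (intro exI[of _ "\<rho> *\<^sub>R axis k 1"] exI[of _ s]) (auto simp: mult.commute)
    qed (simp add: n_def)
    then show ?thesis using U(1) by blast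
  qed
qed

section \<open>Bounded holomorphic functions of several variables\<close>

abbreviation lin :: "('i => complex) => ('i => complex) => complex => 'i => complex" where
  "lin z v w \<equiv> (%i. z i + w * v i)"

definition pd :: "'i set => real => ('i => complex) set" where
  "pd S r = {z. \<forall>i\<in>S. cmod (z i) < r}"

text \<open>Holomorphy is required along complex lines only, so every argument takes place in one
  variable. Points are functions on the whole index type; the last clause says that only coordinates
  in \<open>S\<close> count, which lets variables be added one at a time without changing
  types.\<close>

definition HB :: "'i set => real => (('i => complex) => complex) => bool" where
  "HB S r F \<longleftrightarrow> (\<exists>M. \<forall>z\<in>pd S r. cmod (F z) \<le> M) &
     (\<forall>z v. (%w. F (lin z v w)) holomorphic_on {w. lin z v w \<in> pd S r}) &
     (\<forall>z z'. (\<forall>i\<in>S. z i = z' i) --> F z = F z')"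

lemma HB_bounded: "HB S r F ==> \<exists>M>0. \<forall>z\<in>pd S r. cmod (F z) \<le> M"
  unfolding HB_def by (metis abs_ge_self add.commute add_pos_nonneg abs_ge_zero less_eq_real_def order_trans zero_less_one add_increasing)

lemma HB_holo: "HB S r F ==> (%w. F (lin z v w)) holomorphic_on {w. lin z v w \<in> pd S r}"
  unfolding HB_def by blast

lemma HB_depends: "HB S r F ==> (!!i. i \<in> S ==> z i = z' i) ==> F z = F z'"
  unfolding HB_def by blast

lemma open_line_pd: "finite S ==> open {w. lin z v w \<in> pd S r}"
proof -
  assume "finite S"
  have "{w. lin z v w \<in> pd S r} = (\<Inter>i\<in>S. {w. cmod (z i + w * v i) < r})" by (auto simp: pd_def)
  then show ?thesis using \<open>finite S\<close> by (auto intro!: open_INT open_Collect_less continuous_intros)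
qed

lemma convex_line_pd: "convex {w. lin z v w \<in> pd S r}"
proof -
  have "{w. lin z v w \<in> pd S r} = (\<Inter>i\<in>S. {w. cmod (z i + w * v i) < r})" by (auto simp: pd_def)
  moreover have "!!i. convex {w. cmod (z i + w * v i) < r}"
  proof -
    fix i show "convex {w. cmod (z i + w * v i) < r}"
    proof (rule convexI)
      fix x y and p q :: real assume *: "x \<in> {w. cmod (z i + w * v i) < r}" "y \<in> {w. cmod (z i + w * v i) < r}" "0 \<le> p" "0 \<le> q" "p + q = 1"
      have "p *\<^sub>R (z i + x * v i) + q *\<^sub>R (z i + y * v i) = (p + q) *\<^sub>R z i + (p *\<^sub>R x + q *\<^sub>R y) * v i" by (simp add: algebra_simps)
      then have "z i + (p *\<^sub>R x + q *\<^sub>R y) * v i = p *\<^sub>R (z i + x * v i) + q *\<^sub>R (z i + y * v i)" using * by simp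
      also have "cmod ... \<le> p * cmod (z i + x * v i) + q * cmod (z i + y * v i)" using norm_triangle_ineq[of "p *\<^sub>R (z i + x * v i)" "q *\<^sub>R (z i + y * v i)"] * by simp
      also have "... < r" using * by (intro convex_bound_lt) auto
      finally show "p *\<^sub>R x + q *\<^sub>R y \<in> {w. cmod (z i + w * v i) < r}" by simp
    qed
  qed
  ultimately show ?thesis by (auto intro!: convex_INT)
qed

lemma pd_mono: "r \<le> r' ==> pd S r \<subseteq> pd S r'" by (force simp: pd_def)

lemma HB_mono:
  assumes F: "HB S r F" and r: "r' \<le> r" shows "HB S r' F"
  unfolding HB_def
proof (intro conjI allI impI)
  show "\<exists>M. \<forall>z\<in>pd S r'. cmod (F z) \<le> M" using HB_bounded[OF F] pd_mono[OF r] by blast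
  show "(%w. F (lin z v w)) holomorphic_on {w. lin z v w \<in> pd S r'}" for z v
    by (rule holomorphic_on_subset[OF HB_holo[OF F]]) (use pd_mono[OF r] in auto)
  show "F z = F z'" if "\<forall>i\<in>S. z i = z' i" for z z' using HB_depends[OF F, of z z'] that by simp
qed

lemma HB_const: "HB S r (%z. c)" unfolding HB_def by auto

lemma HB_coord: "i \<in> S ==> HB S r (%z. z i)"
  unfolding HB_def pd_def by (auto intro!: holomorphic_intros exI[of _ r] less_imp_le)

lemma HB_add:
  assumes F: "HB S r F" and G: "HB S r G" shows "HB S r (%z. F z + G z)"
  unfolding HB_def
proof (intro conjI allI impI)
  obtain M where M: "M > 0" "!!z. z \<in> pd S r ==> cmod (F z) \<le> M" using HB_bounded[OF F] by blast
  obtain N where N: "N > 0" "!!z. z \<in> pd S r ==> cmod (G z) \<le> N" using HB_bounded[OF G] by blast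
  have "cmod (F z + G z) \<le> M + N" if "z \<in> pd S r" for z
    using norm_triangle_mono[OF M(2)[OF that] N(2)[OF that]] .
  then show "\<exists>M. \<forall>z\<in>pd S r. cmod (F z + G z) \<le> M" by blast
  show "(%w. F (lin z v w) + G (lin z v w)) holomorphic_on {w. lin z v w \<in> pd S r}" for z v
    by (rule holomorphic_on_add[OF HB_holo[OF F] HB_holo[OF G]])
  show "F z + G z = F z' + G z'" if "\<forall>i\<in>S. z i = z' i" for z z'
    using HB_depends[OF F, of z z'] HB_depends[OF G, of z z'] that by simp
qed

lemma HB_mult:
  assumes F: "HB S r F" and G: "HB S r G" shows "HB S r (%z. F z * G z)"
  unfolding HB_def
proof (intro conjI allI impI)
  obtain M where M: "M > 0" "!!z. z \<in> pd S r ==> cmod (F z) \<le> M" using HB_bounded[OF F] by blast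
  obtain N where N: "N > 0" "!!z. z \<in> pd S r ==> cmod (G z) \<le> N" using HB_bounded[OF G] by blast
  have "cmod (F z * G z) \<le> M * N" if "z \<in> pd S r" for z
    unfolding norm_mult by (rule mult_mono[OF M(2)[OF that] N(2)[OF that]]) (use M in auto)
  then show "\<exists>M. \<forall>z\<in>pd S r. cmod (F z * G z) \<le> M" by blast
  show "(%w. F (lin z v w) * G (lin z v w)) holomorphic_on {w. lin z v w \<in> pd S r}" for z v
    by (rule holomorphic_on_mult[OF HB_holo[OF F] HB_holo[OF G]])
  show "F z * G z = F z' * G z'" if "\<forall>i\<in>S. z i = z' i" for z z'
    using HB_depends[OF F, of z z'] HB_depends[OF G, of z z'] that by simp
qed

lemma HB_divide:
  assumes F: "HB S r F" and G: "HB S r G" and c: "0 < c" "!!z. z \<in> pd S r ==> c \<le> cmod (G z)"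
  shows "HB S r (%z. F z / G z)"
  unfolding HB_def
proof (intro conjI allI impI)
  obtain M where M: "M > 0" "!!z. z \<in> pd S r ==> cmod (F z) \<le> M" using HB_bounded[OF F] by blast
  have "cmod (F z / G z) \<le> M / c" if "z \<in> pd S r" for z
    unfolding norm_divide by (rule frac_le[OF _ M(2)[OF that] c(1) c(2)[OF that]]) (use M in simp)
  then show "\<exists>M. \<forall>z\<in>pd S r. cmod (F z / G z) \<le> M" by blast
  fix z v
  have "G (lin z v w) ~= 0" if "w \<in> {w. lin z v w \<in> pd S r}" for w using c(2)[of "lin z v w"] c(1) that by auto
  then show "(%w. F (lin z v w) / G (lin z v w)) holomorphic_on {w. lin z v w \<in> pd S r}"
    by (intro holomorphic_on_divide HB_holo[OF F] HB_holo[OF G])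
  show "F z / G z = F z' / G z'" if "\<forall>i\<in>S. z i = z' i" for z z'
    using HB_depends[OF F, of z z'] HB_depends[OF G, of z z'] that by simp
qed

lemma HB_power: "HB S r F ==> HB S r (%z. F z ^ n)"
  by (induction n) (auto intro: HB_const HB_mult)

lemma HB_sum: "(!!i. i \<in> I ==> HB S r (F i)) ==> HB S r (%z. \<Sum>i\<in>I. F i z)"
  by (induction I rule: infinite_finite_induct) (auto intro: HB_const HB_add)

lemma HB_prod: "(!!i. i \<in> I ==> HB S r (F i)) ==> HB S r (%z. \<Prod>i\<in>I. F i z)"
  by (induction I rule: infinite_finite_induct) (auto intro: HB_const HB_mult)

text \<open>\<Psi> is the linear part of the affine map \<Phi>, which hence carries complex lines to
  complex lines.\<close>

lemma HB_affine:
  assumes F: "HB S r F" and aff: "!!z v w i. i \<in> S ==> \<Phi> (lin z v w) i = \<Phi> z i + w * \<Psi> v i"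
    and map: "!!z. z \<in> pd S' r' ==> \<Phi> z \<in> pd S r" and dep: "!!z z' i. (!!j. j \<in> S' ==> z j = z' j) ==> i \<in> S ==> \<Phi> z i = \<Phi> z' i"
  shows "HB S' r' (%z. F (\<Phi> z))"
  unfolding HB_def
proof (intro conjI allI impI)
  show "\<exists>M. \<forall>z\<in>pd S' r'. cmod (F (\<Phi> z)) \<le> M" using F map unfolding HB_def by blast
  show "F (\<Phi> z) = F (\<Phi> z')" if "\<forall>i\<in>S'. z i = z' i" for z z' using HB_depends[OF F, of "\<Phi> z" "\<Phi> z'"] dep[of z z'] that by blast
  fix z v
  have e: "F (\<Phi> (lin z v w)) = F (lin (\<Phi> z) (\<Psi> v) w)" for w by (rule HB_depends[OF F]) (rule aff)
  have "{w. lin z v w \<in> pd S' r'} \<subseteq> {w. lin (\<Phi> z) (\<Psi> v) w \<in> pd S r}"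
  proof
    fix w assume "w \<in> {w. lin z v w \<in> pd S' r'}"
    then have "\<Phi> (lin z v w) \<in> pd S r" using map by blast
    then show "w \<in> {w. lin (\<Phi> z) (\<Psi> v) w \<in> pd S r}" using aff by (auto simp: pd_def)
  qed
  then show "(%w. F (\<Phi> (lin z v w))) holomorphic_on {w. lin z v w \<in> pd S' r'}"
    unfolding e using holomorphic_on_subset[OF HB_holo[OF F]] by blast
qed

lemma HB_uniform_limit:
  assumes S: "finite S" and F: "!!n. HB S r (Fn n)" and lim: "!!n z. z \<in> pd S r ==> cmod (Fn n z - F z) \<le> c / real (Suc n)"
    and dep: "!!z z'. (!!i. i \<in> S ==> z i = z' i) ==> F z = F z'"
  shows "HB S r F"
  unfolding HB_def
proof (intro conjI allI impI)
  obtain M where M: "\<forall>z\<in>pd S r. cmod (Fn 0 z) \<le> M" using F[of 0] HB_def by blast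
  have "cmod (F z) \<le> M + c" if "z \<in> pd S r" for z
    using M lim[OF that, of 0] that norm_triangle_ineq2[of "F z" "Fn 0 z"] norm_minus_commute[of "F z" "Fn 0 z"] by fastforce
  then show "\<exists>M. \<forall>z\<in>pd S r. cmod (F z) \<le> M" by blast
  show "F z = F z'" if "\<forall>i\<in>S. z i = z' i" for z z' using dep that by blast
  fix z v
  let ?U = "{w. lin z v w \<in> pd S r}"
  have ul: "uniform_limit ?U (%n w. Fn n (lin z v w)) (%w. F (lin z v w)) sequentially"
  proof (rule uniform_limitI)
    fix e :: real assume e: "0 < e"
    obtain N :: nat where N: "\<bar>c\<bar> / e < N" using reals_Archimedean2 by blast
    have "cmod (Fn n (lin z v w) - F (lin z v w)) < e" if "n \<ge> N" "w \<in> ?U" for n w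
    proof -
      have "cmod (Fn n (lin z v w) - F (lin z v w)) \<le> c / real (Suc n)" using lim that by blast
      also have "... \<le> \<bar>c\<bar> / real (Suc n)" by (intro divide_right_mono) auto
      also have "... < e"
      proof -
        have "\<bar>c\<bar> / e < real (Suc n)" using N that by linarith
        then show ?thesis using e by (simp add: field_simps)
      qed
      finally show ?thesis .
    qed
    then show "\<forall>\<^sub>F n in sequentially. \<forall>x\<in>?U. dist (Fn n (lin z v x)) (F (lin z v x)) < e"
      unfolding dist_norm eventually_sequentially by blast
  qed
  show "(%w. F (lin z v w)) holomorphic_on ?U"
  proof (rule holomorphic_uniform_sequence[OF open_line_pd[OF S]])
    show "(%w. Fn n (lin z v w)) holomorphic_on ?U" for n using HB_holo[OF F] .
    show "\<exists>d>0. Elementary_Metric_Spaces.cball x d \<subseteq> ?U & uniform_limit (Elementary_Metric_Spaces.cball x d) (%n w. Fn n (lin z v w)) (%w. F (lin z v w)) sequentially" if "x \<in> ?U" for x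
      using open_contains_cball[of ?U] open_line_pd[OF S, of z v r] that uniform_limit_on_subset[OF ul] by blast
  qed
qed

lemma bounded_holomorphic_derivs:
  assumes h: "\<phi> holomorphic_on ball a \<rho>" and M: "!!w. w \<in> ball a \<rho> ==> cmod (\<phi> w) \<le> M" and \<rho>: "0 < \<rho>" and u: "cmod (u - a) \<le> \<rho>/2"
  shows "cmod (deriv \<phi> u) \<le> 4 * M / \<rho>" "cmod (deriv (deriv \<phi>) u) \<le> 32 * M / \<rho>\<^sup>2"
proof -
  have sub: "Elementary_Metric_Spaces.cball u (\<rho>/4) \<subseteq> ball a \<rho>"
  proof
    fix x assume "x \<in> Elementary_Metric_Spaces.cball u (\<rho>/4)"
    then show "x \<in> ball a \<rho>" using u \<rho> dist_triangle[of a x u] by (auto simp: dist_norm norm_minus_commute)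
  qed
  have c: "cmod ((deriv ^^ n) \<phi> u) \<le> fact n * M / (\<rho>/4) ^ n" for n
  proof (rule Cauchy_inequality)
    show "\<phi> holomorphic_on ball u (\<rho>/4)" using h sub ball_subset_cball holomorphic_on_subset by blast
    show "continuous_on (Elementary_Metric_Spaces.cball u (\<rho>/4)) \<phi>" using holomorphic_on_imp_continuous_on[OF h] sub continuous_on_subset by blast
    show "cmod (\<phi> x) \<le> M" if "cmod (u - x) = \<rho>/4" for x using M sub that by (auto simp: dist_norm subset_iff)
  qed (use \<rho> in auto)
  show "cmod (deriv \<phi> u) \<le> 4 * M / \<rho>" using c[of 1] by (simp add: mult.commute)
  show "cmod (deriv (deriv \<phi>) u) \<le> 32 * M / \<rho>\<^sup>2" using c[of 2] by (simp add: eval_nat_numeral field_simps)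
qed

lemma bounded_holomorphic_taylor:
  assumes h: "\<phi> holomorphic_on ball a \<rho>" and M: "!!w. w \<in> ball a \<rho> ==> cmod (\<phi> w) \<le> M" and \<rho>: "0 < \<rho>" and w: "cmod (w - a) \<le> \<rho>/2"
  shows "cmod (\<phi> w - \<phi> a) \<le> (4 * M / \<rho>) * cmod (w - a)"
    and "cmod (\<phi> w - \<phi> a - deriv \<phi> a * (w - a)) \<le> (32 * M / \<rho>\<^sup>2) * cmod (w - a) ^ 2"
proof -
  let ?S = "Elementary_Metric_Spaces.cball a (\<rho>/2)"
  have S: "?S \<subseteq> ball a \<rho>" using \<rho> by auto
  have wa: "w \<in> ?S" "a \<in> ?S" using w \<rho> by (auto simp: dist_norm norm_minus_commute)
  have d: "(\<phi> has_field_derivative deriv \<phi> u) (at u within ?S)" if "u \<in> ?S" for u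
    using holomorphic_derivI[OF h open_ball] S that by (auto intro: DERIV_subset)
  have h': "deriv \<phi> holomorphic_on ball a \<rho>" by (rule holomorphic_deriv[OF h open_ball])
  have d': "(deriv \<phi> has_field_derivative deriv (deriv \<phi>) u) (at u within ?S)" if "u \<in> ?S" for u
    using holomorphic_derivI[OF h' open_ball] S that by (auto intro: DERIV_subset)
  have n: "cmod (u - a) \<le> \<rho>/2" if "u \<in> ?S" for u using that by (auto simp: dist_norm norm_minus_commute)
  have M0: "0 \<le> M" using M[of a] \<rho> norm_ge_zero order_trans by (metis centre_in_ball)
  show "cmod (\<phi> w - \<phi> a) \<le> (4 * M / \<rho>) * cmod (w - a)"
    by (rule field_differentiable_bound[of ?S \<phi> "deriv \<phi>"]) (use d bounded_holomorphic_derivs(1)[OF h M \<rho> n] wa in auto)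
  define t where "t = cmod (w - a)"
  let ?T = "Elementary_Metric_Spaces.cball a t"
  have T: "?T \<subseteq> ?S" using w by (auto simp: t_def)
  have wT: "w \<in> ?T" "a \<in> ?T" by (auto simp: t_def dist_norm norm_minus_commute)
  have "cmod ((\<phi> w - deriv \<phi> a * w) - (\<phi> a - deriv \<phi> a * a)) \<le> ((32 * M / \<rho>\<^sup>2) * t) * cmod (w - a)"
  proof (rule field_differentiable_bound[of ?T "%w. \<phi> w - deriv \<phi> a * w" "%u. deriv \<phi> u - deriv \<phi> a"])
    fix u assume u: "u \<in> ?T"
    have "(\<phi> has_field_derivative deriv \<phi> u) (at u within ?T)" using d[of u] u T DERIV_subset by blast
    then show "((%w. \<phi> w - deriv \<phi> a * w) has_field_derivative (deriv \<phi> u - deriv \<phi> a)) (at u within ?T)"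
      by (auto intro!: derivative_eq_intros)
    have "cmod (deriv \<phi> u - deriv \<phi> a) \<le> (32 * M / \<rho>\<^sup>2) * cmod (u - a)"
      by (rule field_differentiable_bound[of ?S "deriv \<phi>" "deriv (deriv \<phi>)"]) (use d' bounded_holomorphic_derivs(2)[OF h M \<rho> n] wa u T in auto)
    also have "... \<le> (32 * M / \<rho>\<^sup>2) * t" using u M0 by (intro mult_left_mono) (auto simp: dist_norm norm_minus_commute)
    finally show "cmod (deriv \<phi> u - deriv \<phi> a) \<le> (32 * M / \<rho>\<^sup>2) * t" .
  qed (use wT in auto)
  then show "cmod (\<phi> w - \<phi> a - deriv \<phi> a * (w - a)) \<le> (32 * M / \<rho>\<^sup>2) * cmod (w - a) ^ 2"
    by (simp add: algebra_simps t_def power2_eq_square)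
qed

text \<open>Join z to z' by a complex line with unit speed in the maximum norm and use Cauchy's
  estimate in one variable. When \<delta> exceeds r/4 the trivial bound 2 M suffices.\<close>

lemma HB_lipschitz:
  assumes F: "HB S r F" and r: "0 < r"
  shows "\<exists>C>0. \<forall>z\<in>pd S (r/2). \<forall>z'\<in>pd S (r/2). \<forall>\<delta>\<ge>0. (\<forall>i\<in>S. cmod (z' i - z i) \<le> \<delta>) --> cmod (F z' - F z) \<le> C * \<delta>"
proof -
  obtain M where M: "M > 0" "!!z. z \<in> pd S r ==> cmod (F z) \<le> M" using HB_bounded[OF F] by blast
  have "cmod (F z' - F z) \<le> (8 * M / r) * \<delta>" if z: "z \<in> pd S (r/2)" "z' \<in> pd S (r/2)" and \<delta>: "\<delta> \<ge> 0" "!!i. i \<in> S ==> cmod (z' i - z i) \<le> \<delta>" for z z' \<delta>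
  proof (cases "\<delta> = 0")
    case True
    then have "F z' = F z" using \<delta> by (intro HB_depends[OF F]) auto
    then show ?thesis using True by simp
  next
    case False
    then have d0: "0 < \<delta>" using \<delta> by simp
    define u where "u = (%i. (z' i - z i) / of_real \<delta>)"
    have u: "cmod (u i) \<le> 1" if "i \<in> S" for i using \<delta>(2)[OF that] d0 by (simp add: u_def norm_divide)
    have sub: "ball 0 (r/2) \<subseteq> {w. lin z u w \<in> pd S r}"
    proof (intro subsetI CollectI)
      fix w :: complex assume "w \<in> ball 0 (r/2)"
      then have w0: "cmod w < r/2" by simp
      have "cmod (z i + w * u i) < r" if "i \<in> S" for i
      proof -
      have w: "cmod w < r/2" "i \<in> S" using w0 that by auto
      have "cmod (z i + w * u i) \<le> cmod (z i) + cmod w * cmod (u i)" by (metis norm_mult norm_triangle_ineq)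
      also have "cmod w * cmod (u i) \<le> cmod w * 1" using u[OF w(2)] by (intro mult_left_mono) auto
      finally show "cmod (z i + w * u i) < r" using w z(1) by (force simp: pd_def)
      qed
      then show "lin z u w \<in> pd S r" by (simp add: pd_def)
    qed
    show ?thesis
    proof (cases "\<delta> \<le> r/4")
      case True
      have "cmod (F (lin z u (of_real \<delta>)) - F (lin z u 0)) \<le> (4 * M / (r/2)) * cmod (of_real \<delta> - 0)"
        by (rule bounded_holomorphic_taylor(1)[OF holomorphic_on_subset[OF HB_holo[OF F] sub]]) (use M(2) sub r True d0 in auto)
      moreover have "lin z u (of_real \<delta>) = z'" "lin z u 0 = z" using d0 by (auto simp: u_def)
      ultimately show ?thesis using d0 by simp
    next
      case False
      have "z \<in> pd S r" "z' \<in> pd S r" using z pd_mono[of "r/2" r S] r by auto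
      then have "cmod (F z' - F z) \<le> 2 * M" using M(2) norm_triangle_ineq4[of "F z'" "F z"] by (metis add_mono mult_2 order_trans)
      also have "... \<le> (8 * M / r) * \<delta>" using False M(1) r by (simp add: field_simps)
      finally show ?thesis .
    qed
  qed
  then show ?thesis using M r by (intro exI[of _ "8 * M / r"]) auto
qed

text \<open>The partial derivative is a uniform limit of difference quotients with steps shrinking
  like 1/(n+1). Each quotient is in the class because it is a combination of translates of
  \<open>F\<close>, and Taylor's formula gives the rate.\<close>

lemma HB_partial:
  fixes i :: 'i
  assumes S: "finite S" "i \<in> S" and F: "HB S r F" and r: "0 < r"
  shows "HB S (r/2) (%z. deriv (%w. F (z(i := w))) (z i))"
proof -
  obtain M where M: "M > 0" "!!z. z \<in> pd S r ==> cmod (F z) \<le> M" using HB_bounded[OF F] by blast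
  define de where "de n = r / (8 * real (Suc n))" for n :: nat
  have e: "0 < de n" "de n \<le> r/8" for n using r by (auto simp: de_def field_simps)
  define Fn where "Fn n z = (F (z(i := z i + of_real (de n))) - F z) * of_real (1 / de n)" for n z
  have line: "z(i := w) = lin (z(i := 0)) ((%_. 0)(i := 1)) w" for z w by (auto simp: fun_eq_iff)
  have hol: "(%w. F (z(i := w))) holomorphic_on ball (z i) (r/2)" and sub: "!!w. w \<in> ball (z i) (r/2) ==> z(i := w) \<in> pd S r" if z: "z \<in> pd S (r/2)" for z
  proof -
    show s: "z(i := w) \<in> pd S r" if "w \<in> ball (z i) (r/2)" for w
    proof -
      have "cmod w < r" using that z S norm_triangle_sub[of w "z i"] by (force simp: pd_def dist_norm norm_minus_commute)
      then show ?thesis using z r by (force simp: pd_def)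
    qed
    show "(%w. F (z(i := w))) holomorphic_on ball (z i) (r/2)"
    proof -
      have eq: "(%w. F (z(i := w))) = (%w. F (lin (z(i := 0)) ((%_. 0)(i := 1)) w))" by (intro ext arg_cong[of _ _ F] line)
      have sb: "ball (z i) (r/2) \<subseteq> {w. lin (z(i := 0)) ((%_. 0)(i := 1)) w \<in> pd S r}"
        using s unfolding line[of z, symmetric] by blast
      show ?thesis unfolding eq by (rule holomorphic_on_subset[OF HB_holo[OF F] sb])
    qed
  qed
  show ?thesis
  proof (rule HB_uniform_limit[OF S(1), where Fn=Fn and c="16 * M / r"])
    fix n
    have "HB S (r/2) (%z. F (z(i := z i + of_real (de n))))"
    proof (rule HB_affine[OF F, where \<Psi>="%v. v"])
      fix z assume z: "z \<in> pd S (r/2)"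
      have "cmod (z i) < r/2" using z S by (auto simp: pd_def)
      then have "cmod (z i + of_real (de n)) < r" using e[of n] r norm_triangle_ineq[of "z i" "of_real (de n)"] by simp
      then show "z(i := z i + of_real (de n)) \<in> pd S r" using z r by (force simp: pd_def)
    qed (use S in auto)
    then have "HB S (r/2) (%z. (F (z(i := z i + of_real (de n))) + (-1) * F z) * of_real (1 / de n))"
      using r by (intro HB_mult HB_add HB_const HB_mono[OF F]) auto
    then show "HB S (r/2) (Fn n)" unfolding Fn_def[abs_def] by simp
  next
    fix n z assume z: "z \<in> pd S (r/2)"
    let ?\<phi> = "%w. F (z(i := w))"
    have "cmod (?\<phi> (z i + of_real (de n)) - ?\<phi> (z i) - deriv ?\<phi> (z i) * (z i + of_real (de n) - z i)) \<le> (32 * M / (r/2)\<^sup>2) * cmod (z i + of_real (de n) - z i) ^ 2"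
      by (rule bounded_holomorphic_taylor(2)[OF hol[OF z]]) (use M(2) sub[OF z] r e[of n] in auto)
    then have b: "cmod (?\<phi> (z i + of_real (de n)) - F z - deriv ?\<phi> (z i) * of_real (de n)) \<le> (128 * M / r\<^sup>2) * (de n)\<^sup>2"
      using e[of n] by (simp add: power_divide)
    have "Fn n z - deriv ?\<phi> (z i) = (?\<phi> (z i + of_real (de n)) - F z - deriv ?\<phi> (z i) * of_real (de n)) * of_real (1 / de n)"
      using e[of n] by (simp add: Fn_def field_simps)
    then have "cmod (Fn n z - deriv ?\<phi> (z i)) \<le> ((128 * M / r\<^sup>2) * (de n)\<^sup>2) * (1 / de n)"
      using b e[of n] M(1) by (simp only: norm_mult norm_of_real) (intro mult_mono, auto)
    also have "... = (128 * M / r\<^sup>2) * de n" using e[of n] by (simp add: power2_eq_square)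
    also have "... = (16 * M / r) / real (Suc n)" unfolding de_def using r by (simp add: power2_eq_square divide_simps del: of_nat_Suc)
    finally show "cmod (Fn n z - deriv ?\<phi> (z i)) \<le> (16 * M / r) / real (Suc n)" .
  next
    fix z z' :: "'i => complex" assume zz: "!!j. j \<in> S ==> z j = z' j"
    have "F (z(i := w)) = F (z'(i := w))" for w by (rule HB_depends[OF F]) (use zz in auto)
    then show "deriv (%w. F (z(i := w))) (z i) = deriv (%w. F (z'(i := w))) (z' i)" using zz S by simp
  qed
qed

text \<open>The explicit rate depends on the Lipschitz constant alone, so Riemann sums converge
  uniformly in parameters. This is how integrals over a circle inherit holomorphy in
  \<open>ps_HB\<close>.\<close>

lemma riemann_sum_bound:
  fixes \<phi> :: "real => complex"
  assumes lip: "!!s t. s \<in> {0..1} ==> t \<in> {0..1} ==> cmod (\<phi> s - \<phi> t) \<le> C * \<bar>s - t\<bar>" and C: "0 \<le> C"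
  shows "cmod ((1 / real (Suc n)) *\<^sub>R (\<Sum>k<Suc n. \<phi> (real k / real (Suc n))) - integral {0..1} \<phi>) \<le> C / real (Suc n)"
proof -
  define N where "N = real (Suc n)"
  have N: "0 < N" by (simp add: N_def)
  have "C-lipschitz_on {0..1} \<phi>" using lip C by (intro lipschitz_onI) (auto simp: dist_norm)
  then have cont: "continuous_on {0..1} \<phi>" by (rule lipschitz_on_continuous_on)
  have "cmod ((1 / N) *\<^sub>R (\<Sum>k<j. \<phi> (real k / N)) - integral {0..real j / N} \<phi>) \<le> real j * (C / N\<^sup>2)" if "j \<le> Suc n" for j
    using that
  proof (induction j)
    case 0 then show ?case by simp
  next
    case (Suc j)
    let ?a = "real j / N" and ?b = "real (Suc j) / N"
    have ab: "0 \<le> ?a" "?a \<le> ?b" "?b \<le> 1" using Suc.prems N by (auto simp: N_def field_simps)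
    have int: "\<phi> integrable_on {0..?b}" using ab by (intro integrable_continuous_real continuous_on_subset[OF cont]) auto
    have inta: "\<phi> integrable_on {?a..?b}" using ab by (intro integrable_continuous_real continuous_on_subset[OF cont]) auto
    have comb: "integral {0..?b} \<phi> = integral {0..?a} \<phi> + integral {?a..?b} \<phi>" using Henstock_Kurzweil_Integration.integral_combine[OF ab(1,2) int] by simp
    have c: "integral {?a..?b} (%t. \<phi> t - \<phi> ?a) = integral {?a..?b} \<phi> - (1 / N) *\<^sub>R \<phi> ?a"
      using ab inta by (subst Henstock_Kurzweil_Integration.integral_diff) (auto simp: diff_divide_distrib[symmetric])
    have "cmod (integral {?a..?b} (%t. \<phi> t - \<phi> ?a)) \<le> (C / N) * (?b - ?a)"
    proof (rule integral_bound[OF ab(2)])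
      show "continuous_on {?a..?b} (%t. \<phi> t - \<phi> ?a)" using ab by (intro continuous_intros continuous_on_subset[OF cont]) auto
      show "cmod (\<phi> t - \<phi> ?a) \<le> C / N" if "t \<in> {?a..?b}" for t
      proof -
        have "cmod (\<phi> t - \<phi> ?a) \<le> C * \<bar>t - ?a\<bar>" using that ab by (intro lip) auto
        also have "... \<le> C * (1 / N)" using that C by (intro mult_left_mono) (auto simp: add_divide_distrib)
        finally show ?thesis by simp
      qed
    qed
    also have "(C / N) * (?b - ?a) = C / N\<^sup>2" by (simp add: diff_divide_distrib[symmetric] power2_eq_square)
    finally have 1: "cmod ((1 / N) *\<^sub>R \<phi> ?a - integral {?a..?b} \<phi>) \<le> C / N\<^sup>2" unfolding c by (metis norm_minus_commute)
    have "(1 / N) *\<^sub>R (\<Sum>k<Suc j. \<phi> (real k / N)) - integral {0..?b} \<phi>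
       = ((1 / N) *\<^sub>R (\<Sum>k<j. \<phi> (real k / N)) - integral {0..?a} \<phi>) + ((1 / N) *\<^sub>R \<phi> ?a - integral {?a..?b} \<phi>)"
      unfolding comb by (simp add: scaleR_add_right)
    then have "cmod ((1 / N) *\<^sub>R (\<Sum>k<Suc j. \<phi> (real k / N)) - integral {0..?b} \<phi>) \<le> real j * (C / N\<^sup>2) + C / N\<^sup>2"
      using Suc.IH Suc.prems 1 norm_triangle_ineq by (smt (verit) Suc_leD)
    moreover have "real j * (C / N\<^sup>2) + C / N\<^sup>2 = real (Suc j) * (C / N\<^sup>2)" by (simp add: algebra_simps add_divide_distrib)
    ultimately show ?case by simp
  qed
  from this[of "Suc n"] have "cmod ((1 / N) *\<^sub>R (\<Sum>k<Suc n. \<phi> (real k / N)) - integral {0..1} \<phi>) \<le> N * (C / N\<^sup>2)"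
    using N by (simp add: N_def)
  also have "N * (C / N\<^sup>2) = C / N" using N by (simp add: power2_eq_square)
  finally show ?thesis by (simp add: N_def)
qed

section \<open>Zeros of holomorphic functions in a disc\<close>

text \<open>If \<open>n\<close> zeros in the disc of radius R are split off, each factor is at least
  3 R on the circle of radius 4 R and at most 2 R at the point R. The maximum principle for the
  cofactor gives |f(R)| \<le> M (2/3)^n, so the lower bound \<mu> limits \<open>n\<close>. For
  maximal \<open>n\<close> the cofactor has no zeros left: the annulus has none and a zero in the
  inner disc could be split off.\<close>

lemma factor_zeros:
  assumes f: "f holomorphic_on ball 0 (5 * R)" and M: "!!y. y \<in> ball 0 (5 * R) ==> cmod (f y) \<le> M" and R: "0 < R"
    and \<mu>: "0 < \<mu>" "!!y. R \<le> cmod y ==> cmod y < 2 * R ==> \<mu> \<le> cmod (f y)" and N: "!!n. n > N ==> M * (2/3) ^ n < \<mu>"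
  obtains zs g where "length zs \<le> N" "set zs \<subseteq> ball 0 R" "g holomorphic_on ball 0 (5 * R)"
     "!!y. y \<in> ball 0 (5 * R) ==> f y = (\<Prod>z\<leftarrow>zs. y - z) * g y" "!!y. y \<in> ball 0 (2 * R) ==> g y ~= 0"
proof -
  define Q where "Q n \<longleftrightarrow> (\<exists>zs g. length zs = n & set zs \<subseteq> ball 0 R & g holomorphic_on ball 0 (5 * R) & (\<forall>y \<in> ball 0 (5 * R). f y = (\<Prod>z\<leftarrow>zs. y - z) * g y))" for n
  have bound: "n \<le> N" if "Q n" for n
  proof (rule ccontr)
    assume "\<not> n \<le> N"
    then have small: "M * (2/3) ^ n < \<mu>" using N by simp
    obtain zs g where zs: "length zs = n" "set zs \<subseteq> ball 0 R" "g holomorphic_on ball 0 (5 * R)" "!!y. y \<in> ball 0 (5 * R) ==> f y = (\<Prod>z\<leftarrow>zs. y - z) * g y"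
      using \<open>Q n\<close> unfolding Q_def by blast
    have low: "(3 * R) ^ length ws \<le> cmod (\<Prod>z\<leftarrow>ws. y - z)" if "cmod y = 4 * R" "set ws \<subseteq> ball 0 R" for y ws
      using that(2)
    proof (induction ws)
      case (Cons z ws)
      have "3 * R \<le> cmod (y - z)" using Cons.prems that(1) norm_triangle_ineq2[of y z] by auto
      then show ?case using Cons R by (auto simp: norm_mult intro!: mult_mono)
    qed simp
    have up: "cmod (\<Prod>z\<leftarrow>ws. y - z) \<le> (2 * R) ^ length ws" if "cmod y = R" "set ws \<subseteq> ball 0 R" for y ws
      using that(2)
    proof (induction ws)
      case (Cons z ws)
      have "cmod (y - z) \<le> 2 * R" using Cons.prems that(1) norm_triangle_ineq4[of y z] by auto
      then show ?case using Cons R by (auto simp: norm_mult intro!: mult_mono)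
    qed simp
    have "cmod (g (of_real R)) \<le> M / (3 * R) ^ n"
    proof (rule maximum_modulus_frontier[of g "Elementary_Metric_Spaces.cball 0 (4 * R)"])
      show "g holomorphic_on interior (Elementary_Metric_Spaces.cball 0 (4 * R))" using R by (intro holomorphic_on_subset[OF zs(3)]) auto
      show "continuous_on (closure (Elementary_Metric_Spaces.cball 0 (4 * R))) g"
        using R by (intro continuous_on_subset[OF holomorphic_on_imp_continuous_on[OF zs(3)]]) auto
      show "cmod (g y) \<le> M / (3 * R) ^ n" if "y \<in> frontier (Elementary_Metric_Spaces.cball 0 (4 * R))" for y
      proof -
        have y: "cmod y = 4 * R" "y \<in> ball 0 (5 * R)" using that R by (auto simp: frontier_cball)
        have "(3 * R) ^ n * cmod (g y) \<le> cmod (\<Prod>z\<leftarrow>zs. y - z) * cmod (g y)" using low[OF y(1) zs(2)] zs(1) by (intro mult_right_mono) auto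
        also have "... = cmod (f y)" using zs(4)[OF y(2)] by (simp add: norm_mult)
        also have "... \<le> M" by (rule M[OF y(2)])
        finally show ?thesis using R by (simp add: field_simps)
      qed
    qed (use R in auto)
    note gb = this
    have "cmod (f (of_real R)) = cmod (\<Prod>z\<leftarrow>zs. of_real R - z) * cmod (g (of_real R))"
      using zs(4)[of "of_real R"] R by (simp add: norm_mult)
    also have "... \<le> (2 * R) ^ n * (M / (3 * R) ^ n)"
      by (rule mult_mono[OF _ gb]) (use up[of "of_real R" zs] zs(1,2) R in auto)
    finally have "cmod (f (of_real R)) \<le> (2 * R) ^ n * (M / (3 * R) ^ n)" .
    also have "... = M * (2/3) ^ n" using R by (simp add: power_mult_distrib power_divide)
    finally show False using small \<mu>(2)[of "of_real R"] R by simp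
  qed
  have Q0: "Q 0" unfolding Q_def using f by (intro exI[of _ "[]"] exI[of _ f]) auto
  have fin: "finite {n. Q n}" by (rule finite_subset[of _ "{..N}"]) (use bound in auto)
  define n where "n = Max {n. Q n}"
  have "{n. Q n} ~= {}" using Q0 by auto
  then have Qn: "Q n" using Max_in[OF fin] unfolding n_def by simp
  have mx: "k \<le> n" if "Q k" for k unfolding n_def using that by (intro Max_ge[OF fin]) simp
  obtain zs g where zs: "length zs = n" "set zs \<subseteq> ball 0 R" "g holomorphic_on ball 0 (5 * R)" "!!y. y \<in> ball 0 (5 * R) ==> f y = (\<Prod>z\<leftarrow>zs. y - z) * g y"
    using Qn unfolding Q_def by blast
  have "g y ~= 0" if y: "y \<in> ball 0 (2 * R)" for y
  proof
    assume g0: "g y = 0"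
    have y5: "y \<in> ball 0 (5 * R)" using y R by auto
    have "f y = 0" using zs(4)[OF y5] g0 by simp
    then have yR: "y \<in> ball 0 R" using \<mu>(2)[of y] \<mu>(1) y by (cases "R \<le> cmod y") auto
    define g1 where "g1 = (%w. if w = y then deriv g y else (g w - g y) / (w - y))"
    have "g1 holomorphic_on ball 0 (5 * R)" unfolding g1_def using pole_lemma[OF zs(3)] y5 by simp
    moreover have "g w = (w - y) * g1 w" for w using g0 by (simp add: g1_def)
    then have "\<forall>w \<in> ball 0 (5 * R). f w = (\<Prod>z\<leftarrow>zs @ [y]. w - z) * g1 w" using zs(4) by (simp add: mult.assoc)
    ultimately have "Q (Suc n)" unfolding Q_def using zs(1,2) yR by (intro exI[of _ "zs @ [y]"] exI[of _ g1]) auto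
    then show False using mx[of "Suc n"] by simp
  qed
  then show thesis by (intro that[of zs g] zs(2-4)) (use zs(1) bound[OF Qn] in simp_all)
qed

text \<open>The maximum principle for 1/g, with |g| \<ge> |f| on the circle of radius R because all
  factors there are at most 2 R \<le> 1, gives |g| \<ge> \<mu> inside. Each of the at most
  \<open>N\<close> linear factors contributes at least \<open>t\<close>.\<close>

lemma factored_lower_bound:
  assumes zs: "length zs \<le> N" "set zs \<subseteq> ball 0 R" "g holomorphic_on ball 0 (5 * R)"
     "!!y. y \<in> ball 0 (5 * R) ==> f y = (\<Prod>z\<leftarrow>zs. y - z) * g y" "!!y. y \<in> ball 0 (2 * R) ==> g y ~= 0"
    and R: "0 < R" "2 * R \<le> 1" and \<mu>: "0 < \<mu>" "!!y. R \<le> cmod y ==> cmod y < 2 * R ==> \<mu> \<le> cmod (f y)"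
    and y: "cmod y \<le> R" and t: "0 \<le> t" "t \<le> 1" "!!z. z \<in> set zs ==> t \<le> cmod (y - z)"
  shows "\<mu> * t ^ N \<le> cmod (f y)"
proof -
  have up: "cmod (\<Prod>z\<leftarrow>ws. u - z) \<le> 1" if "cmod u = R" "set ws \<subseteq> ball 0 R" for u ws
    using that(2)
  proof (induction ws)
    case (Cons z ws)
    have "cmod (u - z) \<le> 1" using Cons.prems that(1) R norm_triangle_ineq4[of u z] by auto
    then show ?case using Cons by (auto simp: norm_mult intro!: mult_le_one)
  qed simp
  have gne: "g u ~= 0" if "u \<in> Elementary_Metric_Spaces.cball 0 R" for u using zs(5)[of u] that R by auto
  have "cmod (1 / g y) \<le> 1 / \<mu>"
  proof (rule maximum_modulus_frontier[of "%y. 1 / g y" "Elementary_Metric_Spaces.cball 0 R"])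
    have gh: "g holomorphic_on Elementary_Metric_Spaces.cball 0 R" using R by (intro holomorphic_on_subset[OF zs(3)]) auto
    then have h: "(%y. 1 / g y) holomorphic_on Elementary_Metric_Spaces.cball 0 R" using gne by (intro holomorphic_intros) auto
    show "(%y. 1 / g y) holomorphic_on interior (Elementary_Metric_Spaces.cball 0 R)" by (rule holomorphic_on_subset[OF h interior_subset])
    show "continuous_on (closure (Elementary_Metric_Spaces.cball 0 R)) (%y. 1 / g y)" using holomorphic_on_imp_continuous_on[OF h] by simp
    show "cmod (1 / g u) \<le> 1 / \<mu>" if "u \<in> frontier (Elementary_Metric_Spaces.cball 0 R)" for u
    proof -
      have u: "cmod u = R" "u \<in> ball 0 (5 * R)" using that R by (auto simp: frontier_cball)
      have "\<mu> \<le> cmod (f u)" using \<mu>(2)[of u] u R by simp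
      also have "... \<le> 1 * cmod (g u)" unfolding zs(4)[OF u(2)] norm_mult using up[OF u(1) zs(2)] by (intro mult_right_mono) auto
      finally show ?thesis using \<mu>(1) by (simp add: norm_divide frac_le)
    qed
  qed (use y in auto)
  then have g: "\<mu> \<le> cmod (g y)" using \<mu>(1) gne[of y] y by (simp add: norm_divide field_simps)
  have low: "t ^ length ws \<le> cmod (\<Prod>z\<leftarrow>ws. y - z)" if "!!z. z \<in> set ws ==> t \<le> cmod (y - z)" for ws
    using that by (induction ws) (auto simp: norm_mult intro!: mult_mono t(1) zero_le_power)
  have "\<mu> * t ^ N \<le> \<mu> * t ^ length zs" using zs(1) t \<mu>(1) by (intro mult_left_mono power_decreasing) auto
  also have "... \<le> cmod (g y) * cmod (\<Prod>z\<leftarrow>zs. y - z)" using g \<mu>(1) t low[of zs] by (intro mult_mono) auto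
  also have "... = cmod (f y)" using zs(4)[of y] y R by (simp add: norm_mult mult.commute)
  finally show ?thesis .
qed

text \<open>Logarithmic derivatives are additive: splitting off one factor adds y^e / (y - z),
  evaluated by Cauchy's formula, and the zero-free cofactor contributes a holomorphic
  integrand.\<close>

lemma power_sum_contour:
  assumes R: "0 < R" and g: "g holomorphic_on ball 0 (2 * R)" "!!y. y \<in> ball 0 (2 * R) ==> g y ~= 0"
  shows "set zs \<subseteq> ball 0 R ==> (!!y. y \<in> ball 0 (2 * R) ==> f y = (\<Prod>z\<leftarrow>zs. y - z) * g y) ==>
    ((%y. y ^ e * deriv f y / f y) has_contour_integral (2 * of_real pi * \<i> * (\<Sum>z\<leftarrow>zs. z ^ e))) (circlepath 0 R)"
proof (induction zs arbitrary: f)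
  case Nil
  have fg: "f y = g y" if "y \<in> ball 0 (2 * R)" for y using Nil that by simp
  have df: "deriv f y = deriv g y" if "y \<in> ball 0 (2 * R)" for y
    using that fg by (intro complex_derivative_transform_within_open[of f "ball 0 (2 * R)"] holomorphic_transform[OF g(1)]) auto
  have "((%y. y ^ e * deriv g y / g y) has_contour_integral 0) (circlepath 0 R)"
  proof (rule Cauchy_theorem_disc_simple[of _ 0 "2 * R"])
    show "(%y. y ^ e * deriv g y / g y) holomorphic_on ball 0 (2 * R)" using g by (intro holomorphic_intros holomorphic_deriv) auto
  qed (use R in auto)
  then have "((%y. y ^ e * deriv f y / f y) has_contour_integral 0) (circlepath 0 R)"
    by (rule has_contour_integral_eq) (use R fg df in \<open>auto simp: path_image_circlepath\<close>)
  then show ?case by simp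
next
  case (Cons z zs)
  define f1 where "f1 = (%y. (\<Prod>z\<leftarrow>zs. y - z) * g y)"
  have ih: "((%y. y ^ e * deriv f1 y / f1 y) has_contour_integral (2 * of_real pi * \<i> * (\<Sum>z\<leftarrow>zs. z ^ e))) (circlepath 0 R)"
    by (rule Cons.IH) (use Cons.prems in \<open>auto simp: f1_def\<close>)
  have "((%y. y ^ e / (y - z)) has_contour_integral (2 * of_real pi * \<i> * z ^ e)) (circlepath 0 R)"
    by (rule Cauchy_integral_circlepath) (use Cons.prems in \<open>auto intro!: continuous_intros holomorphic_intros\<close>)
  from has_contour_integral_add[OF this ih]
  have "((%y. y ^ e / (y - z) + y ^ e * deriv f1 y / f1 y) has_contour_integral (2 * of_real pi * \<i> * (\<Sum>z\<leftarrow>z # zs. z ^ e))) (circlepath 0 R)"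
    by (simp add: algebra_simps)
  then show ?case
  proof (rule has_contour_integral_eq)
    fix y assume "y \<in> path_image (circlepath 0 R)"
    then have y: "cmod y = R" "y \<in> ball 0 (2 * R)" using R by auto
    have ne: "y - w ~= 0" if "w \<in> set (z # zs)" for w using Cons.prems(1) that y by auto
    have plist: "(\<Prod>w\<leftarrow>zs. y - w) ~= 0" using ne by (auto simp: prod_list_zero_iff)
    have hp: "(%y. \<Prod>w\<leftarrow>ws. y - w) holomorphic_on ball 0 (2 * R)" for ws by (induction ws) (auto intro!: holomorphic_intros)
    have f1h: "f1 holomorphic_on ball 0 (2 * R)" unfolding f1_def by (intro holomorphic_intros hp g(1))
    have f1ne: "f1 y ~= 0" using plist g(2)[OF y(2)] by (simp add: f1_def)
    have fe: "f w = (w - z) * f1 w" if "w \<in> ball 0 (2 * R)" for w using Cons.prems(2)[OF that] by (simp add: f1_def mult.assoc)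
    have "((%w. (w - z) * f1 w) has_field_derivative (1 * f1 y + deriv f1 y * (y - z))) (at y)"
      using holomorphic_derivI[OF f1h open_ball y(2)] by (auto intro!: derivative_eq_intros)
    then have "(f has_field_derivative (1 * f1 y + deriv f1 y * (y - z))) (at y)"
      by (rule has_field_derivative_transform_within_open[OF _ open_ball y(2)]) (simp add: fe)
    then have df: "deriv f y = f1 y + deriv f1 y * (y - z)" using DERIV_imp_deriv by fastforce
    have aux: "c / a + c * d / b = c * (b + d * a) / (a * b)" if "a ~= 0" "b ~= 0" for a b c d :: complex
      using that by (simp add: divide_simps distrib_left)
    show "y ^ e / (y - z) + y ^ e * deriv f1 y / f1 y = y ^ e * deriv f y / f y"
      unfolding df fe[OF y(2)] by (rule aux) (use f1ne ne[of z] in auto)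
  qed
qed

lemma power_sum_integral:
  assumes R: "0 < R" and g: "g holomorphic_on ball 0 (2 * R)" "!!y. y \<in> ball 0 (2 * R) ==> g y ~= 0"
    and zs: "set zs \<subseteq> ball 0 R" "!!y. y \<in> ball 0 (2 * R) ==> f y = (\<Prod>z\<leftarrow>zs. y - z) * g y"
  shows "integral {0..1} (%t. let y = of_real R * exp (2 * of_real pi * \<i> * of_real t) in y * (y ^ e * deriv f y / f y)) = (\<Sum>z\<leftarrow>zs. z ^ e)"
proof -
  let ?h = "%y. y ^ e * deriv f y / f y"
  let ?Y = "%t::real. of_real R * exp (2 * of_real pi * \<i> * of_real t)"
  have "(?h has_contour_integral (2 * of_real pi * \<i> * (\<Sum>z\<leftarrow>zs. z ^ e))) (circlepath 0 R)"
    by (rule power_sum_contour[OF R g zs])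
  then have "((%t. ?h (circlepath 0 R t) * vector_derivative (circlepath 0 R) (at t within {0..1})) has_integral (2 * of_real pi * \<i> * (\<Sum>z\<leftarrow>zs. z ^ e))) {0..1}"
    unfolding has_contour_integral_def .
  then have "((%t. (2 * of_real pi * \<i>) * (?Y t * ?h (?Y t))) has_integral (2 * of_real pi * \<i> * (\<Sum>z\<leftarrow>zs. z ^ e))) {0..1}"
  proof (rule has_integral_eq[rotated])
    fix t :: real assume "t \<in> {0..1}"
    then have vd: "vector_derivative (circlepath 0 R) (at t within {0..1}) = 2 * of_real pi * \<i> * of_real R * exp (2 * of_real pi * \<i> * of_real t)"
      using vector_derivative_circlepath01[of t 0 R] by simp
    have ct: "circlepath 0 R t = ?Y t" by (simp add: circlepath)
    show "?h (circlepath 0 R t) * vector_derivative (circlepath 0 R) (at t within {0..1}) = (2 * of_real pi * \<i>) * (?Y t * ?h (?Y t))"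
      unfolding vd ct by (simp only: mult_ac times_divide_eq_left times_divide_eq_right)
  qed
  from has_integral_mult_right[OF this, of "1 / (2 * of_real pi * \<i>)"]
  have "((%t. ?Y t * ?h (?Y t)) has_integral (\<Sum>z\<leftarrow>zs. z ^ e)) {0..1}" by simp
  then show ?thesis unfolding Let_def by (rule integral_unique)
qed

section \<open>Generalized discriminants\<close>

text \<open>Real polynomials in \<tau> 0, ..., \<tau> (j - 1) as lists of monomials. The
  representation serves \<open>mpoly_tuple_sum\<close> only: summed over all j-tuples of roots, a
  monomial splits into a product of power sums.\<close>

definition mpoly :: "nat => (real \<times> (nat => nat)) list => (nat => complex) => complex" where
  "mpoly j L \<tau> = (\<Sum>p\<leftarrow>L. of_real (fst p) * (\<Prod>a<j. \<tau> a ^ snd p a))"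

lemma mpoly_mult: "\<exists>L3. \<forall>\<tau>. mpoly j L3 \<tau> = mpoly j L1 \<tau> * mpoly j L2 \<tau>"
proof (induction L1)
  case Nil then show ?case by (intro exI[of _ "[]"]) (simp add: mpoly_def)
next
  case (Cons p L1)
  then obtain L3 where L3: "!!\<tau>. mpoly j L3 \<tau> = mpoly j L1 \<tau> * mpoly j L2 \<tau>" by blast
  have m: "mpoly j (map (%q. (fst p * fst q, %a. snd p a + snd q a)) L) \<tau> = (of_real (fst p) * (\<Prod>a<j. \<tau> a ^ snd p a)) * mpoly j L \<tau>" for L \<tau>
    by (induction L) (auto simp: mpoly_def algebra_simps power_add prod.distrib)
  show ?case
    by (intro exI[of _ "map (%q. (fst p * fst q, %a. snd p a + snd q a)) L2 @ L3"] allI)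
       (use m[of L2] L3 in \<open>simp add: mpoly_def algebra_simps\<close>)
qed

lemma mpoly_prod:
  assumes "finite I" "!!i. i \<in> I ==> \<exists>L. \<forall>\<tau>. mpoly j L \<tau> = \<phi> i \<tau>"
  shows "\<exists>L. \<forall>\<tau>. mpoly j L \<tau> = (\<Prod>i\<in>I. \<phi> i \<tau>)"
  using assms
proof (induction I rule: finite_induct)
  case empty then show ?case by (intro exI[of _ "[(1, %_. 0)]"]) (simp add: mpoly_def)
next
  case (insert i I)
  obtain L1 where "!!\<tau>. mpoly j L1 \<tau> = \<phi> i \<tau>" using insert.prems[of i] by blast
  moreover obtain L2 where "!!\<tau>. mpoly j L2 \<tau> = (\<Prod>i\<in>I. \<phi> i \<tau>)" using insert.IH insert.prems by blast
  ultimately show ?case using mpoly_mult[of j L1 L2] insert.hyps by auto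
qed

text \<open>A product over ordered pairs of distinct indices, that is, up to sign the square of the
  Vandermonde determinant, hence invariant under permutations.\<close>

definition vand :: "nat => (nat => complex) => complex" where
  "vand j \<tau> = (\<Prod>a<j. \<Prod>b\<in>{..<j} - {a}. \<tau> a - \<tau> b)"

lemma vand_mpoly: "\<exists>L. \<forall>\<tau>. mpoly j L \<tau> = vand j \<tau>"
  unfolding vand_def
proof (intro mpoly_prod)
  fix a b assume "a \<in> {..<j}" "b \<in> {..<j} - {a}"
  have mono: "(\<Prod>c<j. \<tau> c ^ (if c = d then 1 else 0)) = \<tau> d" if "d < j" for d and \<tau> :: "nat => complex"
  proof -
    have "(\<Prod>c<j. \<tau> c ^ (if c = d then 1 else 0)) = (\<Prod>c<j. if c = d then \<tau> c else 1)" by (intro prod.cong) auto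
    then show ?thesis using that by simp
  qed
  then show "\<exists>L. \<forall>\<tau>. mpoly j L \<tau> = \<tau> a - \<tau> b"
    using \<open>a \<in> {..<j}\<close> \<open>b \<in> {..<j} - {a}\<close>
    by (intro exI[of _ "[(1, %c. if c = a then 1 else 0), (-1, %c. if c = b then 1 else 0)]"]) (auto simp: mpoly_def)
qed auto

lemma mpoly_tuple_sum:
  "(\<Sum>\<tau>\<in>{..<j} \<rightarrow>\<^sub>E {..<n::nat}. mpoly j L (%a. zs (\<tau> a))) = (\<Sum>p\<leftarrow>L. of_real (fst p) * (\<Prod>a<j. \<Sum>k<n. zs k ^ snd p a))"
proof (induction L)
  case Nil then show ?case by (simp add: mpoly_def)
next
  case (Cons p L)
  have "(\<Sum>\<tau>\<in>{..<j} \<rightarrow>\<^sub>E {..<n}. of_real (fst p) * (\<Prod>a<j. zs (\<tau> a) ^ snd p a)) = of_real (fst p) * (\<Prod>a<j. \<Sum>k<n. zs k ^ snd p a)"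
    unfolding sum_distrib_left[symmetric] by (subst prod_sum_PiE) auto
  then show ?case using Cons by (simp add: mpoly_def sum.distrib)
qed

text \<open>Up to the factor j! and a sign, the j-th subdiscriminant of the polynomial with root
  list \<open>zs\<close>. Tuples with a repeated root contribute 0, so it vanishes for
  \<open>j\<close> above the number of distinct roots.\<close>

definition Dtup :: "nat => complex list => complex" where
  "Dtup j zs = (\<Sum>\<tau>\<in>{..<j} \<rightarrow>\<^sub>E {..<length zs}. vand j (%a. zs ! \<tau> a))"

lemma vand_zero: "\<not> inj_on \<sigma> {..<j} ==> vand j \<sigma> = 0"
proof -
  assume "\<not> inj_on \<sigma> {..<j}"
  then obtain a b where ab: "a < j" "b < j" "a ~= b" "\<sigma> a = \<sigma> b" unfolding inj_on_def by auto
  then have "(\<Prod>b\<in>{..<j} - {a}. \<sigma> a - \<sigma> b) = 0" by (intro prod_zero) auto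
  then show ?thesis unfolding vand_def using ab by (intro prod_zero) auto
qed

lemma vand_inj:
  assumes "inj_on \<sigma> {..<j}"
  shows "vand j \<sigma> = (\<Prod>z\<in>\<sigma> ` {..<j}. \<Prod>w\<in>\<sigma> ` {..<j} - {z}. z - w)"
proof -
  have "(\<Prod>z\<in>\<sigma> ` {..<j}. \<Prod>w\<in>\<sigma> ` {..<j} - {z}. z - w) = (\<Prod>a<j. \<Prod>w\<in>\<sigma> ` {..<j} - {\<sigma> a}. \<sigma> a - w)"
    by (rule prod.reindex[OF assms, unfolded comp_def])
  also have "... = vand j \<sigma>" unfolding vand_def
  proof (intro prod.cong refl)
    fix a assume "a \<in> {..<j}"
    then have "\<sigma> ` {..<j} - {\<sigma> a} = \<sigma> ` ({..<j} - {a})" using assms by (auto simp: inj_on_def)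
    moreover have "inj_on \<sigma> ({..<j} - {a})" using assms by (rule inj_on_subset) auto
    ultimately show "(\<Prod>w\<in>\<sigma> ` {..<j} - {\<sigma> a}. \<sigma> a - w) = (\<Prod>b\<in>{..<j} - {a}. \<sigma> a - \<sigma> b)"
      using prod.reindex[of \<sigma> "{..<j} - {a}" "%w. \<sigma> a - w"] by (simp add: comp_def)
  qed
  finally show ?thesis by simp
qed

lemma Dtup_high: "card (set zs) < j ==> Dtup j zs = 0"
  unfolding Dtup_def
proof (intro sum.neutral ballI vand_zero notI)
  fix \<tau> assume c: "card (set zs) < j" and \<tau>: "\<tau> \<in> {..<j} \<rightarrow>\<^sub>E {..<length zs}" and i: "inj_on (%a. zs ! \<tau> a) {..<j}"
  have "(%a. zs ! \<tau> a) ` {..<j} \<subseteq> set zs" using \<tau> by (auto simp: PiE_iff)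
  then have "card {..<j} \<le> card (set zs)" using card_inj_on_le[OF i] by blast
  then show False using c by simp
qed

text \<open>When \<open>j\<close> is the number of distinct roots, the nonzero contributions come
  from tuples that enumerate them all, and by symmetry these are equal; \<open>K\<close> counts
  them. No cancellation can occur.\<close>

lemma Dtup_card:
  assumes "set zs = Z" "card Z = j"
  shows "\<exists>K::nat. 1 \<le> K & K \<le> length zs ^ j & Dtup j zs = of_nat K * (\<Prod>z\<in>Z. \<Prod>w\<in>Z - {z}. z - w)"
proof -
  let ?P = "{..<j} \<rightarrow>\<^sub>E {..<length zs}" and ?V = "\<Prod>z\<in>Z. \<Prod>w\<in>Z - {z}. z - w"
  let ?I = "{\<tau>\<in>?P. inj_on (%a. zs ! \<tau> a) {..<j}}"
  have finP: "finite ?P" by (intro finite_PiE) auto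
  have val: "vand j (%a. zs ! \<tau> a) = (if \<tau> \<in> ?I then ?V else 0)" if "\<tau> \<in> ?P" for \<tau>
  proof (cases "inj_on (%a. zs ! \<tau> a) {..<j}")
    case True
    have "(%a. zs ! \<tau> a) ` {..<j} \<subseteq> Z" using that assms by (auto simp: PiE_iff)
    moreover have "card ((%a. zs ! \<tau> a) ` {..<j}) = card Z" using card_image[OF True] assms by simp
    moreover have "finite Z" using assms by auto
    ultimately have "(%a. zs ! \<tau> a) ` {..<j} = Z" by (intro card_subset_eq)
    then show ?thesis using vand_inj[OF True] True that by simp
  qed (use vand_zero in auto)
  have "Dtup j zs = (\<Sum>\<tau>\<in>?P. if \<tau> \<in> ?I then ?V else 0)" unfolding Dtup_def by (intro sum.cong refl val)
  also have "... = of_nat (card ?I) * ?V" using finP by (simp add: sum.If_cases Int_def)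
  finally have "Dtup j zs = of_nat (card ?I) * ?V" .
  moreover have "card ?I \<le> card ?P" using finP by (intro card_mono) auto
  then have "card ?I \<le> length zs ^ j" by (simp add: card_PiE)
  moreover have "?I ~= {}"
  proof -
    have "finite Z" using assms by auto
    then obtain h where h: "bij_betw h {..<j} Z" using assms(2) ex_bij_betw_nat_finite[of Z] by (auto simp: atLeast0LessThan)
    define \<tau> where "\<tau> = (\<lambda>a\<in>{..<j}. SOME k. k < length zs & zs ! k = h a)"
    have k: "\<tau> a < length zs & zs ! \<tau> a = h a" if "a < j" for a
    proof -
      have "h a \<in> set zs" using h that assms by (auto simp: bij_betw_def)
      then have "\<exists>k. k < length zs & zs ! k = h a" by (auto simp: in_set_conv_nth)
      from someI_ex[OF this] show ?thesis using that by (simp add: \<tau>_def)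
    qed
    have "\<tau> \<in> ?P" using k by (auto simp: PiE_iff \<tau>_def)
    moreover have "inj_on (%a. zs ! \<tau> a) {..<j}" using h k by (auto simp: bij_betw_def inj_on_def)
    ultimately show ?thesis by blast
  qed
  then have "1 \<le> card ?I" using finP by (simp add: Suc_le_eq card_gt_0_iff)
  ultimately show ?thesis by blast
qed

text \<open>All root differences are at most 1 in modulus, so the discriminant is at most
  \<open>K\<close> times any single one of them. A lower bound for the discriminant thus separates
  the roots.\<close>

lemma Dtup_separation:
  assumes "set zs \<subseteq> ball 0 R" "2 * R \<le> 1" "length zs \<le> N" "z \<in> set zs" "w \<in> set zs" "z ~= w"
  shows "cmod (Dtup (card (set zs)) zs) \<le> real (Suc N) ^ N * cmod (z - w)" "Dtup (card (set zs)) zs ~= 0"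
proof -
  let ?Z = "set zs"
  obtain K :: nat where K: "1 \<le> K" "K \<le> length zs ^ card ?Z" "Dtup (card ?Z) zs = of_nat K * (\<Prod>z\<in>?Z. \<Prod>w\<in>?Z - {z}. z - w)"
    using Dtup_card[OF refl refl] by blast
  show "Dtup (card ?Z) zs ~= 0" unfolding K(3) using K(1) by (auto simp: prod_zero_iff)
  have le1: "cmod (u - v) \<le> 1" if "u \<in> ?Z" "v \<in> ?Z" for u v
  proof -
    have "cmod u < R" "cmod v < R" using subsetD[OF assms(1) that(1)] subsetD[OF assms(1) that(2)] by simp_all
    then show ?thesis using assms(2) norm_triangle_ineq4[of u v] by linarith
  qed
  have "cmod (\<Prod>z\<in>?Z. \<Prod>w\<in>?Z - {z}. z - w) = (\<Prod>z\<in>?Z. \<Prod>w\<in>?Z - {z}. cmod (z - w))" by (simp add: prod_norm)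
  also have "... = (\<Prod>v\<in>?Z - {z}. cmod (z - v)) * (\<Prod>u\<in>?Z - {z}. \<Prod>v\<in>?Z - {u}. cmod (u - v))" using assms by (intro prod.remove) auto
  also have "... \<le> cmod (z - w) * 1"
  proof (rule mult_mono)
    have "(\<Prod>v\<in>?Z - {z}. cmod (z - v)) = cmod (z - w) * (\<Prod>v\<in>?Z - {z} - {w}. cmod (z - v))" using assms by (intro prod.remove) auto
    also have "... \<le> cmod (z - w) * 1" using le1 assms by (intro mult_left_mono prod_le_1) auto
    finally show "(\<Prod>v\<in>?Z - {z}. cmod (z - v)) \<le> cmod (z - w)" by simp
    show "(\<Prod>u\<in>?Z - {z}. \<Prod>v\<in>?Z - {u}. cmod (u - v)) \<le> 1" using le1 by (intro prod_le_1 conjI prod_nonneg) auto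
  qed (auto intro!: prod_nonneg)
  finally have V: "cmod (\<Prod>z\<in>?Z. \<Prod>w\<in>?Z - {z}. z - w) \<le> cmod (z - w)" by simp
  have "real K \<le> real (Suc N) ^ N"
  proof -
    have "length zs ^ card ?Z \<le> Suc N ^ card ?Z" using assms(3) by (intro power_mono) auto
    also have "... \<le> Suc N ^ N" using card_length[of zs] assms(3) by (intro power_increasing) auto
    finally have "K \<le> Suc N ^ N" using K(2) by simp
    then show ?thesis by (metis of_nat_le_iff of_nat_power)
  qed
  then show "cmod (Dtup (card ?Z) zs) \<le> real (Suc N) ^ N * cmod (z - w)"
    unfolding K(3) norm_mult norm_of_nat using V by (intro mult_mono) auto
qed

section \<open>Real roots along a path of constant root number\<close>

lemma sorted_list_of_set_image:
  fixes h :: "real => real"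
  assumes "finite A" "strict_mono_on A h"
  shows "sorted_list_of_set (h ` A) = map h (sorted_list_of_set A)"
proof (rule sorted_distinct_set_unique[symmetric])
  let ?l = "sorted_list_of_set A"
  have s: "sorted ?l" "distinct ?l" "set ?l = A" using assms by auto
  show "sorted (map h ?l)"
    unfolding sorted_map using s assms(2)
    by (intro sorted_wrt_mono_rel[OF _ s(1)]) (auto simp: strict_mono_on_def order_le_less)
  have "inj_on h A" using assms(2) by (rule strict_mono_on_imp_inj_on)
  then show "distinct (map h ?l)" using s by (simp add: distinct_map)
  show "set (map h ?l) = set (sorted_list_of_set (h ` A))" using s assms(1) by simp
qed (use assms in auto)

text \<open>Compare Lebesgue measures. It converts "the root stays near finitely many centres" into
  a bound on its displacement, although it may wander from one centre to another.\<close>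

lemma interval_cover_bound:
  fixes p q \<tau> :: real
  assumes "finite A" "closed_segment p q \<subseteq> (\<Union>c\<in>A. ball c \<tau>)" "card A \<le> N" "0 \<le> \<tau>"
  shows "\<bar>p - q\<bar> \<le> 2 * real N * \<tau>"
proof -
  have "\<bar>p - q\<bar> = measure lborel (closed_segment p q)" by (auto simp: closed_segment_eq_real_ivl)
  also have "... \<le> measure lborel (\<Union>c\<in>A. ball c \<tau>)"
  proof (rule measure_mono_fmeasurable[OF assms(2)])
    show "(\<Union>c\<in>A. ball c \<tau>) \<in> fmeasurable lborel" using assms(1)
      by (intro fmeasurable.finite_UN) (use assms(4) in \<open>auto simp: ball_eq_greaterThanLessThan fmeasurable_def\<close>)
  qed auto
  also have "... \<le> (\<Sum>c\<in>A. measure lborel (ball c \<tau>))" using assms(1) by (intro measure_UNION_le) auto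
  also have "... = (\<Sum>c\<in>A. 2 * \<tau>)" using assms(4) by (intro sum.cong) (auto simp: ball_eq_greaterThanLessThan)
  also have "... = real (card A) * (2 * \<tau>)" by simp
  also have "... \<le> real N * (2 * \<tau>)" using assms(3,4) by (intro mult_right_mono) auto
  finally show ?thesis by simp
qed

lemma finite_separated:
  fixes Z :: "complex set"
  assumes "finite Z"
  shows "\<exists>e>0. \<forall>z\<in>Z. \<forall>w\<in>Z. z ~= w --> e \<le> cmod (z - w)"
proof -
  define D where "D = insert 1 ((%(z, w). cmod (z - w)) ` {(z, w) \<in> Z \<times> Z. z ~= w})"
  have fD: "finite D" unfolding D_def using assms by (auto intro: finite_subset[of _ "Z \<times> Z"])
  have "0 < Min D" using fD by (subst Min_gr_iff) (auto simp: D_def)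
  moreover have "Min D \<le> cmod (z - w)" if "z \<in> Z" "w \<in> Z" "z ~= w" for z w
    using fD that by (intro Min_le) (auto simp: D_def)
  ultimately show ?thesis by blast
qed

text \<open>\<open>Z t\<close> consists of distinct zeros, and constancy of its cardinality prevents
  them from merging or splitting as \<open>t\<close> varies, while multiplicities play a part only
  through existence. The symmetry \<open>sym\<close> pairs nonreal zeros with their
  conjugates.\<close>

locale root_family =
  fixes \<phi> :: "real => complex => complex" and R :: real and Z :: "real => complex set" and J :: nat
  assumes R: "0 < R" and hol: "!!t. t \<in> {0..1} ==> \<phi> t holomorphic_on ball 0 (2 * R)"
    and cont: "!!t0 \<eta>. t0 \<in> {0..1} ==> 0 < \<eta> ==> \<exists>\<delta>>0. \<forall>t\<in>{0..1}. \<bar>t - t0\<bar> < \<delta> --> (\<forall>y\<in>ball 0 (2 * R). cmod (\<phi> t y - \<phi> t0 y) < \<eta>)"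
    and sym: "!!t y. t \<in> {0..1} ==> y \<in> ball 0 (2 * R) ==> \<phi> t (cnj y) = cnj (\<phi> t y)"
    and Z: "!!t. t \<in> {0..1} ==> Z t = {y \<in> ball 0 R. \<phi> t y = 0}" "!!t. t \<in> {0..1} ==> finite (Z t)" "!!t. t \<in> {0..1} ==> card (Z t) = J"
begin

text \<open>Minimum principle: on the circle |\<psi> t0| is at least m > 0, so for nearby
  \<open>t\<close> the modulus is above m/2 on the circle and below m/2 at the centre, which forces
  a zero inside.\<close>

lemma zero_nearby:
  fixes \<psi> :: "real => complex => complex"
  assumes t0: "t0 \<in> {0..1}" and h: "!!t. t \<in> {0..1} ==> \<psi> t holomorphic_on ball 0 (2 * R)"
    and c: "!!\<eta>. 0 < \<eta> ==> \<exists>\<delta>>0. \<forall>t\<in>{0..1}. \<bar>t - t0\<bar> < \<delta> --> (\<forall>y\<in>ball 0 (2 * R). cmod (\<psi> t y - \<psi> t0 y) < \<eta>)"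
    and \<zeta>: "\<psi> t0 \<zeta> = 0" and e: "0 < e" "Elementary_Metric_Spaces.cball \<zeta> e \<subseteq> ball 0 (2 * R)"
    and nz: "!!y. cmod (y - \<zeta>) = e ==> \<psi> t0 y ~= 0"
  shows "\<exists>\<delta>>0. \<forall>t\<in>{0..1}. \<bar>t - t0\<bar> < \<delta> --> (\<exists>y\<in>ball \<zeta> e. \<psi> t y = 0)"
proof -
  have "continuous_on (sphere \<zeta> e) (%y. cmod (\<psi> t0 y))"
    using holomorphic_on_imp_continuous_on[OF h[OF t0]] e by (intro continuous_on_norm) (meson continuous_on_subset sphere_cball order_trans)
  moreover have "sphere \<zeta> e ~= {}" using e by (simp add: sphere_eq_empty)
  ultimately obtain y0 where y0: "y0 \<in> sphere \<zeta> e" "!!y. y \<in> sphere \<zeta> e ==> cmod (\<psi> t0 y0) \<le> cmod (\<psi> t0 y)"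
    using continuous_attains_inf[OF compact_sphere] by blast
  define m where "m = cmod (\<psi> t0 y0)"
  have m: "0 < m" using nz[of y0] y0(1) by (auto simp: m_def dist_norm norm_minus_commute)
  obtain \<delta> where \<delta>: "\<delta> > 0" "!!t y. t\<in>{0..1} ==> \<bar>t - t0\<bar> < \<delta> ==> y\<in>ball 0 (2 * R) ==> cmod (\<psi> t y - \<psi> t0 y) < m/2"
    using c[of "m/2"] m by auto
  have "\<exists>y\<in>ball \<zeta> e. \<psi> t y = 0" if t: "t \<in> {0..1}" "\<bar>t - t0\<bar> < \<delta>" for t
  proof -
    have "cmod (\<psi> t \<zeta>) < m/2" using \<delta>(2)[OF t, of \<zeta>] \<zeta> e(1) subsetD[OF e(2), of \<zeta>] by simp
    moreover have "m/2 < cmod (\<psi> t y)" if "cmod (\<zeta> - y) = e" for y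
    proof -
      have "m \<le> cmod (\<psi> t0 y)" using y0(2)[of y] that by (simp add: m_def dist_norm)
      moreover have "cmod (\<psi> t y - \<psi> t0 y) < m/2" using that e by (intro \<delta>(2)[OF t]) (auto simp: subset_iff dist_norm)
      ultimately show ?thesis using norm_triangle_ineq2[of "\<psi> t0 y" "\<psi> t y"] norm_minus_commute[of "\<psi> t0 y" "\<psi> t y"] by linarith
    qed
    moreover have "continuous_on (Elementary_Metric_Spaces.cball \<zeta> e) (\<psi> t)" using holomorphic_on_imp_continuous_on[OF h[OF t(1)]] e continuous_on_subset by blast
    moreover have "\<psi> t holomorphic_on ball \<zeta> e" using h[OF t(1)] e ball_subset_cball holomorphic_on_subset by (meson order_trans)
    ultimately obtain y where "y \<in> ball \<zeta> e" "\<psi> t y = 0"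
      using holomorphic_contract_to_zero[of \<zeta> e "\<psi> t"] e(1) by (metis order.strict_trans)
    then show ?thesis by blast
  qed
  then show ?thesis using \<delta>(1) by blast
qed

definition isolating :: "real => real => bool" where
  "isolating t0 e \<longleftrightarrow> (\<forall>z\<in>Z t0. Elementary_Metric_Spaces.cball z e \<subseteq> ball 0 R) & (\<forall>z\<in>Z t0. \<forall>w. \<phi> t0 w = 0 --> cmod (w - z) ~= e)"

definition tracking :: "real => real => real => bool" where
  "tracking t0 e t \<longleftrightarrow> (\<exists>H. bij_betw H (Z t0) (Z t) & (\<forall>z\<in>Z t0. cmod (H z - z) < e & (z \<in> \<real> \<longleftrightarrow> H z \<in> \<real>))) &
       (\<forall>z\<in>Z t0. \<forall>u\<in>Z t. \<forall>v\<in>Z t. cmod (u - z) < e --> cmod (v - z) < e --> u = v)"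

text \<open>Every zero at \<open>t0\<close> has a zero of the nearby function in its small disc, and
  as the discs are disjoint and the cardinalities agree there is exactly one in each. If the centre
  is real, the conjugate of that zero lies in the same disc, so it is real; if not, the disc avoids
  the real axis.\<close>

lemma local_roots:
  assumes t0: "t0 \<in> {0..1}"
  shows "\<exists>e0>0. \<forall>e. 0 < e --> e \<le> e0 --> isolating t0 e &
     (\<exists>\<delta>>0. \<forall>t\<in>{0..1}. \<bar>t - t0\<bar> < \<delta> -->
       tracking t0 e t)"
proof -
  obtain e1 where e1: "e1 > 0" "!!z w. z \<in> Z t0 ==> w \<in> Z t0 ==> z ~= w ==> e1 \<le> cmod (z - w)" using finite_separated[OF Z(2)[OF t0]] by blast
  \<comment> \<open>The radius must stay below a third of the mutual distances, half the distance to
    the boundary circle, and half the distance of nonreal zeros to the real axis.\<close>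
  define S where "S = insert (e1/3) ((%z. (R - cmod z)/2) ` Z t0 \<union> (%z. \<bar>Im z\<bar>/2) ` (Z t0 - \<real>))"
  have fS: "finite S" using Z(2)[OF t0] by (auto simp: S_def)
  define e0 where "e0 = Min S"
  have "0 < e0" unfolding e0_def using fS e1 Z(1)[OF t0] by (subst Min_gr_iff) (auto simp: S_def complex_is_Real_iff)
  have e0: "e0 \<le> e1/3" "!!z. z \<in> Z t0 ==> e0 \<le> (R - cmod z)/2" "!!z. z \<in> Z t0 ==> z \<notin> \<real> ==> e0 \<le> \<bar>Im z\<bar>/2"
    unfolding e0_def by (intro Min_le[OF fS]; simp add: S_def)+
  have main: "isolating t0 e &
     (\<exists>\<delta>>0. \<forall>t\<in>{0..1}. \<bar>t - t0\<bar> < \<delta> -->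
       tracking t0 e t)"
    if e: "0 < e" "e \<le> e0" for e
  proof -
    have sub: "Elementary_Metric_Spaces.cball z e \<subseteq> ball 0 R" if z: "z \<in> Z t0" for z
    proof
      fix w assume "w \<in> Elementary_Metric_Spaces.cball z e"
      then have "cmod w \<le> cmod z + e" using norm_triangle_sub[of w z] by (auto simp: dist_norm norm_minus_commute)
      moreover have "cmod z < R" using z Z(1)[OF t0] by auto
      ultimately show "w \<in> ball 0 R" using e0(2)[OF z] e by simp
    qed
    have sub2: "Elementary_Metric_Spaces.cball z e \<subseteq> ball 0 (2 * R)" if z: "z \<in> Z t0" for z
      using sub[OF z] R by (auto simp: subset_iff)
    have iso: "\<phi> t0 w ~= 0" if z: "z \<in> Z t0" and w: "cmod (w - z) = e" for z w
    proof
      assume "\<phi> t0 w = 0"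
      moreover have "w \<in> ball 0 R" using sub[OF z] w by (auto simp: dist_norm norm_minus_commute subset_iff)
      ultimately have "w \<in> Z t0" using Z(1)[OF t0] by simp
      moreover have "w ~= z" using w e by auto
      ultimately show False using e1(2)[of w z] z w e e0(1) e1(1) by auto
    qed
    have "\<forall>z\<in>Z t0. \<exists>\<delta>>0. \<forall>t\<in>{0..1}. \<bar>t - t0\<bar> < \<delta> --> (\<exists>y\<in>ball z e. \<phi> t y = 0)"
    proof
      fix z assume z: "z \<in> Z t0"
      have "\<phi> t0 z = 0" using z Z(1)[OF t0] by simp
      from zero_nearby[OF t0 hol cont[OF t0] this e(1) sub2[OF z] iso[OF z]]
      show "\<exists>\<delta>>0. \<forall>t\<in>{0..1}. \<bar>t - t0\<bar> < \<delta> --> (\<exists>y\<in>ball z e. \<phi> t y = 0)" by simp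
    qed
    then obtain d where d: "!!z. z \<in> Z t0 ==> 0 < d z" "!!z t. z \<in> Z t0 ==> t \<in> {0..1} ==> \<bar>t - t0\<bar> < d z ==> \<exists>y\<in>ball z e. \<phi> t y = 0" by metis
    define \<delta> where "\<delta> = Min (insert 1 (d ` Z t0))"
    have fd: "finite (insert 1 (d ` Z t0))" using Z(2)[OF t0] by simp
    have \<delta>: "0 < \<delta>" "!!z. z \<in> Z t0 ==> \<delta> \<le> d z" unfolding \<delta>_def using fd d(1) by (auto simp: Min_gr_iff intro!: Min_le)
    have "tracking t0 e t" if t: "t \<in> {0..1}" "\<bar>t - t0\<bar> < \<delta>" for t
    proof -
      have "\<forall>z\<in>Z t0. \<exists>y. y \<in> Z t & cmod (y - z) < e"
      proof
        fix z assume z: "z \<in> Z t0"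
        then obtain y where y: "y \<in> ball z e" "\<phi> t y = 0" using d(2)[OF z t(1)] t(2) \<delta>(2)[OF z] by auto
        then have "y \<in> Z t" using Z(1)[OF t(1)] sub[OF z] by (auto simp: subset_iff)
        then show "\<exists>y. y \<in> Z t & cmod (y - z) < e" using y by (auto simp: dist_norm norm_minus_commute)
      qed
      then obtain H where H: "!!z. z \<in> Z t0 ==> H z \<in> Z t" "!!z. z \<in> Z t0 ==> cmod (H z - z) < e" by metis
      have close: "z = w" if "z \<in> Z t0" "w \<in> Z t0" "cmod (u - z) < e" "cmod (u - w) < e" for z w u
      proof (rule ccontr)
        assume "z ~= w"
        then have "e1 \<le> cmod (z - w)" using e1(2) that by blast
        also have "... \<le> cmod (u - w) + cmod (u - z)" using norm_triangle_ineq4[of "u - w" "u - z"] by simp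
        finally show False using that e e0(1) e1(1) by linarith
      qed
      have inj: "inj_on H (Z t0)" using close H(2) unfolding inj_on_def by metis
      have "H ` Z t0 = Z t"
        using H(1) card_image[OF inj] Z(3)[OF t0] Z(3)[OF t(1)] Z(2)[OF t(1)] by (intro card_subset_eq) auto
      then have bij: "bij_betw H (Z t0) (Z t)" using inj by (simp add: bij_betw_def)
      have uniq: "u = v" if "z \<in> Z t0" "u \<in> Z t" "v \<in> Z t" "cmod (u - z) < e" "cmod (v - z) < e" for z u v
      proof -
        obtain zu zv where z: "zu \<in> Z t0" "u = H zu" "zv \<in> Z t0" "v = H zv" using \<open>u \<in> Z t\<close> \<open>v \<in> Z t\<close> bij_betw_imp_surj_on[OF bij] by (metis imageE)
        have "zu = z" "zv = z" using close[OF z(1) that(1), of u] close[OF z(3) that(1), of v] H(2) z that by auto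
        then show ?thesis using z by simp
      qed
      have real: "z \<in> \<real> \<longleftrightarrow> H z \<in> \<real>" if z: "z \<in> Z t0" for z
      proof
        assume zr: "z \<in> \<real>"
        have Hz: "H z \<in> Z t" using H(1)[OF z] .
        then have "cnj (H z) \<in> Z t" using Z(1)[OF t(1)] sym[OF t(1), of "H z"] R by auto
        moreover have "cmod (cnj (H z) - z) < e"
        proof -
          have "cnj (H z) - z = cnj (H z - z)" using zr by (auto elim!: Reals_cases)
          then show ?thesis using H(2)[OF z] by (metis complex_mod_cnj)
        qed
        ultimately have "cnj (H z) = H z" using uniq[OF z _ Hz] H(2)[OF z] by blast
        then show "H z \<in> \<real>" by (simp add: Reals_cnj_iff)
      next
        assume Hr: "H z \<in> \<real>"
        show "z \<in> \<real>"
        proof (rule ccontr)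
          assume "z \<notin> \<real>"
          then have "2 * e0 \<le> \<bar>Im z\<bar>" using e0(3)[OF z] by simp
          moreover have "\<bar>Im z\<bar> \<le> cmod (H z - z)" using Hr abs_Im_le_cmod[of "H z - z"] by (auto simp: complex_is_Real_iff)
          ultimately show False using H(2)[OF z] e by linarith
        qed
      qed
      show ?thesis unfolding tracking_def using bij H(2) real uniq by blast
    qed
    moreover have "isolating t0 e" unfolding isolating_def using sub iso by blast
    ultimately show ?thesis using \<delta>(1) by blast
  qed
  then show ?thesis using \<open>0 < e0\<close> by blast
qed

text \<open>The real zeros together with the two endpoints, so that each point of (-R, R) either is
  one of these or lies between two consecutive ones.\<close>

definition B :: "real => real set" where "B t = insert R (insert (- R) {y. of_real y \<in> Z t})"

lemma finite_B: "t \<in> {0..1} ==> finite (B t)"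
proof -
  assume "t \<in> {0..1}"
  then have "finite (of_real -` Z t :: real set)" using Z(2) by (intro finite_vimageI) (auto simp: inj_on_def)
  then show ?thesis by (simp add: B_def vimage_def)
qed

lemma B_interior: "t \<in> {0..1} ==> y \<in> B t ==> y ~= R ==> y ~= - R ==> of_real y \<in> Z t & \<bar>y\<bar> < R"
  using Z(1) by (auto simp: B_def)

lemma local_B:
  assumes t0: "t0 \<in> {0..1}" and e: "0 < e"
  shows "\<exists>\<delta>>0. \<forall>t\<in>{0..1}. \<bar>t - t0\<bar> < \<delta> --> (\<exists>h. strict_mono_on (B t0) h & h ` B t0 = B t & (\<forall>y\<in>B t0. \<bar>h y - y\<bar> < e))"
proof -
  obtain e0 where e0: "e0 > 0" and loc: "!!e. 0 < e ==> e \<le> e0 ==> \<exists>\<delta>>0. \<forall>t\<in>{0..1}. \<bar>t - t0\<bar> < \<delta> --> tracking t0 e t"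
    using local_roots[OF t0] by blast
  obtain e1 where e1: "e1 > 0" "!!y w. y \<in> B t0 ==> w \<in> B t0 ==> y ~= w ==> e1 \<le> \<bar>y - w\<bar>"
  proof -
    obtain e1 where "e1 > 0" "\<forall>z\<in>of_real ` B t0. \<forall>w\<in>of_real ` B t0. z ~= w --> e1 \<le> cmod (z - w)"
      using finite_separated[of "of_real ` B t0"] finite_B[OF t0] by blast
    then show thesis by (intro that[of e1]) (auto simp flip: of_real_diff)
  qed
  define e' where "e' = min e (min e0 (e1/2))"
  have e': "0 < e'" "e' \<le> e" "e' \<le> e0" "e' \<le> e1/2" using e e0 e1(1) by (auto simp: e'_def)
  obtain \<delta> where \<delta>: "\<delta> > 0" "!!t. t\<in>{0..1} ==> \<bar>t - t0\<bar> < \<delta> ==> \<exists>H. bij_betw H (Z t0) (Z t) & (\<forall>z\<in>Z t0. cmod (H z - z) < e' & (z \<in> \<real> \<longleftrightarrow> H z \<in> \<real>))"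
    using loc[OF e'(1,3)] unfolding tracking_def by blast
  have "\<exists>h. strict_mono_on (B t0) h & h ` B t0 = B t & (\<forall>y\<in>B t0. \<bar>h y - y\<bar> < e)" if t: "t \<in> {0..1}" "\<bar>t - t0\<bar> < \<delta>" for t
  proof -
    obtain H where H: "bij_betw H (Z t0) (Z t)" "!!z. z\<in>Z t0 ==> cmod (H z - z) < e'" "!!z. z\<in>Z t0 ==> z \<in> \<real> \<longleftrightarrow> H z \<in> \<real>" using \<delta>(2)[OF t] by blast
    define h where "h y = (if \<bar>y\<bar> = R then y else Re (H (of_real y)))" for y :: real
    have in0: "\<bar>y\<bar> < R" if "of_real y \<in> Z t0" for y :: real using that Z(1)[OF t0] by auto
    have Hh: "H (of_real y) = of_real (h y)" if "of_real y \<in> Z t0" for y :: real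
      using H(3)[OF that] in0[OF that] by (auto simp: h_def complex_is_Real_iff complex_eq_iff)
    have cl: "\<bar>h y - y\<bar> < e'" if "y \<in> B t0" for y
    proof (cases "\<bar>y\<bar> = R")
      case True then show ?thesis using e'(1) by (simp add: h_def)
    next
      case False
      then have "of_real y \<in> Z t0" using B_interior[OF t0 that] R by auto
      then show ?thesis using H(2) Hh by (metis norm_of_real of_real_diff)
    qed
    have "strict_mono_on (B t0) h"
    proof (rule strict_mono_onI)
      fix a b assume ab: "a \<in> B t0" "b \<in> B t0" "a < b"
      then have "e1 \<le> b - a" using e1(2)[of b a] by auto
      then show "h a < h b" using cl[OF ab(1)] cl[OF ab(2)] e'(4) by linarith
    qed
    moreover have "h ` B t0 = B t"
    proof
      show "h ` B t0 \<subseteq> B t"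
      proof (rule image_subsetI)
        fix y assume y: "y \<in> B t0"
        show "h y \<in> B t"
        proof (cases "\<bar>y\<bar> = R")
          case True then show ?thesis by (auto simp: h_def B_def)
        next
          case False
          then have z: "of_real y \<in> Z t0" using B_interior[OF t0 y] R by auto
          then have "H (of_real y) \<in> Z t" using H(1) by (auto simp: bij_betw_def)
          then show ?thesis using Hh[OF z] by (simp add: B_def)
        qed
      qed
      show "B t \<subseteq> h ` B t0"
      proof
        fix y assume y: "y \<in> B t"
        show "y \<in> h ` B t0"
        proof (cases "\<bar>y\<bar> = R")
          case True then have "h y = y" "y \<in> B t0" using R by (auto simp: h_def B_def)
          then show ?thesis by (metis imageI)
        next
          case False
          then have "of_real y \<in> Z t" using B_interior[OF t(1) y] R by auto
          then obtain z where z: "z \<in> Z t0" "H z = of_real y" using bij_betw_imp_surj_on[OF H(1)] by (metis imageE)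
          then have "z \<in> \<real>" using H(3) by auto
          then obtain x where x: "z = of_real x" by (auto elim: Reals_cases)
          then have "h x = y" using Hh[of x] z by simp
          then show ?thesis using z x by (auto simp: B_def)
        qed
      qed
    qed
    ultimately show ?thesis using cl e'(2) by (intro exI[of _ h]) force
  qed
  then show ?thesis using \<delta>(1) by blast
qed

definition nB where "nB = card (B 0)"
definition xi :: "nat => real => real" where "xi k t = sorted_list_of_set (B t) ! k"

text \<open>By \<open>local_B\<close> the cardinality is locally constant, and the parameter
  interval is connected.\<close>

lemma card_B: assumes "t \<in> {0..1}" shows "card (B t) = nB"
proof -
  have "\<exists>\<delta>>0. \<forall>s\<in>{0..1}. dist s t0 < \<delta> --> card (B s) = card (B t0)" if t0: "t0 \<in> {0..1}" for t0
  proof -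
    obtain \<delta> where \<delta>: "\<delta> > 0" "!!t. t\<in>{0..1} ==> \<bar>t - t0\<bar> < \<delta> ==> \<exists>h. strict_mono_on (B t0) h & h ` B t0 = B t & (\<forall>y\<in>B t0. \<bar>h y - y\<bar> < 1)" using local_B[OF t0 zero_less_one] by blast
    have "card (B s) = card (B t0)" if "s \<in> {0..1}" "dist s t0 < \<delta>" for s
      using \<delta>(2)[of s] that strict_mono_on_imp_inj_on card_image by (metis dist_real_def)
    then show ?thesis using \<delta>(1) by blast
  qed
  then have "continuous_on {0..1} (%t. real (card (B t)))"
    unfolding continuous_on_iff by (metis dist_self)
  then have "(%t. real (card (B t))) constant_on {0..1}"
  proof (intro continuous_discrete_range_constant)
    have "1 \<le> norm (real p - real q)" if "p ~= q" for p q using that by (cases "p < q") auto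
    then show "\<exists>e>0. \<forall>y. y \<in> {0..1} & real (card (B y)) ~= real (card (B x)) --> e \<le> norm (real (card (B y)) - real (card (B x)))" for x :: real
      by (intro exI[of _ 1]) simp
  qed auto
  then show ?thesis using assms unfolding constant_on_def nB_def by (metis atLeastAtMost_iff of_nat_eq_iff order_refl zero_le_one)
qed

lemma xi_local: 
  assumes t0: "t0 \<in> {0..1}" and t: "t \<in> {0..1}" and h: "strict_mono_on (B t0) h" "h ` B t0 = B t" and k: "k < nB"
  shows "xi k t = h (xi k t0)" "xi k t0 \<in> B t0"
proof -
  have "length (sorted_list_of_set (B t0)) = nB" using finite_B[OF t0] card_B[OF t0] by simp
  then show "xi k t = h (xi k t0)" unfolding xi_def h(2)[symmetric] sorted_list_of_set_image[OF finite_B[OF t0] h(1)] using k by simp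
  have "set (sorted_list_of_set (B t0)) = B t0" using finite_B[OF t0] by simp
  then show "xi k t0 \<in> B t0" unfolding xi_def using k \<open>length (sorted_list_of_set (B t0)) = nB\<close> nth_mem by metis
qed

lemma xi_mem: "t \<in> {0..1} ==> k < nB ==> xi k t \<in> B t"
  using xi_local(2)[of t t id k] by (simp add: strict_mono_on_def)

lemma xi_continuous: assumes k: "k < nB" shows "continuous_on {0..1} (xi k)"
  unfolding continuous_on_iff
proof (intro ballI allI impI)
  fix t0 e :: real assume t0: "t0 \<in> {0..1}" and e: "0 < e"
  obtain \<delta> where \<delta>: "\<delta> > 0" "!!t. t\<in>{0..1} ==> \<bar>t - t0\<bar> < \<delta> ==> \<exists>h. strict_mono_on (B t0) h & h ` B t0 = B t & (\<forall>y\<in>B t0. \<bar>h y - y\<bar> < e)"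
    using local_B[OF t0 e] by blast
  have "dist (xi k t) (xi k t0) < e" if "t \<in> {0..1}" "dist t t0 < \<delta>" for t
    using \<delta>(2)[of t] that xi_local[OF t0 that(1) _ _ k] by (metis dist_real_def)
  then show "\<exists>d>0. \<forall>x'\<in>{0..1}. dist x' t0 < d --> dist (xi k x') (xi k t0) < e" using \<delta>(1) by blast
qed

lemma xi_less: "t \<in> {0..1} ==> k < l ==> l < nB ==> xi k t < xi l t"
  unfolding xi_def using sorted_list_of_set.strict_sorted_key_list_of_set[of "B t"] finite_B[of t] card_B[of t] by (auto simp: sorted_wrt_iff_nth_less)

lemma xi_surj: assumes "t \<in> {0..1}" "y \<in> B t" obtains k where "k < nB" "y = xi k t"
proof -
  have "y \<in> set (sorted_list_of_set (B t))" using finite_B[OF assms(1)] assms by simp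
  then show thesis using that card_B[OF assms(1)] finite_B[OF assms(1)] unfolding in_set_conv_nth xi_def by auto
qed

text \<open>The endpoints belong to \<open>B t\<close> for every \<open>t\<close> and bound it, so
  the first and last index always describe them; an interior index at time 0 can never reach an
  end.\<close>

lemma xi_ends: assumes t: "t \<in> {0..1}" and k: "k < nB"
  shows "\<bar>xi k t\<bar> \<le> R" "xi k 0 = R ==> xi k t = R" "xi k 0 = - R ==> xi k t = - R"
proof -
  have mem: "\<bar>y\<bar> \<le> R" if "s \<in> {0..1}" "y \<in> B s" for s y using B_interior[OF that] R by (cases "y = R"; cases "y = - R") auto
  show "\<bar>xi k t\<bar> \<le> R" using mem[OF t xi_mem[OF t k]] .
  have 0: "(0::real) \<in> {0..1}" by simp
  show "xi k t = R" if "xi k 0 = R"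
  proof (rule ccontr)
    assume ne: "xi k t ~= R"
    obtain l where l: "l < nB" "R = xi l t" using xi_surj[OF t, of R] by (auto simp: B_def)
    then have "k < l" using ne xi_less[OF t, of l k] k mem[OF t xi_mem[OF t k]] by (metis abs_le_D1 linorder_neqE_nat not_le)
    then show False using xi_less[OF 0, of k l] l mem[OF 0 xi_mem[OF 0 l(1)]] that by auto
  qed
  show "xi k t = - R" if "xi k 0 = - R"
  proof (rule ccontr)
    assume ne: "xi k t ~= - R"
    obtain l where l: "l < nB" "- R = xi l t" using xi_surj[OF t, of "- R"] by (auto simp: B_def)
    then have "l < k" using ne xi_less[OF t, of k l] k mem[OF t xi_mem[OF t k]] by (metis abs_le_D2 linorder_neqE_nat minus_le_iff not_le)
    then show False using xi_less[OF 0, of l k] k mem[OF 0 xi_mem[OF 0 l(1)]] that by auto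
  qed
qed

lemma xi_interior: assumes t: "t \<in> {0..1}" and k: "k < nB" and i: "\<bar>xi k 0\<bar> < R"
  shows "of_real (xi k t) \<in> Z t"
proof -
  have 0: "(0::real) \<in> {0..1}" by simp
  have "xi k t ~= R"
  proof
    assume e: "xi k t = R"
    obtain l where l: "l < nB" "R = xi l 0" using xi_surj[OF 0, of R] by (auto simp: B_def)
    then have "xi l t = R" using xi_ends(2)[OF t l(1)] by simp
    then have "l = k" using e xi_less[OF t, of l k] xi_less[OF t, of k l] k l(1) by (metis linorder_neqE_nat order_less_irrefl)
    then show False using l i by simp
  qed
  moreover have "xi k t ~= - R"
  proof
    assume e: "xi k t = - R"
    obtain l where l: "l < nB" "- R = xi l 0" using xi_surj[OF 0, of "- R"] by (auto simp: B_def)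
    then have "xi l t = - R" using xi_ends(3)[OF t l(1)] by simp
    then have "l = k" using e xi_less[OF t, of l k] xi_less[OF t, of k l] k l(1) by (metis linorder_neqE_nat order_less_irrefl)
    then show False using l(2) i R by simp
  qed
  ultimately show ?thesis using B_interior[OF t xi_mem[OF t k]] by blast
qed

text \<open>The times at which \<psi> vanishes on the k-th root form a closed set. It is also open:
  near such a time \<psi> keeps a zero close by, this is a zero of \<phi>, and there is only one of
  those in the disc. Connectedness of the interval leaves all or nothing.\<close>

lemma factor_zero_along_root:
  fixes \<psi> :: "real => complex => complex"
  assumes h: "!!t. t \<in> {0..1} ==> \<psi> t holomorphic_on ball 0 (2 * R)"
    and c: "!!t0 \<eta>. t0 \<in> {0..1} ==> 0 < \<eta> ==> \<exists>\<delta>>0. \<forall>t\<in>{0..1}. \<bar>t - t0\<bar> < \<delta> --> (\<forall>y\<in>ball 0 (2 * R). cmod (\<psi> t y - \<psi> t0 y) < \<eta>)"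
    and z: "!!t y. t \<in> {0..1} ==> \<psi> t y = 0 ==> \<phi> t y = 0"
    and k: "k < nB" and i: "\<bar>xi k 0\<bar> < R" and cu: "continuous_on {0..1} (%t. \<psi> t (of_real (xi k t)))"
    and t: "t \<in> {0..1}"
  shows "\<psi> t (of_real (xi k t)) = 0 \<longleftrightarrow> \<psi> 0 (of_real (xi k 0)) = 0"
proof -
  let ?u = "%t. \<psi> t (of_real (xi k t))"
  let ?A = "{t \<in> {0..1}. ?u t = 0}"
  have "closedin (top_of_set {0..1}) ?A" by (rule continuous_closedin_preimage_constant[OF cu])
  moreover have "openin (top_of_set {0..1}) ?A"
    unfolding openin_contains_ball
  proof (intro conjI ballI)
    fix t0 assume "t0 \<in> ?A"
    then have t0: "t0 \<in> {0..1}" "?u t0 = 0" by auto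
    let ?z = "of_real (xi k t0) :: complex"
    have zZ: "?z \<in> Z t0" using xi_interior[OF t0(1) k i] .
    obtain e where e: "e > 0" "Elementary_Metric_Spaces.cball ?z e \<subseteq> ball 0 R" "!!w. \<phi> t0 w = 0 ==> cmod (w - ?z) ~= e"
       and ex: "\<exists>\<delta>>0. \<forall>t\<in>{0..1}. \<bar>t - t0\<bar> < \<delta> --> (\<forall>u\<in>Z t. \<forall>v\<in>Z t. cmod (u - ?z) < e --> cmod (v - ?z) < e --> u = v)"
    proof -
      obtain e0 where e0: "e0 > 0" and loc: "isolating t0 e0" "\<exists>\<delta>>0. \<forall>t\<in>{0..1}. \<bar>t - t0\<bar> < \<delta> --> tracking t0 e0 t"
        using local_roots[OF t0(1)] by blast
      have i: "Elementary_Metric_Spaces.cball ?z e0 \<subseteq> ball 0 R" "!!w. \<phi> t0 w = 0 ==> cmod (w - ?z) ~= e0" using loc(1) zZ unfolding isolating_def by blast+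
      have "\<exists>\<delta>>0. \<forall>t\<in>{0..1}. \<bar>t - t0\<bar> < \<delta> --> (\<forall>u\<in>Z t. \<forall>v\<in>Z t. cmod (u - ?z) < e0 --> cmod (v - ?z) < e0 --> u = v)"
        using loc(2) zZ unfolding tracking_def by blast
      then show thesis using that[OF e0 i] by blast
    qed
    obtain \<delta>1 where d1: "\<delta>1 > 0" "!!t u v. t\<in>{0..1} ==> \<bar>t - t0\<bar> < \<delta>1 ==> u\<in>Z t ==> v\<in>Z t ==> cmod (u - ?z) < e ==> cmod (v - ?z) < e ==> u = v" using ex by blast
    have "\<exists>\<delta>>0. \<forall>t\<in>{0..1}. \<bar>t - t0\<bar> < \<delta> --> (\<exists>y\<in>ball ?z e. \<psi> t y = 0)"
    proof (rule zero_nearby[OF t0(1) h c[OF t0(1)] t0(2) e(1)])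
      show "Elementary_Metric_Spaces.cball ?z e \<subseteq> ball 0 (2 * R)" using e(2) R by (auto simp: subset_iff)
      show "\<psi> t0 y ~= 0" if "cmod (y - ?z) = e" for y using z[OF t0(1), of y] e(3)[of y] that by blast
    qed
    then obtain \<delta>2 where d2: "\<delta>2 > 0" "!!t. t\<in>{0..1} ==> \<bar>t - t0\<bar> < \<delta>2 ==> \<exists>y\<in>ball ?z e. \<psi> t y = 0" by blast
    obtain \<delta>3 where d3: "\<delta>3 > 0" "!!t. t\<in>{0..1} ==> dist t t0 < \<delta>3 ==> dist (xi k t) (xi k t0) < e"
      using xi_continuous[OF k] t0(1) e(1) unfolding continuous_on_iff by metis
    have "s \<in> ?A" if s: "s \<in> {0..1}" "\<bar>s - t0\<bar> < min \<delta>1 (min \<delta>2 \<delta>3)" for s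
    proof -
      obtain y where y: "y \<in> ball ?z e" "\<psi> s y = 0" using d2(2)[OF s(1)] s(2) by auto
      have "y \<in> Z s" using Z(1)[OF s(1)] z[OF s(1) y(2)] y(1) e(2) by (auto simp: subset_iff)
      moreover have "of_real (xi k s) \<in> Z s" using xi_interior[OF s(1) k i] .
      moreover have "cmod (of_real (xi k s) - ?z) < e" using d3(2)[OF s(1)] s(2) by (simp add: dist_real_def flip: of_real_diff)
      moreover have "cmod (y - ?z) < e" using y(1) by (simp add: dist_norm norm_minus_commute)
      ultimately have "y = of_real (xi k s)" using d1(2)[OF s(1)] s(2) by auto
      then show ?thesis using y(2) s by simp
    qed
    then have "ball t0 (min \<delta>1 (min \<delta>2 \<delta>3)) \<inter> {0..1} \<subseteq> ?A" by (auto simp: dist_real_def abs_minus_commute)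
    then show "\<exists>e>0. ball t0 e \<inter> {0..1} \<subseteq> ?A" using d1(1) d2(1) d3(1) by (intro exI[of _ "min \<delta>1 (min \<delta>2 \<delta>3)"]) auto
  qed auto
  ultimately have "?A = {} \<or> ?A = {0..1}" using connected_clopen[of "{0..1::real}"] by auto
  then show ?thesis
  proof
    assume e: "?A = {}"
    have "0 \<notin> ?A" "t \<notin> ?A" unfolding e by simp_all
    then show ?thesis using t by simp
  next
    assume e: "?A = {0..1}"
    have "0 \<in> ?A" "t \<in> ?A" unfolding e using t by simp_all
    then show ?thesis by simp
  qed
qed

end

section \<open>Functions regular in one variable: roots and discriminants\<close>

definition cpx :: "('i => real) => 'i => complex" where "cpx a = (%i. complex_of_real (a i))"

definition HBR :: "'i set => real => (('i => complex) => complex) => bool" where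
  "HBR S r F \<longleftrightarrow> HB S r F & (\<forall>a. cpx a \<in> pd S r --> F (cpx a) \<in> \<real>)"

lemma HBR_HB: "HBR S r F ==> HB S r F" by (simp add: HBR_def)
lemma HBR_real: "HBR S r F ==> cpx a \<in> pd S r ==> F (cpx a) \<in> \<real>" by (simp add: HBR_def)
lemma HBR_mono: "HBR S r F ==> r' \<le> r ==> HBR S r' F"
  unfolding HBR_def using HB_mono[of S r F r'] pd_mono[of r' r S] by blast
lemma HBR_const: "c \<in> \<real> ==> HBR S r (%z. c)" by (simp add: HBR_def HB_const)
lemma HBR_coord: "i \<in> S ==> HBR S r (%z. z i)" by (simp add: HBR_def HB_coord cpx_def)
lemma HBR_add: "HBR S r F ==> HBR S r G ==> HBR S r (%z. F z + G z)" by (simp add: HBR_def HB_add)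
lemma HBR_mult: "HBR S r F ==> HBR S r G ==> HBR S r (%z. F z * G z)" by (simp add: HBR_def HB_mult)
lemma HBR_prod: "(!!i. i \<in> I ==> HBR S r (F i)) ==> HBR S r (%z. \<Prod>i\<in>I. F i z)"
  by (induction I rule: infinite_finite_induct) (auto intro: HBR_const HBR_mult)
lemma HBR_sum: "(!!i. i \<in> I ==> HBR S r (F i)) ==> HBR S r (%z. \<Sum>i\<in>I. F i z)"
  by (induction I rule: infinite_finite_induct) (auto intro: HBR_const HBR_add)
lemma HBR_sum_list: "(!!p. p \<in> set L ==> HBR S r (F p)) ==> HBR S r (%z. \<Sum>p\<leftarrow>L. F p z)"
  by (induction L) (auto intro: HBR_const HBR_add)

text \<open>\<open>f(z)\<close> and the conjugate of \<open>f\<close> at the conjugate point agree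
  on the real axis, hence everywhere by the identity theorem.\<close>

lemma schwarz_symmetry:
  assumes f: "f holomorphic_on ball 0 r" and real: "!!x::real. \<bar>x\<bar> < r ==> f (of_real x) \<in> \<real>" and y: "y \<in> ball 0 r"
  shows "f (cnj y) = cnj (f y)"
proof -
  have r: "0 < r" using y by (auto intro: le_less_trans[OF norm_ge_zero])
  have "cnj ` ball 0 r = ball 0 r" by (auto simp: image_iff intro!: bexI[of _ "cnj _"])
  then have "(%w. cnj (f (cnj w))) holomorphic_on ball 0 r"
    using holomorphic_on_compose_cnj_cnj[of f "ball 0 r"] f by (simp add: o_def)
  then have h: "(%w. f w - cnj (f (cnj w))) holomorphic_on ball 0 r" by (intro holomorphic_intros f)
  have "f (cnj y) - cnj (f (cnj (cnj y))) = 0"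
  proof (rule analytic_continuation[OF h, of "of_real ` {0<..<r}" 0])
    show "0 islimpt complex_of_real ` {0<..<r}"
      unfolding islimpt_approachable
    proof (intro allI impI)
      fix e :: real assume "0 < e"
      then show "\<exists>x'\<in>complex_of_real ` {0<..<r}. x' ~= 0 & dist x' 0 < e"
        using r by (intro bexI[of _ "of_real (min e r / 2)"] imageI) (auto simp: min_def)
    qed
    show "f z - cnj (f (cnj z)) = 0" if "z \<in> of_real ` {0<..<r}" for z
      using that real by (auto simp: Reals_cnj_iff)
  qed (use y r in auto)
  then show ?thesis by simp
qed

text \<open>The setting of Weierstrass preparation for the variable \<open>i\<close>: by
  \<open>lo\<close> no zeros lie in the annulus R \<le> |y| < 2 R, uniformly for \<open>x\<close> in
  a small polydisc. \<open>F\<close> is a member whose zeros include those of all other members, so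
  its roots alone need to be followed.\<close>

locale regfam =
  fixes S :: "'i set" and i :: 'i and Gs :: "(('i => complex) => complex) set" and F :: "('i => complex) => complex"
    and r R r1 \<mu> M C :: real and N :: nat
  assumes fS: "finite S" and iS: "i \<notin> S" and HBRG: "!!f. f \<in> Gs ==> HBR (insert i S) r f" and FG: "F \<in> Gs"
    and zero: "!!f z. f \<in> Gs ==> f z = 0 ==> F z = 0"
    and pos: "0 < R" "2 * R \<le> 1" "10 * R \<le> r" "0 < r1" "10 * r1 \<le> r" "0 < \<mu>" "0 < M" "0 < C" "1 \<le> N"
    and bd: "!!f z. f \<in> Gs ==> z \<in> pd (insert i S) r ==> cmod (f z) \<le> M"
    and lo: "!!f x y. f \<in> Gs ==> x \<in> pd S r1 ==> R \<le> cmod y ==> cmod y < 2 * R ==> \<mu> \<le> cmod (f (x(i := y)))"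
    and lip: "!!f z z' \<delta>. f \<in> Gs ==> z \<in> pd (insert i S) (r/2) ==> z' \<in> pd (insert i S) (r/2) ==> 0 \<le> \<delta> ==>
        (!!j. j \<in> insert i S ==> cmod (z' j - z j) \<le> \<delta>) ==> cmod (f z' - f z) \<le> C * \<delta>"
    and NN: "!!n. n > N ==> M * (2/3) ^ n < \<mu>"
begin

lemma rpos: "0 < r" using pos by linarith

lemma upd_pd: "x \<in> pd S r1 ==> cmod y < 5 * R ==> x(i := y) \<in> pd (insert i S) (r/2)"
  using pos(1,3,4,5) by (fastforce simp: pd_def)

lemma upd_pd4: "x \<in> pd S r1 ==> cmod y \<le> R ==> x(i := y) \<in> pd (insert i S) (r/4)"
  using pos(1,3,4,5) by (fastforce simp: pd_def)

lemma pd_half: "z \<in> pd T (r/2) ==> z \<in> pd T r" using pd_mono[of "r/2" r T] rpos by auto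

lemma upd_pdr: "x \<in> pd S r1 ==> cmod y < 5 * R ==> x(i := y) \<in> pd (insert i S) r"
  by (intro pd_half upd_pd)

lemma slice_holo:
  assumes "f \<in> Gs" "x \<in> pd S r1"
  shows "(%y. f (x(i := y))) holomorphic_on ball 0 (5 * R)"
proof -
  have e: "lin (x(i := 0)) ((%_. 0)(i := 1)) w = x(i := w)" for w by (auto simp: fun_eq_iff)
  have "(%w. f (lin (x(i := 0)) ((%_. 0)(i := 1)) w)) holomorphic_on {w. lin (x(i := 0)) ((%_. 0)(i := 1)) w \<in> pd (insert i S) r}"
    by (rule HB_holo[OF HBR_HB[OF HBRG[OF assms(1)]]])
  then have "(%w. f (x(i := w))) holomorphic_on {w. x(i := w) \<in> pd (insert i S) r}" unfolding e .
  then show ?thesis by (rule holomorphic_on_subset) (use upd_pdr[OF assms(2)] in auto)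
qed

definition fac where
  "fac f x zs g \<longleftrightarrow> length zs \<le> N & set zs \<subseteq> ball 0 R & g holomorphic_on ball 0 (5 * R) &
     (\<forall>y\<in>ball 0 (5 * R). f (x(i := y)) = (\<Prod>z\<leftarrow>zs. y - z) * g y) & (\<forall>y\<in>ball 0 (2 * R). g y ~= 0)"

definition Zs where "Zs f x = {y \<in> ball 0 R. f (x(i := y)) = 0}"

lemma fac_ex:
  assumes "f \<in> Gs" "x \<in> pd S r1" shows "\<exists>zs g. fac f x zs g"
proof -
  obtain zs g where "length zs \<le> N" "set zs \<subseteq> ball 0 R" "g holomorphic_on ball 0 (5 * R)"
     "!!y. y \<in> ball 0 (5 * R) ==> f (x(i := y)) = (\<Prod>z\<leftarrow>zs. y - z) * g y" "!!y. y \<in> ball 0 (2 * R) ==> g y ~= 0"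
  proof (rule factor_zeros[OF slice_holo[OF assms] _ pos(1) pos(6), of M N])
    show "cmod (f (x(i := y))) \<le> M" if "y \<in> ball 0 (5 * R)" for y
      using that by (intro bd[OF assms(1)] pd_half upd_pd[OF assms(2)]) simp
  qed (use lo[OF assms] NN in auto)
  then show ?thesis unfolding fac_def by blast
qed

lemma fac_set: assumes "fac f x zs g" shows "set zs = Zs f x"
proof -
  have f: "f (x(i := y)) = (\<Prod>z\<leftarrow>zs. y - z) * g y" "g y ~= 0" if "y \<in> ball 0 R" for y
    using assms that pos(1) unfolding fac_def by (auto simp: subset_iff)
  have s: "set zs \<subseteq> ball 0 R" using assms unfolding fac_def by blast
  have "y \<in> set zs \<longleftrightarrow> f (x(i := y)) = 0" if "y \<in> ball 0 R" for y
    unfolding f(1)[OF that] using f(2)[OF that] by (auto simp: prod_list_zero_iff)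
  then show ?thesis using s unfolding Zs_def by blast
qed

lemma fac_lower:
  assumes f: "f \<in> Gs" and x: "x \<in> pd S r1" and y: "cmod y \<le> R" and t: "0 \<le> t" "t \<le> 1" "!!z. z \<in> Zs f x ==> t \<le> cmod (y - z)"
  shows "\<mu> * t ^ N \<le> cmod (f (x(i := y)))"
proof -
  obtain zs g where fc: "fac f x zs g" using fac_ex[OF f x] by blast
  show ?thesis
  proof (rule factored_lower_bound[where f = "%y. f (x(i := y))" and zs = zs and g = g and R = R])
    show "t \<le> cmod (y - z)" if "z \<in> set zs" for z using t(3) fac_set[OF fc] that by blast
  qed (use fc pos lo[OF f x] y t(1,2) in \<open>auto simp: fac_def\<close>)
qed

lemma Zs_subset: "f \<in> Gs ==> Zs f x \<subseteq> Zs F x" unfolding Zs_def using zero by blast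

lemma Zs_finite: assumes "x \<in> pd S r1" shows "finite (Zs F x)" "card (Zs F x) \<le> N"
proof -
  obtain zs g where fc: "fac F x zs g" using fac_ex[OF FG assms] by blast
  show "finite (Zs F x)" "card (Zs F x) \<le> N" unfolding fac_set[OF fc, symmetric] using fc card_length[of zs] by (auto simp: fac_def)
qed

definition ps where
  "ps e x = integral {0..1} (%t::real. let y = of_real R * exp (2 * of_real pi * \<i> * of_real t) in y * (y ^ e * deriv (%w. F (x(i := w))) y / F (x(i := y))))"

lemma ps_eq: assumes "x \<in> pd S r1" "fac F x zs g" shows "ps e x = (\<Sum>z\<leftarrow>zs. z ^ e)"
  unfolding ps_def
proof (rule power_sum_integral[where f = "%w. F (x(i := w))" and g = g and zs = zs and R = R and e = e, OF pos(1)])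
  show "g holomorphic_on ball 0 (2 * R)" by (rule holomorphic_on_subset[of g "ball 0 (5 * R)"]) (use assms(2) pos(1) in \<open>auto simp: fac_def\<close>)
  show "g y ~= 0" if "y \<in> ball 0 (2 * R)" for y using assms(2) that unfolding fac_def by blast
  show "set zs \<subseteq> ball 0 R" using assms(2) unfolding fac_def by blast
  show "F (x(i := y)) = (\<Prod>z\<leftarrow>zs. y - z) * g y" if "y \<in> ball 0 (2 * R)" for y
  proof -
    have "y \<in> ball 0 (5 * R)" using that pos(1) by simp
    then show ?thesis using assms(2) unfolding fac_def by blast
  qed
qed

lemma real_slice:
  assumes "cpx a \<in> pd S r1" "f \<in> Gs" "cmod y < 5 * R"
  shows "f ((cpx a)(i := cnj y)) = cnj (f ((cpx a)(i := y)))"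
proof (rule schwarz_symmetry[OF slice_holo[OF assms(2,1)]])
  fix u :: real assume "\<bar>u\<bar> < 5 * R"
  then have "(cpx a)(i := of_real u) \<in> pd (insert i S) r" by (intro upd_pdr[OF assms(1)]) simp
  moreover have "(cpx a)(i := of_real u) = cpx (a(i := u))" by (auto simp: cpx_def)
  ultimately show "f ((cpx a)(i := of_real u)) \<in> \<real>" using HBR_real[OF HBRG[OF assms(2)], of "a(i := u)"] by simp
qed (use assms in auto)

text \<open>Conjugating all roots and the cofactor gives another admissible factorization of the
  same slice, so the power sum equals its own conjugate.\<close>

lemma ps_real: assumes "cpx a \<in> pd S r1" shows "ps e (cpx a) \<in> \<real>"
proof -
  obtain zs g where fc: "fac F (cpx a) zs g" using fac_ex[OF FG assms] by blast
  have pl: "(\<Prod>z\<leftarrow>map cnj ws. y - z) = cnj (\<Prod>z\<leftarrow>ws. cnj y - z)" for ws y by (induction ws) auto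
  have sl: "(\<Sum>z\<leftarrow>map cnj ws. z ^ e) = cnj (\<Sum>z\<leftarrow>ws. z ^ e)" for ws by (induction ws) auto
  have "cnj ` ball 0 (5 * R) = ball 0 (5 * R)" by (auto simp: image_iff intro!: bexI[of _ "cnj _"])
  then have gh: "(%w. cnj (g (cnj w))) holomorphic_on ball 0 (5 * R)"
    using holomorphic_on_compose_cnj_cnj[of g "ball 0 (5 * R)"] fc by (simp add: o_def fac_def)
  have "F ((cpx a)(i := y)) = (\<Prod>z\<leftarrow>map cnj zs. y - z) * cnj (g (cnj y))" if y: "cmod y < 5 * R" for y
  proof -
    have "F ((cpx a)(i := y)) = cnj (F ((cpx a)(i := cnj y)))" using real_slice[OF assms FG y] by simp
    also have "... = cnj ((\<Prod>z\<leftarrow>zs. cnj y - z) * g (cnj y))" using fc y unfolding fac_def by simp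
    finally show ?thesis unfolding pl by simp
  qed
  moreover have "set (map cnj zs) \<subseteq> ball 0 R" "length (map cnj zs) \<le> N" "\<forall>y\<in>ball 0 (2 * R). cnj (g (cnj y)) ~= 0"
    using fc unfolding fac_def by auto
  ultimately have "fac F (cpx a) (map cnj zs) (%w. cnj (g (cnj w)))" using gh unfolding fac_def by simp
  then have "ps e (cpx a) = (\<Sum>z\<leftarrow>map cnj zs. z ^ e)" by (rule ps_eq[OF assms])
  also have "... = cnj (ps e (cpx a))" unfolding sl using ps_eq[OF assms fc] by simp
  finally show ?thesis by (simp add: Reals_cnj_iff)
qed

lemma HB_upd: assumes G: "HB (insert i S) \<rho> G" and y: "cmod y < \<rho>" and \<rho>: "r1 \<le> \<rho>" shows "HB S r1 (%x. G (x(i := y)))"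
  by (rule HB_affine[OF G, where \<Psi> = "%v. v(i := 0)"]) (use y \<rho> in \<open>auto simp: pd_def\<close>)

lemma quotient_lipschitz:
  fixes A A' B B' :: complex
  assumes "cmod (A - A') \<le> LA * \<delta>" "cmod (B - B') \<le> LB * \<delta>" "cmod A' \<le> MA" "\<mu> \<le> cmod B" "\<mu> \<le> cmod B'" "0 \<le> LB * \<delta>"
  shows "cmod (A / B - A' / B') \<le> (LA / \<mu> + MA * LB / \<mu>\<^sup>2) * \<delta>"
proof -
  have B: "B ~= 0" "B' ~= 0" using assms pos(6) by auto
  have "A / B - A' / B' = (A - A') / B + A' * (B' - B) / (B * B')" using B by (simp add: field_simps)
  then have "cmod (A / B - A' / B') \<le> cmod (A - A') / cmod B + cmod A' * cmod (B - B') / (cmod B * cmod B')"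
    using norm_triangle_ineq[of "(A - A') / B" "A' * (B' - B) / (B * B')"] by (simp add: norm_divide norm_mult norm_minus_commute)
  also have "... \<le> (LA * \<delta>) / \<mu> + (MA * (LB * \<delta>)) / (\<mu> * \<mu>)"
    using assms(4,5) pos(6) order_trans[OF norm_ge_zero assms(3)] order_trans[OF norm_ge_zero assms(1)]
    by (intro add_mono frac_le mult_mono[OF assms(3,2)] mult_mono[OF assms(4,5)] mult_pos_pos mult_nonneg_nonneg[OF _ assms(6)] assms(1)) auto
  also have "... = (LA / \<mu> + MA * LB / \<mu>\<^sup>2) * \<delta>" using pos(6) by (simp add: field_simps power2_eq_square)
  finally show ?thesis .
qed

text \<open>For fixed \<open>t\<close> the integrand is a quotient of holomorphic functions with
  denominator at least \<mu>, and it is Lipschitz in \<open>t\<close> uniformly in \<open>x\<close>.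
  Hence its Riemann sums converge uniformly.\<close>

lemma ps_HB: "HB S r1 (ps e)"
proof -
  define P where "P = (%z. deriv (%w. F (z(i := w))) (z i))"
  define A where "A = (%z. z i * (z i ^ e * P z))"
  have PH: "HB (insert i S) (r/2) P" unfolding P_def using fS by (intro HB_partial HBR_HB HBRG FG rpos) auto
  have AH: "HB (insert i S) (r/2) A" unfolding A_def by (intro HB_mult HB_power HB_coord PH) auto
  have FH: "HB (insert i S) (r/2) F" using HB_mono[OF HBR_HB[OF HBRG[OF FG]], of "r/2"] rpos by simp
  obtain LA where LA: "LA > 0" "!!z z' \<delta>. z\<in>pd (insert i S) (r/4) ==> z'\<in>pd (insert i S) (r/4) ==> \<delta>\<ge>0 ==> (\<forall>j\<in>insert i S. cmod (z' j - z j) \<le> \<delta>) ==> cmod (A z' - A z) \<le> LA * \<delta>"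
    using HB_lipschitz[OF AH] rpos by auto
  obtain MA where MA: "MA > 0" "!!z. z \<in> pd (insert i S) (r/2) ==> cmod (A z) \<le> MA" using HB_bounded[OF AH] by blast
  define Y where "Y = (%t::real. of_real R * exp (2 * of_real pi * \<i> * of_real t))"
  have Yn: "cmod (Y t) = R" for t using pos(1) by (simp add: Y_def norm_mult)
  have Yl: "cmod (Y s - Y t) \<le> 2 * pi * R * \<bar>s - t\<bar>" for s t
  proof -
    have "cmod (exp (\<i> * of_real u) - 1) \<le> \<bar>u\<bar>" for u :: real
      using dist_exp_i_1[of u] abs_sin_x_le_abs_x[of "u/2"] by (simp add: dist_norm)
    then have "cmod (exp (\<i> * of_real (2 * pi * (s - t))) - 1) \<le> \<bar>2 * pi * (s - t)\<bar>" .
    moreover have "Y s - Y t = Y t * (exp (\<i> * of_real (2 * pi * (s - t))) - 1)"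
      unfolding Y_def by (simp add: algebra_simps flip: exp_add)
    ultimately show ?thesis using pos(1) by (simp add: norm_mult Yn abs_mult mult.assoc mult_left_mono)
  qed
  define Q where "Q x t = A (x(i := Y t)) / F (x(i := Y t))" for x t
  have QH: "HB S r1 (%x. Q x t)" for t unfolding Q_def
  proof (rule HB_divide[where c = \<mu>])
    show "HB S r1 (%x. A (x(i := Y t)))" "HB S r1 (%x. F (x(i := Y t)))" by (rule HB_upd[OF AH] HB_upd[OF FH]; use Yn[of t] pos in simp)+
    show "\<mu> \<le> cmod (F (x(i := Y t)))" if "x \<in> pd S r1" for x using lo[OF FG that, of "Y t"] Yn[of t] pos(1) by simp
  qed (rule pos(6))
  define L where "L = (LA / \<mu> + MA * C / \<mu>\<^sup>2) * (2 * pi * R)"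
  have L0: "0 \<le> L" unfolding L_def using LA(1) MA(1) pos by (intro mult_nonneg_nonneg add_nonneg_nonneg) auto
  have Ql: "cmod (Q x s - Q x t) \<le> L * \<bar>s - t\<bar>" if x: "x \<in> pd S r1" for x s t
  proof -
    define \<delta> where "\<delta> = 2 * pi * R * \<bar>s - t\<bar>"
    have \<delta>: "0 \<le> \<delta>" using pos(1) by (simp add: \<delta>_def)
    have in4: "x(i := Y s) \<in> pd (insert i S) (r/4)" for s using upd_pd4[OF x] Yn by simp
    have in2: "x(i := Y s) \<in> pd (insert i S) (r/2)" for s using upd_pd[OF x] Yn pos(1) by simp
    have d: "cmod ((x(i := Y s)) j - (x(i := Y t)) j) \<le> \<delta>" for j using Yl[of s t] \<delta> by (simp add: \<delta>_def)
    have "cmod (Q x s - Q x t) \<le> (LA / \<mu> + MA * C / \<mu>\<^sup>2) * \<delta>" unfolding Q_def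
    proof (rule quotient_lipschitz)
      show "cmod (A (x(i := Y s)) - A (x(i := Y t))) \<le> LA * \<delta>" using d by (intro LA(2)[OF in4 in4 \<delta>]) blast
      show "cmod (F (x(i := Y s)) - F (x(i := Y t))) \<le> C * \<delta>" using d by (intro lip[OF FG in2 in2 \<delta>])
      show "cmod (A (x(i := Y t))) \<le> MA" by (rule MA(2)[OF in2])
    qed (use lo[OF FG x] Yn pos \<delta> in auto)
    then show ?thesis by (simp add: L_def \<delta>_def mult.assoc)
  qed
  have psQ: "ps e x = integral {0..1} (Q x)" for x
    unfolding ps_def Q_def A_def P_def Y_def Let_def by simp
  show ?thesis
  proof (rule HB_uniform_limit[OF fS, where Fn = "%n x. of_real (1 / real (Suc n)) * (\<Sum>k<Suc n. Q x (real k / real (Suc n)))" and c = L])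
    show "HB S r1 (%x. of_real (1 / real (Suc n)) * (\<Sum>k<Suc n. Q x (real k / real (Suc n))))" for n
      by (intro HB_mult HB_const HB_sum QH)
    show "cmod (of_real (1 / real (Suc n)) * (\<Sum>k<Suc n. Q x (real k / real (Suc n))) - ps e x) \<le> L / real (Suc n)" if "x \<in> pd S r1" for n x
      unfolding psQ using riemann_sum_bound[of "Q x" L n, OF Ql[OF that] L0] by (simp add: scaleR_conv_of_real)
    fix x x' :: "'i => complex" assume "!!j. j \<in> S ==> x j = x' j"
    then have "F (x(i := w)) = F (x'(i := w))" for w by (intro HB_depends[OF FH]) auto
    then show "ps e x = ps e x'" unfolding ps_def by simp
  qed
qed

lemma ps_HBR: "HBR S r1 (ps e)" unfolding HBR_def using ps_HB ps_real by blast

definition Dfun where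
  "Dfun j x = (\<Sum>p\<leftarrow>(SOME L. \<forall>\<tau>. mpoly j L \<tau> = vand j \<tau>). of_real (fst p) * (\<Prod>a<j. ps (snd p a) x))"

lemma Dfun_HBR: "HBR S r1 (Dfun j)"
  unfolding Dfun_def by (intro HBR_sum_list HBR_mult HBR_const HBR_prod ps_HBR) auto

lemma Dfun_eq: assumes "x \<in> pd S r1" "fac F x zs g" shows "Dfun j x = Dtup j zs"
proof -
  define L where "L = (SOME L. \<forall>\<tau>. mpoly j L \<tau> = vand j \<tau>)"
  have L: "mpoly j L \<tau> = vand j \<tau>" for \<tau> using someI_ex[OF vand_mpoly[of j]] unfolding L_def by blast
  have s: "ps e x = (\<Sum>k<length zs. zs ! k ^ e)" for e
    using ps_eq[OF assms, of e] by (simp add: sum_list_sum_nth atLeast0LessThan)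
  have "Dfun j x = (\<Sum>p\<leftarrow>L. of_real (fst p) * (\<Prod>a<j. \<Sum>k<length zs. zs ! k ^ snd p a))" unfolding Dfun_def L_def s ..
  then show ?thesis unfolding Dtup_def L[symmetric]
    using mpoly_tuple_sum[of j L "%k. zs ! k" "length zs"] by simp
qed

lemma Dfun_card: assumes "x \<in> pd S r1"
  shows "Dfun (card (Zs F x)) x ~= 0" "card (Zs F x) < j ==> Dfun j x = 0"
    "z \<in> Zs F x ==> w \<in> Zs F x ==> z ~= w ==> cmod (Dfun (card (Zs F x)) x) \<le> real (Suc N) ^ N * cmod (z - w)"
proof -
  obtain zs g where fc: "fac F x zs g" using fac_ex[OF FG assms] by blast
  note st = fac_set[OF fc]
  obtain K :: nat where K: "1 \<le> K" "Dtup (card (set zs)) zs = of_nat K * (\<Prod>z\<in>set zs. \<Prod>w\<in>set zs - {z}. z - w)"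
    using Dtup_card[OF refl refl, of zs] by blast
  have "Dtup (card (set zs)) zs ~= 0" unfolding K(2) using K(1) by (auto simp: prod_zero_iff)
  then show "Dfun (card (Zs F x)) x ~= 0" unfolding Dfun_eq[OF assms fc] st .
  show "Dfun j x = 0" if "card (Zs F x) < j" unfolding Dfun_eq[OF assms fc] using Dtup_high[of zs j] that st by simp
  show "cmod (Dfun (card (Zs F x)) x) \<le> real (Suc N) ^ N * cmod (z - w)" if "z \<in> Zs F x" "w \<in> Zs F x" "z ~= w"
    unfolding Dfun_eq[OF assms fc] st[symmetric] using fc that pos(2) by (intro Dtup_separation(1)) (auto simp: fac_def st)
qed

text \<open>The number of distinct roots is the largest \<open>j\<close> with \<open>Dfun j\<close>
  nonzero, so it is read off from the zero pattern of the discriminants.\<close>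

lemma card_Zs_eq:
  assumes x: "x \<in> pd S r1" "x' \<in> pd S r1" and e: "!!j. j \<le> N ==> Dfun j x = 0 \<longleftrightarrow> Dfun j x' = 0"
  shows "card (Zs F x) = card (Zs F x')"
proof (rule antisym)
  show "card (Zs F x) \<le> card (Zs F x')"
    using Dfun_card(1)[OF x(1)] Dfun_card(2)[OF x(2), of "card (Zs F x)"] e[of "card (Zs F x)"] Zs_finite(2)[OF x(1)] by (meson not_le)
  show "card (Zs F x') \<le> card (Zs F x)"
    using Dfun_card(1)[OF x(2)] Dfun_card(2)[OF x(1), of "card (Zs F x')"] e[of "card (Zs F x')"] Zs_finite(2)[OF x(2)] by (meson not_le)
qed

end

section \<open>Lifting a path to the additional variable\<close>

definition rv :: "(('i => complex) => complex) => ('i => real) => real" where "rv f a = Re (f (cpx a))"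

lemma cpx_upd: "cpx (a(i := y)) = (cpx a)(i := of_real y)" by (auto simp: cpx_def)

lemma sgn_const:
  fixes u :: "real => real"
  assumes c: "continuous_on {0..1} u" and nz: "!!t. t \<in> {0..1} ==> u t ~= 0" and t: "t \<in> {0..1}"
  shows "sgn (u t) = sgn (u 0)"
proof (rule ccontr)
  assume ne: "sgn (u t) ~= sgn (u 0)"
  have "connected (u ` {0..1})" using c by (intro connected_continuous_image) auto
  moreover have "u t \<in> u ` {0..1}" "u 0 \<in> u ` {0..1}" using t by auto
  moreover have "(u t < 0 & 0 < u 0) \<or> (u 0 < 0 & 0 < u t)" using ne nz[OF t] nz[of 0] by (auto simp: sgn_real_def split: if_splits)
  ultimately have "0 \<in> u ` {0..1}" using connectedD_interval[of "u ` {0..1}"] by (meson less_imp_le)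
  then show False using nz by auto
qed

lemma segment_in_path:
  fixes u :: "real => real"
  assumes c: "continuous_on {0..1} u" and t: "t \<in> {0..1}"
  shows "closed_segment (u 0) (u t) \<subseteq> u ` {0..1}"
proof -
  have "connected (u ` {0..1})" using c by (intro connected_continuous_image) auto
  then have "convex (u ` {0..1})" by (simp add: is_interval_connected_1 flip: is_interval_convex_1)
  then show ?thesis using t by (intro closed_segment_subset) auto
qed

context regfam begin

lemma real_value:
  assumes "cpx a \<in> pd S r1" "\<bar>y\<bar> < 5 * R" "f \<in> Gs"
  shows "f ((cpx a)(i := of_real y)) = of_real (rv f (a(i := y)))"
proof -
  have "cpx (a(i := y)) \<in> pd (insert i S) r" unfolding cpx_upd using assms(2) by (intro upd_pdr[OF assms(1)]) simp
  then have "f (cpx (a(i := y))) \<in> \<real>" by (rule HBR_real[OF HBRG[OF assms(3)]])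
  then show ?thesis unfolding rv_def cpx_upd[symmetric] by (simp add: complex_is_Real_iff complex_eq_iff)
qed

end

text \<open>\<open>x\<close> is a path for the variables in \<open>S\<close>, as supplied by the
  induction. \<tau> limits how far roots can wander, \<open>s\<close> separates the roots at the end
  of the path, \<kappa> is the distance from other roots demanded at the end, and \<open>y0\<close>
  is the starting value of the new coordinate.\<close>

locale lifted_path = regfam +
  fixes x :: "real => 'a => real" and \<rho>1 \<tau> s \<kappa> y0 :: real
  assumes xc: "!!j. j \<in> S ==> continuous_on {0..1} (%t. x t j)"
    and xp: "!!t. t \<in> {0..1} ==> cpx (x t) \<in> pd S r1"
    and xr: "!!t j. t \<in> {0..1} ==> j \<in> S ==> \<bar>x t j - x 0 j\<bar> \<le> \<rho>1"
    and \<rho>1: "0 \<le> \<rho>1" "C * \<rho>1 < \<mu> * \<tau> ^ N" "0 < \<tau>" "\<tau> \<le> 1"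
    and cJ: "!!t. t \<in> {0..1} ==> card (Zs F (cpx (x t))) = card (Zs F (cpx (x 0)))"
    and sep: "!!z w. z \<in> Zs F (cpx (x 1)) ==> w \<in> Zs F (cpx (x 1)) ==> z ~= w ==> s \<le> cmod (z - w)"
    and s: "s \<le> 1" "C * s \<le> \<mu>" "s \<le> 2 * R" and \<kappa>: "0 < \<kappa>" "4 * \<kappa> \<le> s" and y0: "\<bar>y0\<bar> < R"
begin

lemma lip_path:
  assumes f: "f \<in> Gs" and t: "t \<in> {0..1}" "t0 \<in> {0..1}" and y: "cmod y < 5 * R" "cmod y' < 5 * R"
  shows "cmod (f ((cpx (x t))(i := y)) - f ((cpx (x t0))(i := y'))) \<le> C * ((\<Sum>j\<in>S. \<bar>x t j - x t0 j\<bar>) + cmod (y - y'))"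
proof (rule lip[OF f upd_pd[OF xp[OF t(2)] y(2)] upd_pd[OF xp[OF t(1)] y(1)]])
  show n: "0 \<le> (\<Sum>j\<in>S. \<bar>x t j - x t0 j\<bar>) + cmod (y - y')" by (intro add_nonneg_nonneg sum_nonneg) auto
  fix j assume j: "j \<in> insert i S"
  show "cmod (((cpx (x t))(i := y)) j - ((cpx (x t0))(i := y')) j) \<le> (\<Sum>j\<in>S. \<bar>x t j - x t0 j\<bar>) + cmod (y - y')"
  proof (cases "j = i")
    case True
    have "0 \<le> (\<Sum>j\<in>S. \<bar>x t j - x t0 j\<bar>)" by (intro sum_nonneg) auto
    then show ?thesis using True by simp
  next
    case False
    then have "\<bar>x t j - x t0 j\<bar> \<le> (\<Sum>j\<in>S. \<bar>x t j - x t0 j\<bar>)" using j fS member_le_sum[of j S "%j. \<bar>x t j - x t0 j\<bar>"] by simp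
    moreover have "cmod (((cpx (x t))(i := y)) j - ((cpx (x t0))(i := y')) j) = \<bar>x t j - x t0 j\<bar>"
      using False by (simp add: cpx_def flip: of_real_diff)
    ultimately show ?thesis by (metis add_increasing2 norm_ge_zero)
  qed
qed

lemma unif_cont:
  assumes f: "f \<in> Gs" and t0: "t0 \<in> {0..1}" and \<eta>: "0 < \<eta>"
  shows "\<exists>\<delta>>0. \<forall>t\<in>{0..1}. \<bar>t - t0\<bar> < \<delta> --> (\<forall>y\<in>ball 0 (2 * R). cmod (f ((cpx (x t))(i := y)) - f ((cpx (x t0))(i := y))) < \<eta>)"
proof -
  have "continuous_on {0..1} (%t. C * (\<Sum>j\<in>S. \<bar>x t j - x t0 j\<bar>))" by (intro continuous_intros xc)
  then obtain \<delta> where \<delta>: "\<delta> > 0" "!!t. t\<in>{0..1} ==> dist t t0 < \<delta> ==> dist (C * (\<Sum>j\<in>S. \<bar>x t j - x t0 j\<bar>)) (C * (\<Sum>j\<in>S. \<bar>x t0 j - x t0 j\<bar>)) < \<eta>"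
    by (elim continuous_on_iff[THEN iffD1, rule_format, OF _ t0 \<eta>, THEN exE]) blast
  have "cmod (f ((cpx (x t))(i := y)) - f ((cpx (x t0))(i := y))) < \<eta>" if t: "t \<in> {0..1}" "\<bar>t - t0\<bar> < \<delta>" and y: "y \<in> ball 0 (2 * R)" for t y
  proof -
    have "cmod (f ((cpx (x t))(i := y)) - f ((cpx (x t0))(i := y))) \<le> C * ((\<Sum>j\<in>S. \<bar>x t j - x t0 j\<bar>) + cmod (y - y))"
      using y pos(1) by (intro lip_path[OF f t(1) t0]) auto
    moreover have "C * (\<Sum>j\<in>S. \<bar>x t j - x t0 j\<bar>) < \<eta>" using \<delta>(2)[of t] t by (simp add: dist_real_def)
    ultimately show ?thesis by simp
  qed
  then show ?thesis using \<delta>(1) by blast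
qed

lemma cont_along:
  assumes f: "f \<in> Gs" and Y: "continuous_on {0..1} Y" "!!t. t \<in> {0..1} ==> \<bar>Y t\<bar> \<le> R"
  shows "continuous_on {0..1} (%t. f ((cpx (x t))(i := of_real (Y t))))" "continuous_on {0..1} (%t. rv f ((x t)(i := Y t)))"
proof -
  show c: "continuous_on {0..1} (%t. f ((cpx (x t))(i := of_real (Y t))))"
    unfolding continuous_on_iff
  proof (intro ballI allI impI)
    fix t0 e :: real assume t0: "t0 \<in> {0..1}" and e: "0 < e"
    have "continuous_on {0..1} (%t. C * ((\<Sum>j\<in>S. \<bar>x t j - x t0 j\<bar>) + \<bar>Y t - Y t0\<bar>))" by (intro continuous_intros xc Y)
    then obtain \<delta> where \<delta>: "\<delta> > 0" "!!t. t\<in>{0..1} ==> dist t t0 < \<delta> ==> dist (C * ((\<Sum>j\<in>S. \<bar>x t j - x t0 j\<bar>) + \<bar>Y t - Y t0\<bar>)) (C * ((\<Sum>j\<in>S. \<bar>x t0 j - x t0 j\<bar>) + \<bar>Y t0 - Y t0\<bar>)) < e"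
      by (elim continuous_on_iff[THEN iffD1, rule_format, OF _ t0 e, THEN exE]) blast
    have "dist (f ((cpx (x t))(i := of_real (Y t)))) (f ((cpx (x t0))(i := of_real (Y t0)))) < e" if t: "t \<in> {0..1}" "dist t t0 < \<delta>" for t
    proof -
      have "dist (f ((cpx (x t))(i := of_real (Y t)))) (f ((cpx (x t0))(i := of_real (Y t0)))) \<le> C * ((\<Sum>j\<in>S. \<bar>x t j - x t0 j\<bar>) + cmod (of_real (Y t) - of_real (Y t0)))"
        unfolding dist_norm using Y(2)[OF t(1)] Y(2)[OF t0] pos(1) by (intro lip_path[OF f t(1) t0]) auto
      then show ?thesis using \<delta>(2)[OF t] by (simp add: dist_real_def flip: of_real_diff)
    qed
    then show "\<exists>d>0. \<forall>t\<in>{0..1}. dist t t0 < d --> dist (f ((cpx (x t))(i := of_real (Y t)))) (f ((cpx (x t0))(i := of_real (Y t0)))) < e"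
      using \<delta>(1) by blast
  qed
  have "continuous_on {0..1} (%t. Re (f ((cpx (x t))(i := of_real (Y t)))))" by (intro continuous_intros c)
  then show "continuous_on {0..1} (%t. rv f ((x t)(i := Y t)))" unfolding rv_def cpx_upd .
qed

sublocale rf: root_family "%t y. F ((cpx (x t))(i := y))" R "%t. Zs F (cpx (x t))" "card (Zs F (cpx (x 0)))"
proof
  show "0 < R" by (rule pos(1))
  show "(%y. F ((cpx (x t))(i := y))) holomorphic_on ball 0 (2 * R)" if "t \<in> {0..1}" for t
    by (rule holomorphic_on_subset[OF slice_holo[OF FG xp[OF that]]]) (use pos(1) in auto)
  show "F ((cpx (x t))(i := cnj y)) = cnj (F ((cpx (x t))(i := y)))" if "t \<in> {0..1}" "y \<in> ball 0 (2 * R)" for t y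
    using that(2) pos(1) by (intro real_slice[OF xp[OF that(1)] FG]) auto
  show "Zs F (cpx (x t)) = {y \<in> ball 0 R. F ((cpx (x t))(i := y)) = 0}" for t by (rule Zs_def)
  show "finite (Zs F (cpx (x t)))" if "t \<in> {0..1}" for t by (rule Zs_finite(1)[OF xp[OF that]])
qed (rule unif_cont[OF FG] cJ; assumption)+

text \<open>At distance \<tau> from all initial roots |F| is at least \<mu> \<tau>^N at time 0, more
  than the C \<rho>1 by which \<open>F\<close> can change along the path. So the root stays in the
  union of at most \<open>N\<close> discs, whose real shadows have total length at most 2 N
  \<tau>.\<close>

lemma xi_confined:
  assumes k: "k < rf.nB" and t: "t \<in> {0..1}"
  shows "\<bar>rf.xi k t - rf.xi k 0\<bar> \<le> 2 * real N * \<tau>"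
proof (cases "\<bar>rf.xi k 0\<bar> < R")
  case True
  have near: "\<exists>z\<in>Zs F (cpx (x 0)). cmod (of_real (rf.xi k t) - z) < \<tau>" if t: "t \<in> {0..1}" for t
  proof (rule ccontr)
    assume no: "\<not> ?thesis"
    have zt: "of_real (rf.xi k t) \<in> Zs F (cpx (x t))" by (rule rf.xi_interior[OF t k True])
    then have ab: "\<bar>rf.xi k t\<bar> < R" "F ((cpx (x t))(i := of_real (rf.xi k t))) = 0" by (auto simp: Zs_def)
    have "\<mu> * \<tau> ^ N \<le> cmod (F ((cpx (x 0))(i := of_real (rf.xi k t))))"
      using no ab(1) \<rho>1 by (intro fac_lower[OF FG xp]) (auto simp: not_less)
    also have "... = cmod (F ((cpx (x t))(i := of_real (rf.xi k t))) - F ((cpx (x 0))(i := of_real (rf.xi k t))))" using ab(2) by simp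
    also have "... \<le> C * \<rho>1"
    proof (rule lip[OF FG upd_pd[OF xp] upd_pd[OF xp[OF t]] \<rho>1(1)])
      fix j assume "j \<in> insert i S"
      then show "cmod (((cpx (x t))(i := of_real (rf.xi k t))) j - ((cpx (x 0))(i := of_real (rf.xi k t))) j) \<le> \<rho>1"
        using xr[OF t, of j] \<rho>1(1) by (auto simp: cpx_def simp flip: of_real_diff)
    qed (use ab pos in auto)
    finally show False using \<rho>1(2) by simp
  qed
  show ?thesis
  proof (subst abs_minus_commute, rule interval_cover_bound[where A = "Re ` Zs F (cpx (x 0))"])
    have fin: "finite (Zs F (cpx (x 0)))" "card (Zs F (cpx (x 0))) \<le> N" using Zs_finite[OF xp[of 0]] by auto
    show "finite (Re ` Zs F (cpx (x 0)))" using fin by simp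
    show "card (Re ` Zs F (cpx (x 0))) \<le> N" using fin card_image_le[OF fin(1), of Re] by linarith
    show "0 \<le> \<tau>" using \<rho>1 by simp
    have "rf.xi k ` {0..1} \<subseteq> (\<Union>c\<in>Re ` Zs F (cpx (x 0)). ball c \<tau>)"
    proof (rule image_subsetI)
      fix t :: real assume "t \<in> {0..1}"
      from near[OF this] obtain z where z: "z \<in> Zs F (cpx (x 0))" "cmod (of_real (rf.xi k t) - z) < \<tau>" by blast
      then have "\<bar>rf.xi k t - Re z\<bar> < \<tau>" using abs_Re_le_cmod[of "of_real (rf.xi k t) - z"] by simp
      then show "rf.xi k t \<in> (\<Union>c\<in>Re ` Zs F (cpx (x 0)). ball c \<tau>)" using z(1) by (auto simp: dist_real_def abs_minus_commute)
    qed
    then show "closed_segment (rf.xi k 0) (rf.xi k t) \<subseteq> (\<Union>c\<in>Re ` Zs F (cpx (x 0)). ball c \<tau>)"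
      by (rule order_trans[OF segment_in_path[OF rf.xi_continuous[OF k] t]])
  qed
next
  case False
  have "\<bar>rf.xi k 0\<bar> \<le> R" using rf.xi_ends(1)[of 0 k] k by simp
  then have "rf.xi k 0 = R \<or> rf.xi k 0 = - R" using False by linarith
  then have "rf.xi k t = rf.xi k 0" using rf.xi_ends(2,3)[OF t k] by auto
  then show ?thesis using \<rho>1(3) by simp
qed

text \<open>The separation of roots extends to the endpoints: there |F| \<ge> \<mu>, and by the
  Lipschitz bound a zero of \<open>F\<close> cannot be closer than \<mu> / C \<ge> s.\<close>

lemma B_separated:
  assumes "p \<in> rf.B 1" "q \<in> rf.B 1" "p < q"
  shows "s \<le> q - p"
proof -
  have one: "(1::real) \<in> {0..1}" by simp
  have edge: "s \<le> \<bar>e - p\<bar>" if e: "\<bar>e\<bar> = R" and p: "of_real p \<in> Zs F (cpx (x 1))" for e p :: real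
  proof -
    have p': "\<bar>p\<bar> < R" "F ((cpx (x 1))(i := of_real p)) = 0" using p by (auto simp: Zs_def)
    have "C * s \<le> \<mu>" by (rule s(2))
    also have "\<mu> \<le> cmod (F ((cpx (x 1))(i := of_real e)))" using e pos(1) by (intro lo[OF FG xp[OF one]]) auto
    also have "... = cmod (F ((cpx (x 1))(i := of_real e)) - F ((cpx (x 1))(i := of_real p)))" using p'(2) by simp
    also have "... \<le> C * \<bar>e - p\<bar>"
      using lip_path[OF FG one one, of "of_real e" "of_real p"] e p' pos(1) by (simp flip: of_real_diff)
    finally show ?thesis using pos(8) by simp
  qed
  have B: "u = R \<or> u = - R \<or> of_real u \<in> Zs F (cpx (x 1))" if "u \<in> rf.B 1" for u using that by (auto simp: rf.B_def)
  have zz: "s \<le> \<bar>u - v\<bar>" if "of_real u \<in> Zs F (cpx (x 1))" "of_real v \<in> Zs F (cpx (x 1))" "u ~= v" for u v :: real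
    using sep[OF that(1,2)] that(3) by (simp flip: of_real_diff)
  have "s \<le> \<bar>q - p\<bar>"
    using B[OF assms(1)] B[OF assms(2)]
  proof (elim disjE)
    assume "of_real p \<in> Zs F (cpx (x 1))" "of_real q \<in> Zs F (cpx (x 1))"
    then show ?thesis using zz[of q p] assms(3) by simp
  next
    assume "p = R" "of_real q \<in> Zs F (cpx (x 1))" then show ?thesis using edge[of p q] pos(1) by (simp add: abs_minus_commute)
  next
    assume "p = - R" "of_real q \<in> Zs F (cpx (x 1))" then show ?thesis using edge[of p q] pos(1) by (simp add: abs_minus_commute)
  next
    assume "q = R" "of_real p \<in> Zs F (cpx (x 1))" then show ?thesis using edge[of q p] pos(1) by simp
  next
    assume "q = - R" "of_real p \<in> Zs F (cpx (x 1))" then show ?thesis using edge[of q p] pos(1) by simp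
  qed (use s(3) assms(3) pos(1) in auto)
  then show ?thesis using assms(3) by simp
qed

lemma rv_abs: "t \<in> {0..1} ==> f \<in> Gs ==> \<bar>y\<bar> \<le> R ==> cmod (f ((cpx (x t))(i := of_real y))) = \<bar>rv f ((x t)(i := y))\<bar>"
  using real_value[OF xp, of t y f] pos(1) by simp

definition good_lift :: "(real => real) => bool" where
  "good_lift Y \<longleftrightarrow> Y 0 = y0 & continuous_on {0..1} Y & (\<forall>t\<in>{0..1}. \<bar>Y t - y0\<bar> \<le> 6 * real N * \<tau> + \<kappa> & \<bar>Y t\<bar> \<le> R) &
     (\<forall>f\<in>Gs. (\<forall>t\<in>{0..1}. sgn (rv f ((x t)(i := Y t))) = sgn (rv f ((x 0)(i := y0)))) &
        (rv f ((x 0)(i := y0)) = 0 \<or> \<mu> * \<kappa> ^ N \<le> \<bar>rv f ((x 1)(i := Y 1))\<bar>))"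

lemma good_liftI:
  assumes Y: "Y 0 = y0" "continuous_on {0..1} Y" "!!t. t\<in>{0..1} ==> \<bar>Y t - y0\<bar> \<le> 6 * real N * \<tau> + \<kappa>" "!!t. t\<in>{0..1} ==> \<bar>Y t\<bar> \<le> R"
    and pat: "!!f t. f \<in> Gs ==> t \<in> {0..1} ==> f ((cpx (x t))(i := of_real (Y t))) = 0 \<longleftrightarrow> f ((cpx (x 0))(i := of_real y0)) = 0"
    and far: "!!f z. f \<in> Gs ==> f ((cpx (x 1))(i := of_real (Y 1))) ~= 0 ==> z \<in> Zs f (cpx (x 1)) ==> \<kappa> \<le> cmod (of_real (Y 1) - z)"
  shows "good_lift Y"
  unfolding good_lift_def
proof (intro conjI ballI)
  fix f assume f: "f \<in> Gs"
  have rz: "rv f ((x t)(i := Y t)) = 0 \<longleftrightarrow> f ((cpx (x t))(i := of_real (Y t))) = 0" if "t \<in> {0..1}" for t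
    using rv_abs[OF that f Y(4)[OF that]] by (metis abs_eq_0 norm_eq_zero)
  have r0: "rv f ((x 0)(i := y0)) = 0 \<longleftrightarrow> f ((cpx (x 0))(i := of_real y0)) = 0" using rz[of 0] Y(1) by simp
  have rp: "rv f ((x t)(i := Y t)) = 0 \<longleftrightarrow> rv f ((x 0)(i := y0)) = 0" if "t \<in> {0..1}" for t using rz[OF that] r0 pat[OF f that] by simp
  show "sgn (rv f ((x t)(i := Y t))) = sgn (rv f ((x 0)(i := y0)))" if t: "t \<in> {0..1}" for t
  proof (cases "rv f ((x 0)(i := y0)) = 0")
    case True then show ?thesis using rp[OF t] by simp
  next
    case False
    then show ?thesis using sgn_const[OF cont_along(2)[OF f Y(2,4)] _ t] rp Y(1) by simp
  qed
  show "rv f ((x 0)(i := y0)) = 0 \<or> \<mu> * \<kappa> ^ N \<le> \<bar>rv f ((x 1)(i := Y 1))\<bar>"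
  proof (cases "rv f ((x 0)(i := y0)) = 0")
    case False
    have "\<mu> * \<kappa> ^ N \<le> cmod (f ((cpx (x 1))(i := of_real (Y 1))))"
    proof (rule fac_lower[OF f xp])
      show "\<kappa> \<le> cmod (of_real (Y 1) - z)" if "z \<in> Zs f (cpx (x 1))" for z
        using far[OF f _ that] False rz[of 1] rp[of 1] by simp
    qed (use Y(4)[of 1] \<kappa> s(1) in auto)
    then show ?thesis using rv_abs[of 1 f "Y 1"] f Y(4)[of 1] by simp
  qed simp
next
  show "\<bar>Y t - y0\<bar> \<le> 6 * real N * \<tau> + \<kappa>" "\<bar>Y t\<bar> \<le> R" if "t \<in> {0..1}" for t by (rule Y(3)[OF that], rule Y(4)[OF that])
qed (rule Y(1), rule Y(2))

text \<open>Follow the root that starts at \<open>y0\<close>. A member of \<open>Gs\<close> vanishes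
  along all of it or nowhere. At the end the zeros of a nonvanishing member are other roots of
  \<open>F\<close>, hence at distance at least \<open>s\<close>.\<close>

lemma root_lift:
  assumes "y0 \<in> rf.B 0" shows "\<exists>Y. good_lift Y"
proof -
  obtain k where k: "k < rf.nB" "y0 = rf.xi k 0" using rf.xi_surj[of 0 y0] assms by auto
  have i0: "\<bar>rf.xi k 0\<bar> < R" using k y0 by simp
  have "good_lift (rf.xi k)"
  proof (rule good_liftI)
    show "\<bar>rf.xi k t - y0\<bar> \<le> 6 * real N * \<tau> + \<kappa>" if "t \<in> {0..1}" for t
    proof -
      have "0 \<le> real N * \<tau>" using \<rho>1(3) by simp
      then show ?thesis using xi_confined[OF k(1) that] k(2) \<kappa>(1) by linarith
    qed
    show "\<bar>rf.xi k t\<bar> \<le> R" if "t \<in> {0..1}" for t by (rule rf.xi_ends(1)[OF that k(1)])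
    then have ca: "continuous_on {0..1} (%t. f ((cpx (x t))(i := of_real (rf.xi k t))))" if "f \<in> Gs" for f
      by (intro cont_along(1)[OF that rf.xi_continuous[OF k(1)]])
    show "f ((cpx (x t))(i := of_real (rf.xi k t))) = 0 \<longleftrightarrow> f ((cpx (x 0))(i := of_real y0)) = 0" if f: "f \<in> Gs" and t: "t \<in> {0..1}" for f t
      unfolding k(2)
    proof (rule rf.factor_zero_along_root[where \<psi> = "%t y. f ((cpx (x t))(i := y))", OF _ unif_cont[OF f] _ k(1) i0 ca[OF f] t])
      show "(%y. f ((cpx (x t))(i := y))) holomorphic_on ball 0 (2 * R)" if "t \<in> {0..1}" for t
        by (rule holomorphic_on_subset[OF slice_holo[OF f xp[OF that]]]) (use pos(1) in auto)
    qed (use zero[OF f] in auto)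
    show "\<kappa> \<le> cmod (of_real (rf.xi k 1) - z)" if f: "f \<in> Gs" and nz: "f ((cpx (x 1))(i := of_real (rf.xi k 1))) ~= 0" and z: "z \<in> Zs f (cpx (x 1))" for f z
    proof -
      have "of_real (rf.xi k 1) \<in> Zs F (cpx (x 1))" using rf.xi_interior[OF _ k(1) i0, of 1] by simp
      moreover have "z \<in> Zs F (cpx (x 1))" using Zs_subset[OF f] z by blast
      moreover have "of_real (rf.xi k 1) ~= z" using nz z by (auto simp: Zs_def)
      ultimately have "s \<le> cmod (of_real (rf.xi k 1) - z)" by (rule sep)
      then show ?thesis using \<kappa> by linarith
    qed
  qed (use k rf.xi_continuous in auto)
  then show ?thesis by blast
qed

lemma convex_comb_close:
  fixes l u l' u' \<sigma> \<beta> :: real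
  assumes "0 \<le> \<sigma>" "\<sigma> \<le> 1" "\<bar>l - l'\<bar> \<le> \<beta>" "\<bar>u - u'\<bar> \<le> \<beta>"
  shows "\<bar>((1 - \<sigma>) * l + \<sigma> * u) - ((1 - \<sigma>) * l' + \<sigma> * u')\<bar> \<le> \<beta>"
proof -
  have "((1 - \<sigma>) * l + \<sigma> * u) - ((1 - \<sigma>) * l' + \<sigma> * u') = (1 - \<sigma>) * (l - l') + \<sigma> * (u - u')" by (simp add: algebra_simps)
  also have "\<bar>...\<bar> \<le> (1 - \<sigma>) * \<bar>l - l'\<bar> + \<sigma> * \<bar>u - u'\<bar>"
    using abs_triangle_ineq[of "(1 - \<sigma>) * (l - l')" "\<sigma> * (u - u')"] assms(1,2) by (simp add: abs_mult)
  also have "... \<le> (1 - \<sigma>) * \<beta> + \<sigma> * \<beta>" using assms by (intro add_mono mult_left_mono) auto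
  finally show ?thesis by (simp add: algebra_simps)
qed

text \<open>Between consecutive real roots nothing vanishes, so every path inside the moving band
  preserves signs. The point is kept in the band by convex coordinates relative to its edges, which
  are adjusted to end at distance \<kappa> from both edges.\<close>

lemma band_lift:
  assumes nB: "y0 \<notin> rf.B 0" shows "\<exists>Y. good_lift Y"
proof -
  have z01: "(0::real) \<in> {0..1}" "(1::real) \<in> {0..1}" by auto
  let ?K = "{k. k < rf.nB & rf.xi k 0 < y0}"
  have "- R \<in> rf.B 0" "R \<in> rf.B 0" by (auto simp: rf.B_def)
  then obtain k1 k2 where k1: "k1 < rf.nB" "- R = rf.xi k1 0" and k2: "k2 < rf.nB" "R = rf.xi k2 0"
    using rf.xi_surj[OF z01(1)] by metis
  have fK: "finite ?K" by simp
  have neK: "?K ~= {}" using k1 y0 by auto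
  define k where "k = Max ?K"
  have k: "k < rf.nB" "rf.xi k 0 < y0" using Max_in[OF fK neK] unfolding k_def by auto
  have kmax: "m \<le> k" if "m \<in> ?K" for m unfolding k_def by (rule Max_ge[OF fK that])
  have Sk: "Suc k < rf.nB"
  proof (rule ccontr)
    assume "\<not> ?thesis"
    then have "k2 \<le> k" using k2(1) k(1) by linarith
    then have "rf.xi k2 0 \<le> rf.xi k 0" using rf.xi_less[OF z01(1), of k2 k] k(1) by (cases "k2 = k") (auto intro: less_imp_le)
    then show False using k2(2) k(2) y0 by linarith
  qed
  have uy: "y0 < rf.xi (Suc k) 0"
  proof -
    have "\<not> rf.xi (Suc k) 0 < y0" using kmax[of "Suc k"] Sk by auto
    moreover have "rf.xi (Suc k) 0 ~= y0" using rf.xi_mem[OF z01(1) Sk] nB by auto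
    ultimately show ?thesis by linarith
  qed
  define l where "l = rf.xi k"
  define u where "u = rf.xi (Suc k)"
  have lu: "l t < u t" if "t \<in> {0..1}" for t using rf.xi_less[OF that, of k "Suc k"] Sk by (simp add: l_def u_def)
  have lc: "continuous_on {0..1} l" and uc: "continuous_on {0..1} u" using rf.xi_continuous[OF k(1)] rf.xi_continuous[OF Sk] by (simp_all add: l_def u_def)
  have lb: "\<bar>l t\<bar> \<le> R" and ub: "\<bar>u t\<bar> \<le> R" if "t \<in> {0..1}" for t
    using rf.xi_ends(1)[OF that k(1)] rf.xi_ends(1)[OF that Sk] by (simp_all add: l_def u_def)
  have between: "\<not> (l t < v & v < u t)" if t: "t \<in> {0..1}" and v: "v \<in> rf.B t" for t v
  proof
    assume lv: "l t < v & v < u t"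
    obtain m where m: "m < rf.nB" "v = rf.xi m t" using rf.xi_surj[OF t v] by blast
    show False
    proof (cases "m \<le> k")
      case True
      then have "v \<le> l t" using rf.xi_less[OF t, of m k] k(1) m by (cases "m = k") (auto simp: l_def)
      then show False using lv by simp
    next
      case False
      then have "u t \<le> v" using rf.xi_less[OF t, of "Suc k" m] m by (cases "m = Suc k") (auto simp: u_def)
      then show False using lv by simp
    qed
  qed
  have nzero: "f ((cpx (x t))(i := of_real v)) ~= 0" if t: "t \<in> {0..1}" and v: "l t < v" "v < u t" and f: "f \<in> Gs" for t v f
  proof
    assume "f ((cpx (x t))(i := of_real v)) = 0"
    then have "F ((cpx (x t))(i := of_real v)) = 0" by (rule zero[OF f])
    moreover have "\<bar>v\<bar> < R" using lb[OF t] ub[OF t] v by linarith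
    ultimately have "of_real v \<in> Zs F (cpx (x t))" by (simp add: Zs_def)
    then have "v \<in> rf.B t" by (simp add: rf.B_def)
    then show False using between[OF t] v by blast
  qed
  define \<beta> where "\<beta> = 2 * real N * \<tau>"
  have lcl: "\<bar>l t - l 0\<bar> \<le> \<beta>" and ucl: "\<bar>u t - u 0\<bar> \<le> \<beta>" if "t \<in> {0..1}" for t
    using xi_confined[OF k(1) that] xi_confined[OF Sk that] by (simp_all add: l_def u_def \<beta>_def)
  have w: "s \<le> u 1 - l 1"
    using B_separated[OF rf.xi_mem[OF z01(2) k(1)] rf.xi_mem[OF z01(2) Sk]] lu[OF z01(2)] by (simp add: l_def u_def)
  define s0 where "s0 = (y0 - l 0) / (u 0 - l 0)"
  have s0: "0 < s0" "s0 < 1" and y0e: "y0 = (1 - s0) * l 0 + s0 * u 0"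
  proof -
    have "l 0 < y0" "y0 < u 0" using k(2) uy by (simp_all add: l_def u_def)
    then show "0 < s0" "s0 < 1" by (simp_all add: s0_def)
    have "s0 * (u 0 - l 0) = y0 - l 0" using lu[OF z01(1)] by (simp add: s0_def)
    then show "y0 = (1 - s0) * l 0 + s0 * u 0" by (simp add: algebra_simps)
  qed
  \<comment> \<open>The end position if the initial convex coordinate were kept; it may be too close
    to an edge of the band.\<close>
  define y' where "y' = (1 - s0) * l 1 + s0 * u 1"
  have y'b: "l 1 < y'" "y' < u 1"
  proof -
    have "0 < s0 * (u 1 - l 1)" "0 < (1 - s0) * (u 1 - l 1)" using s0 lu[OF z01(2)] by simp_all
    then show "l 1 < y'" "y' < u 1" unfolding y'_def by (simp_all add: algebra_simps)
  qed
  \<comment> \<open>Clamping moves y' by at most \<kappa>, and there is room because the band has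
    width at least s \<ge> 4 \<kappa>.\<close>
  define Y1 where "Y1 = max (l 1 + \<kappa>) (min (u 1 - \<kappa>) y')"
  have Y1: "l 1 + \<kappa> \<le> Y1" "Y1 \<le> u 1 - \<kappa>" "\<bar>Y1 - y'\<bar> \<le> \<kappa>" using w \<kappa> y'b unfolding Y1_def by auto
  define s1 where "s1 = (Y1 - l 1) / (u 1 - l 1)"
  have s1: "0 < s1" "s1 < 1" using Y1 \<kappa> lu[OF z01(2)] by (simp_all add: s1_def)
  have Y1e: "Y1 = (1 - s1) * l 1 + s1 * u 1"
  proof -
    have "s1 * (u 1 - l 1) = Y1 - l 1" using lu[OF z01(2)] by (simp add: s1_def)
    then show ?thesis by (simp add: algebra_simps)
  qed
  define \<sigma> where "\<sigma> t = (1 - t) * s0 + t * s1" for t :: real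
  have \<sigma>: "0 < \<sigma> t" "\<sigma> t < 1" if "t \<in> {0..1}" for t
  proof -
    have "0 \<le> (1 - t) * s0" "0 \<le> t * s1" "0 \<le> (1 - t) * (1 - s0)" "0 \<le> t * (1 - s1)" using that s0 s1 by auto
    moreover have "0 < (1 - t) * s0 \<or> 0 < t * s1" "0 < (1 - t) * (1 - s0) \<or> 0 < t * (1 - s1)" using that s0 s1 by (cases "t = 0"; auto)+
    moreover have "(1 - t) * (1 - s0) + t * (1 - s1) = 1 - \<sigma> t" by (simp add: \<sigma>_def algebra_simps)
    ultimately show "0 < \<sigma> t" "\<sigma> t < 1" unfolding \<sigma>_def by linarith+
  qed
  define Y where "Y t = (1 - \<sigma> t) * l t + \<sigma> t * u t" for t
  have Yb: "l t < Y t" "Y t < u t" if t: "t \<in> {0..1}" for t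
  proof -
    have "0 < \<sigma> t * (u t - l t)" "0 < (1 - \<sigma> t) * (u t - l t)" using \<sigma>[OF t] lu[OF t] by simp_all
    then show "l t < Y t" "Y t < u t" unfolding Y_def by (simp_all add: algebra_simps)
  qed
  have Y_1: "Y 1 = Y1" unfolding Y_def \<sigma>_def Y1e by simp
  have "good_lift Y"
  proof (rule good_liftI)
    show "Y 0 = y0" unfolding Y_def \<sigma>_def by (simp flip: y0e)
    show "continuous_on {0..1} Y" unfolding Y_def \<sigma>_def by (intro continuous_intros lc uc)
    show "\<bar>Y t\<bar> \<le> R" if "t \<in> {0..1}" for t using Yb[OF that] lb[OF that] ub[OF that] by linarith
    show "\<bar>Y t - y0\<bar> \<le> 6 * real N * \<tau> + \<kappa>" if t: "t \<in> {0..1}" for t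
    proof -
      \<comment> \<open>Displacements: the edges move at most 2 \<beta> between times t and 1, y'
        differs from y0 by at most \<beta>, and the clamping adds \<kappa>. With \<beta> = 2 N
        \<tau> the total is 6 N \<tau> + \<kappa>.\<close>
      have a: "\<bar>l t - l 1\<bar> \<le> 2 * \<beta>" "\<bar>u t - u 1\<bar> \<le> 2 * \<beta>" using lcl[OF t] lcl[OF z01(2)] ucl[OF t] ucl[OF z01(2)] by linarith+
      have "\<bar>Y t - ((1 - \<sigma> t) * l 1 + \<sigma> t * u 1)\<bar> \<le> 2 * \<beta>" unfolding Y_def using \<sigma>[OF t] by (intro convex_comb_close a) auto
      moreover have "(1 - \<sigma> t) * l 1 + \<sigma> t * u 1 - y' = t * (Y1 - y')" unfolding \<sigma>_def y'_def Y1e by (simp add: algebra_simps)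
      moreover have "\<bar>t * (Y1 - y')\<bar> \<le> 1 * \<kappa>" unfolding abs_mult using t Y1(3) \<kappa> by (intro mult_mono) auto
      moreover have "\<bar>y' - y0\<bar> \<le> \<beta>" unfolding y'_def y0e using s0 lcl[OF z01(2)] ucl[OF z01(2)] by (intro convex_comb_close) auto
      ultimately show ?thesis unfolding \<beta>_def by linarith
    qed
    show "f ((cpx (x t))(i := of_real (Y t))) = 0 \<longleftrightarrow> f ((cpx (x 0))(i := of_real y0)) = 0" if "f \<in> Gs" "t \<in> {0..1}" for f t
      using nzero[OF that(2) Yb[OF that(2)] that(1)] nzero[OF z01(1) _ _ that(1), of y0] k(2) uy by (simp add: l_def u_def)
    show "\<kappa> \<le> cmod (of_real (Y 1) - z)" if f: "f \<in> Gs" and zf: "z \<in> Zs f (cpx (x 1))" for f z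
    proof -
      have z: "z \<in> Zs F (cpx (x 1))" using Zs_subset[OF f] zf by blast
      show ?thesis
      proof (cases "z \<in> \<real>")
        case True
        then obtain v where v: "z = of_real v" by (auto elim: Reals_cases)
        then have "v \<in> rf.B 1" using z by (simp add: rf.B_def)
        then have "v \<le> l 1 \<or> u 1 \<le> v" using between[OF z01(2)] by (meson not_le)
        then have "\<kappa> \<le> \<bar>Y 1 - v\<bar>" using Y1 Y_1 by auto
        then show ?thesis unfolding v by (simp flip: of_real_diff)
      next
        case False
        \<comment> \<open>A nonreal root and its conjugate are \<open>s\<close> apart, so its
          imaginary part is at least s/2 and real points are far from it.\<close>
        have "cnj z \<in> Zs F (cpx (x 1))"
          using z real_slice[OF xp[OF z01(2)] FG, of z] pos(1) by (auto simp: Zs_def)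
        moreover have "z ~= cnj z" using False by (metis Reals_cnj_iff)
        ultimately have "s \<le> cmod (z - cnj z)" using z by (intro sep)
        also have "z - cnj z = of_real (2 * Im z) * \<i>" by (simp add: complex_eq_iff)
        also have "cmod (of_real (2 * Im z) * \<i>) = 2 * \<bar>Im z\<bar>" by (simp add: norm_mult)
        finally have "s \<le> 2 * \<bar>Im z\<bar>" .
        moreover have "\<bar>Im z\<bar> \<le> cmod (of_real (Y 1) - z)" using abs_Im_le_cmod[of "of_real (Y 1) - z"] by simp
        ultimately show ?thesis using \<kappa> by linarith
      qed
    qed
  qed
  then show ?thesis by blast
qed

lemma lift_exists: "\<exists>Y. good_lift Y" using root_lift band_lift by blast

end

section \<open>Effective curve selection\<close>

definition spath :: "'i set => (('i => complex) => complex) set => ('i => real) => real => real => (real => 'i => real) => bool" where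
  "spath S Fs a \<rho> b \<gamma> \<longleftrightarrow> (\<forall>j\<in>S. \<gamma> 0 j = a j) & (\<forall>j\<in>S. continuous_on {0..1} (%t. \<gamma> t j)) & (\<forall>t\<in>{0..1}. \<forall>j\<in>S. \<bar>\<gamma> t j - a j\<bar> \<le> \<rho>) &
     (\<forall>f\<in>Fs. \<forall>t\<in>{0..1}. sgn (rv f (\<gamma> t)) = sgn (rv f a)) & (\<forall>f\<in>Fs. rv f a = 0 \<or> b \<le> \<bar>rv f (\<gamma> 1)\<bar>)"

text \<open>\<open>c\<close> and \<open>L\<close> do not depend on the base point or on the scale,
  which is the content: \<open>L\<close> is an exponent of Lojasiewicz type. The signs, including
  zero, are preserved along the whole path because the lift to one more variable needs the zero
  pattern of the discriminants at every time.\<close>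

definition star :: "'i set => (('i => complex) => complex) set => bool" where
  "star S Fs \<longleftrightarrow> (\<exists>r0>0. \<exists>c>0. \<exists>L::nat. \<forall>a \<rho>. (\<forall>j\<in>S. \<bar>a j\<bar> < r0) --> 0 < \<rho> --> \<rho> \<le> r0 --> (\<exists>\<gamma>. spath S Fs a \<rho> (c * \<rho> ^ L) \<gamma>))"

lemma star_subset: assumes "star S Gs" "Fs \<subseteq> Gs" shows "star S Fs"
proof -
  obtain r0 c L where s: "0 < r0" "0 < c" "\<forall>a \<rho>. (\<forall>j\<in>S. \<bar>a j\<bar> < r0) --> 0 < \<rho> --> \<rho> \<le> r0 --> (\<exists>\<gamma>. spath S Gs a \<rho> (c * \<rho> ^ L) \<gamma>)"
    using assms(1) unfolding star_def by (elim exE conjE)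
  have "spath S Fs a \<rho> b \<gamma>" if "spath S Gs a \<rho> b \<gamma>" for a \<rho> b \<gamma> using that assms(2) unfolding spath_def by (simp add: subset_iff)
  then have "\<forall>a \<rho>. (\<forall>j\<in>S. \<bar>a j\<bar> < r0) --> 0 < \<rho> --> \<rho> \<le> r0 --> (\<exists>\<gamma>. spath S Fs a \<rho> (c * \<rho> ^ L) \<gamma>)" using s(3) by meson
  then show ?thesis unfolding star_def using s(1,2) by (intro exI[of _ r0] exI[of _ c] exI[of _ L] conjI)
qed

lemma rv_depends: "HB S r f ==> (!!j. j \<in> S ==> a j = b j) ==> rv f a = rv f b"
  unfolding rv_def using HB_depends[of S r f "cpx a" "cpx b"] by (simp add: cpx_def)

lemma finite_upper:
  fixes P :: "'x => real => bool"
  assumes "finite A" "!!f. f \<in> A ==> \<exists>M>0. P f M" "!!f M M'. P f M ==> M \<le> M' ==> P f M'"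
  shows "\<exists>M>0. \<forall>f\<in>A. P f M"
  using assms(1,2)
proof (induction A rule: finite_induct)
  case empty then show ?case by (intro exI[of _ 1]) auto
next
  case (insert f A)
  obtain M1 where M1: "M1 > 0" "\<forall>f\<in>A. P f M1" using insert by blast
  obtain M2 where M2: "M2 > 0" "P f M2" using insert.prems by blast
  show ?case using M1 M2 assms(3)[of _ M1 "max M1 M2"] assms(3)[of f M2 "max M1 M2"] by (intro exI[of _ "max M1 M2"]) auto
qed

lemma finite_lower:
  fixes P :: "'x => real => bool"
  assumes "finite A" "!!f. f \<in> A ==> \<exists>M>0. P f M" "!!f M M'. P f M ==> 0 < M' ==> M' \<le> M ==> P f M'"
  shows "\<exists>M>0. \<forall>f\<in>A. P f M"
  using assms(1,2)
proof (induction A rule: finite_induct)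
  case empty then show ?case by (intro exI[of _ 1]) auto
next
  case (insert f A)
  obtain M1 where M1: "M1 > 0" "\<forall>f\<in>A. P f M1" using insert by blast
  obtain M2 where M2: "M2 > 0" "P f M2" using insert.prems by blast
  show ?case using M1 M2 assms(3)[of _ M1 "min M1 M2"] assms(3)[of f M2 "min M1 M2"] by (intro exI[of _ "min M1 M2"]) auto
qed

context regfam begin

lemma Dfun_zero_iff: "cpx a \<in> pd S r1 ==> Dfun j (cpx a) = 0 \<longleftrightarrow> rv (Dfun j) a = 0"
  and Dfun_abs: "cpx a \<in> pd S r1 ==> cmod (Dfun j (cpx a)) = \<bar>rv (Dfun j) a\<bar>"
proof -
  assume "cpx a \<in> pd S r1"
  then have "Dfun j (cpx a) = of_real (rv (Dfun j) a)" using HBR_real[OF Dfun_HBR] by (simp add: rv_def complex_is_Real_iff complex_eq_iff)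
  then show "Dfun j (cpx a) = 0 \<longleftrightarrow> rv (Dfun j) a = 0" "cmod (Dfun j (cpx a)) = \<bar>rv (Dfun j) a\<bar>" by simp_all
qed

text \<open>The hypothesis for the discriminants yields a path along which the number of distinct
  roots is constant and at whose end the leading discriminant is at least a power of the scale, so
  the roots are separated there. \<open>lifted_path\<close> supplies the remaining
  coordinate.\<close>

lemma lift_star:
  assumes st: "star S (Dfun ` {..N})"
  shows "star (insert i S) Gs"
proof -
  obtain rI cI LI where I: "0 < rI" "0 < cI" "\<forall>a \<rho>. (\<forall>j\<in>S. \<bar>a j\<bar> < rI) --> 0 < \<rho> --> \<rho> \<le> rI --> (\<exists>\<gamma>. spath S (Dfun ` {..N}) a \<rho> (cI * \<rho> ^ LI) \<gamma>)"
    using st unfolding star_def by (elim exE conjE)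
  \<comment> \<open>The last bound gives C \<rho>1 < \<mu> \<tau>^N for \<rho>1 = \<epsilon>
    \<rho>^N and \<tau> = \<rho> / (12 N), the confinement condition on the roots.\<close>
  define \<epsilon> where "\<epsilon> = min (min 1 (r1/2)) (min rI (\<mu> / (2 * C * (12 * real N) ^ N)))"
  have N1: "1 \<le> real N" using pos(9) by simp
  have \<epsilon>: "0 < \<epsilon>" "\<epsilon> \<le> 1" "\<epsilon> \<le> r1/2" "\<epsilon> \<le> rI" "\<epsilon> \<le> \<mu> / (2 * C * (12 * real N) ^ N)"
    using pos I(1) N1 by (auto simp: \<epsilon>_def)
  define r0 where "r0 = min (min 1 rI) (min (r1/2) R)"
  have r0: "0 < r0" "r0 \<le> 1" "r0 \<le> rI" "r0 \<le> r1/2" "r0 \<le> R" using pos I(1) by (auto simp: r0_def)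
  \<comment> \<open>The quotient with \<open>real (Suc N) ^ N\<close> comes from
    \<open>Dtup_separation\<close>; the other terms enforce s \<le> 1, C s \<le> \<mu> and s \<le> 2
    R.\<close>
  define k0 where "k0 = min (min 1 (cI / real (Suc N) ^ N)) (min (\<mu> / C) (2 * R))"
  have k0: "0 < k0" "k0 \<le> 1" "k0 \<le> cI / real (Suc N) ^ N" "k0 \<le> \<mu> / C" "k0 \<le> 2 * R" using pos I(2) by (auto simp: k0_def)
  define k1 where "k1 = min (k0 * \<epsilon> ^ LI) 1 / 4"
  have k1: "0 < k1" "4 * k1 \<le> k0 * \<epsilon> ^ LI" "4 * k1 \<le> 1" using k0(1) \<epsilon>(1) by (auto simp: k1_def)
  have main: "\<exists>\<gamma>. spath (insert i S) Gs a \<rho> ((\<mu> * k1 ^ N) * \<rho> ^ ((N * LI + 1) * N)) \<gamma>" if a: "\<forall>j\<in>insert i S. \<bar>a j\<bar> < r0" and \<rho>: "0 < \<rho>" "\<rho> \<le> r0" for a \<rho>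
  proof -
    define \<rho>1 where "\<rho>1 = \<epsilon> * \<rho> ^ N"
    have \<rho>le: "\<rho> \<le> 1" using \<rho> r0 by linarith
    have \<rho>N: "0 < \<rho> ^ N" "\<rho> ^ N \<le> \<rho>" "\<rho> ^ N \<le> 1"
      using \<rho>(1) \<rho>le pos(9) power_decreasing[of 1 N \<rho>] by (auto simp: power_le_one)
    have \<rho>1: "0 < \<rho>1" "\<rho>1 \<le> \<epsilon>" "\<rho>1 \<le> \<rho>" "\<rho>1 \<le> 1"
    proof -
      show "0 < \<rho>1" using \<epsilon>(1) \<rho>N by (simp add: \<rho>1_def)
      show "\<rho>1 \<le> \<epsilon>" unfolding \<rho>1_def using \<epsilon>(1) \<rho>N by (simp add: mult_left_le)
      then show "\<rho>1 \<le> 1" using \<epsilon>(2) by linarith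
      have "\<rho>1 \<le> 1 * \<rho>" unfolding \<rho>1_def using \<epsilon> \<rho>N \<rho> by (intro mult_mono) auto
      then show "\<rho>1 \<le> \<rho>" by simp
    qed
    obtain x where x: "spath S (Dfun ` {..N}) a \<rho>1 (cI * \<rho>1 ^ LI) x"
    proof -
      have "\<forall>j\<in>S. \<bar>a j\<bar> < rI" using a r0 by force
      moreover have "\<rho>1 \<le> rI" using \<rho>1 \<epsilon> by linarith
      ultimately show thesis using I(3) \<rho>1(1) that by blast
    qed
    have x0: "x 0 j = a j" if "j \<in> S" for j using x that by (simp add: spath_def)
    have xd: "\<bar>x t j - a j\<bar> \<le> \<rho>1" if "t \<in> {0..1}" "j \<in> S" for t j using x that by (simp add: spath_def)
    have xs: "sgn (rv (Dfun j) (x t)) = sgn (rv (Dfun j) a)" if "t \<in> {0..1}" "j \<le> N" for t j using x that by (simp add: spath_def)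
    have xl: "rv (Dfun j) a = 0 \<or> cI * \<rho>1 ^ LI \<le> \<bar>rv (Dfun j) (x 1)\<bar>" if "j \<le> N" for j using x that by (simp add: spath_def)
    have xp: "cpx (x t) \<in> pd S r1" if "t \<in> {0..1}" for t
      unfolding pd_def cpx_def
    proof (intro CollectI ballI)
      fix j assume j: "j \<in> S"
      have "\<bar>x t j\<bar> \<le> \<bar>a j\<bar> + \<rho>1" using xd[OF that j] by linarith
      moreover have "\<bar>a j\<bar> < r0" using a j by simp
      ultimately show "cmod (of_real (x t j)) < r1" using r0 \<epsilon> \<rho>1 by simp
    qed
    have Dz: "Dfun j (cpx (x t)) = 0 \<longleftrightarrow> rv (Dfun j) a = 0" if "t \<in> {0..1}" "j \<le> N" for t j
      unfolding Dfun_zero_iff[OF xp[OF that(1)]] using xs[OF that] by (metis sgn_zero_iff)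
    define s where "s = k0 * \<rho>1 ^ LI"
    have pl: "0 < \<rho>1 ^ LI" "\<rho>1 ^ LI \<le> 1" using \<rho>1 by (auto simp: power_le_one)
    have sk: "s \<le> k0" unfolding s_def using pl k0 by (simp add: mult_left_le)
    \<comment> \<open>\<open>s\<close> is k0 \<epsilon>^LI \<rho>^(N LI). The additional factor
      \<rho> makes \<kappa> at most \<rho>/4 besides 4 \<kappa> \<le> s.\<close>
    define \<kappa> where "\<kappa> = k1 * \<rho> ^ (N * LI + 1)"
    have \<kappa>0: "0 < \<kappa>" using k1 \<rho> by (simp add: \<kappa>_def)
    have \<kappa>s: "4 * \<kappa> \<le> s"
    proof -
      have "4 * \<kappa> \<le> (k0 * \<epsilon> ^ LI) * \<rho> ^ (N * LI)" unfolding \<kappa>_def mult.assoc[symmetric]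
        by (rule mult_mono[OF k1(2) power_decreasing]) (use k0(1) \<epsilon>(1) \<rho> \<rho>le in auto)
      also have "... = s" by (simp add: s_def \<rho>1_def power_mult_distrib power_mult)
      finally show ?thesis .
    qed
    have \<kappa>\<rho>: "\<kappa> \<le> \<rho>/4"
    proof -
      have "\<rho> ^ (N * LI + 1) \<le> \<rho>" using power_decreasing[of 1 "N * LI + 1" \<rho>] \<rho> \<rho>le by simp
      then have "\<kappa> \<le> (1/4) * \<rho>" unfolding \<kappa>_def using k1 \<rho> by (intro mult_mono) auto
      then show ?thesis by simp
    qed
    \<comment> \<open>Chosen so that 6 N \<tau> = \<rho>/2, which leaves \<rho>/2 for \<kappa> in
      the displacement allowed by \<open>spath\<close>.\<close>
    define \<tau> where "\<tau> = \<rho> / (12 * real N)"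
    have \<tau>: "0 < \<tau>" "\<tau> \<le> 1" "6 * real N * \<tau> = \<rho>/2"
      using \<rho> \<rho>le N1 by (auto simp: \<tau>_def field_simps)
    have conf: "C * \<rho>1 < \<mu> * \<tau> ^ N"
    proof -
      have pw: "0 < (12 * real N) ^ N" using N1 by simp
      have "C * \<rho>1 = (C * \<epsilon>) * \<rho> ^ N" by (simp add: \<rho>1_def)
      also have "C * \<epsilon> \<le> C * (\<mu> / (2 * C * (12 * real N) ^ N))" using \<epsilon>(5) pos(8) by (intro mult_left_mono) auto
      also have "... = \<mu> / (2 * (12 * real N) ^ N)" using pos(8) by simp
      finally have "C * \<rho>1 \<le> \<mu> / (2 * (12 * real N) ^ N) * \<rho> ^ N" using \<rho>N by simp
      also have "... < \<mu> / (12 * real N) ^ N * \<rho> ^ N" using pw \<rho>N pos(6) by (intro mult_strict_right_mono divide_strict_left_mono) auto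
      also have "... = \<mu> * \<tau> ^ N" by (simp add: \<tau>_def power_divide)
      finally show ?thesis .
    qed
    note \<rho>1le = \<rho>1(3) and \<tau>2 = \<tau>(3)
    interpret lifted_path S i Gs F r R r1 \<mu> M C N x \<rho>1 \<tau> s \<kappa> "a i"
    proof
      show "continuous_on {0..1} (%t. x t j)" if "j \<in> S" for j using x that by (simp add: spath_def)
      show "\<bar>x t j - x 0 j\<bar> \<le> \<rho>1" if "t \<in> {0..1}" "j \<in> S" for t j using xd[OF that] x0[OF that(2)] by simp
      show "card (Zs F (cpx (x t))) = card (Zs F (cpx (x 0)))" if t: "t \<in> {0..1}" for t
        using Dz[OF t] Dz[of 0] by (intro card_Zs_eq xp t) auto
      show "s \<le> cmod (z - w)" if "z \<in> Zs F (cpx (x 1))" "w \<in> Zs F (cpx (x 1))" "z ~= w" for z w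
      proof -
        let ?J = "card (Zs F (cpx (x 1)))"
        have p1: "cpx (x 1) \<in> pd S r1" by (rule xp) simp
        have JN: "?J \<le> N" by (rule Zs_finite(2)[OF p1])
        have "rv (Dfun ?J) a ~= 0" using Dz[of 1 ?J] JN Dfun_card(1)[OF p1] by simp
        then have "cI * \<rho>1 ^ LI \<le> cmod (Dfun ?J (cpx (x 1)))" using xl[OF JN] Dfun_abs[OF p1] by simp
        also have "... \<le> real (Suc N) ^ N * cmod (z - w)" by (rule Dfun_card(3)[OF p1 that])
        finally have "cI / real (Suc N) ^ N * \<rho>1 ^ LI \<le> cmod (z - w)" by (simp add: field_simps del: of_nat_Suc)
        moreover have "s \<le> cI / real (Suc N) ^ N * \<rho>1 ^ LI" unfolding s_def using k0(3) pl by (intro mult_right_mono) auto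
        ultimately show ?thesis by linarith
      qed
      have "C * s \<le> C * (\<mu> / C)" using sk k0(4) pos(8) by (intro mult_left_mono) auto
      then show "C * s \<le> \<mu>" using pos(8) by simp
      show "\<bar>a i\<bar> < R" using a r0(5) by force
    qed (use xp \<rho>1 conf \<tau> sk k0 \<kappa>0 \<kappa>s in auto)
    obtain Y where Y: "good_lift Y" using lift_exists by blast
    have up: "rv f ((x 0)(i := a i)) = rv f a" if "f \<in> Gs" for f
      by (rule rv_depends[OF HBR_HB[OF HBRG[OF that]]]) (use x0 in auto)
    have "spath (insert i S) Gs a \<rho> (\<mu> * \<kappa> ^ N) (%t. (x t)(i := Y t))"
      unfolding spath_def
    proof (intro conjI ballI)
      fix j assume j: "j \<in> insert i S"
      show "((x 0)(i := Y 0)) j = a j" using x0 j Y by (auto simp: good_lift_def)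
      show "continuous_on {0..1} (%t. ((x t)(i := Y t)) j)" using j Y xc by (cases "j = i") (auto simp: good_lift_def)
    next
      fix t :: real and j assume t: "t \<in> {0..1}" and j: "j \<in> insert i S"
      have "\<bar>Y t - a i\<bar> \<le> \<rho>/2 + \<kappa>" using Y t \<tau>2 by (simp add: good_lift_def)
      then show "\<bar>((x t)(i := Y t)) j - a j\<bar> \<le> \<rho>" using xd[OF t, of j] j \<rho>1le \<tau>2 \<kappa>\<rho> by (cases "j = i") auto
    next
      fix f t assume f: "f \<in> Gs" and t: "t \<in> {0..1::real}"
      show "sgn (rv f ((x t)(i := Y t))) = sgn (rv f a)" using Y f t up[OF f] by (simp add: good_lift_def)
    next
      fix f assume f: "f \<in> Gs"
      show "rv f a = 0 \<or> \<mu> * \<kappa> ^ N \<le> \<bar>rv f ((x 1)(i := Y 1))\<bar>" using Y f unfolding good_lift_def up[OF f, symmetric] by blast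
    qed
    moreover have "\<mu> * \<kappa> ^ N = (\<mu> * k1 ^ N) * \<rho> ^ ((N * LI + 1) * N)" by (simp only: \<kappa>_def power_mult_distrib power_mult mult.assoc)
    ultimately show ?thesis by auto
  qed
  have "0 < \<mu> * k1 ^ N" using pos(6) k1(1) by simp
  then show ?thesis unfolding star_def using r0(1) main
    by (intro exI[of _ r0] exI[of _ "\<mu> * k1 ^ N"] exI[of _ "(N * LI + 1) * N"] conjI allI impI) auto
qed

end

text \<open>The product of the functions carries all their zeros, and on the i-axis it has no zero
  in a punctured disc. So there is an annulus on which every function is bounded below by
  compactness, and the Lipschitz bound extends half of this to nearby parameters: these are the data
  of \<open>regfam\<close>.\<close>

lemma regular_star:
  fixes i :: 'i
  assumes S: "finite S" "i \<notin> S" and Fs: "finite Fs" "!!f. f \<in> Fs ==> HBR (insert i S) r f" and r: "0 < r"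
    and reg: "!!f. f \<in> Fs ==> \<exists>\<epsilon>>0. \<forall>w. 0 < cmod w --> cmod w < \<epsilon> --> f ((%_. 0)(i := w)) ~= 0"
    and IH: "!!Gs r'. finite Gs ==> 0 < r' ==> (!!g. g \<in> Gs ==> HBR S r' g) ==> star S Gs"
  shows "star (insert i S) Fs"
proof -
  define F where "F = (%z::'i => complex. \<Prod>f\<in>Fs. f z)"
  define Gs where "Gs = insert F Fs"
  have finG: "finite Gs" using Fs(1) by (simp add: Gs_def)
  have HF: "HBR (insert i S) r F" unfolding F_def by (rule HBR_prod[where F = "%f. f"]) (rule Fs(2))
  have HG: "HBR (insert i S) r f" if "f \<in> Gs" for f using that HF Fs(2) by (auto simp: Gs_def)
  have "\<exists>\<epsilon>>0. \<forall>f\<in>Fs. \<forall>w. 0 < cmod w --> cmod w < \<epsilon> --> f ((%_. 0)(i := w)) ~= 0"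
    by (rule finite_lower[OF Fs(1) reg]) auto
  then obtain \<epsilon> where \<epsilon>: "\<epsilon> > 0" "!!f w. f \<in> Fs ==> 0 < cmod w ==> cmod w < \<epsilon> ==> f ((%_. 0)(i := w)) ~= 0" by blast
  have \<epsilon>G: "f ((%_. 0)(i := w)) ~= 0" if "f \<in> Gs" "0 < cmod w" "cmod w < \<epsilon>" for f w
    using that \<epsilon>(2)[OF _ that(2,3)] Fs(1) by (auto simp: Gs_def F_def)
  define R where "R = min (min (1/2) (r/10)) (\<epsilon>/3)"
  have R: "0 < R" "2 * R \<le> 1" "10 * R \<le> r" "2 * R < \<epsilon>" using r \<epsilon>(1) by (auto simp: R_def)
  have "\<exists>M>0. \<forall>f\<in>Gs. \<forall>z\<in>pd (insert i S) r. cmod (f z) \<le> M"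
    by (rule finite_upper[OF finG]) (use HB_bounded[OF HBR_HB[OF HG]] in \<open>auto intro: order_trans\<close>)
  then obtain M where M: "M > 0" "!!f z. f \<in> Gs ==> z\<in>pd (insert i S) r ==> cmod (f z) \<le> M" by blast
  have "\<exists>C>0. \<forall>f\<in>Gs. \<forall>z\<in>pd (insert i S) (r/2). \<forall>z'\<in>pd (insert i S) (r/2). \<forall>\<delta>\<ge>0. (\<forall>j\<in>insert i S. cmod (z' j - z j) \<le> \<delta>) --> cmod (f z' - f z) \<le> C * \<delta>"
  proof (rule finite_upper[OF finG HB_lipschitz[OF HBR_HB[OF HG] r]])
    fix f :: "('i => complex) => complex" and M M' :: real
    assume a: "\<forall>z\<in>pd (insert i S) (r/2). \<forall>z'\<in>pd (insert i S) (r/2). \<forall>\<delta>\<ge>0. (\<forall>j\<in>insert i S. cmod (z' j - z j) \<le> \<delta>) --> cmod (f z' - f z) \<le> M * \<delta>" and le: "M \<le> M'"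
    show "\<forall>z\<in>pd (insert i S) (r/2). \<forall>z'\<in>pd (insert i S) (r/2). \<forall>\<delta>\<ge>0. (\<forall>j\<in>insert i S. cmod (z' j - z j) \<le> \<delta>) --> cmod (f z' - f z) \<le> M' * \<delta>"
    proof (intro ballI allI impI)
      fix z z' \<delta> assume h: "z \<in> pd (insert i S) (r/2)" "z' \<in> pd (insert i S) (r/2)" "0 \<le> \<delta>" "\<forall>j\<in>insert i S. cmod (z' j - z j) \<le> \<delta>"
      have "cmod (f z' - f z) \<le> M * \<delta>" using a h by blast
      also have "... \<le> M' * \<delta>" using le h(3) by (rule mult_right_mono)
      finally show "cmod (f z' - f z) \<le> M' * \<delta>" .
    qed
  qed
  then obtain C where C: "C > 0" "!!f z z' \<delta>. f \<in> Gs ==> z\<in>pd (insert i S) (r/2) ==> z'\<in>pd (insert i S) (r/2) ==> 0 \<le> \<delta> ==> (!!j. j \<in> insert i S ==> cmod (z' j - z j) \<le> \<delta>) ==> cmod (f z' - f z) \<le> C * \<delta>"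
    by (elim exE conjE) (rule that, blast+)
  let ?A = "Elementary_Metric_Spaces.cball 0 (2 * R) - ball 0 R :: complex set"
  have "\<exists>\<mu>>0. \<forall>f\<in>Gs. \<forall>w\<in>?A. \<mu> \<le> cmod (f ((%_. 0)(i := w)))"
  proof (rule finite_lower[OF finG])
    fix f assume f: "f \<in> Gs"
    have e: "lin (%_. 0) ((%_. 0)(i := 1)) w = (%_. 0)(i := w)" for w by (auto simp: fun_eq_iff)
    have "(%w. f (lin (%_. 0) ((%_. 0)(i := 1)) w)) holomorphic_on {w. lin (%_. 0) ((%_. 0)(i := 1)) w \<in> pd (insert i S) r}"
      by (rule HB_holo[OF HBR_HB[OF HG[OF f]]])
    then have "(%w. f ((%_. 0)(i := w))) holomorphic_on {w. (%_. 0)(i := w) \<in> pd (insert i S) r}" unfolding e .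
    then have "(%w. f ((%_. 0)(i := w))) holomorphic_on ?A" by (rule holomorphic_on_subset) (use R r in \<open>auto simp: pd_def\<close>)
    then have "continuous_on ?A (%w. cmod (f ((%_. 0)(i := w))))" by (intro continuous_on_norm holomorphic_on_imp_continuous_on)
    moreover have "compact ?A" by (intro compact_diff) auto
    moreover have "of_real R \<in> ?A" using R by auto
    then have "?A ~= {}" by blast
    ultimately obtain w0 where w0: "w0 \<in> ?A" "!!w. w \<in> ?A ==> cmod (f ((%_. 0)(i := w0))) \<le> cmod (f ((%_. 0)(i := w)))"
      using continuous_attains_inf[of ?A] by blast
    have "0 < cmod w0" "cmod w0 < \<epsilon>" using w0(1) R by auto
    then have "0 < cmod (f ((%_. 0)(i := w0)))" using \<epsilon>G[OF f] by simp
    then show "\<exists>\<mu>>0. \<forall>w\<in>?A. \<mu> \<le> cmod (f ((%_. 0)(i := w)))" using w0(2) by blast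
  qed (auto intro: order_trans)
  then obtain \<mu>0 where \<mu>0: "\<mu>0 > 0" "!!f w. f \<in> Gs ==> w \<in> ?A ==> \<mu>0 \<le> cmod (f ((%_. 0)(i := w)))" by blast
  define r1 where "r1 = min (r/10) (\<mu>0 / (2 * C))"
  have r1: "0 < r1" "10 * r1 \<le> r" "C * r1 \<le> \<mu>0/2"
  proof -
    show "0 < r1" "10 * r1 \<le> r" using r C(1) \<mu>0(1) by (auto simp: r1_def)
    have "C * r1 \<le> C * (\<mu>0 / (2 * C))" using C(1) by (intro mult_left_mono) (auto simp: r1_def)
    then show "C * r1 \<le> \<mu>0/2" using C(1) by simp
  qed
  obtain n where n: "(2/3::real) ^ n < (\<mu>0/2) / M" using real_arch_pow_inv[of "(\<mu>0/2) / M" "2/3"] \<mu>0(1) M(1) by auto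
  define N where "N = max 1 n"
  interpret regfam S i Gs F r R r1 "\<mu>0/2" M C N
  proof
    show "F z = 0" if "f \<in> Gs" "f z = 0" for f z using that Fs(1) by (auto simp: Gs_def F_def)
    show "\<mu>0/2 \<le> cmod (f (x(i := y)))" if f: "f \<in> Gs" and x: "x \<in> pd S r1" and y: "R \<le> cmod y" "cmod y < 2 * R" for f x y
    proof -
      have "cmod (f (x(i := y)) - f ((%_. 0)(i := y))) \<le> C * r1"
        using x y R r r1 S(2) by (intro C(2)[OF f]) (fastforce simp: pd_def)+
      moreover have "\<mu>0 \<le> cmod (f ((%_. 0)(i := y)))" using y by (intro \<mu>0(2)[OF f]) auto
      ultimately show ?thesis using r1(3) norm_triangle_ineq2[of "f ((%_. 0)(i := y))" "f (x(i := y))"] norm_minus_commute[of "f ((%_. 0)(i := y))" "f (x(i := y))"] by linarith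
    qed
    show "M * (2/3) ^ k < \<mu>0/2" if "k > N" for k
    proof -
      have "(2/3::real) ^ k \<le> (2/3) ^ n" using that by (intro power_decreasing) (auto simp: N_def)
      then have "(2/3::real) ^ k < (\<mu>0/2) / M" using n by linarith
      then show ?thesis using M(1) by (simp add: field_simps)
    qed
    show "cmod (f z' - f z) \<le> C * \<delta>" if "f \<in> Gs" "z \<in> pd (insert i S) (r/2)" "z' \<in> pd (insert i S) (r/2)" "0 \<le> \<delta>" "!!j. j \<in> insert i S ==> cmod (z' j - z j) \<le> \<delta>" for f z z' \<delta>
      by (rule C(2)[OF that])
    show "HBR (insert i S) r f" if "f \<in> Gs" for f by (rule HG[OF that])
    show "cmod (f z) \<le> M" if "f \<in> Gs" "z\<in>pd (insert i S) r" for f z by (rule M(2)[OF that])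
  qed (use S R r1 \<mu>0(1) M(1) C(1) in \<open>simp_all add: Gs_def N_def\<close>)
  have "star S (Dfun ` {..N})" using Dfun_HBR r1(1) by (intro IH) auto
  then have "star (insert i S) Gs" by (rule lift_star)
  then show ?thesis by (rule star_subset) (simp add: Gs_def subset_insertI)
qed

section \<open>Generic linear coordinates and the induction on the dimension\<close>

lemma cpx_line: "lin (cpx p) (cpx q) (of_real w) = cpx (%j. p j + w * q j)" by (auto simp: cpx_def)

lemma islimpt_real_interval: "0 islimpt complex_of_real ` {0<..<1}"
  unfolding islimpt_approachable
proof (intro allI impI)
  fix e :: real assume "0 < e"
  then show "\<exists>x'\<in>complex_of_real ` {0<..<1}. x' ~= 0 & dist x' 0 < e"
    by (intro bexI[of _ "of_real (min e 1 / 2)"] imageI) (auto simp: min_def)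
qed

text \<open>On the complex line through \<open>p\<close> and \<open>q\<close> the product of the two
  functions would vanish on the real segment, hence identically. Near \<open>p\<close> the first is
  nonzero, so the second vanishes there, and then also at \<open>q\<close>.\<close>

lemma common_nonzero:
  assumes T: "finite T" and P: "HB T r P" and f: "HB T r f"
    and p: "cpx p \<in> pd T r" "P (cpx p) ~= 0" and q: "cpx q \<in> pd T r" "f (cpx q) ~= 0"
  shows "\<exists>a. cpx a \<in> pd T r & P (cpx a) ~= 0 & f (cpx a) ~= 0"
proof (rule ccontr)
  assume no: "\<not> ?thesis"
  define v where "v = cpx (%j. q j - p j)"
  let ?U = "{w. lin (cpx p) v w \<in> pd T r}" and ?P = "%w. P (lin (cpx p) v w)" and ?f = "%w. f (lin (cpx p) v w)"
  have U: "open ?U" "convex ?U" "connected ?U" using open_line_pd[OF T] convex_line_pd convex_connected by blast+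
  have l0: "lin (cpx p) v 0 = cpx p" and l1: "lin (cpx p) v 1 = cpx q" by (auto simp: v_def cpx_def)
  have U01: "0 \<in> ?U" "1 \<in> ?U" using p(1) q(1) l0 l1 by simp_all
  have seg: "of_real w \<in> ?U" if "0 < w" "w < 1" for w :: real
  proof -
    have "(1 - w) *\<^sub>R 0 + w *\<^sub>R 1 \<in> ?U" using that by (intro convexD[OF U(2) U01]) auto
    then show ?thesis by (simp add: scaleR_conv_of_real)
  qed
  have hP: "?P holomorphic_on ?U" and hf: "?f holomorphic_on ?U" by (rule HB_holo[OF P], rule HB_holo[OF f])
  have prod0: "?P w * ?f w = 0" if "w \<in> ?U" for w
  proof (rule analytic_continuation[OF _ U(1,3) _ U01(1) islimpt_real_interval _ that])
    show "(%w. ?P w * ?f w) holomorphic_on ?U" by (intro holomorphic_on_mult hP hf)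
    show "complex_of_real ` {0<..<1} \<subseteq> ?U" using seg by auto
    fix z assume "z \<in> complex_of_real ` {0<..<1}"
    then obtain w where w: "z = of_real w" "0 < w" "w < 1" by auto
    have "cpx (%j. p j + w * (q j - p j)) \<in> pd T r" using seg[OF w(2,3)] by (simp only: mem_Collect_eq v_def cpx_line)
    then show "?P z * ?f z = 0" using no unfolding w(1) v_def cpx_line by auto
  qed
  have "isCont ?P 0" using holomorphic_on_imp_continuous_on[OF hP] U(1) U01(1) by (simp add: continuous_on_eq_continuous_at)
  moreover have "?P 0 ~= 0" using p(2) l0 by simp
  ultimately obtain e1 where e1: "e1 > 0" "!!w. dist 0 w < e1 ==> ?P w ~= 0" using continuous_at_avoid[of 0 ?P 0] by blast
  obtain e2 where e2: "e2 > 0" "ball 0 e2 \<subseteq> ?U" using U(1) U01(1) open_contains_ball by blast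
  have "?f 1 = 0"
  proof (rule analytic_continuation[OF hf U(1,3) _ U01(1) _ _ U01(2)])
    show "ball 0 (min e1 e2) \<subseteq> ?U" using e2(2) by auto
    show "(0::complex) islimpt ball 0 (min e1 e2)" using e1(1) e2(1) by (simp add: islimpt_ball)
    fix z :: complex assume z: "z \<in> ball 0 (min e1 e2)"
    then have "z \<in> ?U" "?P z ~= 0" using e2(2) e1(2)[of z] by auto
    then show "?f z = 0" using prod0[of z] by simp
  qed
  then show False using l1 q(2) by simp
qed

lemma generic_point:
  assumes T: "finite T" and r: "0 < r" and A: "finite A" "!!f. f \<in> A ==> HB T r f" "!!f. f \<in> A ==> \<exists>a. cpx a \<in> pd T r & f (cpx a) ~= 0"
  shows "\<exists>a. cpx a \<in> pd T r & (\<forall>f\<in>A. f (cpx a) ~= 0)"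
  using A
proof (induction A rule: finite_induct)
  case empty
  then show ?case using r by (intro exI[of _ "%_. 0"]) (auto simp: pd_def cpx_def)
next
  case (insert f A)
  obtain p where p: "cpx p \<in> pd T r" "\<forall>f\<in>A. f (cpx p) ~= 0" using insert.IH insert.prems by blast
  obtain q where q: "cpx q \<in> pd T r" "f (cpx q) ~= 0" using insert.prems(2) by blast
  have "HB T r (%z. \<Prod>f\<in>A. f z)" using insert.prems(1) by (intro HB_prod[where F = "%f. f"]) auto
  moreover have "HB T r f" using insert.prems(1) by blast
  moreover have "(\<Prod>f\<in>A. f (cpx p)) ~= 0" using p(2) insert.hyps by simp
  ultimately obtain a where "cpx a \<in> pd T r" "(\<Prod>f\<in>A. f (cpx a)) ~= 0" "f (cpx a) ~= 0"
    using common_nonzero[of T r "%z. \<Prod>f\<in>A. f z" f p q] T p(1) q by blast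
  then show ?case using insert.hyps by auto
qed

lemma isolated_on_line:
  assumes T: "finite T" and r: "0 < r" and f: "HB T r f" and v: "cpx v \<in> pd T r" "f (cpx v) ~= 0"
  shows "\<exists>\<epsilon>>0. \<forall>w. 0 < cmod w --> cmod w < \<epsilon> --> f (%j. w * of_real (v j)) ~= 0"
proof -
  let ?U = "{w. lin (%_. 0) (cpx v) w \<in> pd T r}" and ?g = "%w. f (lin (%_. 0) (cpx v) w)"
  have e: "?g w = f (%j. w * of_real (v j))" for w by (simp add: cpx_def)
  have U: "open ?U" "connected ?U" by (rule open_line_pd[OF T], rule convex_connected[OF convex_line_pd])
  have h: "?g holomorphic_on ?U" by (rule HB_holo[OF f])
  have U01: "0 \<in> ?U" "1 \<in> ?U" using r v(1) by (auto simp: pd_def)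
  have g1: "?g 1 ~= 0" using v(2) by simp
  show ?thesis
  proof (cases "?g 0 = 0")
    case True
    obtain \<epsilon> where "0 < \<epsilon>" "ball 0 \<epsilon> \<subseteq> ?U" "!!z. z \<in> ball 0 \<epsilon> - {0} ==> ?g z ~= 0"
      by (rule isolated_zeros[OF h U U01(1) True U01(2) g1]) (rule that)
    then show ?thesis unfolding e by (intro exI[of _ \<epsilon>]) auto
  next
    case False
    have "isCont ?g 0" using holomorphic_on_imp_continuous_on[OF h] U(1) U01(1) by (simp add: continuous_on_eq_continuous_at)
    then obtain \<epsilon> where "\<epsilon> > 0" "!!w. dist 0 w < \<epsilon> ==> ?g w ~= 0" using False continuous_at_avoid[of 0 ?g 0] by blast
    then show ?thesis unfolding e by (intro exI[of _ \<epsilon>]) auto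
  qed
qed

text \<open>A real linear change of coordinates turns the i-axis into a line on which no relevant
  function vanishes identically, so \<open>regular_star\<close> applies; the paths are transported
  back. Functions that are zero at all real points are set aside, since their sign conditions hold
  trivially.\<close>

lemma star_insert:
  fixes i :: 'i
  assumes S: "finite S" "i \<notin> S" and Fs: "finite Fs" "!!f. f \<in> Fs ==> HBR (insert i S) r f" and r: "0 < r"
    and IH: "!!Gs r'. finite Gs ==> 0 < r' ==> (!!g. g \<in> Gs ==> HBR S r' g) ==> star S Gs"
  shows "star (insert i S) Fs"
proof -
  let ?T = "insert i S"
  have T: "finite ?T" using S by simp
  define Fs' where "Fs' = {f\<in>Fs. \<exists>a. cpx a \<in> pd ?T r & f (cpx a) ~= 0}"
  have finF': "finite Fs'" using Fs(1) by (simp add: Fs'_def)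
  have HF': "HBR ?T r f" if "f \<in> Fs'" for f using that Fs(2) by (simp add: Fs'_def)
  \<comment> \<open>The coordinate function is included so that the i-th entry of \<open>v\<close>
    is nonzero and the change of coordinates is invertible.\<close>
  obtain v where v: "cpx v \<in> pd ?T r" "\<forall>f\<in>insert (%z. z i) Fs'. f (cpx v) ~= 0"
  proof -
    have "\<exists>v. cpx v \<in> pd ?T r & (\<forall>f\<in>insert (%z. z i) Fs'. f (cpx v) ~= 0)"
    proof (rule generic_point[OF T r])
      show "HB ?T r f" if "f \<in> insert (%z. z i) Fs'" for f using that HF' HBR_HB HB_coord[of i ?T r] by auto
      show "\<exists>a. cpx a \<in> pd ?T r & f (cpx a) ~= 0" if "f \<in> insert (%z. z i) Fs'" for f
        using that
      proof
        assume "f = (%z. z i)"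
        then show ?thesis using r by (intro exI[of _ "%_. r/2"]) (auto simp: pd_def cpx_def)
      qed (simp add: Fs'_def)
    qed (use finF' in simp)
    then show thesis using that by blast
  qed
  have vi: "v i ~= 0" using v(2) by (simp add: cpx_def)
  have fv: "f (cpx v) ~= 0" if "f \<in> Fs'" for f using v(2) that by simp
  define V where "V = (\<Sum>j\<in>?T. \<bar>v j\<bar>)"
  have V0: "0 \<le> V" unfolding V_def by (intro sum_nonneg) auto
  have Vj: "\<bar>v j\<bar> \<le> V" if "j \<in> ?T" for j unfolding V_def using T that by (intro member_le_sum) auto
  \<comment> \<open>Adds the multiple of \<open>v\<close> given by the i-th coordinate: the i-axis
    goes to the line spanned by \<open>v\<close>, and the remaining axes are fixed.\<close>
  define \<Phi> where "\<Phi> z = (%j. if j = i then z i * of_real (v i) else z j + z i * of_real (v j))" for z :: "'i => complex"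
  define \<Phi>r where "\<Phi>r a = (%j. if j = i then a i * v i else a j + a i * v j)" for a :: "'i => real"
  have \<Phi>c: "\<Phi> (cpx a) = cpx (\<Phi>r a)" for a by (auto simp: \<Phi>_def \<Phi>r_def cpx_def)
  define r' where "r' = r / (1 + V)"
  have r': "0 < r'" "r' * (1 + V) = r" using r V0 by (simp_all add: r'_def)
  have \<Phi>pd: "\<Phi> z \<in> pd ?T r" if z: "z \<in> pd ?T r'" for z
    unfolding pd_def
  proof (intro CollectI ballI)
    fix j assume j: "j \<in> ?T"
    have zi: "cmod (z i) < r'" and zj: "cmod (z j) < r'" using z j by (auto simp: pd_def)
    have le: "cmod (z i * of_real (v j)) \<le> r' * V" unfolding norm_mult using zi Vj[OF j] r'(1) by (intro mult_mono) auto
    have eq: "r' + r' * V = r" using r'(2) by (simp add: algebra_simps)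
    show "cmod (\<Phi> z j) < r"
    proof (cases "j = i")
      case True then show ?thesis using le r'(1) eq by (simp add: \<Phi>_def)
    next
      case False
      then have "cmod (\<Phi> z j) \<le> cmod (z j) + cmod (z i * of_real (v j))" unfolding \<Phi>_def by (simp add: norm_triangle_ineq)
      then show ?thesis using le zj eq by linarith
    qed
  qed
  have HB\<Phi>: "HBR ?T r' (%z. f (\<Phi> z))" if "f \<in> Fs'" for f
    unfolding HBR_def
  proof (intro conjI allI impI)
    show "HB ?T r' (%z. f (\<Phi> z))"
      by (rule HB_affine[OF HBR_HB[OF HF'[OF that]], where \<Psi> = \<Phi>]) (use \<Phi>pd in \<open>auto simp: \<Phi>_def algebra_simps\<close>)
    show "f (\<Phi> (cpx a)) \<in> \<real>" if "cpx a \<in> pd ?T r'" for a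
      using \<Phi>pd[OF that] HBR_real[OF HF'[OF \<open>f \<in> Fs'\<close>]] unfolding \<Phi>c by blast
  qed
  have "star ?T ((%f z. f (\<Phi> z)) ` Fs')"
  proof (rule regular_star[OF S _ _ r'(1) _ IH])
    show "finite ((%f z. f (\<Phi> z)) ` Fs')" using finF' by simp
    show "HBR ?T r' g" if "g \<in> (%f z. f (\<Phi> z)) ` Fs'" for g using that HB\<Phi> by auto
    show "\<exists>\<epsilon>>0. \<forall>w. 0 < cmod w --> cmod w < \<epsilon> --> g ((%_. 0)(i := w)) ~= 0" if g: "g \<in> (%f z. f (\<Phi> z)) ` Fs'" for g
    proof -
      obtain f where f: "f \<in> Fs'" "g = (%z. f (\<Phi> z))" using g by blast
      have "\<Phi> ((%_. 0)(i := w)) = (%j. w * of_real (v j))" for w by (auto simp: \<Phi>_def)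
      then show ?thesis unfolding f(2) using isolated_on_line[OF T r HBR_HB[OF HF'[OF f(1)]] v(1) fv[OF f(1)]] by simp
    qed
  qed
  then obtain r0 c L where st: "0 < r0" "0 < c" "\<forall>a \<rho>. (\<forall>j\<in>?T. \<bar>a j\<bar> < r0) --> 0 < \<rho> --> \<rho> \<le> r0 --> (\<exists>\<gamma>. spath ?T ((%f z. f (\<Phi> z)) ` Fs') a \<rho> (c * \<rho> ^ L) \<gamma>)"
    unfolding star_def by (elim exE conjE)
  \<comment> \<open>Dominates the norm of the coordinate change, 1 + V, and that of its inverse, 1 +
    (1 + V) / |v i|, so one constant rescales both the base point and the radius.\<close>
  define A where "A = (1 + (1 + V) / \<bar>v i\<bar>) + (1 + V)"
  have A: "1 \<le> A" "1 + V \<le> A" "1 + (1 + V) / \<bar>v i\<bar> \<le> A" using V0 by (simp_all add: A_def)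
  define R where "R = min (r0 / A) (r/2)"
  have R: "0 < R" "R * A \<le> r0" "R \<le> r/2" using st(1) A(1) r by (auto simp: R_def min_def field_simps)
  have main: "\<exists>\<gamma>. spath ?T Fs a \<rho> ((c / A ^ L) * \<rho> ^ L) \<gamma>" if a: "\<forall>j\<in>?T. \<bar>a j\<bar> < R" and \<rho>: "0 < \<rho>" "\<rho> \<le> R" for a \<rho>
  proof -
    define b where "b j = (if j = i then a i / v i else a j - a i / v i * v j)" for j
    have \<Phi>b: "\<Phi>r b = a" using vi by (auto simp: \<Phi>r_def b_def)
    have bb: "\<bar>b j\<bar> < r0" if j: "j \<in> ?T" for j
    proof -
      have aj: "\<bar>a i\<bar> < R" "\<bar>a j\<bar> < R" using a j by auto
      have "\<bar>b j\<bar> \<le> \<bar>a j\<bar> + \<bar>a i\<bar> * ((1 + V) / \<bar>v i\<bar>)"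
      proof (cases "j = i")
        case True
        have "\<bar>b j\<bar> = \<bar>a i\<bar> * (1 / \<bar>v i\<bar>)" using True by (simp add: b_def abs_divide)
        also have "... \<le> \<bar>a i\<bar> * ((1 + V) / \<bar>v i\<bar>)" using V0 by (intro mult_left_mono divide_right_mono) auto
        finally show ?thesis by linarith
      next
        case False
        have "b j = a j - a i / v i * v j" using False by (simp add: b_def)
        then have "\<bar>b j\<bar> \<le> \<bar>a j\<bar> + \<bar>a i / v i * v j\<bar>" by (simp only: abs_triangle_ineq4)
        also have "\<bar>a i / v i * v j\<bar> = \<bar>a i\<bar> * (\<bar>v j\<bar> / \<bar>v i\<bar>)" by (simp add: abs_mult abs_divide)
        also have "... \<le> \<bar>a i\<bar> * ((1 + V) / \<bar>v i\<bar>)" using Vj[OF j] by (intro mult_left_mono divide_right_mono) auto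
        finally show ?thesis by simp
      qed
      also have "... < R + R * ((1 + V) / \<bar>v i\<bar>)" using aj V0 by (intro add_less_le_mono mult_right_mono) auto
      also have "... = R * (1 + (1 + V) / \<bar>v i\<bar>)" by (simp add: algebra_simps)
      also have "... \<le> R * A" using A(3) R(1) by (intro mult_left_mono) auto
      finally show ?thesis using R(2) by linarith
    qed
    have \<rho>A: "0 < \<rho> / A" "\<rho> / A \<le> r0"
    proof -
      show "0 < \<rho> / A" using \<rho> A by simp
      have "\<rho> / A \<le> R / 1" using \<rho> A R by (intro frac_le) auto
      also have "R \<le> R * A" using A R by simp
      finally show "\<rho> / A \<le> r0" using R by simp
    qed
    obtain \<gamma> where \<gamma>: "spath ?T ((%f z. f (\<Phi> z)) ` Fs') b (\<rho> / A) (c * (\<rho> / A) ^ L) \<gamma>" using st(3) bb \<rho>A by blast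
    have rvc: "rv (%z. f (\<Phi> z)) u = rv f (\<Phi>r u)" for f u by (simp add: rv_def \<Phi>c)
    have "spath ?T Fs a \<rho> ((c / A ^ L) * \<rho> ^ L) (%t. \<Phi>r (\<gamma> t))"
    proof -
      have g0: "\<gamma> 0 j = b j" if "j \<in> ?T" for j using \<gamma> that unfolding spath_def by blast
      have gc: "continuous_on {0..1} (%t. \<gamma> t j)" if "j \<in> ?T" for j using \<gamma> that unfolding spath_def by blast
      have gd: "\<bar>\<gamma> t j - b j\<bar> \<le> \<rho> / A" if "t \<in> {0..1}" "j \<in> ?T" for t j using \<gamma> that unfolding spath_def by blast
      have gs: "sgn (rv f (\<Phi>r (\<gamma> t))) = sgn (rv f a)" if "f \<in> Fs'" "t \<in> {0..1}" for f t
      proof -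
        have "sgn (rv (%z. f (\<Phi> z)) (\<gamma> t)) = sgn (rv (%z. f (\<Phi> z)) b)" using \<gamma> that unfolding spath_def by blast
        then show ?thesis unfolding rvc \<Phi>b .
      qed
      have gl: "rv f a = 0 \<or> c * (\<rho> / A) ^ L \<le> \<bar>rv f (\<Phi>r (\<gamma> 1))\<bar>" if "f \<in> Fs'" for f
      proof -
        have "rv (%z. f (\<Phi> z)) b = 0 \<or> c * (\<rho> / A) ^ L \<le> \<bar>rv (%z. f (\<Phi> z)) (\<gamma> 1)\<bar>" using \<gamma> that unfolding spath_def by blast
        then show ?thesis unfolding rvc \<Phi>b .
      qed
      have cd: "\<bar>\<Phi>r (\<gamma> t) j - a j\<bar> \<le> \<rho>" if t: "t \<in> {0..1}" and j: "j \<in> ?T" for t j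
      proof -
        have di: "\<bar>\<gamma> t i - b i\<bar> \<le> \<rho> / A" and dj: "\<bar>\<gamma> t j - b j\<bar> \<le> \<rho> / A" using gd[OF t] j by auto
        have m: "\<bar>(\<gamma> t i - b i) * v j\<bar> \<le> \<rho> / A * V" unfolding abs_mult using di Vj[OF j] \<rho>A by (intro mult_mono) auto
        have "\<bar>\<Phi>r (\<gamma> t) j - \<Phi>r b j\<bar> \<le> \<rho> / A + \<rho> / A * V"
        proof (cases "j = i")
          case True
          then have "\<Phi>r (\<gamma> t) j - \<Phi>r b j = (\<gamma> t i - b i) * v j" by (simp add: \<Phi>r_def algebra_simps)
          then show ?thesis using m \<rho>A by simp
        next
          case False
          then have "\<Phi>r (\<gamma> t) j - \<Phi>r b j = (\<gamma> t j - b j) + (\<gamma> t i - b i) * v j" by (simp add: \<Phi>r_def algebra_simps)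
          then show ?thesis using m dj abs_triangle_ineq[of "\<gamma> t j - b j" "(\<gamma> t i - b i) * v j"] by linarith
        qed
        also have "... = \<rho> * ((1 + V) / A)" using A(1) by (simp add: field_simps)
        also have "... \<le> \<rho> * 1" using A \<rho> by (intro mult_left_mono) auto
        finally show ?thesis using \<Phi>b by simp
      qed
      have van: "rv f (\<Phi>r (\<gamma> t)) = 0" "rv f a = 0" if f: "f \<in> Fs" "f \<notin> Fs'" and t: "t \<in> {0..1}" for f t
      proof -
        have z: "rv f u = 0" if "cpx u \<in> pd ?T r" for u using f that by (auto simp: Fs'_def rv_def)
        have aR: "\<bar>a j\<bar> < r/2" if "j \<in> ?T" for j using a that R(3) by force
        show "rv f a = 0" using aR r by (intro z) (fastforce simp: pd_def cpx_def)
        have "\<bar>\<Phi>r (\<gamma> t) j\<bar> < r" if "j \<in> ?T" for j using cd[OF t that] aR[OF that] \<rho>(2) R(3) by linarith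
        then show "rv f (\<Phi>r (\<gamma> t)) = 0" by (intro z) (simp add: pd_def cpx_def)
      qed
      have ce: "(c / A ^ L) * \<rho> ^ L = c * (\<rho> / A) ^ L" by (simp add: power_divide)
      show ?thesis unfolding spath_def ce
      proof (intro conjI ballI)
        fix j assume j: "j \<in> ?T"
        have "\<Phi>r (\<gamma> 0) j = \<Phi>r b j" using g0[OF j] g0[of i] by (simp add: \<Phi>r_def)
        then show "\<Phi>r (\<gamma> 0) j = a j" using \<Phi>b by simp
        show "continuous_on {0..1} (%t. \<Phi>r (\<gamma> t) j)" unfolding \<Phi>r_def using gc[OF j] gc[of i] by (cases "j = i") (auto intro!: continuous_intros)
      next
        show "\<bar>\<Phi>r (\<gamma> t) j - a j\<bar> \<le> \<rho>" if "t \<in> {0..1}" "j \<in> ?T" for t j by (rule cd[OF that])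
      next
        show "sgn (rv f (\<Phi>r (\<gamma> t))) = sgn (rv f a)" if "f \<in> Fs" "t \<in> {0..1}" for f t
          using gs[OF _ that(2)] van[OF that(1) _ that(2)] by (cases "f \<in> Fs'") simp_all
      next
        show "rv f a = 0 \<or> c * (\<rho> / A) ^ L \<le> \<bar>rv f (\<Phi>r (\<gamma> 1))\<bar>" if "f \<in> Fs" for f
          using gl van(2)[OF that, of 1] by (cases "f \<in> Fs'") simp_all
      qed
    qed
    then show ?thesis by blast
  qed
  have "0 < c / A ^ L" using st(2) A(1) by simp
  then show ?thesis unfolding star_def using R(1) main by (intro exI[of _ R] exI[of _ "c / A ^ L"] exI[of _ L] conjI allI impI) auto
qed

theorem star_all:
  assumes "finite S" "finite Fs" "0 < r" "!!f. f \<in> Fs ==> HBR S r f"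
  shows "star S Fs"
  using assms
proof (induction S arbitrary: Fs r rule: finite_induct)
  case empty
  have same: "rv f a = rv f (%_. 0)" if "f \<in> Fs" for f a by (rule rv_depends[OF HBR_HB[OF empty(3)[OF that]]]) simp
  have "\<exists>c>0. \<forall>f\<in>Fs. rv f (%_. 0) = 0 \<or> c \<le> \<bar>rv f (%_. 0)\<bar>"
  proof (rule finite_lower[OF empty(1)])
    show "\<exists>c>0. rv f (%_. 0) = 0 \<or> c \<le> \<bar>rv f (%_. 0)\<bar>" for f :: "('a => complex) => complex"
      by (cases "rv f (%_. 0) = 0") (auto intro: exI[of _ 1] exI[of _ "\<bar>rv f (%_. 0)\<bar>"])
  qed auto
  then obtain c where c: "c > 0" "!!f. f \<in> Fs ==> rv f (%_. 0) = 0 \<or> c \<le> \<bar>rv f (%_. 0)\<bar>" by blast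
  have "spath {} Fs a \<rho> (c * \<rho> ^ 0) (%_. a)" for a \<rho> using c(2) same unfolding spath_def by (metis empty_iff mult.right_neutral power_0)
  then show ?case unfolding star_def using c(1) by (intro exI[of _ 1] exI[of _ c] exI[of _ 0] conjI) auto
next
  case (insert i S)
  then show ?case by (intro star_insert) auto
qed

section \<open>Simplices in semianalytic sets\<close>

definition shifted :: "'i set => ('i => real) => ('i => real) => 'i => real" where
  "shifted S p u = (%s. if s \<in> S then p s + u s else 0)"

lemma HBR_diff: "HBR S r F ==> HBR S r G ==> HBR S r (%z. F z - G z)"
  using HBR_add[of S r F "%z. - 1 * G z"] HBR_mult[of S r "%z. - 1" G] HBR_const[of "- 1" S r] by simp

lemma HBR_power: "HBR S r F ==> HBR S r (%z. F z ^ n)"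
  by (induction n) (auto intro: HBR_const HBR_mult)

lemma infsum_split_finite:
  fixes h :: "'a => 'b::banach"
  assumes "finite B" "B \<subseteq> A" "h summable_on A"
  shows "infsum h A = sum h B + infsum h (A - B)"
proof -
  have "infsum h (B \<union> (A - B)) = infsum h B + infsum h (A - B)"
    by (rule infsum_Un_disjoint[OF summable_on_finite[OF assms(1)] summable_on_subset_banach[OF assms(3)]]) auto
  moreover have "B \<union> (A - B) = A" using assms(2) by auto
  ultimately show ?thesis using assms(1) by simp
qed

text \<open>The power series converges absolutely at the corner of a small cube, so its terms have a
  summable majorant on the complex polydisc of that size. The sum is therefore a uniform limit of
  polynomials, with real values at real points because the coefficients are real.\<close>

lemma complexification:
  assumes S: "finite S" and F: "c_analytic_on S U F" and p: "p \<in> U"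
  shows "\<exists>r>0. \<exists>H. HBR S r H & (\<forall>u. (\<forall>s\<in>S. \<bar>u s\<bar> < r) --> shifted S p u \<in> U & rv H u = F (shifted S p u))"
proof -
  obtain r c where r: "0 < r" "cball S p r \<subseteq> U" and hs: "!!q. q \<in> cball S p r ==> ((%\<beta>. c \<beta> * (\<Prod>i\<in>S. (q i - p i) ^ \<beta> i)) has_sum F q) (mindex S)"
    using F p unfolding c_analytic_on_def by blast
  \<comment> \<open>The point with all offsets equal to \<tau> has Euclidean distance \<tau> times
    the square root of \<open>card S\<close>, which is below \<open>r\<close>.\<close>
  define \<tau> where "\<tau> = r / (real (card S) + 1)"
  have \<tau>: "0 < \<tau>" "\<tau> * (real (card S) + 1) = r" using r(1) by (simp_all add: \<tau>_def add_pos_nonneg field_simps add_eq_0_iff_both_eq_0)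
  have inb: "shifted S p u \<in> cball S p r" if u: "!!s. s \<in> S ==> \<bar>u s\<bar> \<le> \<tau>" for u
  proof -
    have "(\<Sum>i\<in>S. (p i - shifted S p u i)\<^sup>2) = (\<Sum>i\<in>S. (u i)\<^sup>2)" by (intro sum.cong) (auto simp: shifted_def)
    also have "... \<le> (\<Sum>i\<in>S. \<tau>\<^sup>2)" using u \<tau>(1) by (intro sum_mono) (simp add: abs_le_square_iff[symmetric])
    also have "... = real (card S) * \<tau>\<^sup>2" by simp
    also have "... < (real (card S) + 1)\<^sup>2 * \<tau>\<^sup>2" using \<tau>(1) by (intro mult_strict_right_mono) (auto simp: power2_eq_square algebra_simps add_pos_nonneg)
    also have "... = r\<^sup>2" unfolding \<tau>(2)[symmetric] by (simp add: power_mult_distrib)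
    finally have "sqrt (\<Sum>i\<in>S. (p i - shifted S p u i)\<^sup>2) < r" using r(1) by (intro real_less_lsqrt) auto
    then show ?thesis unfolding cball_def cdist_def cspace_def by (simp add: shifted_def)
  qed
  have hsu: "((%\<beta>. c \<beta> * (\<Prod>i\<in>S. u i ^ \<beta> i)) has_sum F (shifted S p u)) (mindex S)" if u: "!!s. s \<in> S ==> \<bar>u s\<bar> \<le> \<tau>" for u
  proof -
    have "(\<Prod>i\<in>S. (shifted S p u i - p i) ^ \<beta> i) = (\<Prod>i\<in>S. u i ^ \<beta> i)" for \<beta> by (intro prod.cong) (auto simp: shifted_def)
    moreover have "shifted S p u \<in> cball S p r" by (rule inb) (rule u)
    ultimately show ?thesis using hs[of "shifted S p u"] by simp
  qed
  define W where "W \<beta> = \<bar>c \<beta> * (\<Prod>i\<in>S. \<tau> ^ \<beta> i)\<bar>" for \<beta>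
  have "(%\<beta>. c \<beta> * (\<Prod>i\<in>S. \<tau> ^ \<beta> i)) summable_on mindex S"
    using has_sum_imp_summable[OF hsu[of "%_. \<tau>"]] \<tau>(1) by simp
  then have "(%\<beta>. norm (c \<beta> * (\<Prod>i\<in>S. \<tau> ^ \<beta> i))) summable_on mindex S" by (rule iffD1[OF summable_on_iff_abs_summable_on_real])
  moreover have "W = (%\<beta>. norm (c \<beta> * (\<Prod>i\<in>S. \<tau> ^ \<beta> i)))" by (rule ext) (simp add: W_def)
  ultimately have Ws: "W summable_on mindex S" by simp
  define T where "T z \<beta> = of_real (c \<beta>) * (\<Prod>i\<in>S. z i ^ \<beta> i)" for z :: "'a => complex" and \<beta>
  define H where "H z = infsum (T z) (mindex S)" for z
  have TW: "cmod (T z \<beta>) \<le> W \<beta>" if z: "z \<in> pd S \<tau>" for z \<beta>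
  proof -
    have "cmod (\<Prod>i\<in>S. z i ^ \<beta> i) \<le> (\<Prod>i\<in>S. \<tau> ^ \<beta> i)"
      unfolding prod_norm[symmetric] norm_power using z by (intro prod_mono conjI power_mono) (auto simp: pd_def less_imp_le)
    then have "cmod (\<Prod>i\<in>S. z i ^ \<beta> i) \<le> \<bar>\<Prod>i\<in>S. \<tau> ^ \<beta> i\<bar>" by linarith
    then show ?thesis unfolding T_def W_def norm_mult abs_mult norm_of_real by (rule mult_left_mono) simp
  qed
  have Ts: "(%\<beta>. cmod (T z \<beta>)) summable_on B" if "z \<in> pd S \<tau>" "B \<subseteq> mindex S" for z B
    by (rule Infinite_Sum.abs_summable_on_comparison_test'[OF summable_on_subset_banach[OF Ws that(2)]]) (rule TW[OF that(1)])
  have "\<forall>n. \<exists>B. finite B & B \<subseteq> mindex S & dist (sum W B) (infsum W (mindex S)) \<le> 1 / real (Suc n)"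
    using infsum_finite_approximation[OF Ws] by simp
  then obtain B where B: "!!n. finite (B n)" "!!n. B n \<subseteq> mindex S" "!!n. dist (sum W (B n)) (infsum W (mindex S)) \<le> 1 / real (Suc n)" by metis
  note split = infsum_split_finite[OF B(1,2)]
  have HB: "HB S \<tau> H"
  proof (rule HB_uniform_limit[OF S, where Fn = "%n z. \<Sum>\<beta>\<in>B n. T z \<beta>" and c = 1])
    show "HB S \<tau> (%z. \<Sum>\<beta>\<in>B n. T z \<beta>)" for n unfolding T_def by (intro HB_sum HB_mult HB_const HB_prod HB_power HB_coord)
    show "H z = H z'" if "!!i. i \<in> S ==> z i = z' i" for z z'
    proof -
      have "T z = T z'" unfolding T_def using that by (intro ext) (simp cong: prod.cong)
      then show ?thesis by (simp add: H_def)
    qed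
    fix n z assume z: "z \<in> pd S \<tau>"
    have "H z - sum (T z) (B n) = infsum (T z) (mindex S - B n)"
      unfolding H_def using split[OF Infinite_Sum.abs_summable_summable[OF Ts[OF z order_refl]], of n] by simp
    then have "cmod (sum (T z) (B n) - H z) = cmod (infsum (T z) (mindex S - B n))" by (metis norm_minus_commute)
    also have "... \<le> infsum (%\<beta>. cmod (T z \<beta>)) (mindex S - B n)" by (rule Infinite_Sum.norm_infsum_bound[OF Ts[OF z]]) auto
    also have "... \<le> infsum W (mindex S - B n)" using TW[OF z] by (intro infsum_mono Ts[OF z] summable_on_subset_banach[OF Ws]) auto
    also have "... = infsum W (mindex S) - sum W (B n)" using split[OF Ws, of n] by simp
    also have "... \<le> 1 / real (Suc n)" using B(3)[of n] by (simp add: dist_real_def)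
    finally show "cmod (sum (T z) (B n) - H z) \<le> 1 / real (Suc n)" .
  qed
  have val: "H (cpx u) = of_real (F (shifted S p u))" if "\<forall>s\<in>S. \<bar>u s\<bar> < \<tau>" for u
  proof -
    have "((%\<beta>. complex_of_real (c \<beta> * (\<Prod>i\<in>S. u i ^ \<beta> i))) has_sum of_real (F (shifted S p u))) (mindex S)"
      using that by (intro has_sum_of_real hsu) (auto simp: less_imp_le)
    moreover have "complex_of_real (c \<beta> * (\<Prod>i\<in>S. u i ^ \<beta> i)) = T (cpx u) \<beta>" for \<beta> by (simp add: T_def cpx_def)
    ultimately show ?thesis unfolding H_def by (simp add: infsumI)
  qed
  have "HBR S \<tau> H" unfolding HBR_def using HB val by (auto simp: pd_def cpx_def)
  moreover have "\<forall>u. (\<forall>s\<in>S. \<bar>u s\<bar> < \<tau>) --> shifted S p u \<in> U & rv H u = F (shifted S p u)"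
  proof (intro allI impI conjI)
    fix u assume u: "\<forall>s\<in>S. \<bar>u s\<bar> < \<tau>"
    show "shifted S p u \<in> U" using inb[of u] u r(2) by (auto simp: less_imp_le)
    show "rv H u = F (shifted S p u)" using val[OF u] by (simp add: rv_def)
  qed
  ultimately show ?thesis using \<tau>(1) by blast
qed

definition prj :: "('d::finite + nat => real) => real^'d" where "prj p = (\<chi> j. p (Inl j))"

text \<open>The vertices are indexed by \<open>'d option\<close>, with \<open>None\<close> for the
  base vertex. The inequalities on edges and volume are strict and \<sigma> and \<open>l\<close> are
  parameters of their own, so that everything is a sign condition on finitely many analytic
  functions and survives a move inside a sign stratum.\<close>

definition frame :: "('d::finite + nat => real) set => ('d + nat) set => ('d + nat => real) => real => bool" where
  "frame A S a \<epsilon> \<longleftrightarrow> (\<exists>(b :: 'd option => 'd + nat => real) \<sigma> l. (\<forall>\<kappa>. b \<kappa> \<in> A) & (\<forall>\<kappa>. \<forall>s\<in>S. \<bar>b \<kappa> s - a s\<bar> \<le> \<epsilon>) &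
     0 < \<sigma> & \<sigma> \<le> \<epsilon> & 0 < l & l \<le> \<epsilon> & (\<forall>k. norm (prj (b (Some k)) - prj (b None)) < \<sigma>) &
     \<sigma> ^ (CARD('d) + 1) < l * \<bar>det (\<chi> k. prj (b (Some k)) - prj (b None))\<bar>)"

definition good :: "('d::finite + nat => real) set => ('d + nat) set => ('d + nat => real) => bool" where
  "good A S a \<longleftrightarrow> (\<forall>\<epsilon>>0. frame A S a \<epsilon>)"

text \<open>Coordinates of a frame regarded as a single point: all coordinates of all d + 1
  vertices, then \<sigma> at \<open>Inr True\<close> and \<open>l\<close> at
  \<open>Inr False\<close>.\<close>

type_synonym 'd frame_index = "(('d + nat) \<times> 'd option) + bool"

definition distance_form :: "'d::finite => ('d frame_index => complex) => complex" where
  "distance_form k z = z (Inr True) ^ 2 - (\<Sum>j\<in>UNIV. (z (Inl (Inl j, Some k)) - z (Inl (Inl j, None))) ^ 2)"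

text \<open>Both this and \<open>distance_form\<close> are written with squares: they are then
  polynomials, and for positive \<sigma> and \<open>l\<close> their positivity expresses the strict
  inequalities in \<open>frame\<close>.\<close>

definition volume_form :: "('d::finite frame_index => complex) => complex" where
  "volume_form z = (z (Inr False) * det (\<chi> k j. z (Inl (Inl j, Some k)) - z (Inl (Inl j, None)))) ^ 2 - (z (Inr True) ^ (CARD('d) + 1)) ^ 2"

lemma det_of_real: "det (\<chi> k j. complex_of_real (M k j)) = of_real (det (\<chi> k j. M k j))"
  unfolding det_def by simp

lemma rv_forms:
  fixes b :: "'d::finite option => 'd + nat => real"
  assumes "!!\<kappa> j. u (Inl (Inl j, \<kappa>)) = b \<kappa> (Inl j) - a (Inl j)"
  shows "rv (distance_form k) u = u (Inr True) ^ 2 - norm (prj (b (Some k)) - prj (b None)) ^ 2"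
    and "rv volume_form u = (u (Inr False) * det (\<chi> k. prj (b (Some k)) - prj (b None))) ^ 2 - (u (Inr True) ^ (CARD('d) + 1)) ^ 2"
proof -
  have d: "u (Inl (Inl j, Some k)) - u (Inl (Inl j, None)) = (prj (b (Some k)) - prj (b None)) $ j" for j k
    unfolding assms by (simp add: prj_def)
  have n: "norm (prj (b (Some k)) - prj (b None)) ^ 2 = (\<Sum>j\<in>UNIV. ((prj (b (Some k)) - prj (b None)) $ j) ^ 2)"
    unfolding power2_norm_eq_inner inner_vec_def by (simp add: power2_eq_square)
  have "distance_form k (cpx u) = of_real (u (Inr True) ^ 2 - (\<Sum>j\<in>UNIV. (u (Inl (Inl j, Some k)) - u (Inl (Inl j, None))) ^ 2))"
    by (simp add: distance_form_def cpx_def)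
  then show "rv (distance_form k) u = u (Inr True) ^ 2 - norm (prj (b (Some k)) - prj (b None)) ^ 2"
    unfolding rv_def d n by simp
  have "volume_form (cpx u) = of_real ((u (Inr False) * det (\<chi> k j. u (Inl (Inl j, Some k)) - u (Inl (Inl j, None)))) ^ 2 - (u (Inr True) ^ (CARD('d) + 1)) ^ 2)"
    unfolding volume_form_def cpx_def of_real_diff[symmetric] det_of_real by simp
  then have "rv volume_form u = (u (Inr False) * det (\<chi> k j. (prj (b (Some k)) - prj (b None)) $ j)) ^ 2 - (u (Inr True) ^ (CARD('d) + 1)) ^ 2"
    unfolding rv_def d by simp
  moreover have "(\<chi> k j. (prj (b (Some k)) - prj (b None)) $ j) = (\<chi> k. prj (b (Some k)) - prj (b None))" by (simp add: vec_eq_iff)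
  ultimately show "rv volume_form u = (u (Inr False) * det (\<chi> k. prj (b (Some k)) - prj (b None))) ^ 2 - (u (Inr True) ^ (CARD('d) + 1)) ^ 2"
    by simp
qed

lemma HBR_forms:
  fixes S :: "('d::finite + nat) set"
  assumes "range Inl \<subseteq> S"
  shows "HBR (Inl ` (S \<times> UNIV) \<union> range Inr) r (distance_form k)" "HBR (Inl ` (S \<times> UNIV) \<union> range Inr) r (volume_form :: ('d frame_index => complex) => complex)"
proof -
  let ?S = "Inl ` (S \<times> UNIV) \<union> range Inr :: 'd frame_index set"
  have c: "HBR ?S r (%z. z (Inl (Inl j, \<kappa>)))" "HBR ?S r (%z. z (Inr \<beta>))" for j \<kappa> \<beta> using assms by (auto intro!: HBR_coord)
  show "HBR ?S r (distance_form k)" unfolding distance_form_def by (intro HBR_diff HBR_power HBR_sum c)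
  have "HBR ?S r (%z. det (\<chi> k j. z (Inl (Inl j, Some k)) - z (Inl (Inl j, None))))"
    unfolding det_def vec_lambda_beta by (intro HBR_sum HBR_mult HBR_const HBR_prod HBR_diff c) simp
  then show "HBR ?S r volume_form" unfolding volume_form_def by (intro HBR_diff HBR_power HBR_mult c)
qed

lemma HBR_block:
  fixes S :: "'i set" and \<kappa> :: 'k
  assumes "HBR S r H"
  shows "HBR (Inl ` (S \<times> UNIV) \<union> range Inr :: ('i \<times> 'k + bool) set) r (%z. H (%s. z (Inl (s, \<kappa>))))"
    (is "HBR ?T r _")
  unfolding HBR_def
proof (intro conjI allI impI)
  show "HB ?T r (%z. H (%s. z (Inl (s, \<kappa>))))"
    by (rule HB_affine[OF HBR_HB[OF assms], where \<Psi> = "%v s. v (Inl (s, \<kappa>))"]) (auto simp: pd_def)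
  fix a assume "cpx a \<in> pd ?T r"
  then have "cpx (%s. a (Inl (s, \<kappa>))) \<in> pd S r" by (auto simp: pd_def cpx_def)
  from HBR_real[OF assms this] show "H (%s. cpx a (Inl (s, \<kappa>))) \<in> \<real>" by (simp add: cpx_def)
qed

lemma c_analytic_on_zero: "copen S U ==> c_analytic_on S U (%_. 0)"
  unfolding copen_def c_analytic_on_def
proof (intro ballI)
  fix p assume "U \<subseteq> cspace S & (\<forall>p\<in>U. \<exists>r>0. cball S p r \<subseteq> U)" "p \<in> U"
  then obtain r where "r > 0" "cball S p r \<subseteq> U" by blast
  then show "\<exists>r>0. \<exists>c::('a => nat) => real. cball S p r \<subseteq> U & (\<forall>q\<in>cball S p r. ((%\<beta>. c \<beta> * (\<Prod>i\<in>S. (q i - p i) ^ \<beta> i)) has_sum 0) (mindex S))"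
    by (intro exI[of _ r] conjI exI[of _ "%_. 0"]) auto
qed

text \<open>Near a good point there are frames of every size, but without a lower bound on their
  volume. \<open>star_all\<close>, applied to a frame as one point, moves it a distance comparable
  to \<rho> without leaving its sign stratum: the vertices remain in \<open>A\<close> and the frame
  inequalities persist, while \<open>volume_form\<close> becomes at least a power of \<rho>.\<close>

lemma local_dagger:
  fixes A :: "('d::finite + nat => real) set"
  assumes S: "S = range Inl \<union> Inr ` {..<e}" and sa: "semianalytic S A" and a0: "a0 \<in> cspace S" and X: "prj ` A \<subseteq> X"
  shows "\<exists>r>0. \<exists>n. \<forall>a. good A S a --> (\<forall>s\<in>S. \<bar>a s - a0 s\<bar> < r) --> dagger X (prj a) n"
proof -
  have fS: "finite S" unfolding S by simp
  have Asub: "A \<subseteq> cspace S" using sa unfolding semianalytic_def by blast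
  obtain U0 N M f g where U0: "copen S U0" "a0 \<in> U0"
    and AU: "A \<inter> U0 = (\<Union>i<(N::nat). {q\<in>U0. \<forall>j<(M::nat). f i j q = 0 & 0 < g i j q})"
    and an: "!!i j. i < N ==> j < M ==> c_analytic_on S U0 (f i j) & c_analytic_on S U0 (g i j)"
  proof -
    from sa[unfolded semianalytic_def, THEN conjunct2, THEN bspec, OF a0]
    show thesis by (elim exE conjE) (rule that, assumption, assumption, assumption, simp)
  qed
  \<comment> \<open>The zero function is included so that \<open>P\<close> is not empty when the
    description of \<open>A\<close> has no conditions; the membership of the shifted points in
    \<open>U0\<close> is obtained through it.\<close>
  define P where "P = {%_. 0} \<union> (%(i, j). f i j) ` ({..<N} \<times> {..<M}) \<union> (%(i, j). g i j) ` ({..<N} \<times> {..<M})"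
  have fP: "finite P" by (simp add: P_def)
  have anP: "c_analytic_on S U0 h" if "h \<in> P" for h using that an c_analytic_on_zero[OF U0(1)] by (auto simp: P_def)
  have P0: "(%_. 0) \<in> P" by (simp add: P_def)
  have Pf: "f i j \<in> P" "g i j \<in> P" if "i < N" "j < M" for i j using that by (force simp: P_def)+
  define Q where "Q h \<rho> H \<longleftrightarrow> HBR S \<rho> H & (\<forall>u. (\<forall>s\<in>S. \<bar>u s\<bar> < \<rho>) --> shifted S a0 u \<in> U0 & rv H u = h (shifted S a0 u))" for h \<rho> H
  have "\<exists>r>0. \<forall>h\<in>P. \<exists>H. Q h r H"
  proof (rule finite_lower[OF fP])
    show "\<exists>r>0. \<exists>H. Q h r H" if "h \<in> P" for h unfolding Q_def by (rule complexification[OF fS anP[OF that] U0(2)])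
    fix h and r r' :: real assume "\<exists>H. Q h r H" and le: "r' \<le> r"
    then obtain H where H: "Q h r H" by (elim exE)
    have mono: "\<forall>s\<in>S. \<bar>u s\<bar> < r" if "\<forall>s\<in>S. \<bar>u s\<bar> < r'" for u using that le by force
    have "Q h r' H" unfolding Q_def
    proof (intro conjI allI impI)
      show "HBR S r' H" using H unfolding Q_def by (elim conjE) (rule HBR_mono[OF _ le])
      fix u assume "\<forall>s\<in>S. \<bar>u s\<bar> < r'"
      then have "\<forall>s\<in>S. \<bar>u s\<bar> < r" by (rule mono)
      then show "shifted S a0 u \<in> U0" "rv H u = h (shifted S a0 u)" using H[unfolded Q_def, THEN conjunct2, rule_format, of u] by simp_all
    qed
    then show "\<exists>H. Q h r' H" by (rule exI[of _ H])
  qed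
  then obtain r where r: "r > 0" and exH: "\<forall>h\<in>P. \<exists>H. Q h r H" by (elim exE conjE)
  obtain Hc where HQ: "\<forall>h\<in>P. Q h r (Hc h)" using bchoice[OF exH] by (elim exE)
  have Hc: "HBR S r (Hc h)" "shifted S a0 u \<in> U0 & rv (Hc h) u = h (shifted S a0 u)" if "h \<in> P" "\<forall>s\<in>S. \<bar>u s\<bar> < r" for h u
    using HQ[rule_format, OF that(1), unfolded Q_def] that(2) by simp_all
  have HcH: "HBR S r (Hc h)" if "h \<in> P" for h using HQ[rule_format, OF that, unfolded Q_def] by (rule conjunct1)
  let ?SS = "Inl ` (S \<times> UNIV) \<union> range Inr :: 'd frame_index set"
  define bl where "bl h \<kappa> = (%z :: 'd frame_index => complex. Hc h (%s. z (Inl (s, \<kappa>))))" for h \<kappa>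
  define Fs where "Fs = (%(h, \<kappa>). bl h \<kappa>) ` (P \<times> UNIV) \<union> range (%\<beta> z. z (Inr \<beta>)) \<union> range distance_form \<union> {volume_form}"
  have star: "star ?SS Fs"
  proof (rule star_all[OF _ _ r])
    show "finite ?SS" using fS by simp
    show "finite Fs" unfolding Fs_def using fP by simp
    have "range Inl \<subseteq> S" using S by blast
    then show "HBR ?SS r F" if "F \<in> Fs" for F
      using that HBR_forms[of S r] HBR_block[OF HcH] HBR_coord[of "Inr _" ?SS r] unfolding Fs_def bl_def by auto
  qed
  obtain r0 c L where st: "0 < r0" "0 < c" "\<forall>a \<rho>. (\<forall>j\<in>?SS. \<bar>a j\<bar> < r0) --> 0 < \<rho> --> \<rho> \<le> r0 --> (\<exists>\<gamma>. spath ?SS Fs a \<rho> (c * \<rho> ^ L) \<gamma>)"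
    using star unfolding star_def by (elim exE conjE)
  define R0 where "R0 = min r0 (r/2)"
  have R0: "0 < R0" "R0 \<le> r0" "R0 \<le> r/2" using st(1) r by (auto simp: R0_def)
  obtain n1 n2 :: nat where n12: "4 / R0 \<le> real n1" "1 / c \<le> real n2" using real_arch_simple by blast
  \<comment> \<open>The summands provide in turn: 2 d for distances in the projection and the bound
    2, L + 1 for the volume exponent, \<open>n1\<close> for 4 \<rho> \<le> R0, and \<open>n2\<close>
    for \<rho> \<le> c.\<close>
  define n where "n = 2 * CARD('d) + 2 + (L + 1) + n1 + n2"
  have n: "4 \<le> real n * R0" "1 \<le> real n * c" "2 \<le> real n" "2 * real CARD('d) \<le> real n" "L + 1 \<le> 2 * n"
  proof -
    have "4 \<le> real n1 * R0" using n12(1) R0(1) by (simp add: field_simps)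
    also have "... \<le> real n * R0" using R0(1) by (intro mult_right_mono) (auto simp: n_def)
    finally show "4 \<le> real n * R0" .
    have "1 \<le> real n2 * c" using n12(2) st(2) by (simp add: field_simps)
    also have "... \<le> real n * c" using st(2) by (intro mult_right_mono) (auto simp: n_def)
    finally show "1 \<le> real n * c" .
  qed (auto simp: n_def)
  have "dagger X (prj a) n" if gd: "good A S a" and ar: "\<forall>s\<in>S. \<bar>a s - a0 s\<bar> < R0/2" for a
    unfolding dagger_def
  proof (intro allI impI)
    fix \<rho> :: real assume \<rho>: "0 < \<rho>" "real n * \<rho> \<le> 1"
    have scale: "t * \<rho> \<le> q" if "t \<le> real n * q" "0 < q" for t q
    proof -
      have "t * \<rho> \<le> real n * q * \<rho>" using that(1) \<rho>(1) by (intro mult_right_mono) auto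
      also have "... = q * (real n * \<rho>)" by simp
      also have "... \<le> q * 1" using that(2) \<rho>(2) by (intro mult_left_mono) auto
      finally show ?thesis by simp
    qed
    have \<rho>R: "4 * \<rho> \<le> R0" "1 * \<rho> \<le> c" "2 * \<rho> \<le> 1" using scale[OF n(1) R0(1)] scale[OF n(2) st(2)] scale[of 2 1] n(3) by auto
    have "frame A S a \<rho>" using gd \<rho>(1) unfolding good_def by blast
    from this[unfolded frame_def] obtain b \<sigma> l where fr: "\<forall>\<kappa>. b \<kappa> \<in> A" "\<forall>\<kappa>. \<forall>s\<in>S. \<bar>b \<kappa> s - a s\<bar> \<le> \<rho>"
      "0 < \<sigma>" "\<sigma> \<le> \<rho>" "0 < l" "l \<le> \<rho>" "\<forall>k. norm (prj (b (Some k)) - prj (b None)) < \<sigma>"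
      "\<sigma> ^ (CARD('d) + 1) < l * \<bar>det (\<chi> k. prj (b (Some k)) - prj (b None))\<bar>" by (elim exE conjE)
    note \<sigma> = fr(3,4) and l = fr(5,6) and vol = fr(8)
    have bA: "b \<kappa> \<in> A" and ba: "s \<in> S ==> \<bar>b \<kappa> s - a s\<bar> \<le> \<rho>" and dst: "norm (prj (b (Some k)) - prj (b None)) < \<sigma>" for \<kappa> s k
      using fr(1,2,7) by blast+
    \<comment> \<open>The frame as one point, with vertex coordinates relative to \<open>a0\<close>,
      the centre of the complexified functions.\<close>
    define u :: "'d frame_index => real" where "u = case_sum (%(s, \<kappa>). b \<kappa> s - a0 s) (%\<beta>. if \<beta> then \<sigma> else l)"
    have u: "u (Inl (s, \<kappa>)) = b \<kappa> s - a0 s" "u (Inr True) = \<sigma>" "u (Inr False) = l" for s \<kappa> by (simp_all add: u_def)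
    have ub: "\<bar>u j\<bar> < R0" if "j \<in> ?SS" for j
      using that
    proof
      assume "j \<in> Inl ` (S \<times> UNIV)"
      then obtain s \<kappa> where j: "s \<in> S" "j = Inl (s, \<kappa>)" by auto
      have "\<bar>a s - a0 s\<bar> < R0/2" using ar j(1) by blast
      then show ?thesis using ba[OF j(1), of \<kappa>] \<rho>R(1) R0(1) unfolding j(2) u by linarith
    next
      assume "j \<in> range Inr"
      then obtain \<beta> where "j = Inr \<beta>" by blast
      then show ?thesis using \<sigma> l \<rho>R(1) \<rho>(1) by (cases \<beta>) (auto simp: u)
    qed
    have h1: "\<forall>j\<in>?SS. \<bar>u j\<bar> < r0" using less_le_trans[OF ub R0(2)] by (rule ballI)
    have h2: "\<rho> \<le> r0" using \<rho>R(1) R0 \<rho>(1) by linarith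
    obtain \<gamma> where \<gamma>: "spath ?SS Fs u \<rho> (c * \<rho> ^ L) \<gamma>"
      using st(3)[THEN spec[of _ u], THEN spec[of _ \<rho>], THEN mp, OF h1, THEN mp, OF \<rho>(1), THEN mp, OF h2] by (rule exE)
    note \<gamma>' = \<gamma>[unfolded spath_def]
    define u' where "u' = \<gamma> 1"
    have one: "(1::real) \<in> {0..1}" by simp
    have du: "\<bar>u' j - u j\<bar> \<le> \<rho>" if "j \<in> ?SS" for j
    proof -
      have "\<forall>t\<in>{0..1}. \<forall>j\<in>?SS. \<bar>\<gamma> t j - u j\<bar> \<le> \<rho>" using \<gamma>' by (elim conjE)
      from bspec[OF bspec[OF this one] that] show ?thesis unfolding u'_def .
    qed
    have sg: "sgn (rv F u') = sgn (rv F u)" if "F \<in> Fs" for F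
    proof -
      have "\<forall>F\<in>Fs. \<forall>t\<in>{0..1}. sgn (rv F (\<gamma> t)) = sgn (rv F u)" using \<gamma>' by (elim conjE)
      then show ?thesis using that unfolding u'_def by simp
    qed
    have lw: "rv F u = 0 \<or> c * \<rho> ^ L \<le> \<bar>rv F u'\<bar>" if "F \<in> Fs" for F
    proof -
      have "\<forall>F\<in>Fs. rv F u = 0 \<or> c * \<rho> ^ L \<le> \<bar>rv F (\<gamma> 1)\<bar>" using \<gamma>' by (elim conjE)
      then show ?thesis using that unfolding u'_def by (rule bspec)
    qed
    have ps: "0 < rv F u'" if "F \<in> Fs" "0 < rv F u" for F using sg[OF that(1)] that(2) by (metis sgn_greater)
    have ur: "\<bar>u (Inl (s, \<kappa>))\<bar> < r" "\<bar>u' (Inl (s, \<kappa>))\<bar> < r" if "s \<in> S" for s \<kappa>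
    proof -
      have m: "Inl (s, \<kappa>) \<in> ?SS" using that by blast
      show "\<bar>u (Inl (s, \<kappa>))\<bar> < r" "\<bar>u' (Inl (s, \<kappa>))\<bar> < r" using ub[OF m] du[OF m] R0(1,3) \<rho>R(1) \<rho>(1) by linarith+
    qed
    define b' where "b' \<kappa> = shifted S a0 (%s. u' (Inl (s, \<kappa>)))" for \<kappa>
    have bs: "shifted S a0 (%s. u (Inl (s, \<kappa>))) = b \<kappa>" for \<kappa>
      using bA[of \<kappa>] Asub by (auto simp: shifted_def u cspace_def fun_eq_iff subset_iff)
    have rvb: "rv (bl h \<kappa>) w = rv (Hc h) (%s. w (Inl (s, \<kappa>)))" for h \<kappa> w by (simp add: rv_def bl_def cpx_def)
    have blF: "bl h \<kappa> \<in> Fs" if "h \<in> P" for h \<kappa> using that unfolding Fs_def by (auto intro: image_eqI[of _ _ "(h, \<kappa>)"])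
    have b'A: "b' \<kappa> \<in> A" for \<kappa>
    proof -
      have val: "rv (bl h \<kappa>) u = h (b \<kappa>)" "rv (bl h \<kappa>) u' = h (b' \<kappa>)" "b \<kappa> \<in> U0" "b' \<kappa> \<in> U0" if h: "h \<in> P" for h
        using Hc(2)[OF h, of "%s. u (Inl (s, \<kappa>))"] Hc(2)[OF h, of "%s. u' (Inl (s, \<kappa>))"] ur unfolding rvb bs b'_def by blast+
      have bU: "b \<kappa> \<in> U0 & b' \<kappa> \<in> U0" using val(3,4)[OF P0] by blast
      then have "b \<kappa> \<in> A \<inter> U0" using bA by blast
      then obtain i where i: "i < N" "\<forall>j<M. f i j (b \<kappa>) = 0 & 0 < g i j (b \<kappa>)" unfolding AU by blast
      have "f i j (b' \<kappa>) = 0 & 0 < g i j (b' \<kappa>)" if j: "j < M" for j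
      proof
        have "sgn (rv (bl (f i j) \<kappa>) u') = sgn (rv (bl (f i j) \<kappa>) u)" by (rule sg[OF blF[OF Pf(1)[OF i(1) j]]])
        then show "f i j (b' \<kappa>) = 0" unfolding val(1,2)[OF Pf(1)[OF i(1) j]] using i(2) j by (simp add: sgn_zero_iff)
        have "0 < rv (bl (g i j) \<kappa>) u" unfolding val(1)[OF Pf(2)[OF i(1) j]] using i(2) j by blast
        then show "0 < g i j (b' \<kappa>)" using ps[OF blF[OF Pf(2)[OF i(1) j]], of \<kappa>] unfolding val(2)[OF Pf(2)[OF i(1) j]] by blast
      qed
      then have "b' \<kappa> \<in> A \<inter> U0" unfolding AU using i(1) bU by blast
      then show ?thesis by blast
    qed
    have formF: "(%z. z (Inr \<beta>)) \<in> Fs" "distance_form k \<in> Fs" "volume_form \<in> Fs" for \<beta> k unfolding Fs_def by blast+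
    define \<sigma>' where "\<sigma>' = u' (Inr True)"
    define l' where "l' = u' (Inr False)"
    have pos': "0 < \<sigma>'" "0 < l'"
      using ps[OF formF(1)[of True]] ps[OF formF(1)[of False]] \<sigma>(1) l(1) by (simp_all add: rv_def cpx_def u \<sigma>'_def l'_def)
    have le': "\<sigma>' \<le> 2 * \<rho>" "l' \<le> 2 * \<rho>" using du[OF UnI2[OF rangeI[of Inr True]]] du[OF UnI2[OF rangeI[of Inr False]]] \<sigma>(2) l(2) unfolding u \<sigma>'_def l'_def by linarith+
    have uu: "u (Inl (Inl j, \<kappa>)) = b \<kappa> (Inl j) - a0 (Inl j)" "u' (Inl (Inl j, \<kappa>)) = b' \<kappa> (Inl j) - a0 (Inl j)" for j \<kappa>
      by (simp_all add: u b'_def shifted_def S)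
    note f0 = rv_forms[of u b a0, OF uu(1)] and f1 = rv_forms[of u' b' a0, OF uu(2)]
    have dst': "norm (prj (b' (Some k)) - prj (b' None)) < \<sigma>'" for k
    proof -
      have "norm (prj (b (Some k)) - prj (b None)) ^ 2 < \<sigma> ^ 2" using dst[of k] by (intro power_strict_mono) auto
      then have "0 < rv (distance_form k) u" unfolding f0 u by simp
      then have "0 < rv (distance_form k) u'" by (rule ps[OF formF(2)])
      then have "norm (prj (b' (Some k)) - prj (b' None)) ^ 2 < \<sigma>' ^ 2" unfolding f1 \<sigma>'_def by simp
      then show ?thesis by (rule power_less_imp_less_base) (use pos'(1) in simp)
    qed
    define D' where "D' = det (\<chi> k. prj (b' (Some k)) - prj (b' None))"
    have "0 < rv volume_form u"
    proof -
      have "(\<sigma> ^ (CARD('d) + 1)) ^ 2 < (l * \<bar>det (\<chi> k. prj (b (Some k)) - prj (b None))\<bar>) ^ 2" using vol \<sigma>(1) by (intro power_strict_mono) auto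
      then show ?thesis unfolding f0 u by (simp add: power_mult_distrib)
    qed
    then have vp: "0 < rv volume_form u'" "c * \<rho> ^ L \<le> rv volume_form u'" using ps[OF formF(3)] lw[OF formF(3)] by auto
    have rvv: "rv volume_form u' = (l' * \<bar>D'\<bar>) ^ 2 - (\<sigma>' ^ (CARD('d) + 1)) ^ 2"
      unfolding f1 D'_def l'_def \<sigma>'_def by (simp add: power_mult_distrib)
    have vol': "\<sigma>' ^ (CARD('d) + 1) < l' * \<bar>D'\<bar>"
    proof -
      have "(\<sigma>' ^ (CARD('d) + 1)) ^ 2 < (l' * \<bar>D'\<bar>) ^ 2" using vp(1) rvv by simp
      then show ?thesis by (rule power_less_imp_less_base) (use pos'(2) in simp)
    qed
    \<comment> \<open>The lower bound c \<rho>^L for \<open>volume_form\<close> gives (l' D')^2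
      \<ge> \<rho>^(L+1), and l' \<le> 1 while L + 1 \<le> 2 n.\<close>
    have low: "\<rho> ^ n \<le> \<bar>D'\<bar>"
    proof (rule ccontr)
      assume "\<not> ?thesis"
      then have lt: "\<bar>D'\<bar> ^ 2 < (\<rho> ^ n) ^ 2" using \<rho>(1) by (intro power_strict_mono) auto
      have "\<rho> ^ (L + 1) \<le> c * \<rho> ^ L" using \<rho>R(2) \<rho>(1) by (simp add: mult_right_mono)
      also have "... \<le> (l' * \<bar>D'\<bar>) ^ 2" using vp(2) rvv zero_le_power2[of "\<sigma>' ^ (CARD('d) + 1)"] by linarith
      also have "... \<le> (1 * \<bar>D'\<bar>) ^ 2" using le'(2) pos'(2) \<rho>R(3) by (intro power_mono mult_right_mono) auto
      also have "... < \<rho> ^ (n * 2)" using lt by (simp add: power_mult)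
      also have "... \<le> \<rho> ^ (L + 1)" using n(5) \<rho>(1) \<rho>R(3) by (intro power_decreasing) auto
      finally show False by simp
    qed
    have near: "norm (prj (b' \<kappa>) - prj a) \<le> real n * \<rho>" for \<kappa>
    proof -
      have "norm (prj (b' \<kappa>) - prj a) \<le> (\<Sum>j\<in>UNIV. \<bar>(prj (b' \<kappa>) - prj a) $ j\<bar>)" by (rule norm_le_l1_cart)
      also have "... \<le> (\<Sum>j\<in>(UNIV::'d set). 2 * \<rho>)"
      proof (rule sum_mono)
        fix j :: 'd
        have m: "Inl (Inl j, \<kappa>) \<in> ?SS" "Inl j \<in> S" by (auto simp: S)
        have "b' \<kappa> (Inl j) - b \<kappa> (Inl j) = u' (Inl (Inl j, \<kappa>)) - u (Inl (Inl j, \<kappa>))" unfolding uu by simp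
        then have "\<bar>b' \<kappa> (Inl j) - a (Inl j)\<bar> \<le> 2 * \<rho>" using du[OF m(1)] ba[OF m(2), of \<kappa>] by linarith
        then show "\<bar>(prj (b' \<kappa>) - prj a) $ j\<bar> \<le> 2 * \<rho>" by (simp add: prj_def)
      qed
      also have "... = 2 * real CARD('d) * \<rho>" by simp
      also have "... \<le> real n * \<rho>" using n(4) \<rho>(1) by (intro mult_right_mono) auto
      finally show ?thesis .
    qed
    show "\<exists>b0 (b :: 'd => real^'d) \<sigma>. b0 \<in> X & (\<forall>j. b j \<in> X) & norm (b0 - prj a) \<le> real n * \<rho> & (\<forall>j. norm (b j - prj a) \<le> real n * \<rho>)
      & 0 < \<sigma> & \<sigma> \<le> 1 & (\<forall>j. norm (b j - b0) \<le> \<sigma>)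
      & \<sigma> ^ (CARD('d) + 1) \<le> real n * \<rho> * \<bar>det (\<chi> j. b j - b0)\<bar> & \<rho> ^ n \<le> \<bar>det (\<chi> j. b j - b0)\<bar>"
    proof (intro exI[of _ "prj (b' None)"] exI[of _ "%k. prj (b' (Some k))"] exI[of _ \<sigma>'] conjI allI)
      show "prj (b' None) \<in> X" "prj (b' (Some j)) \<in> X" for j using b'A X by blast+
      show "\<sigma>' \<le> 1" using le'(1) \<rho>R(3) by linarith
      show "norm (prj (b' (Some j)) - prj (b' None)) \<le> \<sigma>'" for j using dst'[of j] by simp
      have "l' * \<bar>D'\<bar> \<le> real n * \<rho> * \<bar>D'\<bar>"
      proof -
        have "2 * \<rho> \<le> real n * \<rho>" using n(3) \<rho>(1) by (intro mult_right_mono) auto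
        then show ?thesis using le'(2) by (intro mult_right_mono) auto
      qed
      then show "\<sigma>' ^ (CARD('d) + 1) \<le> real n * \<rho> * \<bar>det (\<chi> k. prj (b' (Some k)) - prj (b' None))\<bar>" using vol' unfolding D'_def by linarith
      show "\<rho> ^ n \<le> \<bar>det (\<chi> k. prj (b' (Some k)) - prj (b' None))\<bar>" using low unfolding D'_def .
    qed (use near pos' in auto)
  qed
  then show ?thesis using R0(1) by (intro exI[of _ "R0/2"] exI[of _ n] conjI) auto
qed

section \<open>Subanalytic sets are regular\<close>

lemma dagger_mono:
  assumes "dagger X x n" "n \<le> n'" shows "dagger X x n'"
proof (cases "n' = 0")
  case True then show ?thesis using assms by simp
next
  case False
  show ?thesis unfolding dagger_def
  proof (intro allI impI)
    fix \<rho> :: real assume \<rho>: "0 < \<rho>" "real n' * \<rho> \<le> 1"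
    have le: "real n * \<rho> \<le> real n' * \<rho>" using assms(2) \<rho>(1) by (intro mult_right_mono) auto
    have "1 * \<rho> \<le> real n' * \<rho>" using False \<rho>(1) by (intro mult_right_mono) auto
    then have \<rho>1: "\<rho> \<le> 1" using \<rho>(2) by linarith
    have pw: "\<rho> ^ n' \<le> \<rho> ^ n" using \<rho>(1) \<rho>1 assms(2) by (intro power_decreasing) auto
    have "real n * \<rho> \<le> 1" using le \<rho>(2) by linarith
    from assms(1)[unfolded dagger_def, rule_format, OF \<rho>(1) this]
    obtain b0 b \<sigma> where b: "b0 \<in> X" "\<forall>j. b j \<in> X" "norm (b0 - x) \<le> real n * \<rho>" "\<forall>j. norm (b j - x) \<le> real n * \<rho>"
      "0 < \<sigma>" "\<sigma> \<le> 1" "\<forall>j. norm (b j - b0) \<le> \<sigma>" "\<sigma> ^ (CARD('a) + 1) \<le> real n * \<rho> * \<bar>det (\<chi> j. b j - b0)\<bar>" "\<rho> ^ n \<le> \<bar>det (\<chi> j. b j - b0)\<bar>"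
      by (elim exE conjE)
    show "\<exists>b0 (b :: 'a => real^'a) \<sigma>. b0 \<in> X & (\<forall>j. b j \<in> X) & norm (b0 - x) \<le> real n' * \<rho> & (\<forall>j. norm (b j - x) \<le> real n' * \<rho>)
      & 0 < \<sigma> & \<sigma> \<le> 1 & (\<forall>j. norm (b j - b0) \<le> \<sigma>)
      & \<sigma> ^ (CARD('a) + 1) \<le> real n' * \<rho> * \<bar>det (\<chi> j. b j - b0)\<bar> & \<rho> ^ n' \<le> \<bar>det (\<chi> j. b j - b0)\<bar>"
    proof (intro exI[of _ b0] exI[of _ b] exI[of _ \<sigma>] conjI allI)
      show "norm (b0 - x) \<le> real n' * \<rho>" using b(3) le by linarith
      show "norm (b j - x) \<le> real n' * \<rho>" for j using b(4)[rule_format, of j] le by linarith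
      have "real n * \<rho> * \<bar>det (\<chi> j. b j - b0)\<bar> \<le> real n' * \<rho> * \<bar>det (\<chi> j. b j - b0)\<bar>" using le by (rule mult_right_mono) simp
      then show "\<sigma> ^ (CARD('a) + 1) \<le> real n' * \<rho> * \<bar>det (\<chi> j. b j - b0)\<bar>" using b(8) by linarith
      show "\<rho> ^ n' \<le> \<bar>det (\<chi> j. b j - b0)\<bar>" using b(9) pw by linarith
    qed (use b(1,2,5,6,7) in blast)+
  qed
qed

text \<open>For each scale \<rho> take a point \<open>y\<close> within \<rho> of \<open>x\<close>.
  Its simplex serves for \<open>x\<close> too, and passing to \<open>Suc n\<close> allows exactly
  this additional distance \<rho>.\<close>

lemma dagger_closure:
  assumes "!!\<epsilon>. 0 < \<epsilon> ==> \<exists>y. norm (y - x) < \<epsilon> & dagger X y n"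
  shows "dagger X x (Suc n)"
  unfolding dagger_def
proof (intro allI impI)
  fix \<rho> :: real assume \<rho>: "0 < \<rho>" "real (Suc n) * \<rho> \<le> 1"
  have e: "real (Suc n) * \<rho> = real n * \<rho> + \<rho>" by (simp add: algebra_simps)
  have n0: "0 \<le> real n * \<rho>" using \<rho>(1) by simp
  obtain y where y: "norm (y - x) < \<rho>" "dagger X y n" using assms[OF \<rho>(1)] by (elim exE conjE)
  have "real n * \<rho> \<le> 1" using e \<rho> by linarith
  from y(2)[unfolded dagger_def, rule_format, OF \<rho>(1) this]
  obtain b0 b \<sigma> where b: "b0 \<in> X" "\<forall>j. b j \<in> X" "norm (b0 - y) \<le> real n * \<rho>" "\<forall>j. norm (b j - y) \<le> real n * \<rho>"
      "0 < \<sigma>" "\<sigma> \<le> 1" "\<forall>j. norm (b j - b0) \<le> \<sigma>" "\<sigma> ^ (CARD('a) + 1) \<le> real n * \<rho> * \<bar>det (\<chi> j. b j - b0)\<bar>" "\<rho> ^ n \<le> \<bar>det (\<chi> j. b j - b0)\<bar>"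
    by (elim exE conjE)
  show "\<exists>b0 (b :: 'a => real^'a) \<sigma>. b0 \<in> X & (\<forall>j. b j \<in> X) & norm (b0 - x) \<le> real (Suc n) * \<rho> & (\<forall>j. norm (b j - x) \<le> real (Suc n) * \<rho>)
      & 0 < \<sigma> & \<sigma> \<le> 1 & (\<forall>j. norm (b j - b0) \<le> \<sigma>)
      & \<sigma> ^ (CARD('a) + 1) \<le> real (Suc n) * \<rho> * \<bar>det (\<chi> j. b j - b0)\<bar> & \<rho> ^ Suc n \<le> \<bar>det (\<chi> j. b j - b0)\<bar>"
  proof (intro exI[of _ b0] exI[of _ b] exI[of _ \<sigma>] conjI allI)
    have tri: "norm (v - x) \<le> real (Suc n) * \<rho>" if "norm (v - y) \<le> real n * \<rho>" for v
      using norm_triangle_ineq[of "v - y" "y - x"] that y(1) e by simp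
    show "norm (b0 - x) \<le> real (Suc n) * \<rho>" by (rule tri[OF b(3)])
    show "norm (b j - x) \<le> real (Suc n) * \<rho>" for j by (rule tri[OF b(4)[rule_format]])
    have "real n * \<rho> * \<bar>det (\<chi> j. b j - b0)\<bar> \<le> real (Suc n) * \<rho> * \<bar>det (\<chi> j. b j - b0)\<bar>" using e \<rho>(1) by (intro mult_right_mono) auto
    then show "\<sigma> ^ (CARD('a) + 1) \<le> real (Suc n) * \<rho> * \<bar>det (\<chi> j. b j - b0)\<bar>" using b(8) by linarith
    have "\<rho> \<le> 1" using \<rho>(2) e n0 by linarith
    then have "\<rho> ^ Suc n \<le> \<rho> ^ n" using \<rho>(1) by (intro power_decreasing) auto
    then show "\<rho> ^ Suc n \<le> \<bar>det (\<chi> j. b j - b0)\<bar>" using b(9) by linarith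
  qed (use b(1,2,5,6,7) in blast)+
qed

lemma bounded_coordinates_subsequence:
  fixes a :: "nat => 'i => real"
  assumes "finite S" "!!k s. s \<in> S ==> \<bar>a k s\<bar> \<le> B"
  shows "\<exists>r l. strict_mono (r :: nat => nat) & (\<forall>s\<in>S. (%k. a (r k) s) \<longlonglongrightarrow> l s)"
  using assms
proof (induction S rule: finite_induct)
  case empty
  then show ?case by (intro exI[of _ id] exI[of _ "%_. 0"]) (auto simp: strict_mono_def)
next
  case (insert i S)
  have "\<exists>r l. strict_mono (r :: nat => nat) & (\<forall>s\<in>S. (%k. a (r k) s) \<longlonglongrightarrow> l s)" by (rule insert.IH) (use insert.prems in auto)
  then obtain r :: "nat => nat" and l where rl: "strict_mono r" "\<forall>s\<in>S. (%k. a (r k) s) \<longlonglongrightarrow> l s" by (elim exE conjE)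
  have "bounded (range (%k. a (r k) i))" using insert.prems[of i] by (intro boundedI[of _ B]) auto
  then obtain l' r' where r': "strict_mono (r' :: nat => nat)" "((%k. a (r k) i) \<circ> r') \<longlonglongrightarrow> l'"
    using bounded_imp_convergent_subsequence by blast
  have "(%k. a ((r \<circ> r') k) s) \<longlonglongrightarrow> (l(i := l')) s" if "s \<in> insert i S" for s
  proof (cases "s = i")
    case True then show ?thesis using r'(2) by (simp add: o_def)
  next
    case False
    then have "(%k. a (r k) s) \<longlonglongrightarrow> l s" using rl(2) that by simp
    from LIMSEQ_subseq_LIMSEQ[OF this r'(1)] show ?thesis using False by (simp add: o_def)
  qed
  then have "\<forall>s\<in>insert i S. (%k. a ((r \<circ> r') k) s) \<longlonglongrightarrow> (l(i := l')) s" by blast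
  then show ?case using strict_mono_o[OF rl(1) r'(1)] by (intro exI[of _ "r \<circ> r'"] exI[of _ "l(i := l')"] conjI)
qed

text \<open>If the closure contained a ball, points of \<open>P\<close> could approximate an
  orthogonal corner with edges \<open>s\<close>, whose determinant s^d is far larger than (2
  s)^(d+1) / \<epsilon> for small \<open>s\<close>.\<close>

lemma degenerate_empty_interior:
  fixes P :: "(real^'d) set"
  assumes \<epsilon>: "0 < \<epsilon>" and deg: "!!p0 (p :: 'd => real^'d) \<sigma>. p0 \<in> P ==> (!!k. p k \<in> P) ==> 0 < \<sigma> ==> \<sigma> \<le> \<epsilon> ==> (!!k. norm (p k - p0) < \<sigma>) ==>
     \<epsilon> * \<bar>det (\<chi> k. p k - p0)\<bar> \<le> \<sigma> ^ (CARD('d) + 1)"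
  shows "interior (closure P) = {}"
proof (rule ccontr)
  assume "interior (closure P) ~= {}"
  then obtain y where "y \<in> interior (closure P)" by blast
  then obtain e where e: "e > 0" "ball y e \<subseteq> closure P" unfolding mem_interior by blast
  \<comment> \<open>2 s \<le> \<epsilon> admits \<sigma> = 2 s in \<open>deg\<close>, and the power
    of 2 makes the limiting inequality \<epsilon> \<le> 2^(d+1) s fail by a factor 2.\<close>
  define s where "s = min (e/2) (min (\<epsilon>/2) (\<epsilon> / 2 ^ (CARD('d) + 2)))"
  have s: "0 < s" "s < e" "2 * s \<le> \<epsilon>" "s * 2 ^ (CARD('d) + 2) \<le> \<epsilon>"
  proof -
    show "0 < s" "s < e" "2 * s \<le> \<epsilon>" using e(1) \<epsilon> by (auto simp: s_def)
    have "s \<le> \<epsilon> / 2 ^ (CARD('d) + 2)" by (simp add: s_def)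
    then show "s * 2 ^ (CARD('d) + 2) \<le> \<epsilon>" by (simp add: field_simps)
  qed
  define v where "v k = y + s *\<^sub>R axis k 1" for k :: 'd
  have y: "y \<in> closure P" and vk: "v k \<in> closure P" for k
    using e s(1,2) by (auto intro!: subsetD[OF e(2)] simp: v_def dist_norm)
  obtain q0 where q0: "!!n. q0 n \<in> P" "q0 \<longlonglongrightarrow> y" using y closure_sequential by blast
  have "\<forall>k. \<exists>q. (\<forall>n. q n \<in> P) & q \<longlonglongrightarrow> v k" using vk closure_sequential by blast
  then have "\<exists>q. \<forall>k. (\<forall>n. q k n \<in> P) & q k \<longlonglongrightarrow> v k" by (rule choice)
  then obtain q where q: "!!k n. q k n \<in> P" "!!k. q k \<longlonglongrightarrow> v k" by blast
  have lim: "(%n. q k n - q0 n) \<longlonglongrightarrow> s *\<^sub>R axis k 1" for k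
    using tendsto_diff[OF q(2)[of k] q0(2)] by (simp add: v_def)
  have "(%n. det (\<chi> k. q k n - q0 n)) \<longlonglongrightarrow> det (\<chi> k. (s *\<^sub>R axis k 1 :: real^'d))"
    unfolding det_def vec_lambda_beta by (intro tendsto_sum tendsto_mult tendsto_const tendsto_prod tendsto_vec_nth lim)
  also have "det (\<chi> k. (s *\<^sub>R axis k 1 :: real^'d)) = s ^ CARD('d)"
    by (subst det_diagonal) (auto simp: axis_def)
  finally have "(%n. \<epsilon> * \<bar>det (\<chi> k. q k n - q0 n)\<bar>) \<longlonglongrightarrow> \<epsilon> * \<bar>s ^ CARD('d)\<bar>" by (intro tendsto_intros)
  moreover have "\<forall>\<^sub>F n in sequentially. \<epsilon> * \<bar>det (\<chi> k. q k n - q0 n)\<bar> \<le> (2 * s) ^ (CARD('d) + 1)"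
  proof -
    have "\<forall>\<^sub>F n in sequentially. norm (q k n - q0 n) < 2 * s" for k
    proof (rule order_tendstoD(2))
      show "(%n. norm (q k n - q0 n)) \<longlonglongrightarrow> norm (s *\<^sub>R axis k 1 :: real^'d)" by (intro tendsto_norm lim)
      show "norm (s *\<^sub>R axis k 1 :: real^'d) < 2 * s" using s(1) by simp
    qed
    then have "\<forall>\<^sub>F n in sequentially. \<forall>k. norm (q k n - q0 n) < 2 * s" by (rule eventually_all_finite)
    then show ?thesis
    proof (rule eventually_mono)
      fix n assume "\<forall>k. norm (q k n - q0 n) < 2 * s"
      then show "\<epsilon> * \<bar>det (\<chi> k. q k n - q0 n)\<bar> \<le> (2 * s) ^ (CARD('d) + 1)" using s(1,3) by (intro deg q0 q) auto
    qed
  qed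
  ultimately have "\<epsilon> * \<bar>s ^ CARD('d)\<bar> \<le> (2 * s) ^ (CARD('d) + 1)" by (rule tendsto_upperbound) simp
  then have "\<epsilon> * s ^ CARD('d) \<le> (2 ^ (CARD('d) + 1) * s) * s ^ CARD('d)" using s(1) by (simp add: power_mult_distrib algebra_simps)
  then have "\<epsilon> \<le> 2 ^ (CARD('d) + 1) * s" using s(1) by simp
  moreover have "2 * (2 ^ (CARD('d) + 1) * s) \<le> \<epsilon>" using s(4) by (simp add: algebra_simps)
  ultimately show False using \<epsilon> by linarith
qed

lemma frame_mono: assumes "frame A S a \<epsilon>" "\<epsilon> \<le> \<epsilon>'" shows "frame A S a \<epsilon>'"
proof -
  from assms(1)[unfolded frame_def] obtain b \<sigma> l where b: "\<forall>\<kappa>. b \<kappa> \<in> A" "\<forall>\<kappa>. \<forall>s\<in>S. \<bar>b \<kappa> s - a s\<bar> \<le> \<epsilon>"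
     "0 < \<sigma>" "\<sigma> \<le> \<epsilon>" "0 < l" "l \<le> \<epsilon>" "\<forall>k. norm (prj (b (Some k)) - prj (b None)) < \<sigma>"
     "\<sigma> ^ (CARD('a) + 1) < l * \<bar>det (\<chi> k. prj (b (Some k)) - prj (b None))\<bar>" by (elim exE conjE)
  have "\<forall>\<kappa>. \<forall>s\<in>S. \<bar>b \<kappa> s - a s\<bar> \<le> \<epsilon>'" using b(2) assms(2) by (meson order_trans)
  moreover have "\<sigma> \<le> \<epsilon>'" "l \<le> \<epsilon>'" using b(4,6) assms(2) by linarith+
  ultimately show ?thesis unfolding frame_def using b(1,3,5,7,8) by (intro exI[of _ b] exI[of _ \<sigma>] exI[of _ l] conjI)
qed

text \<open>Baire category. A point that is not good lacks frames of some size 1/(m+1). The points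
  of one small grid cell that lack them have degenerate projections, since otherwise they would form
  a frame for each other. So the bad points project into countably many nowhere dense closed
  sets.\<close>

lemma good_dense:
  fixes A :: "('d::finite + nat => real) set" and W :: "(real^'d) set"
  assumes S: "finite S" and W: "open W" "W ~= {}" "W \<subseteq> prj ` A"
  shows "\<exists>a. good A S a & prj a \<in> W"
proof (rule ccontr)
  assume no: "\<not> ?thesis"
  \<comment> \<open>Cells of size 1/(m+1) in the coordinates \<open>S\<close> upstairs: projections
    of close points are close, but close projections may come from distant points of
    \<open>A\<close>, which would not form a frame.\<close>
  define cell where "cell m a = restrict (%s. \<lfloor>a s * real (Suc m)\<rfloor>) S" for m :: nat and a :: "'d + nat => real"
  define P where "P m z = prj ` {a\<in>A. \<not> frame A S a (1 / real (Suc m)) & cell m a = z}" for m z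
  have close: "\<bar>b s - a s\<bar> \<le> 1 / real (Suc m)" if "cell m a = cell m b" "s \<in> S" for a b s m
  proof -
    have "\<lfloor>a s * real (Suc m)\<rfloor> = \<lfloor>b s * real (Suc m)\<rfloor>" using fun_cong[OF that(1), of s] that(2) by (simp add: cell_def)
    then have "\<bar>b s * real (Suc m) - a s * real (Suc m)\<bar> \<le> 1" by linarith
    then have "\<bar>b s - a s\<bar> * real (Suc m) \<le> 1" by (simp add: abs_mult flip: left_diff_distrib del: of_nat_Suc)
    then show ?thesis by (simp add: field_simps)
  qed
  have thin: "interior (closure (P m z)) = {}" for m z
  proof (rule degenerate_empty_interior)
    show "0 < 1 / real (Suc m)" by simp
    fix p0 and p :: "'d => real^'d" and \<sigma> :: real
    assume p: "p0 \<in> P m z" "!!k. p k \<in> P m z" and \<sigma>: "0 < \<sigma>" "\<sigma> \<le> 1 / real (Suc m)" "!!k. norm (p k - p0) < \<sigma>"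
    obtain b0 where b0: "b0 \<in> A" "\<not> frame A S b0 (1 / real (Suc m))" "cell m b0 = z" "p0 = prj b0" using p(1) unfolding P_def by blast
    have "\<forall>k. \<exists>b. b \<in> A & cell m b = z & p k = prj b" using p(2) unfolding P_def by blast
    then have "\<exists>b. \<forall>k. b k \<in> A & cell m (b k) = z & p k = prj (b k)" by (rule choice)
    then obtain b where b: "!!k. b k \<in> A" "!!k. cell m (b k) = z" "!!k. p k = prj (b k)" by blast
    define bb where "bb \<kappa> = (case \<kappa> of None => b0 | Some k => b k)" for \<kappa>
    show "1 / real (Suc m) * \<bar>det (\<chi> k. p k - p0)\<bar> \<le> \<sigma> ^ (CARD('d) + 1)"
    proof (rule ccontr)
      assume "\<not> ?thesis"
      then have gt: "\<sigma> ^ (CARD('d) + 1) < 1 / real (Suc m) * \<bar>det (\<chi> k. prj (bb (Some k)) - prj (bb None))\<bar>"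
        unfolding bb_def by (simp only: option.case b(3)[symmetric] b0(4)[symmetric] not_le)
      have "frame A S b0 (1 / real (Suc m))" unfolding frame_def
      proof (rule exI[of _ bb], rule exI[of _ \<sigma>], rule exI[of _ "1 / real (Suc m)"], intro conjI allI ballI)
        show "bb \<kappa> \<in> A" for \<kappa> using b0(1) b(1) by (cases \<kappa>) (auto simp: bb_def)
        show "\<bar>bb \<kappa> s - b0 s\<bar> \<le> 1 / real (Suc m)" if "s \<in> S" for \<kappa> s
          by (rule close[OF _ that]) (use b0(3) b(2) in \<open>cases \<kappa>, auto simp: bb_def\<close>)
        show "norm (prj (bb (Some k)) - prj (bb None)) < \<sigma>" for k using \<sigma>(3)[of k] by (simp add: bb_def b(3) b0(4))
        show "\<sigma> ^ (CARD('d) + 1) < 1 / real (Suc m) * \<bar>det (\<chi> k. prj (bb (Some k)) - prj (bb None))\<bar>" by (rule gt)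
      qed (use \<sigma>(1,2) in \<open>simp_all del: of_nat_Suc\<close>)
      then show False using b0(2) by blast
    qed
  qed
  let ?G = "(%(m, z). - closure (P m z)) ` (UNIV \<times> (S \<rightarrow>\<^sub>E (UNIV :: int set)))"
  have "UNIV \<subseteq> closure (\<Inter>?G)"
  proof (rule Baire)
    show "closed (UNIV :: (real^'d) set)" by simp
    have "countable (S \<rightarrow>\<^sub>E (UNIV :: int set))" using S by (intro countable_PiE) auto
    then show "countable ?G" by (intro countable_image countable_SIGMA) auto
    fix T assume "T \<in> ?G"
    then obtain m z where T: "T = - closure (P m z)" by auto
    have "closure T = UNIV" unfolding T closure_complement thin by simp
    then show "openin (top_of_set UNIV) T & UNIV \<subseteq> closure T" unfolding T by auto
  qed
  then have "W \<inter> closure (\<Inter>?G) ~= {}" using W(2) by blast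
  then have "W \<inter> \<Inter>?G ~= {}" using open_Int_closure_eq_empty[OF W(1)] by blast
  then obtain x where x: "x \<in> W" "x \<in> \<Inter>?G" by blast
  obtain a where a: "a \<in> A" "x = prj a" using x(1) W(3) by blast
  have "\<not> good A S a" using no x(1) a(2) by blast
  then obtain \<epsilon> where \<epsilon>: "0 < \<epsilon>" "\<not> frame A S a \<epsilon>" unfolding good_def by blast
  obtain m where "inverse (real (Suc m)) < \<epsilon>" using reals_Archimedean[OF \<epsilon>(1)] by blast
  then have "\<not> frame A S a (1 / real (Suc m))" using frame_mono[of A S a "1 / real (Suc m)" \<epsilon>] \<epsilon>(2) by (auto simp: inverse_eq_divide)
  then have "x \<in> P m (cell m a)" using a unfolding P_def by blast
  then have "x \<in> closure (P m (cell m a))" using closure_subset by blast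
  moreover have "cell m a \<in> S \<rightarrow>\<^sub>E UNIV" by (simp add: cell_def)
  then have "- closure (P m (cell m a)) \<in> ?G" by (intro image_eqI[of _ _ "(m, cell m a)"]) auto
  then have "x \<in> - closure (P m (cell m a))" using x(2) by blast
  ultimately show False by blast
qed

lemma good_bounded:
  fixes A :: "('d::finite + nat => real) set"
  assumes "good A S a" "\<forall>p\<in>A. \<forall>i. \<bar>p i\<bar> \<le> R" "s \<in> S"
  shows "\<bar>a s\<bar> \<le> R + 1"
proof -
  have "frame A S a 1" using assms(1) unfolding good_def by simp
  from this[unfolded frame_def] obtain b :: "'d option => 'd + nat => real" where b: "\<forall>\<kappa>. b \<kappa> \<in> A" "\<forall>\<kappa>. \<forall>s\<in>S. \<bar>b \<kappa> s - a s\<bar> \<le> 1" by (elim exE conjE) (rule that)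
  have "\<bar>b None s\<bar> \<le> R" "\<bar>b None s - a s\<bar> \<le> 1" using b assms(2,3) by blast+
  then show ?thesis by linarith
qed

text \<open>\<open>local_dagger\<close> gives an \<open>n\<close> near each point of the coordinate
  space, and boundedness of \<open>A\<close> makes it uniform by a compactness argument over good
  points. Projections of good points are dense near \<open>x0\<close>, and
  \<open>dagger_closure\<close> passes to the remaining points of \<open>X\<close>.\<close>

theorem subanalytic_reg:
  fixes X :: "(real^'d) set"
  assumes X: "X = closure (interior X)" and sub: "subanalytic X"
  shows "reg X"
  unfolding reg_def
proof
  fix x0 assume x0: "x0 \<in> X"
  from sub[unfolded subanalytic_def, rule_format, of x0]
  obtain U and e :: nat and A R where U: "open U" "x0 \<in> U" and sa: "semianalytic (range Inl \<union> Inr ` {..<e}) A" and R: "\<forall>p\<in>A. \<forall>i. \<bar>p i\<bar> \<le> R"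
    and XU: "X \<inter> U = (%p. \<chi> j. p (Inl j)) ` A" by (elim exE conjE) (rule that)
  define S :: "('d + nat) set" where "S = range Inl \<union> Inr ` {..<e}"
  have fS: "finite S" by (simp add: S_def)
  have XA: "X \<inter> U = prj ` A" using XU by (simp add: prj_def[abs_def])
  have "\<exists>n. \<forall>a. good A S a --> dagger X (prj a) n"
  proof (rule ccontr)
    assume "\<not> ?thesis"
    then have "\<forall>n. \<exists>a. good A S a & \<not> dagger X (prj a) n" by blast
    then have "\<exists>a. \<forall>n. good A S (a n) & \<not> dagger X (prj (a n)) n" by (rule choice)
    then obtain a where a: "!!n. good A S (a n)" "!!n. \<not> dagger X (prj (a n)) n" by blast
    have "\<exists>q l. strict_mono (q :: nat => nat) & (\<forall>s\<in>S. (%k. a (q k) s) \<longlonglongrightarrow> l s)"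
      by (rule bounded_coordinates_subsequence[OF fS, of a "R + 1"]) (rule good_bounded[OF a(1) R])
    then obtain q :: "nat => nat" and l where q: "strict_mono q" "\<forall>s\<in>S. (%k. a (q k) s) \<longlonglongrightarrow> l s" by (elim exE conjE)
    \<comment> \<open>The limit of the counterexamples, set to 0 off \<open>S\<close> to be a point
      of \<open>cspace S\<close>. It need not lie in \<open>A\<close>, which is why
      \<open>local_dagger\<close> allows an arbitrary centre.\<close>
    define a0 where "a0 s = (if s \<in> S then l s else 0)" for s
    have "a0 \<in> cspace S" by (simp add: a0_def cspace_def)
    then have "\<exists>r>0. \<exists>n. \<forall>a. good A S a --> (\<forall>s\<in>S. \<bar>a s - a0 s\<bar> < r) --> dagger X (prj a) n"
      using sa XA by (intro local_dagger[OF S_def]) (auto simp: S_def)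
    then obtain r n where rn: "r > 0" "\<forall>a. good A S a --> (\<forall>s\<in>S. \<bar>a s - a0 s\<bar> < r) --> dagger X (prj a) n" by (elim exE conjE)
    have "\<forall>s\<in>S. \<forall>\<^sub>F k in sequentially. \<bar>a (q k) s - a0 s\<bar> < r"
      using q(2) rn(1) by (auto simp: a0_def tendsto_iff dist_real_def)
    then have "\<forall>\<^sub>F k in sequentially. \<forall>s\<in>S. \<bar>a (q k) s - a0 s\<bar> < r" using fS by (simp add: eventually_ball_finite)
    moreover have "\<forall>\<^sub>F k in sequentially. n \<le> k" by (rule eventually_ge_at_top)
    ultimately have "\<forall>\<^sub>F k in sequentially. (\<forall>s\<in>S. \<bar>a (q k) s - a0 s\<bar> < r) & n \<le> k" by (rule eventually_conj)
    then obtain k where k: "\<forall>s\<in>S. \<bar>a (q k) s - a0 s\<bar> < r" "n \<le> k" using eventually_happens' sequentially_bot by blast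
    have "dagger X (prj (a (q k))) n" using rn(2) a(1) k(1) by blast
    \<comment> \<open>The counterexample with number \<open>q k\<close> fails \<open>dagger\<close>
      for \<open>q k\<close>, hence by \<open>dagger_mono\<close> for every smaller index, in
      particular for \<open>n\<close>.\<close>
    moreover have "n \<le> q k" using k(2) seq_suble[OF q(1), of k] by linarith
    ultimately show False using dagger_mono a(2) by blast
  qed
  then obtain n where n: "!!a. good A S a ==> dagger X (prj a) n" by blast
  obtain \<delta> where \<delta>: "\<delta> > 0" "ball x0 \<delta> \<subseteq> U" using U openE by blast
  have "dagger X x (Suc n)" if x: "x \<in> X \<inter> ball x0 \<delta>" for x
  proof (rule dagger_closure)
    fix \<epsilon> :: real assume \<epsilon>: "0 < \<epsilon>"
    let ?V = "U \<inter> ball x \<epsilon>"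
    have "x \<in> ?V" "open ?V" using x \<delta>(2) \<epsilon> U(1) by auto
    moreover have "x \<in> closure (interior X)" using x X by blast
    ultimately have "?V \<inter> interior X ~= {}" using open_Int_closure_eq_empty[of ?V "interior X"] by blast
    moreover have "?V \<inter> interior X \<subseteq> prj ` A" using XA interior_subset[of X] by blast
    moreover have "open (?V \<inter> interior X)" using U(1) by auto
    ultimately obtain a where a: "good A S a" "prj a \<in> ?V \<inter> interior X" using good_dense[OF fS] by blast
    then have "norm (prj a - x) < \<epsilon>" by (simp add: dist_norm norm_minus_commute)
    then show "\<exists>y. norm (y - x) < \<epsilon> & dagger X y n" using n[OF a(1)] by blast
  qed
  then show "\<exists>n. \<exists>\<delta>>0. \<forall>x\<in>X \<inter> ball x0 \<delta>. dagger X x n" using \<delta>(1) by blast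
qed

theorem theorem9p5:
  fixes X :: "(real^'d) set" and f g :: "real^'d \<Rightarrow> complex"
    and m :: nat and C \<alpha> :: real
  assumes "holder_set X \<or> (simple_set X \<and> fat X \<and> subanalytic X)"
    and "m \<ge> 1" and "C > 0" and "\<alpha> > 0"
    and "g \<in> Cinf X" and "(\<lambda>x. f x * g x) \<in> Cinf X" and "(\<lambda>x. f x ^ m) \<in> Cinf X"
    and "\<forall>x\<in>X. cmod (f x) \<le> C * cmod (g x) powr \<alpha>"
  shows "f \<in> Cinf X"
proof -
  have X: "X = closure (interior X)" using assms(1) unfolding holder_set_def fat_def by blast
  have "reg X" using assms(1) holder_reg subanalytic_reg[OF X] by blast
  then show ?thesis by (rule root_in_Cinf[OF _ X assms(2-8)])
qed

end
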